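(* Let $p$ be an odd prime, $1\leq r\leq p-2$, and $\delta$ a nonzero $p$-th-power-free integer. Let $\ell\neq p$ be a rational prime and $V$ a place of $K$ above $\ell$. If $\ell\nmid\delta$, then $\mathrm{Im}(\delta_V)$ is the subgroup of $K_V^\times/K_V^{\times p}$ formed by the classes of units $\mathcal{O}_{K_V}^\times$ (which is identified with $\mathbb{F}_V^\times/\mathbb{F}_V^{\times p}$). If $\ell\mid\delta$, then $\mathrm{Im}(\delta_V)$ is the subgroup of $K_V^\times/K_V^{\times p}$ generated by $\delta$.
   Context: $\omega$ is a primitive $p$-th root of unity, $K=\mathbb{Q}(\omega)$, $\Pi=\omega-\omega^{-1}$, $\mathbb{F}_V$ the residue field of $K_V$. $C$ is the smooth projective curve with affine model $y^p=x^r(\delta-x)$ and $J$ its Jacobian, with $\mathcal{O}_K$-action induced by $(x,y)\mapsto(x,\omega y)$. For a field $L\supseteq K$, $\delta_L:J(L)/\Pi J(L)\to L^\times/L^{\times p}$ sends the class of an $L$-rational degree-zero divisor $\sum a_iP_i$ supported away from $(0,0)$ and the point at infinity to $\prod x(P_i)^{a_i}$ (well defined and injective); $\delta_V:=\delta_{K_V}$. *)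

theory Defs
  imports
    Complex_Main
    "HOL-Computational_Algebra.Computational_Algebra"
    "HOL-Algebra.Group"
    "HOL-Algebra.Coset"
    "HOL-Algebra.Generated_Groups"
    "HOL-Algebra.QuotRing"
    "HOL-Algebra.Algebraic_Closure_Type"
begin

section \<open>Power quotients of abelian groups\<close>

definition pth_powers :: "('g, 'm) monoid_scheme \<Rightarrow> nat \<Rightarrow> 'g set" where
  "pth_powers G p = (\<lambda>x. x [^]\<^bsub>G\<^esub> p) ` carrier G"

definition power_quot :: "('g, 'm) monoid_scheme \<Rightarrow> nat \<Rightarrow> 'g set monoid" where
  "power_quot G p = G Mod pth_powers G p"

definition power_coset :: "('g, 'm) monoid_scheme \<Rightarrow> nat \<Rightarrow> 'g \<Rightarrow> 'g set" where
  "power_coset G p x = pth_powers G p #>\<^bsub>G\<^esub> x"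

abbreviation field_units :: "'a::field monoid" where
  "field_units \<equiv> units_of ring_of_type_algebra"


section \<open>Cyclotomic fields, places and completions\<close>

definition primitive_root_of_unity :: "nat \<Rightarrow> 'a::field \<Rightarrow> bool" where
  "primitive_root_of_unity n w \<longleftrightarrow> w ^ n = 1 \<and> (\<forall>k. 0 < k \<and> k < n \<longrightarrow> w ^ k \<noteq> 1)"

text \<open>The field \<open>\<rat>(w)\<close>, as the set of all fractions of polynomial expressions in \<open>w\<close>
  (fractions with denominator zero evaluate to zero).\<close>

definition rat_adjoin :: "'a::field_char_0 \<Rightarrow> 'a set" where
  "rat_adjoin w =
     {poly (map_poly of_rat f) w / poly (map_poly of_rat g) w | f g :: rat poly. True}"

definition nonarch_abs_on :: "'a::field set \<Rightarrow> ('a \<Rightarrow> real) \<Rightarrow> bool" where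
  "nonarch_abs_on K v \<longleftrightarrow>
     (\<forall>a\<in>K. 0 \<le> v a \<and> (v a = 0 \<longleftrightarrow> a = 0)) \<and>
     (\<forall>a\<in>K. \<forall>b\<in>K. v (a * b) = v a * v b \<and> v (a + b) \<le> max (v a) (v b))"

text \<open>A place of \<open>K\<close> above the rational prime \<open>l\<close> is given by any absolute value in its
  equivalence class.\<close>

definition place_above :: "'a::field set \<Rightarrow> nat \<Rightarrow> ('a \<Rightarrow> real) \<Rightarrow> bool" where
  "place_above K l v \<longleftrightarrow> nonarch_abs_on K v \<and> v (of_nat l) < 1"

text \<open>The field \<open>'l\<close> with absolute value \<open>av\<close> is the completion of \<open>(K, v)\<close> via \<open>\<iota>\<close>; completions
  are unique up to a unique isometric isomorphism over \<open>K\<close>.\<close>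

definition is_completion ::
  "'k::field set \<Rightarrow> ('k \<Rightarrow> real) \<Rightarrow> ('k \<Rightarrow> 'l::field) \<Rightarrow> ('l \<Rightarrow> real) \<Rightarrow> bool" where
  "is_completion K v \<iota> av \<longleftrightarrow>
     nonarch_abs_on UNIV av \<and>
     \<iota> 1 = 1 \<and> (\<forall>a\<in>K. \<forall>b\<in>K. \<iota> (a + b) = \<iota> a + \<iota> b \<and> \<iota> (a * b) = \<iota> a * \<iota> b) \<and>
     (\<forall>a\<in>K. av (\<iota> a) = v a) \<and>
     (\<forall>z. \<forall>e>0. \<exists>a\<in>K. av (z - \<iota> a) < e) \<and>
     (\<forall>s :: nat \<Rightarrow> 'l. (\<forall>e>0. \<exists>N. \<forall>m\<ge>N. \<forall>n\<ge>N. av (s m - s n) < e) \<longrightarrow>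
        (\<exists>z. (\<lambda>n. av (s n - z)) \<longlonglongrightarrow> 0))"

definition valuation_ring :: "('l::field \<Rightarrow> real) \<Rightarrow> 'l ring" where
  "valuation_ring av = ring_of_type_algebra\<lparr>carrier := {u. av u \<le> 1}\<rparr>"

definition residue_field :: "('l::field \<Rightarrow> real) \<Rightarrow> 'l set ring" where
  "residue_field av = valuation_ring av Quot {u. av u < 1}"

definition residue :: "('l::field \<Rightarrow> real) \<Rightarrow> 'l \<Rightarrow> 'l set" where
  "residue av u = {u. av u < 1} +>\<^bsub>valuation_ring av\<^esub> u"

text \<open>The classes in \<open>L\<^sup>\<times>/L\<^sup>\<times>\<^sup>p\<close> of the units of the valuation ring.\<close>

definition unit_classes :: "('l::field \<Rightarrow> real) \<Rightarrow> nat \<Rightarrow> 'l set set" where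
  "unit_classes av p = power_coset field_units p ` {u. av u = 1}"


section \<open>The smooth projective curve with affine model \<open>y\<^sup>p = x\<^sup>r (d - x)\<close>\<close>

text \<open>In a bivariate polynomial of type \<open>'a poly poly\<close> the inner variable is \<open>x\<close> and the outer
  variable is \<open>y\<close>.\<close>

definition curve_poly :: "nat \<Rightarrow> nat \<Rightarrow> 'a::field \<Rightarrow> 'a poly poly" where
  "curve_poly p r d = [:0, 1:] ^ p - [: [:0, 1:] ^ r * [:d, -1:] :]"

text \<open>Over an algebraically closed field \<open>k\<close>, the points of the smooth projective curve with a given
  function field are the normalised discrete valuations of that function field which are trivial
  on \<open>k\<close>. The function field here is the fraction field of \<open>k[x,y]/(F)\<close>, and a valuation \<open>v\<close> is
  represented by its values on (representatives of) elements of \<open>k[x,y]/(F)\<close>, so that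
  \<open>v (g/h) = v g - v h\<close>. The value at \<open>0\<close>, properly \<open>\<infinity>\<close>, is set to \<open>0\<close>; it is never used.\<close>

type_synonym 'a point = "'a poly poly \<Rightarrow> int"

definition curve_points :: "'a::field poly poly \<Rightarrow> 'a point set" where
  "curve_points F =
     {v. v 0 = 0 \<and>
         (\<forall>g h. F dvd g - h \<longrightarrow> v g = v h) \<and>
         (\<forall>g h. \<not> F dvd g \<and> \<not> F dvd h \<longrightarrow> v (g * h) = v g + v h) \<and>
         (\<forall>g h. \<not> F dvd g \<and> \<not> F dvd h \<and> \<not> F dvd g + h \<longrightarrow> min (v g) (v h) \<le> v (g + h)) \<and>
         (\<forall>c. c \<noteq> 0 \<longrightarrow> v [:[:c:]:] = 0) \<and>
         (\<exists>g h. \<not> F dvd g \<and> \<not> F dvd h \<and> v g - v h = 1)}"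

text \<open>\<open>P\<close> lies above the point \<open>(a,b)\<close> of the affine model.\<close>

definition lies_above :: "'a::field point \<Rightarrow> 'a \<Rightarrow> 'a \<Rightarrow> bool" where
  "lies_above P a b \<longleftrightarrow> P [:[:-a, 1:]:] > 0 \<and> P [:[:-b:], 1:] > 0"

definition x_coord :: "'a::field point \<Rightarrow> 'a" where
  "x_coord P = (THE a. \<exists>b. lies_above P a b)"

text \<open>The automorphism \<open>(x,y) \<mapsto> (x, w y)\<close>, on points: \<open>ord\<^bsub>\<tau> P\<^esub> g = ord\<^bsub>P\<^esub> (g \<circ> \<tau>)\<close>.\<close>

definition curve_aut :: "'a::field \<Rightarrow> 'a point \<Rightarrow> 'a point" where
  "curve_aut w P = (\<lambda>g. P (pcompose g [:0, [:w:]:]))"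


section \<open>Rational divisors and the Jacobian\<close>

text \<open>Throughout, \<open>'l\<close> is the ground field \<open>L\<close>, assumed to be perfect; divisors live on the curve over
  the algebraic closure of \<open>L\<close>.\<close>

type_synonym 'l divisor = "'l alg_closure point \<Rightarrow> int"

definition divisors :: "nat \<Rightarrow> nat \<Rightarrow> 'l::field \<Rightarrow> 'l divisor set" where
  "divisors p r d =
     {D. finite {P. D P \<noteq> 0} \<and> {P. D P \<noteq> 0} \<subseteq> curve_points (curve_poly p r (to_ac d))}"

definition div_degree :: "'l::field divisor \<Rightarrow> int" where
  "div_degree D = (\<Sum>P | D P \<noteq> 0. D P)"

definition galois_group :: "('l::field alg_closure \<Rightarrow> 'l alg_closure) set" where
  "galois_group =
     {\<sigma> \<in> ring_iso ring_of_type_algebra ring_of_type_algebra. \<forall>c. \<sigma> (to_ac c) = to_ac c}"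

text \<open>The following is the action of \<open>\<sigma>\<^sup>-\<^sup>1\<close> on points: if \<open>P\<close> lies above \<open>(a,b)\<close>, then
  \<open>galois_act \<sigma> P\<close> lies above \<open>(\<sigma>\<^sup>-\<^sup>1 a, \<sigma>\<^sup>-\<^sup>1 b)\<close>.\<close>

definition galois_act ::
  "('l::field alg_closure \<Rightarrow> 'l alg_closure) \<Rightarrow> 'l alg_closure point \<Rightarrow> 'l alg_closure point" where
  "galois_act \<sigma> P = (\<lambda>g. P (map_poly (map_poly \<sigma>) g))"

definition rational_divisor :: "'l::field divisor \<Rightarrow> bool" where
  "rational_divisor D \<longleftrightarrow> (\<forall>\<sigma>\<in>galois_group. \<forall>P. D (galois_act \<sigma> P) = D P)"

definition div0_group :: "nat \<Rightarrow> nat \<Rightarrow> 'l::field \<Rightarrow> 'l divisor monoid" where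
  "div0_group p r d =
     \<lparr>carrier = {D \<in> divisors p r d. rational_divisor D \<and> div_degree D = 0},
      monoid.mult = (\<lambda>D E P. D P + E P), one = (\<lambda>P. 0)\<rparr>"

text \<open>The divisors of the rational functions \<open>g/h\<close> defined over \<open>L\<close>.\<close>

definition principal_divisors :: "nat \<Rightarrow> nat \<Rightarrow> 'l::field \<Rightarrow> 'l divisor set" where
  "principal_divisors p r d =
     {(\<lambda>P. if P \<in> curve_points (curve_poly p r (to_ac d))
           then P (map_poly (map_poly to_ac) g) - P (map_poly (map_poly to_ac) h) else 0)
      | g h. \<not> curve_poly p r d dvd g \<and> \<not> curve_poly p r d dvd h}"

text \<open>The group \<open>J(L)\<close>. As the curve has an \<open>L\<close>-rational point, the \<open>L\<close>-points of the Jacobian are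
  the classes of the \<open>L\<close>-rational divisors of degree zero.\<close>

definition jacobian :: "nat \<Rightarrow> nat \<Rightarrow> 'l::field \<Rightarrow> 'l divisor set monoid" where
  "jacobian p r d = div0_group p r d Mod principal_divisors p r d"

definition div_class :: "nat \<Rightarrow> nat \<Rightarrow> 'l::field \<Rightarrow> 'l divisor \<Rightarrow> 'l divisor set" where
  "div_class p r d D = principal_divisors p r d #>\<^bsub>div0_group p r d\<^esub> D"

text \<open>The endomorphism \<open>\<Pi> = w - w\<^sup>-\<^sup>1\<close>, where \<open>w\<close> acts by the push-forward of divisors along
  \<open>\<tau> = curve_aut w\<close>, that is, by \<open>D \<mapsto> D \<circ> \<tau>\<^sup>-\<^sup>1\<close>.\<close>

definition Pi_divisor :: "'l::field \<Rightarrow> 'l divisor \<Rightarrow> 'l divisor" where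
  "Pi_divisor w D =
     (\<lambda>P. D (curve_aut (inverse (to_ac w)) P) - D (curve_aut (to_ac w) P))"

definition Pi_jacobian :: "nat \<Rightarrow> nat \<Rightarrow> 'l::field \<Rightarrow> 'l \<Rightarrow> 'l divisor set \<Rightarrow> 'l divisor set" where
  "Pi_jacobian p r d w Cl = (\<Union>D\<in>Cl. div_class p r d (Pi_divisor w D))"

definition jacobian_mod_Pi ::
  "nat \<Rightarrow> nat \<Rightarrow> 'l::field \<Rightarrow> 'l \<Rightarrow> 'l divisor set set monoid" where
  "jacobian_mod_Pi p r d w =
     jacobian p r d Mod (Pi_jacobian p r d w ` carrier (jacobian p r d))"


section \<open>The descent map\<close>

text \<open>Support away from the points above \<open>(0,0)\<close> and the points at infinity.\<close>

definition good_support :: "'l::field divisor \<Rightarrow> bool" where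
  "good_support D \<longleftrightarrow>
     (\<forall>P. D P \<noteq> 0 \<longrightarrow> (\<exists>a b. (a, b) \<noteq> (0, 0) \<and> lies_above P a b))"

definition x_value :: "'l::field divisor \<Rightarrow> 'l alg_closure" where
  "x_value D = (\<Prod>P | D P \<noteq> 0. x_coord P powi D P)"

text \<open>For a rational divisor \<open>D\<close> the product \<open>x_value D\<close> is an element \<open>u\<close> of the ground field. All
  admissible \<open>D\<close> representing \<open>c\<close> give the same class of \<open>u\<close> modulo \<open>p\<close>-th powers.\<close>

definition descent_map ::
  "nat \<Rightarrow> nat \<Rightarrow> 'l::field \<Rightarrow> 'l divisor set set \<Rightarrow> 'l set" where
  "descent_map p r d c =
     the_elem {power_coset field_units p u | u D.
       D \<in> carrier (div0_group p r d) \<and> good_support D \<and>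
       div_class p r d D \<in> c \<and> to_ac u = x_value D}"

definition descent_image :: "nat \<Rightarrow> nat \<Rightarrow> 'l::field \<Rightarrow> 'l \<Rightarrow> 'l set set" where
  "descent_image p r d w = descent_map p r d ` carrier (jacobian_mod_Pi p r d w)"

end

theory Submission
  imports Defs "HOL-Number_Theory.Number_Theory"
begin

text \<open>Let \<open>L\<close> be the completion. Two rational divisors with the same class modulo \<open>\<Pi>J(L)\<close>, both
  supported on points with \<open>x \<noteq> 0, \<infinity>\<close>, differ by a principal divisor \<open>div f\<close> after moving, since \<open>x\<close> takes the
  value \<open>1\<close> on divisors of the form \<open>D \<circ> \<tau>\<^sup>-\<^sup>1 - D \<circ> \<tau>\<close>. As \<open>x\<close> has divisor \<open>p P\<^sub>0 - p P\<^sub>\<infinity>\<close>, the value of \<open>x\<close> on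
  \<open>div f\<close> is, as in Weil reciprocity, the quotient of the leading coefficients of the norm of \<open>f\<close> at \<open>x = 0\<close>
  and \<open>x = \<infinity>\<close>, and both are \<open>p\<close>-th powers in \<open>L\<close>. So the image of the descent map consists of the classes of
  the products \<open>\<Prod> a\<^sup>m\<close> over Galois invariant \<open>m\<close> of degree zero on the affine points \<open>(a, b)\<close>, \<open>a \<noteq> 0\<close>.

  If \<open>l\<close> does not divide \<open>\<delta>\<close>, the absolute values \<open>|a| \<noteq> 1\<close> contribute \<open>p\<close>-th powers up to units, and a point
  count over a large residue field yields a divisor on which \<open>x\<close> is not a \<open>p\<close>-th power. If \<open>l\<close> divides \<open>\<delta>\<close>,
  then \<open>a\<close> is a \<open>p\<close>-th power times a power of \<open>\<delta>\<close> unless \<open>a / \<delta>\<close> and \<open>1 - a / \<delta>\<close> are both units. The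
  points of the latter kind in a fixed residue class have total multiplicity divisible by \<open>p\<close>.\<close>

section \<open>Ring homomorphisms and roots of power series\<close>

text \<open>Whatever must land in \<open>L\<close> is obtained by Galois descent: an element of the
  closure fixed by the Galois group is rational (\<open>galois_fixed\<close>). Hence every choice
  made at a point has to commute with automorphisms. Because \<open>l\<close> is not
  \<open>p\<close>, two such choices exist: a unit congruent to 1 has exactly one
  \<open>p\<close>-th root congruent to 1 (\<open>rho\<close>), and an integral element has exactly
  one Teichmueller representative (\<open>teich\<close>). A coordinate \<open>a\<close> is written
  as the \<open>p\<close>-th power of an expression in these, times a controlled factor, before
  multiplying over a divisor. Cyclotomy enters through the locale \<open>unramified\<close>:
  absolute values are powers of that of \<open>l\<close>, and residues satisfy
  \<open>x^q = x\<close> for a power \<open>q\<close> of \<open>l\<close> congruent to 1 modulo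
  \<open>p\<close>. On the geometric side a point is an abstract valuation, tied to coordinates by
  Laurent expansions. The points over \<open>x = 0\<close> and \<open>x = \<infinity>\<close> are
  tractable because \<open>p\<close> is prime to \<open>r\<close> and \<open>r + 1\<close>: in a
  reduced function the terms \<open>c_j(x) y^j\<close> have pairwise distinct orders there, so each
  value and each leading coefficient comes from a single term.\<close>

definition rhom :: "('a::comm_ring_1 \<Rightarrow> 'b::comm_ring_1) \<Rightarrow> bool" where
  "rhom h \<longleftrightarrow> h 0 = 0 \<and> h 1 = 1 \<and> (\<forall>a b. h (a + b) = h a + h b) \<and> (\<forall>a b. h (a * b) = h a * h b)"

lemma rhomI:
  assumes "h 0 = 0" "h 1 = 1" "\<And>a b. h (a + b) = h a + h b" "\<And>a b. h (a * b) = h a * h b"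
  shows "rhom h" using assms by (simp add: rhom_def)

lemma rhom_0: "rhom h \<Longrightarrow> h 0 = 0"
  and rhom_1: "rhom h \<Longrightarrow> h 1 = 1"
  and rhom_add: "rhom h \<Longrightarrow> h (a + b) = h a + h b"
  and rhom_mult: "rhom h \<Longrightarrow> h (a * b) = h a * h b" by (auto simp: rhom_def)

lemma rhom_minus: "rhom h \<Longrightarrow> h (- a) = - h a"
  by (metis add.right_inverse add_eq_0_iff rhom_0 rhom_add)

lemma rhom_diff: "rhom h \<Longrightarrow> h (a - b) = h a - h b"
  using rhom_add[of h a "- b"] rhom_minus[of h b] by simp

lemma rhom_power: "rhom h \<Longrightarrow> h (a ^ n) = h a ^ n"
  by (induction n) (simp_all add: rhom_1 rhom_mult)

lemma rhom_sum: "rhom h \<Longrightarrow> h (\<Sum>x\<in>A. f x) = (\<Sum>x\<in>A. h (f x))"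
  by (induction A rule: infinite_finite_induct) (simp_all add: rhom_0 rhom_add)

lemma rhom_prod: "rhom h \<Longrightarrow> h (\<Prod>x\<in>A. f x) = (\<Prod>x\<in>A. h (f x))"
  by (induction A rule: infinite_finite_induct) (simp_all add: rhom_1 rhom_mult)

lemma rhom_of_nat: "rhom h \<Longrightarrow> h (of_nat n) = of_nat n"
  by (induction n) (simp_all add: rhom_0 rhom_1 rhom_add)

lemma rhom_of_int: "rhom h \<Longrightarrow> h (of_int n) = of_int n"
  by (cases n rule: int_cases2) (simp_all add: rhom_of_nat rhom_minus)

lemma rhom_dvd: "rhom h \<Longrightarrow> a dvd b \<Longrightarrow> h a dvd h b"
  by (auto simp: dvd_def rhom_mult)

lemmas rhom_simps = rhom_0 rhom_1 rhom_add rhom_mult rhom_minus rhom_diff rhom_power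

lemma rhom_field_eq_0: "rhom (h :: 'a::field \<Rightarrow> 'b::field) \<Longrightarrow> h a = 0 \<longleftrightarrow> a = 0"
  by (metis mult_zero_left right_inverse rhom_0 rhom_1 rhom_mult zero_neq_one)

lemma rhom_inverse: "rhom (h :: 'a::field \<Rightarrow> 'b::field) \<Longrightarrow> h (inverse a) = inverse (h a)"
  by (metis inverse_unique inverse_zero right_inverse rhom_0 rhom_1 rhom_mult)

lemma rhom_divide: "rhom (h :: 'a::field \<Rightarrow> 'b::field) \<Longrightarrow> h (a / b) = h a / h b"
  by (simp add: divide_inverse rhom_inverse rhom_mult)

lemma rhom_powi: "rhom (h :: 'a::field \<Rightarrow> 'b::field) \<Longrightarrow> h (a powi n) = h a powi n"
  by (simp add: power_int_def rhom_power rhom_inverse)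

lemma rhom_inj: "rhom (h :: 'a::field \<Rightarrow> 'b::field) \<Longrightarrow> h a = h b \<longleftrightarrow> a = b"
  using rhom_field_eq_0[of h "a - b"] by (simp add: rhom_diff)

lemma rhom_comp: "rhom g \<Longrightarrow> rhom h \<Longrightarrow> rhom (\<lambda>x. g (h x))"
  by (simp add: rhom_def)

lemma rhom_to_ac: "rhom to_ac" by (auto intro: rhomI)

lemma rhom_map_poly:
  assumes h: "rhom h"
  shows "rhom (map_poly h)"
proof (rule rhomI)
  show "map_poly h (a + b) = map_poly h a + map_poly h b" for a b
    by (rule poly_eqI) (simp add: coeff_map_poly rhom_simps[OF h])
  show "map_poly h (a * b) = map_poly h a * map_poly h b" for a b
    by (rule poly_eqI) (simp add: coeff_map_poly rhom_simps[OF h] coeff_mult rhom_sum[OF h])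
qed (use h in \<open>simp_all add: rhom_simps map_poly_1\<close>)

lemma rhom_poly_eval: "rhom (\<lambda>f. poly f y)" by (auto intro: rhomI)

lemma rhom_poly_map: "rhom h \<Longrightarrow> rhom (\<lambda>f. poly (map_poly h f) y)"
  using rhom_comp[OF rhom_poly_eval rhom_map_poly] .

lemma map_poly_pCons_rhom: "rhom h \<Longrightarrow> map_poly h (pCons a f) = pCons (h a) (map_poly h f)"
  by (simp add: map_poly_pCons rhom_0)

lemma rhom_pcompose: "rhom (\<lambda>f. pcompose f g)"
  by (rule rhomI) (simp_all add: pcompose_add pcompose_mult one_pCons)

lemma rhom_const_poly: "rhom (\<lambda>c. [:c:])" by (rule rhomI) (simp_all add: one_pCons)

lemma rhom_poly_eqI:
  assumes "rhom \<phi>" "rhom \<psi>" "\<And>c. \<phi> [:c:] = \<psi> [:c:]" "\<phi> [:0, 1:] = \<psi> [:0, 1:]"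
  shows "\<phi> f = \<psi> f"
proof (induction f)
  case (pCons a f)
  have "pCons a f = [:a:] + [:0, 1:] * f" by simp
  then show ?case using assms pCons.IH by (simp only: rhom_add rhom_mult)
qed (use assms in \<open>simp add: rhom_0\<close>)

lemma rhom_poly2_eqI:
  assumes "rhom \<phi>" "rhom \<psi>" "\<And>c. \<phi> [:[:c:]:] = \<psi> [:[:c:]:]"
    "\<phi> [:[:0, 1:]:] = \<psi> [:[:0, 1:]:]" "\<phi> [:0, 1:] = \<psi> [:0, 1:]"
  shows "\<phi> f = \<psi> f"
proof (rule rhom_poly_eqI[OF assms(1,2) _ assms(5)])
  fix c :: "'a poly"
  have "rhom (\<lambda>c. \<phi> [:c:])" "rhom (\<lambda>c. \<psi> [:c:])"
    by (rule rhom_comp[OF assms(1) rhom_const_poly] rhom_comp[OF assms(2) rhom_const_poly])+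
  from this assms(3,4) show "\<phi> [:c:] = \<psi> [:c:]" by (rule rhom_poly_eqI)
qed

lemma poly_rhom: "rhom h \<Longrightarrow> poly (map_poly h f) (h x) = h (poly f x)"
  by (induction f) (simp_all add: map_poly_pCons_rhom rhom_simps)

lemma map_poly_eq_0_rhom: "rhom (h :: 'a::field \<Rightarrow> 'b::field) \<Longrightarrow> map_poly h f = 0 \<longleftrightarrow> f = 0"
  by (auto simp: poly_eq_iff coeff_map_poly rhom_0 rhom_field_eq_0)

lemma degree_map_poly_rhom: "rhom (h :: 'a::field \<Rightarrow> 'b::field) \<Longrightarrow> degree (map_poly h f) = degree f"
  by (rule degree_map_poly) (simp add: rhom_field_eq_0)

lemma poly_prod_roots_coeff_rhom:
  assumes "rhom h"
  shows "map_poly h (\<Prod>x\<in>A. [:- f x, 1:]) = (\<Prod>x\<in>A. [:- h (f x), 1:])"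
  using assms by (simp add: rhom_prod[OF rhom_map_poly] map_poly_pCons_rhom rhom_simps)

lemma poly_eq_map_to_ac:
  assumes "\<And>i. coeff f i \<in> range to_ac"
  obtains g where "f = map_poly to_ac g" "degree g = degree f"
proof
  show *: "f = map_poly to_ac (map_poly of_ac f)"
    using assms by (intro poly_eqI) (simp add: coeff_map_poly to_ac_of_ac)
  show "degree (map_poly of_ac f) = degree f"
    using degree_map_poly_rhom[OF rhom_to_ac, of "map_poly of_ac f"] * by metis
qed

section \<open>Roots of power series by successive approximation\<close>

text \<open>The first-order effect of a perturbation at degree \<open>n\<close>: lower coefficients
  of the power do not move, and the one at \<open>n\<close> moves by the derivative
  \<open>p B(0)^(p-1)\<close> times \<open>c\<close>.\<close>

lemma fps_power_add_X_power_nth: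
  fixes B :: "'a::comm_ring_1 fps"
  assumes "n > 0"
  shows "m \<le> n \<Longrightarrow> ((B + fps_const c * fps_X ^ n) ^ p) $ m =
     (B ^ p) $ m + (if m = n then of_nat p * c * (B $ 0) ^ (p - 1) else 0)"
proof (induction p arbitrary: m)
  case (Suc p)
  let ?C = "B + fps_const c * fps_X ^ n"
  have C: "?C $ i = B $ i + (if i = n then c else 0)" for i by (simp add: fps_X_power_iff)
  have "(?C ^ Suc p) $ m = (\<Sum>i=0..m. ?C $ i * (?C ^ p) $ (m - i))"
    by (simp add: fps_mult_nth)
  \<comment> \<open>For \<open>m = n\<close> the perturbation enters either through the power
    (\<open>i = 0\<close>) or through the factor (\<open>i = n\<close>); both at once would have
    degree \<open>2n\<close>, beyond \<open>m\<close>.\<close>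
  also have "\<dots> = (\<Sum>i=0..m. B $ i * (B ^ p) $ (m - i)
      + (if i = 0 \<and> m = n then B $ 0 * (of_nat p * c * (B $ 0) ^ (p - 1)) else 0)
      + (if i = n \<and> m = n then c * (B ^ p) $ 0 else 0))"
  proof (intro sum.cong refl)
    fix i assume i: "i \<in> {0..m}"
    have "(?C ^ p) $ (m - i) = (B ^ p) $ (m - i) +
        (if m - i = n then of_nat p * c * (B $ 0) ^ (p - 1) else 0)"
      by (rule Suc.IH) (use Suc.prems in simp)
    moreover have "m - i = n \<longleftrightarrow> i = 0 \<and> m = n"
      using Suc.prems i assms by auto
    moreover have "i = n \<Longrightarrow> m = n" using Suc.prems i by auto
    ultimately show "?C $ i * (?C ^ p) $ (m - i) = B $ i * (B ^ p) $ (m - i)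
      + (if i = 0 \<and> m = n then B $ 0 * (of_nat p * c * (B $ 0) ^ (p - 1)) else 0)
      + (if i = n \<and> m = n then c * (B ^ p) $ 0 else 0)"
      unfolding C using assms by (auto simp: algebra_simps)
  qed
  also have "\<dots> = (\<Sum>i=0..m. B $ i * (B ^ p) $ (m - i))
      + (if m = n then B $ 0 * (of_nat p * c * (B $ 0) ^ (p - 1)) else 0)
      + (if m = n then c * (B ^ p) $ 0 else 0)"
    by (subst sum.distrib, subst sum.distrib) (use Suc.prems in \<open>cases "m = n"; simp\<close>)
  also have "(\<Sum>i=0..m. B $ i * (B ^ p) $ (m - i)) = (B ^ Suc p) $ m"
    by (simp add: fps_mult_nth)
  also have "(B ^ p) $ 0 = (B $ 0) ^ p" by (rule fps_power_zeroth)
  also have "(B ^ Suc p) $ m + (if m = n then B $ 0 * (of_nat p * c * (B $ 0) ^ (p - 1)) else 0)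
      + (if m = n then c * (B $ 0) ^ p else 0) = (B ^ Suc p) $ m +
     (if m = n then of_nat (Suc p) * c * (B $ 0) ^ (Suc p - 1) else 0)"
    by (cases p) (simp_all add: algebra_simps del: power_Suc add: power_Suc[of "B $ 0"])
  finally show ?case .
qed (use assms in \<open>auto simp: fps_mult_nth fps_one_nth\<close>)

lemma fps_power_nth_cong:
  assumes "\<And>i. i \<le> m \<Longrightarrow> A $ i = (B :: 'a::comm_ring_1 fps) $ i"
  shows "(A ^ p) $ m = (B ^ p) $ m" using assms
proof (induction p arbitrary: m)
  case (Suc p)
  then show ?case by (auto simp: fps_mult_nth intro!: sum.cong)
qed simp

text \<open>The coefficients are found one at a time: prescribing the coefficient of
  \<open>X^n\<close> in the power is a linear equation with slope \<open>p s^(p-1)\<close>, nonzero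
  by hypothesis. Such roots later supply the local expansions of \<open>y\<close>.\<close>

lemma fps_root_exists:
  fixes A :: "'a::field fps"
  assumes "of_nat p \<noteq> (0::'a)" "s \<noteq> 0" "A $ 0 = s ^ p"
  obtains B where "B ^ p = A" "B $ 0 = s"
proof -
  define step where "step n B = B + fps_const ((A $ n - (B ^ p) $ n) / (of_nat p * s ^ (p - 1))) * fps_X ^ n"
    for n and B :: "'a fps"
  define S where "S = rec_nat (fps_const s) (\<lambda>n. step (Suc n))"
  have S0: "S 0 = fps_const s" and SS: "S (Suc n) = step (Suc n) (S n)" for n
    by (simp_all add: S_def)
  have Snth: "S (Suc n) $ i = S n $ i" if "i \<noteq> Suc n" for n i
    using that by (auto simp: SS step_def fps_X_power_iff)
  have const: "S n $ 0 = s" for n by (induction n) (simp_all add: S0 Snth)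
  have good: "(S n ^ p) $ m = A $ m" if "m \<le> n" for n m using that
  proof (induction n arbitrary: m)
    case 0
    then show ?case by (simp add: S0 fps_const_power assms)
  next
    case (Suc n)
    have "(S (Suc n) ^ p) $ m = (S n ^ p) $ m + (if m = Suc n then of_nat p *
       ((A $ Suc n - (S n ^ p) $ Suc n) / (of_nat p * s ^ (p - 1))) * (S n $ 0) ^ (p - 1) else 0)"
      unfolding SS step_def by (rule fps_power_add_X_power_nth) (use Suc.prems in auto)
    then show ?case using Suc assms const by auto
  qed
  have stab: "S n $ i = S i $ i" if "i \<le> n" for i n
    using that by (induction n) (auto simp: Snth le_Suc_eq)
  \<comment> \<open>Later stages leave coefficient \<open>n\<close> alone, so the diagonal is the
    limit of the stages.\<close>
  define B where "B = Abs_fps (\<lambda>n. S n $ n)"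
  have "(B ^ p) $ n = A $ n" for n
  proof -
    have "(B ^ p) $ n = (S n ^ p) $ n"
      by (rule fps_power_nth_cong) (simp add: B_def stab[symmetric])
    then show ?thesis using good[of n n] by simp
  qed
  then have "B ^ p = A" by (simp add: fps_eq_iff)
  moreover have "B $ 0 = s" by (simp add: B_def const)
  ultimately show ?thesis using that by blast
qed

section \<open>The Galois group of an algebraic closure\<close>

lemma galois_iff:
  "\<sigma> \<in> galois_group \<longleftrightarrow> rhom \<sigma> \<and> bij \<sigma> \<and> (\<forall>c. \<sigma> (to_ac c) = to_ac c)"
proof -
  have "\<sigma> 0 = 0" if "\<forall>x y. \<sigma> (x + y) = \<sigma> x + \<sigma> y"
    using that by (metis add_cancel_right_left)
  then show ?thesis
    by (auto simp: galois_group_def ring_iso_def ring_hom_def ring_of_type_algebra_def rhom_def)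
qed

lemma galoisD:
  assumes "\<sigma> \<in> galois_group"
  shows "rhom \<sigma>" "bij \<sigma>" "\<sigma> (to_ac c) = to_ac c"
  using assms by (auto simp: galois_iff)

lemma galois_id: "(\<lambda>x. x) \<in> galois_group"
  by (simp add: galois_iff rhom_def flip: id_def)

lemma galois_comp: "\<sigma> \<in> galois_group \<Longrightarrow> \<tau> \<in> galois_group \<Longrightarrow> (\<lambda>x. \<sigma> (\<tau> x)) \<in> galois_group"
  using bij_comp[of \<tau> \<sigma>] by (simp add: galois_iff rhom_comp comp_def)

lemma galois_inv:
  assumes "\<sigma> \<in> galois_group"
  shows "inv_into UNIV \<sigma> \<in> galois_group"
proof -
  note \<sigma> = galoisD[OF assms]
  have eq: "inv_into UNIV \<sigma> x = y \<longleftrightarrow> x = \<sigma> y" for x y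
    using \<sigma>(2) by (metis bij_inv_eq_iff)
  have s: "\<sigma> (inv_into UNIV \<sigma> x) = x" for x using \<sigma>(2) by (metis eq)
  have "rhom (inv_into UNIV \<sigma>)"
    by (rule rhomI) (simp_all add: eq s rhom_simps[OF \<sigma>(1)])
  moreover have "bij (inv_into UNIV \<sigma>)" using \<sigma>(2) by (rule bij_imp_bij_inv)
  ultimately show ?thesis by (simp add: galois_iff eq \<sigma>)
qed

lemma galois_inv_apply:
  assumes "\<sigma> \<in> galois_group"
  shows "\<sigma> (inv_into UNIV \<sigma> x) = x" "inv_into UNIV \<sigma> (\<sigma> x) = x"
  using galoisD(2)[OF assms] by (metis bij_inv_eq_iff)+

lemma galois_map_poly:
  assumes "\<sigma> \<in> galois_group"
  shows "map_poly \<sigma> (map_poly to_ac f) = map_poly to_ac f"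
  using galoisD[OF assms] by (simp add: poly_eq_iff coeff_map_poly rhom_0)

lemma rhom_fixing_root:
  assumes "rhom \<sigma>" "\<And>c. \<sigma> (to_ac c) = to_ac c" "poly (map_poly to_ac f) x = 0"
  shows "poly (map_poly to_ac f) (\<sigma> x) = 0"
proof -
  have "map_poly \<sigma> (map_poly to_ac f) = map_poly to_ac f"
    using assms by (simp add: poly_eq_iff coeff_map_poly rhom_0)
  then show ?thesis
    using poly_rhom[OF assms(1), of "map_poly to_ac f" x] assms by (simp add: rhom_0)
qed

lemma finite_galois_orbit: "finite {\<sigma> x | \<sigma>. \<sigma> \<in> galois_group}"
proof -
  obtain f where f: "f \<noteq> 0" "poly (map_poly to_ac f) x = 0"
    using alg_closure_algebraic by blast
  then have "finite {y. poly (map_poly to_ac f) y = 0}"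
    by (intro poly_roots_finite) (simp add: map_poly_eq_0_rhom[OF rhom_to_ac])
  moreover have "{\<sigma> x | \<sigma>. \<sigma> \<in> galois_group} \<subseteq> {y. poly (map_poly to_ac f) y = 0}"
    using rhom_fixing_root[OF _ _ f(2)] by (auto simp: galois_iff)
  ultimately show ?thesis by (rule finite_subset[rotated])
qed

text \<open>Surjectivity comes from algebraicity: the injective map sends the finite root set of a
  polynomial over the ground field into itself, hence onto itself.\<close>

lemma rhom_fixing_bij:
  assumes "rhom (\<sigma> :: 'l::field alg_closure \<Rightarrow> 'l alg_closure)" "\<And>c. \<sigma> (to_ac c) = to_ac c"
  shows "bij \<sigma>"
proof -
  have inj: "inj \<sigma>" using rhom_inj[OF assms(1)] by (auto simp: inj_on_def)
  moreover have "surj \<sigma>"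
    unfolding surj_def
  proof
    fix y
    obtain f :: "'l poly" where f: "f \<noteq> 0" "poly (map_poly to_ac f) y = 0"
      using alg_closure_algebraic by blast
    let ?S = "{y. poly (map_poly to_ac f) y = 0}"
    have "finite ?S"
      using f by (intro poly_roots_finite) (simp add: map_poly_eq_0_rhom[OF rhom_to_ac])
    moreover have "\<sigma> ` ?S \<subseteq> ?S" using rhom_fixing_root[OF assms] by auto
    ultimately have "\<sigma> ` ?S = ?S"
      using inj by (metis endo_inj_surj inj_on_subset subset_UNIV)
    then show "\<exists>x. y = \<sigma> x" using f(2) by blast
  qed
  ultimately show ?thesis by (simp add: bij_def)
qed

section \<open>Extending partial homomorphisms to automorphisms\<close>

text \<open>A graph rather than a function on a subfield, so that chains are joined by plain unions.
  Single-valuedness follows from the condition at 0, and closure under inverses from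
  algebraicity.\<close>

definition partial_hom :: "('l::field alg_closure \<times> 'l alg_closure) set \<Rightarrow> bool" where
  "partial_hom R \<longleftrightarrow> (\<forall>c. (to_ac c, to_ac c) \<in> R) \<and>
     (\<forall>x y x' y'. (x, y) \<in> R \<and> (x', y') \<in> R \<longrightarrow> (x + x', y + y') \<in> R \<and> (x * x', y * y') \<in> R) \<and>
     (\<forall>y. (0, y) \<in> R \<longrightarrow> y = 0)"

lemma map_poly_smult_rhom: "rhom h \<Longrightarrow> map_poly h (Polynomial.smult c f) = Polynomial.smult (h c) (map_poly h f)"
  by (rule poly_eqI) (simp add: coeff_map_poly rhom_simps)

text \<open>Dividing an annihilating polynomial by the variable until its constant term is nonzero
  expresses the inverse polynomially. Therefore subrings of the closure containing the ground field
  are already fields.\<close>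

lemma inverse_eq_poly:
  fixes x :: "'l::field alg_closure"
  assumes "x \<noteq> 0"
  obtains h :: "'l poly" where "x * poly (map_poly to_ac h) x = 1"
proof -
  have "\<exists>h :: 'l poly. x * poly (map_poly to_ac h) x = 1"
    if "f \<noteq> 0" "poly (map_poly to_ac f) x = 0" for f using that
  proof (induction f rule: pderiv.induct)
    case (1 c f)
    show ?case
    proof (cases "c = 0")
      case True
      then show ?thesis
        using 1 assms by (auto simp: map_poly_pCons_rhom[OF rhom_to_ac] split: if_splits)
    next
      case False
      have "x * poly (map_poly to_ac (smult (- inverse c) f)) x
          = - to_ac (inverse c) * (x * poly (map_poly to_ac f) x)"
        by (simp add: map_poly_smult_rhom[OF rhom_to_ac] rhom_minus[OF rhom_map_poly[OF rhom_to_ac]])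
      also have "x * poly (map_poly to_ac f) x = - to_ac c"
        using 1(3) by (simp add: map_poly_pCons_rhom[OF rhom_to_ac] add_eq_0_iff)
      finally show ?thesis using False by (intro exI[of _ "smult (- inverse c) f"]) simp
    qed
  qed
  then show ?thesis using alg_closure_algebraic[of x] that by metis
qed

context
  fixes R :: "('l::field alg_closure \<times> 'l alg_closure) set"
  assumes R: "partial_hom R"
begin

lemma ph_const: "(to_ac c, to_ac c) \<in> R"
  and ph_add: "(x, y) \<in> R \<Longrightarrow> (x', y') \<in> R \<Longrightarrow> (x + x', y + y') \<in> R"
  and ph_mult: "(x, y) \<in> R \<Longrightarrow> (x', y') \<in> R \<Longrightarrow> (x * x', y * y') \<in> R"
  and ph_zero: "(0, y) \<in> R \<Longrightarrow> y = 0" using R by (auto simp: partial_hom_def)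

lemma ph_minus: "(x, y) \<in> R \<Longrightarrow> (- x, - y) \<in> R"
  using ph_mult[OF ph_const[of "- 1"], of x y] by simp

lemma ph_diff: "(x, y) \<in> R \<Longrightarrow> (x', y') \<in> R \<Longrightarrow> (x - x', y - y') \<in> R"
  using ph_add[OF _ ph_minus] by simp

lemma ph_unique: "(x, y) \<in> R \<Longrightarrow> (x, y') \<in> R \<Longrightarrow> y = y'"
  using ph_diff ph_zero by fastforce

lemma ph_poly: "(x, y) \<in> R \<Longrightarrow> (poly (map_poly to_ac h) x, poly (map_poly to_ac h) y) \<in> R"
proof (induction h)
  case 0
  then show ?case using ph_const[of 0] by simp
next
  case (pCons c h)
  then show ?case by (simp add: map_poly_pCons_rhom[OF rhom_to_ac] ph_add ph_mult ph_const)
qed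

lemma ph_inverse: "(x, y) \<in> R \<Longrightarrow> (inverse x, inverse y) \<in> R"
proof (cases "x = 0")
  case True
  assume "(x, y) \<in> R"
  then show ?thesis using True ph_zero[of y] ph_const[of 0] by simp
next
  case False
  assume xy: "(x, y) \<in> R"
  obtain h where h: "x * poly (map_poly to_ac h) x = 1" using inverse_eq_poly[OF False] by blast
  have "(1, y * poly (map_poly to_ac h) y) \<in> R"
    using ph_mult[OF xy ph_poly[OF xy, of h]] h by simp
  then have "y * poly (map_poly to_ac h) y = 1" using ph_unique[of 1 _ 1] ph_const[of 1] by simp
  then show ?thesis using ph_poly[OF xy, of h] h by (metis inverse_unique)
qed

definition ph_fun :: "'l alg_closure \<Rightarrow> 'l alg_closure" where
  "ph_fun x = (THE y. (x, y) \<in> R)"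

lemma ph_fun_eq: "(x, y) \<in> R \<Longrightarrow> ph_fun x = y"
  unfolding ph_fun_def using ph_unique by blast

lemma ph_fun_in: "x \<in> Domain R \<Longrightarrow> (x, ph_fun x) \<in> R"
  using ph_fun_eq by blast

definition ph_polys :: "'l alg_closure poly set" where
  "ph_polys = {g. \<forall>i. coeff g i \<in> Domain R}"

lemma ph_domain:
  assumes "x \<in> Domain R" "y \<in> Domain R"
  shows "x + y \<in> Domain R" "x * y \<in> Domain R" "x - y \<in> Domain R" "inverse x \<in> Domain R"
    "ph_fun (x + y) = ph_fun x + ph_fun y" "ph_fun (x * y) = ph_fun x * ph_fun y"
    "ph_fun (x - y) = ph_fun x - ph_fun y"
proof -
  note xy = assms[THEN ph_fun_in]
  show "x + y \<in> Domain R" "x * y \<in> Domain R" "x - y \<in> Domain R" "inverse x \<in> Domain R"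
    by (rule DomainI[OF ph_add[OF xy]] DomainI[OF ph_mult[OF xy]] DomainI[OF ph_diff[OF xy]]
        DomainI[OF ph_inverse[OF xy(1)]])+
  show "ph_fun (x + y) = ph_fun x + ph_fun y" "ph_fun (x * y) = ph_fun x * ph_fun y"
    "ph_fun (x - y) = ph_fun x - ph_fun y"
    by (rule ph_fun_eq[OF ph_add[OF xy]] ph_fun_eq[OF ph_mult[OF xy]] ph_fun_eq[OF ph_diff[OF xy]])+
qed

lemma ph_fun_0: "ph_fun 0 = 0" and ph_fun_1: "ph_fun 1 = 1"
  using ph_fun_eq ph_const[of 0] ph_const[of 1] by auto

lemma ph_domain_const: "to_ac c \<in> Domain R" using ph_const by blast

lemma ph_sum:
  assumes "\<And>i. i \<in> A \<Longrightarrow> f i \<in> Domain R"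
  shows "sum f A \<in> Domain R \<and> ph_fun (sum f A) = (\<Sum>i\<in>A. ph_fun (f i))"
  using assms by (induction A rule: infinite_finite_induct)
     (use ph_domain_const[of 0] in \<open>auto simp: ph_fun_0 ph_domain(1,5) simp del: Domain_iff\<close>)

lemma ph_polys_add:
  assumes "f \<in> ph_polys" "g \<in> ph_polys"
  shows "f + g \<in> ph_polys" "map_poly ph_fun (f + g) = map_poly ph_fun f + map_poly ph_fun g"
    "f - g \<in> ph_polys" "map_poly ph_fun (f - g) = map_poly ph_fun f - map_poly ph_fun g"
  using assms
  by (auto simp: ph_polys_def poly_eq_iff coeff_map_poly ph_fun_0 ph_domain simp del: Domain_iff)

lemma ph_polys_mult:
  assumes "f \<in> ph_polys" "g \<in> ph_polys"
  shows "f * g \<in> ph_polys" "map_poly ph_fun (f * g) = map_poly ph_fun f * map_poly ph_fun g"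
proof -
  have *: "coeff f i * coeff g j \<in> Domain R" for i j
    using assms ph_domain(2) by (auto simp: ph_polys_def simp del: Domain_iff)
  show "f * g \<in> ph_polys"
    unfolding ph_polys_def mem_Collect_eq coeff_mult by (intro allI ph_sum[THEN conjunct1] *)
  have "ph_fun (coeff (f * g) n) = coeff (map_poly ph_fun f * map_poly ph_fun g) n" for n
  proof -
    have "ph_fun (coeff (f * g) n) = (\<Sum>i\<le>n. ph_fun (coeff f i * coeff g (n - i)))"
      unfolding coeff_mult by (rule ph_sum[THEN conjunct2]) (rule *)
    also have "\<dots> = (\<Sum>i\<le>n. ph_fun (coeff f i) * ph_fun (coeff g (n - i)))"
      using assms by (intro sum.cong refl ph_domain(6)) (auto simp: ph_polys_def simp del: Domain_iff)
    finally show ?thesis by (simp add: coeff_mult coeff_map_poly ph_fun_0)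
  qed
  then show "map_poly ph_fun (f * g) = map_poly ph_fun f * map_poly ph_fun g"
    by (intro poly_eqI) (simp add: coeff_map_poly ph_fun_0)
qed

lemma ph_polys_monom: "c \<in> Domain R \<Longrightarrow> monom c n \<in> ph_polys"
  using ph_domain_const[of 0] by (auto simp: ph_polys_def simp del: Domain_iff)

text \<open>The minimal polynomial over the subfield \<open>Domain R\<close>, characterised by least
  degree instead of irreducibility because the subfield is only a set.\<close>

definition ph_minpoly :: "'l alg_closure \<Rightarrow> 'l alg_closure poly \<Rightarrow> bool" where
  "ph_minpoly \<alpha> f \<longleftrightarrow> f \<in> ph_polys \<and> lead_coeff f = 1 \<and> poly f \<alpha> = 0 \<and>
     (\<forall>g\<in>ph_polys. g \<noteq> 0 \<and> poly g \<alpha> = 0 \<longrightarrow> degree f \<le> degree g)"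

lemma ph_minpoly_exists: obtains f where "ph_minpoly \<alpha> f"
proof -
  obtain p where p: "p \<noteq> 0" "poly (map_poly to_ac p) \<alpha> = 0"
    using alg_closure_algebraic by blast
  define P where "P g \<longleftrightarrow> g \<in> ph_polys \<and> g \<noteq> 0 \<and> poly g \<alpha> = 0" for g
  have "P (map_poly to_ac p)"
    using p ph_domain_const by (auto simp: P_def ph_polys_def coeff_map_poly
        map_poly_eq_0_rhom[OF rhom_to_ac] simp del: Domain_iff)
  then obtain g where g: "P g" and min: "\<And>h. P h \<Longrightarrow> degree g \<le> degree h"
    using ex_has_least_nat[of P "map_poly to_ac p" degree] by blast
  have "ph_minpoly \<alpha> (smult (inverse (lead_coeff g)) g)"
    unfolding ph_minpoly_def
  proof (intro conjI ballI impI)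
    show "smult (inverse (lead_coeff g)) g \<in> ph_polys"
      using g unfolding P_def ph_polys_def mem_Collect_eq coeff_smult
      by (intro allI ph_domain(2) ph_domain(4)) auto
    show "degree (smult (inverse (lead_coeff g)) g) \<le> degree h"
      if "h \<in> ph_polys" "h \<noteq> 0 \<and> poly h \<alpha> = 0" for h
      using min[of h] that g by (auto simp: P_def)
  qed (use g in \<open>auto simp: P_def\<close>)
  then show ?thesis using that by blast
qed

text \<open>Division by the monic \<open>f\<close> with coefficients kept in the domain: minimality
  gives \<open>degree f \<le> degree g\<close> as long as \<open>g\<close> is nonzero, so
  subtracting a monomial multiple of \<open>f\<close> lowers the degree.\<close>

lemma ph_minpoly_kernel:
  assumes f: "ph_minpoly \<alpha> f" and \<beta>: "poly (map_poly ph_fun f) \<beta> = 0"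
    and g: "g \<in> ph_polys" "poly g \<alpha> = 0"
  shows "poly (map_poly ph_fun g) \<beta> = 0" using g
proof (induction "degree g" arbitrary: g rule: less_induct)
  case less
  have f': "f \<in> ph_polys" "lead_coeff f = 1" "poly f \<alpha> = 0"
    using f by (auto simp: ph_minpoly_def)
  show ?case
  proof (cases "g = 0")
    case False
    define m where "m = monom (lead_coeff g) (degree g - degree f)"
    have fg: "degree f \<le> degree g" using f less.prems False by (auto simp: ph_minpoly_def)
    have m: "m \<in> ph_polys"
      unfolding m_def by (rule ph_polys_monom) (use less.prems in \<open>simp add: ph_polys_def\<close>)
    have mf: "m * f \<in> ph_polys" by (rule ph_polys_mult[OF m f'(1)])
    have deg: "degree (m * f) = degree g"
      using fg False f'(2) by (subst degree_mult_eq) (auto simp: m_def degree_monom_eq monom_eq_0_iff)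
    have "coeff (m * f) (degree g) = lead_coeff (m * f)" by (simp add: deg)
    also have "\<dots> = lead_coeff m" using f'(2) by (subst lead_coeff_mult) simp
    finally have "coeff (m * f) (degree g) = lead_coeff g" by (simp only: m_def lead_coeff_monom)
    then have "degree (g - m * f) < degree g \<or> g - m * f = 0"
      using deg by (metis coeff_diff degree_diff_le diff_self eq_zero_or_degree_less le_refl)
    moreover have "poly (g - m * f) \<alpha> = 0" "g - m * f \<in> ph_polys"
      using less.prems f' ph_polys_add(3) mf by auto
    ultimately have "poly (map_poly ph_fun (g - m * f)) \<beta> = 0"
      using less.hyps[of "g - m * f"] by auto
    then show ?thesis
      using \<beta> less.prems mf m f'(1) by (simp add: ph_polys_add ph_polys_mult)
  qed simp
qed

text \<open>The extension sends \<open>g(\<alpha>)\<close> to the transported \<open>g\<close> at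
  \<open>\<beta>\<close>; \<open>ph_minpoly_kernel\<close> is exactly what makes 0 go only to
  0.\<close>

lemma ph_extend:
  assumes f: "ph_minpoly \<alpha> f" and \<beta>: "poly (map_poly ph_fun f) \<beta> = 0"
  obtains R' where "partial_hom R'" "R \<subseteq> R'" "(\<alpha>, \<beta>) \<in> R'"
proof
  define R' where "R' = {(poly g \<alpha>, poly (map_poly ph_fun g) \<beta>) | g. g \<in> ph_polys}"
  have const: "[:x:] \<in> ph_polys \<and> poly (map_poly ph_fun [:x:]) \<beta> = y" if "(x, y) \<in> R" for x y
    using that ph_polys_monom[of x 0] ph_fun_eq[OF that]
    by (auto simp: monom_0 map_poly_pCons[where f = ph_fun, OF ph_fun_0])
  show sub: "R \<subseteq> R'"
  proof
    fix z assume "z \<in> R"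
    moreover obtain x y where "z = (x, y)" by force
    ultimately show "z \<in> R'"
      using const[of x y] unfolding R'_def by (intro CollectI exI[of _ "[:x:]"]) simp
  qed
  have "monom 1 1 \<in> ph_polys" using ph_domain_const[of 1] by (intro ph_polys_monom) simp
  then show "(\<alpha>, \<beta>) \<in> R'"
    unfolding R'_def
    by (intro CollectI exI[of _ "monom 1 1"]) (simp add: map_poly_monom ph_fun_0 ph_fun_1 poly_monom)
  show "partial_hom R'"
    unfolding partial_hom_def
  proof (intro conjI allI impI)
    show "(to_ac c, to_ac c) \<in> R'" for c using sub ph_const by blast
    show "y = 0" if "(0, y) \<in> R'" for y
      using that ph_minpoly_kernel[OF f \<beta>] unfolding R'_def by auto
    fix x y x' y' assume "(x, y) \<in> R' \<and> (x', y') \<in> R'"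
    then obtain g h where gh: "g \<in> ph_polys" "h \<in> ph_polys" and
      "x = poly g \<alpha>" "y = poly (map_poly ph_fun g) \<beta>"
      "x' = poly h \<alpha>" "y' = poly (map_poly ph_fun h) \<beta>"
      unfolding R'_def by blast
    then have "x + x' = poly (g + h) \<alpha>" "y + y' = poly (map_poly ph_fun (g + h)) \<beta>"
      "x * x' = poly (g * h) \<alpha>" "y * y' = poly (map_poly ph_fun (g * h)) \<beta>"
      using ph_polys_add(1,2)[OF gh] ph_polys_mult[OF gh] by simp_all
    then show "(x + x', y + y') \<in> R'" "(x * x', y * y') \<in> R'"
      using ph_polys_add(1)[OF gh] ph_polys_mult(1)[OF gh] unfolding R'_def by blast+
  qed
qed

lemma ph_fun_degree:
  assumes "ph_minpoly \<alpha> f"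
  shows "degree (map_poly ph_fun f) = degree f" using assms by (intro antisym degree_le le_degree)
     (simp_all add: ph_minpoly_def coeff_map_poly ph_fun_0 ph_fun_1 coeff_eq_0)

end

text \<open>By Zorn there is a maximal extension. Its domain is everything, since any
  \<open>x\<close> can be adjoined by sending it to a root of its transported minimal
  polynomial.\<close>

lemma partial_hom_maximal:
  assumes "partial_hom R"
  obtains \<sigma> where "\<sigma> \<in> galois_group" "\<And>x y. (x, y) \<in> R \<Longrightarrow> \<sigma> x = y"
proof -
  define \<A> where "\<A> = {R'. partial_hom R' \<and> R \<subseteq> R'}"
  have "\<exists>M\<in>\<A>. \<forall>Y\<in>\<A>. M \<subseteq> Y \<longrightarrow> Y = M"
  proof (rule subset_Zorn_nonempty)
    show "\<A> \<noteq> {}" using assms by (auto simp: \<A>_def)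
    fix C assume C: "C \<noteq> {}" "subset.chain \<A> C"
    have CA: "Y \<in> \<A>" if "Y \<in> C" for Y using C that by (auto simp: subset.chain_def)
    have two: "\<exists>Y\<in>C. u \<in> Y \<and> v \<in> Y" if "u \<in> \<Union>C" "v \<in> \<Union>C" for u v
      using that C(2) unfolding subset_chain_def by (meson Union_iff subsetD)
    have "partial_hom (\<Union>C)"
      unfolding partial_hom_def
    proof (intro conjI allI impI)
      show "(to_ac c, to_ac c) \<in> \<Union>C" for c
        using C(1) CA ph_const unfolding \<A>_def by blast
      show "y = 0" if "(0, y) \<in> \<Union>C" for y
        using that CA ph_zero unfolding \<A>_def by blast
      fix x y x' y' assume "(x, y) \<in> \<Union>C \<and> (x', y') \<in> \<Union>C"
      then obtain Y where "Y \<in> C" "(x, y) \<in> Y" "(x', y') \<in> Y" using two by meson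
      then show "(x + x', y + y') \<in> \<Union>C" "(x * x', y * y') \<in> \<Union>C"
        using CA[of Y] ph_add[of Y x y x' y'] ph_mult[of Y x y x' y'] unfolding \<A>_def by blast+
    qed
    moreover have "R \<subseteq> \<Union>C" using C(1) CA unfolding \<A>_def by blast
    ultimately show "\<Union>C \<in> \<A>" by (simp add: \<A>_def)
  qed
  then obtain M where M: "partial_hom M" "R \<subseteq> M"
    and max: "\<And>Y. partial_hom Y \<Longrightarrow> M \<subseteq> Y \<Longrightarrow> Y = M"
    unfolding \<A>_def by auto
  have dom: "x \<in> Domain M" for x
  proof -
    obtain f where f: "ph_minpoly M x f" using ph_minpoly_exists[OF M(1)] by blast
    have "degree f > 0"
    proof (rule ccontr)
      assume "\<not> ?thesis"
      then have "f = 1"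
        using f by (auto simp: ph_minpoly_def[OF M(1)] one_pCons elim!: degree_eq_zeroE)
      then show False using f by (simp add: ph_minpoly_def[OF M(1)])
    qed
    then obtain y where "poly (map_poly (ph_fun M) f) y = 0"
      using alg_closed_imp_poly_has_root[of "map_poly (ph_fun M) f"] ph_fun_degree[OF M(1) f] by auto
    then obtain M' where "partial_hom M'" "M \<subseteq> M'" "(x, y) \<in> M'"
      using ph_extend[OF M(1) f] by blast
    then show ?thesis using max by blast
  qed
  let ?\<sigma> = "ph_fun M"
  have "rhom ?\<sigma>"
    by (rule rhomI) (simp_all add: ph_fun_0[OF M(1)] ph_fun_1[OF M(1)] ph_domain[OF M(1)] dom del: Domain_iff)
  moreover have "?\<sigma> (to_ac c) = to_ac c" for c using ph_fun_eq[OF M(1) ph_const[OF M(1)]] .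
  ultimately have "?\<sigma> \<in> galois_group" using rhom_fixing_bij by (auto simp: galois_iff)
  moreover have "?\<sigma> x = y" if "(x, y) \<in> R" for x y
    using ph_fun_eq[OF M(1)] M(2) that by blast
  ultimately show ?thesis using that by blast
qed

text \<open>An element outside the ground field has a minimal polynomial of degree at least 2, which
  in characteristic zero has a second root \<open>b\<close>; the assignment \<open>a\<close> to
  \<open>b\<close> then extends to an automorphism moving \<open>a\<close>.\<close>

theorem galois_fixed:
  fixes a :: "'l::field alg_closure"
  assumes char: "CHAR('l) = 0" and fixed: "\<And>\<sigma>. \<sigma> \<in> galois_group \<Longrightarrow> \<sigma> a = a"
  shows "a \<in> range to_ac"
proof (rule ccontr)
  assume a: "a \<notin> range to_ac"
  define R :: "('l alg_closure \<times> 'l alg_closure) set" where "R = {(to_ac c, to_ac c) | c. True}"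
  have R: "partial_hom R"
    unfolding partial_hom_def R_def by (auto simp flip: to_ac_add to_ac_mult)
  have D: "Domain R = range to_ac" by (auto simp: R_def)
  obtain f where f: "ph_minpoly R a f" using ph_minpoly_exists[OF R] by blast
  have f': "f \<in> ph_polys R" "lead_coeff f = 1" "poly f a = 0"
    "\<And>g. g \<in> ph_polys R \<Longrightarrow> g \<noteq> 0 \<Longrightarrow> poly g a = 0 \<Longrightarrow> degree f \<le> degree g"
    using f by (auto simp: ph_minpoly_def[OF R])
  have idf: "map_poly (ph_fun R) f = f"
  proof (rule poly_eqI)
    fix i
    obtain c where "coeff f i = to_ac c" using f'(1) unfolding ph_polys_def[OF R] D by blast
    then show "coeff (map_poly (ph_fun R) f) i = coeff f i"
      using ph_fun_eq[OF R ph_const[OF R]] by (simp add: coeff_map_poly ph_fun_0[OF R])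
  qed
  obtain h where h: "f = [:- a, 1:] * h" using f'(3) by (metis dvdE poly_eq_0_iff_dvd)
  have "h \<noteq> 0" using f'(2) h by auto
  have degf: "degree f = Suc (degree h)"
    unfolding h using \<open>h \<noteq> 0\<close> by (subst degree_mult_eq) auto
  have "degree h > 0"
  proof (rule ccontr)
    assume "\<not> ?thesis"
    then obtain c where c: "h = [:c:]" by (auto elim: degree_eq_zeroE)
    then have "c = 1" using f'(2) degf unfolding h by (simp add: c)
    then have "coeff f 0 = - a"
      unfolding h c by simp
    moreover have "coeff f 0 \<in> range to_ac"
      using f'(1) unfolding ph_polys_def[OF R] D by blast
    ultimately have "- a \<in> range to_ac" by simp
    then show False
      using a by (metis (no_types, lifting) add.inverse_inverse imageE rangeI to_ac_minus)
  qed
  then obtain b where b: "poly h b = 0" using alg_closed_imp_poly_has_root by blast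
  \<comment> \<open>A double root would also be a root of the derivative, which is nonzero and of
    smaller degree than the minimal polynomial.\<close>
  have "b \<noteq> a"
  proof
    assume "b = a"
    then have "poly (pderiv f) a = 0" using b unfolding h pderiv_mult by simp
    moreover have cf: "of_nat n = (0::'l alg_closure) \<longleftrightarrow> n = 0" for n
      using char by (simp add: of_nat_eq_0_iff_char_dvd)
    have "pderiv f \<in> ph_polys R"
      unfolding ph_polys_def[OF R] coeff_pderiv mem_Collect_eq
    proof
      fix i
      have "to_ac (of_nat (Suc i)) * coeff f (Suc i) \<in> Domain R"
        using f'(1) unfolding ph_polys_def[OF R]
        by (intro ph_domain(2)[OF R ph_domain_const[OF R]]) blast
      then show "of_nat (Suc i) * coeff f (Suc i) \<in> Domain R" by simp
    qed
    moreover have "coeff (pderiv f) (degree h) \<noteq> 0"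
      using f'(2) cf by (simp add: coeff_pderiv degf del: of_nat_Suc)
    then have "pderiv f \<noteq> 0" by auto
    ultimately have "degree f \<le> degree (pderiv f)" using f'(4) by blast
    then show False
      using degree_le[of "degree h" "pderiv f"] degf by (simp add: coeff_pderiv coeff_eq_0)
  qed
  moreover have "poly (map_poly (ph_fun R) f) b = 0"
    unfolding idf using b by (simp add: h)
  then obtain R' where R': "partial_hom R'" "(a, b) \<in> R'" using ph_extend[OF R f] by blast
  then obtain \<sigma> where "\<sigma> \<in> galois_group" "\<sigma> a = b"
    using partial_hom_maximal by blast
  ultimately show False using fixed by blast
qed

section \<open>Extending complete absolute values\<close>

lemma primitive_root_power_eq_iff:
  fixes w :: "'a::field"
  assumes w: "primitive_root_of_unity p w" and ij: "i < p" "j < p"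
  shows "w ^ i = w ^ j \<longleftrightarrow> i = j"
proof -
  have "w \<noteq> 0" using w ij by (auto simp: primitive_root_of_unity_def zero_power)
  have *: "i = j" if "i \<le> j" "w ^ i = w ^ j" "j < p" for i j
  proof (rule ccontr)
    assume "i \<noteq> j"
    have "w ^ i * w ^ (j - i) = w ^ j"
      using \<open>i \<le> j\<close> by (subst power_add[symmetric]) simp
    then have "w ^ i * w ^ (j - i) = w ^ i * 1" using that by simp
    then have "w ^ (j - i) = 1" using \<open>w \<noteq> 0\<close> by simp
    then show False
      using w that \<open>i \<noteq> j\<close> by (auto simp: primitive_root_of_unity_def)
  qed
  then show ?thesis using ij by (metis linorder_le_cases)
qed

text \<open>Both sides are monic of degree \<open>p\<close>, so a nonzero difference would have too
  many roots. The \<open>p\<close> roots \<open>w^j b\<close> are distinct only for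
  \<open>b \<noteq> 0\<close>, hence the separate case.\<close>

lemma primitive_root_poly:
  fixes w b :: "'a::field"
  assumes w: "primitive_root_of_unity p w" and p: "p > 0"
  shows "[:0, 1:] ^ p - [:b ^ p:] = (\<Prod>j<p. [:- (w ^ j * b), 1:])"
proof (cases "b = 0")
  case True
  then show ?thesis using p by simp
next
  case False
  let ?l = "[:0, 1:] ^ p - [:b ^ p:]" and ?r = "\<Prod>j<p. [:- (w ^ j * b), 1:]"
  have "degree ?r = p" by (subst degree_prod_eq_sum_degree) auto
  moreover have "lead_coeff ?r = 1" by (simp add: lead_coeff_prod)
  moreover have l: "?l = monom 1 p - [:b ^ p:]" by (simp add: monom_altdef)
  moreover have "coeff ?l i = 0" if "i > p" for i
    using that p unfolding l by (simp add: coeff_pCons split: nat.split)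
  moreover have "coeff ?l p = 1" using p unfolding l by (simp add: coeff_pCons split: nat.split)
  ultimately have "coeff (?l - ?r) i = 0" if "i \<ge> p" for i
    using that by (cases "i = p") (auto simp: coeff_eq_0)
  then have deg: "degree (?l - ?r) < p \<or> ?l - ?r = 0" by (metis leading_coeff_0_iff not_le)
  have "?l - ?r = 0"
  proof (rule ccontr)
    assume nz: "?l - ?r \<noteq> 0"
    have "poly (?l - ?r) (w ^ j * b) = 0" if "j < p" for j
    proof -
      have "poly ?r (w ^ j * b) = 0" using that by (auto simp: poly_prod)
      moreover have "(w ^ j * b) ^ p = b ^ p"
        using w by (simp add: power_mult_distrib primitive_root_of_unity_def
            mult.commute[of j] flip: power_mult) (simp add: power_mult)
      ultimately show ?thesis by simp
    qed
    then have "(\<lambda>j. w ^ j * b) ` {..<p} \<subseteq> {x. poly (?l - ?r) x = 0}" by blast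
    from order_trans[OF card_mono[OF poly_roots_finite[OF nz] this] card_poly_roots_bound[OF nz]]
    have "card ((\<lambda>j. w ^ j * b) ` {..<p}) \<le> degree (?l - ?r)" .
    moreover have "card ((\<lambda>j. w ^ j * b) ` {..<p}) = p"
      using False primitive_root_power_eq_iff[OF w] by (subst card_image) (auto simp: inj_on_def)
    ultimately show False using deg nz by simp
  qed
  then show ?thesis by simp
qed

lemma primitive_root_prod:
  fixes w b :: "'a::field"
  assumes "primitive_root_of_unity p w" "p > 0"
  shows "x ^ p - b ^ p = (\<Prod>j<p. x - w ^ j * b)"
  using arg_cong[OF primitive_root_poly[OF assms], of "\<lambda>f. poly f x" b]
  by (simp add: poly_prod)

lemma primitive_root_prod_one_minus:
  fixes w :: "'a::field"
  assumes w: "primitive_root_of_unity p w" and p: "p > 0"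
  shows "(\<Prod>j\<in>{0<..<p}. 1 - w ^ j) = of_nat p"
proof -
  have "[:-1, 1:] * (\<Sum>i<p. [:0, 1:] ^ i) = ([:0, 1:] :: 'a poly) ^ p - 1"
    using power_diff_1_eq[of "[:0, 1:] :: 'a poly" p] by (simp add: one_pCons)
  also have "\<dots> = (\<Prod>j<p. [:- (w ^ j), 1:])"
    using primitive_root_poly[OF w p, of 1] by (simp add: one_pCons)
  also have "\<dots> = (\<Prod>j\<in>insert 0 {0<..<p}. [:- (w ^ j), 1:])"
    using p by (intro prod.cong) auto
  also have "\<dots> = [:-1, 1:] * (\<Prod>j\<in>{0<..<p}. [:- (w ^ j), 1:])"
    by (subst prod.insert) auto
  finally have "(\<Sum>i<p. [:0, 1:] ^ i) = (\<Prod>j\<in>{0<..<p}. [:- (w ^ j), 1:])"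
    by (subst (asm) mult_cancel_left) simp
  from arg_cong[OF this, of "\<lambda>f. poly f 1"] show ?thesis by (simp add: poly_prod poly_sum)
qed

section \<open>Ultrametric estimates\<close>

locale nonarch =
  fixes av :: "'k::field \<Rightarrow> real"
  assumes nonarch: "nonarch_abs_on UNIV av"
begin

lemma av_nonneg [simp]: "0 \<le> av a"
  and av_eq_0_iff [simp]: "av a = 0 \<longleftrightarrow> a = 0"
  and av_mult: "av (a * b) = av a * av b"
  and av_add: "av (a + b) \<le> max (av a) (av b)"
  using nonarch by (auto simp: nonarch_abs_on_def)

lemma av_0 [simp]: "av 0 = 0" by simp

lemma av_pos_iff [simp]: "0 < av a \<longleftrightarrow> a \<noteq> 0" by (simp add: less_le)

lemma av_1 [simp]: "av 1 = 1" using av_mult[of 1 1] by simp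

lemma av_power: "av (a ^ n) = av a ^ n" by (induction n) (simp_all add: av_mult)

lemma av_root_of_unity: "a ^ n = 1 \<Longrightarrow> n > 0 \<Longrightarrow> av a = 1"
  using av_power[of a n] power_eq_imp_eq_base[of "av a" n 1] by simp

lemma av_minus [simp]: "av (- a) = av a"
  using av_mult[of "-1" a] av_root_of_unity[of "-1" 2] by simp

lemma av_minus_commute: "av (a - b) = av (b - a)" using av_minus[of "a - b"] by simp

lemma av_diff: "av (a - b) \<le> max (av a) (av b)" using av_add[of a "- b"] by simp

lemma av_add_le: "av a \<le> c \<Longrightarrow> av b \<le> c \<Longrightarrow> av (a + b) \<le> c"
  using av_add[of a b] by simp

lemma av_add_less: "av a < c \<Longrightarrow> av b < c \<Longrightarrow> av (a + b) < c"
  using av_add[of a b] by (simp add: max_def split: if_splits)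

lemma av_diff_le: "av a \<le> c \<Longrightarrow> av b \<le> c \<Longrightarrow> av (a - b) \<le> c"
  using av_diff[of a b] by simp

lemma av_diff_less: "av a < c \<Longrightarrow> av b < c \<Longrightarrow> av (a - b) < c"
  using av_diff[of a b] by (simp add: max_def split: if_splits)

lemma av_diff_trans_less: "av (a - b) < c \<Longrightarrow> av (b - d) < c \<Longrightarrow> av (a - d) < c"
  using av_add_less[of "a - b" c "b - d"] by simp

lemma av_add_eq: "av b < av a \<Longrightarrow> av (a + b) = av a"
  using av_add[of a b] av_diff[of "a + b" b] by (simp add: max_def split: if_splits)

lemma av_close_eq: "av (a - b) < av b \<Longrightarrow> av a = av b"
  using av_add_eq[of "a - b" b] by simp

lemma av_inverse: "av (inverse a) = inverse (av a)"
  by (cases "a = 0") (use av_mult[of a "inverse a"] in \<open>auto simp: field_simps\<close>)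

lemma av_divide: "av (a / b) = av a / av b" by (simp add: divide_inverse av_mult av_inverse)

lemma av_powi: "av (a powi n) = av a powi n" by (simp add: power_int_def av_power av_inverse)

lemma av_prod: "av (prod f A) = (\<Prod>x\<in>A. av (f x))"
  by (induction A rule: infinite_finite_induct) (simp_all add: av_mult)

lemma av_sum_le: "(\<And>i. i \<in> A \<Longrightarrow> av (f i) \<le> B) \<Longrightarrow> 0 \<le> B \<Longrightarrow> av (sum f A) \<le> B"
  by (induction A rule: infinite_finite_induct) (auto intro: av_add_le)

lemma av_sum_less: "(\<And>i. i \<in> A \<Longrightarrow> av (f i) < B) \<Longrightarrow> 0 < B \<Longrightarrow> av (sum f A) < B"
  by (induction A rule: infinite_finite_induct) (auto intro: av_add_less)

lemma av_of_nat_le: "av (of_nat n) \<le> 1" by (induction n) (auto intro: av_add_le)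

lemma av_of_int_le: "av (of_int n) \<le> 1" using av_of_nat_le by (cases n rule: int_cases2) auto

lemma av_poly_le:
  assumes "\<And>i. av (coeff f i) \<le> 1" "av x \<le> 1"
  shows "av (poly f x) \<le> 1"
  unfolding poly_altdef
  by (intro av_sum_le) (simp_all add: av_mult av_power assms mult_le_one power_le_one)

lemma av_prod_diff:
  assumes "\<And>x. x \<in> A \<Longrightarrow> av (f x) \<le> 1" "\<And>x. x \<in> A \<Longrightarrow> av (g x) \<le> 1"
    "\<And>x. x \<in> A \<Longrightarrow> av (f x - g x) < 1"
  shows "av (prod f A - prod g A) < 1" using assms
proof (induction A rule: infinite_finite_induct)
  case (insert x A)
  have "av (prod f A) \<le> 1" using insert.prems unfolding av_prod by (intro prod_le_1) auto
  moreover have "av (g x) \<le> 1" "av (f x - g x) < 1" "av (prod f A - prod g A) < 1"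
    using insert by auto
  ultimately have "av ((f x - g x) * prod f A) < 1" "av (g x * (prod f A - prod g A)) < 1"
    unfolding av_mult using mult_left_le_one_le[of "av (f x - g x)" "av (prod f A)"]
      mult_left_le_one_le[of "av (prod f A - prod g A)" "av (g x)"]
    by (simp_all add: mult.commute)
  moreover have "prod f (insert x A) - prod g (insert x A) =
      (f x - g x) * prod f A + g x * (prod f A - prod g A)"
    using insert.hyps by (simp add: algebra_simps)
  ultimately show ?case by (simp only: av_add_less)
qed auto

lemma av_power_diff: "av x \<le> 1 \<Longrightarrow> av y \<le> 1 \<Longrightarrow> av (x - y) < 1 \<Longrightarrow> av (x ^ n - y ^ n) < 1"
  using av_prod_diff[of "{..<n}" "\<lambda>_. x" "\<lambda>_. y"] by simp

definition fps_le :: "real \<Rightarrow> 'k fps \<Rightarrow> bool" where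
  "fps_le B f \<longleftrightarrow> (\<forall>i. av (f $ i) \<le> B)"

lemma fps_le_mult:
  assumes "fps_le A f" "fps_le B g" "0 \<le> A" "0 \<le> B"
  shows "fps_le (A * B) (f * g)"
  unfolding fps_le_def fps_mult_nth
  by (intro allI av_sum_le) (use assms in \<open>auto simp: fps_le_def av_mult intro!: mult_mono\<close>)

lemma fps_le_diff: "fps_le A f \<Longrightarrow> fps_le A g \<Longrightarrow> fps_le A (f - g)"
  by (auto simp: fps_le_def intro: av_diff_le)

lemma fps_le_add: "fps_le A f \<Longrightarrow> fps_le A g \<Longrightarrow> fps_le A (f + g)"
  by (auto simp: fps_le_def intro: av_add_le)

lemma fps_le_shift: "fps_le A f \<Longrightarrow> fps_le A (fps_shift k f)"
  by (auto simp: fps_le_def)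

lemma fps_le_1: "fps_le 1 1" by (simp add: fps_le_def fps_one_nth)

lemma fps_le_mono: "fps_le A f \<Longrightarrow> A \<le> B \<Longrightarrow> fps_le B f"
  unfolding fps_le_def using order_trans by blast

lemma fps_le_tendsto_0:
  assumes "\<And>n. fps_le (e ^ n * B) f" "0 < e" "e < 1"
  shows "f = 0"
proof (rule fps_ext)
  fix i
  have "(\<lambda>n. e ^ n * B) \<longlonglongrightarrow> 0"
    using tendsto_mult_left_zero[OF LIMSEQ_realpow_zero[of e]] assms by simp
  then have "av (f $ i) \<le> 0" using assms(1) by (intro LIMSEQ_le_const) (auto simp: fps_le_def)
  then have "av (f $ i) = 0" using antisym av_nonneg by blast
  then show "f $ i = 0 $ i" by simp
qed

lemma fps_le_inverse:
  assumes f: "fps_le 1 f" and f0: "av (f $ 0) = 1"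
  shows "fps_le 1 (inverse f)"
  unfolding fps_le_def
proof
  fix n
  have "f $ 0 \<noteq> 0" using f0 by auto
  show "av (inverse f $ n) \<le> 1"
  proof (induction n rule: less_induct)
    case (less n)
    have "f * inverse f = 1"
      using \<open>f $ 0 \<noteq> 0\<close> by (simp add: inverse_mult_eq_1')
    then have "(f * inverse f) $ n = (if n = 0 then 1 else 0)" by (simp add: fps_one_nth)
    moreover have "(f * inverse f) $ n = f $ 0 * inverse f $ n + (\<Sum>i=1..n. f $ i * inverse f $ (n - i))"
      unfolding fps_mult_nth by (subst sum.atLeast_Suc_atMost) auto
    ultimately have "f $ 0 * inverse f $ n =
        (if n = 0 then 1 else 0) - (\<Sum>i=1..n. f $ i * inverse f $ (n - i))"
      by (simp add: algebra_simps)
    moreover have "av (\<Sum>i=1..n. f $ i * inverse f $ (n - i)) \<le> 1"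
      using less f by (intro av_sum_le) (auto simp: av_mult fps_le_def intro!: mult_le_one)
    ultimately have "av (f $ 0 * inverse f $ n) \<le> 1" by (auto intro: av_diff_le)
    then show ?case by (simp add: av_mult f0)
  qed
qed

end

section \<open>Completeness and Hensel factorisation\<close>

locale complete_nonarch = nonarch av for av :: "'k::field \<Rightarrow> real" +
  assumes complete: "\<And>s :: nat \<Rightarrow> 'k. (\<forall>e>0. \<exists>N. \<forall>m\<ge>N. \<forall>n\<ge>N. av (s m - s n) < e) \<Longrightarrow>
        \<exists>z. (\<lambda>n. av (s n - z)) \<longlonglongrightarrow> 0"
begin

text \<open>By the ultrametric inequality the whole tail after stage \<open>n\<close> is no larger
  than its first step, so the bound passes to the limit without a loss from summation.\<close>

lemma geometric_limit:
  assumes e: "0 < e" "e < 1" and s: "\<And>n. av (s (Suc n) - s n) \<le> e ^ n"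
  obtains z where "\<And>n. av (s n - z) \<le> e ^ n"
proof -
  have far: "av (s m - s n) \<le> e ^ n" if "m \<ge> n" for m n using that
  proof (induction m rule: dec_induct)
    case (step m)
    have "av (s (Suc m) - s m) \<le> e ^ n"
      using s[of m] power_decreasing[of n m e] step.hyps e by linarith
    from av_add_le[OF this step.IH] show ?case by simp
  qed (use e in simp)
  have far': "av (s m - s n) \<le> e ^ N" if "m \<ge> N" "n \<ge> N" for m n N
    using av_diff_le[OF far[OF that(1)] far[OF that(2)]] by simp
  have "\<exists>z. (\<lambda>n. av (s n - z)) \<longlonglongrightarrow> 0"
  proof (rule complete, intro allI impI)
    fix d :: real assume "d > 0"
    then obtain N where "e ^ N < d" using e real_arch_pow_inv by blast
    then show "\<exists>N. \<forall>m\<ge>N. \<forall>n\<ge>N. av (s m - s n) < d"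
      using far' by (meson order_le_less_trans)
  qed
  then obtain z where z: "(\<lambda>n. av (s n - z)) \<longlonglongrightarrow> 0" by blast
  have "av (s n - z) \<le> e ^ n" for n
  proof -
    have "(\<lambda>m. max (e ^ n) (av (s m - z))) \<longlonglongrightarrow> max (e ^ n) 0"
      by (intro tendsto_max z tendsto_const)
    moreover have "\<exists>N. \<forall>m\<ge>N. av (s n - z) \<le> max (e ^ n) (av (s m - z))"
    proof (intro exI allI impI)
      fix m assume "m \<ge> n"
      from far[OF this] have "av (s n - s m) \<le> e ^ n" by (simp add: av_minus_commute)
      then show "av (s n - z) \<le> max (e ^ n) (av (s m - z))"
        using av_add[of "s n - s m" "s m - z"] by simp
    qed
    ultimately have "av (s n - z) \<le> max (e ^ n) 0" by (rule LIMSEQ_le_const)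
    then show ?thesis using e by simp
  qed
  then show ?thesis using that by blast
qed

text \<open>Weierstrass division: \<open>X\<^sup>k\<close> modulo \<open>F = P + X\<^sup>k U\<close> is computed by the contraction
  \<open>Z \<mapsto> 1 - shift\<^sub>k (Z P / U)\<close> of the power series ring; the fixed point \<open>Z\<close> makes \<open>Z F / U\<close> a monic
  polynomial of degree \<open>k\<close>.\<close>

lemma hensel_factor:
  fixes F :: "'k poly"
  assumes int: "\<And>i. av (coeff F i) \<le> 1" and unit: "av (coeff F k) = 1"
    and small: "\<And>i. i < k \<Longrightarrow> av (coeff F i) < 1"
  obtains g where "degree g = k" "g dvd F"
proof -
  \<comment> \<open>A common contraction factor; the entry \<open>1/2\<close> keeps it positive when
    \<open>k = 0\<close> or when all lower coefficients vanish.\<close>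
  define e where "e = Max (insert (1/2) ((\<lambda>i. av (coeff F i)) ` {..<k}))"
  have e: "0 < e" "e < 1" and le: "\<And>i. i < k \<Longrightarrow> av (coeff F i) \<le> e"
  proof -
    have fin: "finite (insert (1/2) ((\<lambda>i. av (coeff F i)) ` {..<k}))" by simp
    have "1/2 \<le> e" unfolding e_def by (intro Max_ge fin) simp
    then show "0 < e" by simp
    show "e < 1" unfolding e_def using small by (subst Max_less_iff) auto
    show "av (coeff F i) \<le> e" if "i < k" for i
      unfolding e_def using that by (intro Max_ge fin) auto
  qed
  define U where "U = Abs_fps (\<lambda>i. coeff F (i + k))"
  define P where "P = Abs_fps (\<lambda>i. if i < k then coeff F i else 0)"
  have F: "fps_of_poly F = P + fps_X ^ k * U"
    by (rule fps_ext) (simp add: U_def P_def fps_X_power_mult_nth)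
  have U: "fps_le 1 U" "av (U $ 0) = 1" "U $ 0 \<noteq> 0"
    using int unit by (auto simp: fps_le_def U_def)
  have iU: "fps_le 1 (inverse U)" "U * inverse U = 1"
    using fps_le_inverse U by (auto simp: inverse_mult_eq_1')
  have P: "fps_le e P" using le e by (auto simp: fps_le_def P_def)
  define W where "W = P * inverse U"
  have W: "fps_le e W" using fps_le_mult[OF P iU(1)] e by (simp add: W_def)
  define S where "S = rec_nat 0 (\<lambda>_ Z. 1 - fps_shift k (Z * W))"
  have S: "S 0 = 0" "S (Suc n) = 1 - fps_shift k (S n * W)" for n by (simp_all add: S_def)
  have step: "fps_le (e ^ n) (S (Suc n) - S n)" for n
  proof (induction n)
    case 0
    then show ?case by (simp add: S fps_le_1)
  next
    case (Suc n)
    have "S (Suc (Suc n)) - S (Suc n) = fps_shift k ((S n - S (Suc n)) * W)"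
      by (simp only: S(2)[of "Suc n"] S(2)[of n] left_diff_distrib fps_shift_diff) simp
    moreover have "fps_le (e ^ n) (S n - S (Suc n))"
      using Suc by (simp add: fps_le_def av_minus_commute)
    from fps_le_mult[OF this W] have "fps_le (e ^ Suc n) ((S n - S (Suc n)) * W)"
      using e by (simp add: mult.commute)
    ultimately show ?case by (simp only: fps_le_shift)
  qed
  have "\<exists>z. \<forall>n. av (S n $ i - z) \<le> e ^ n" for i
  proof (rule geometric_limit[of e "\<lambda>n. S n $ i"])
    show "av (S (Suc n) $ i - S n $ i) \<le> e ^ n" for n using step by (simp add: fps_le_def)
  qed (use e in blast)+
  then obtain z where z: "\<And>i n. av (S n $ i - z i) \<le> e ^ n" by metis
  define Z where "Z = Abs_fps z"
  have Zn: "fps_le (e ^ n) (S n - Z)" for n using z by (simp add: fps_le_def Z_def)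
  have Z1: "fps_le 1 Z" using Zn[of 0] by (simp add: S fps_le_def)
  have "fps_le (e ^ n * 1) (1 - fps_shift k (Z * W) - Z)" for n
  proof -
    have "fps_le (e ^ Suc n) (fps_shift k ((S n - Z) * W))"
      using fps_le_shift[OF fps_le_mult[OF Zn W]] e by (simp add: mult.commute)
    from fps_le_add[OF this Zn[of "Suc n"]]
    have "fps_le (e ^ Suc n) (fps_shift k ((S n - Z) * W) + (S (Suc n) - Z))" .
    moreover have "fps_shift k ((S n - Z) * W) + (S (Suc n) - Z) = 1 - fps_shift k (Z * W) - Z"
      by (simp add: S(2) algebra_simps fps_shift_diff)
    moreover have "e ^ Suc n \<le> e ^ n * 1" using e by (simp add: mult_left_le_one_le)
    ultimately show ?thesis using fps_le_mono by metis
  qed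
  then have "1 - fps_shift k (Z * W) - Z = 0" using e by (rule fps_le_tendsto_0)
  then have fix_Z: "fps_shift k (Z * W) + Z = 1" by (simp add: algebra_simps)
  have ZW: "fps_le e (Z * W)" using fps_le_mult[OF Z1 W] e by simp
  have "Z $ 0 = 1 - (Z * W) $ k"
    using arg_cong[OF fix_Z, of "\<lambda>f. f $ 0"] by (simp add: algebra_simps)
  moreover have "av ((Z * W) $ k) < av 1"
    using ZW e by (auto simp: fps_le_def intro: order_le_less_trans)
  ultimately have Z0: "av (Z $ 0) = 1" using av_add_eq[of "- ((Z * W) $ k)" 1] by simp
  then have "Z $ 0 \<noteq> 0" by auto
  then have iZ: "fps_le 1 (inverse Z)" "Z * inverse Z = 1"
    using fps_le_inverse[OF Z1 Z0] by (auto simp: inverse_mult_eq_1')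
  \<comment> \<open>The fixed point equation says that \<open>Z F / U = Z W + Z X^k\<close> has
    coefficient 1 at \<open>k\<close> and 0 beyond, so this truncation loses nothing.\<close>
  define g where "g = monom 1 k + poly_of_list (map (\<lambda>i. (Z * W) $ i) [0..<k])"
  have g: "coeff g i = (if i = k then 1 else if i < k then (Z * W) $ i else 0)" for i
    by (auto simp: g_def nth_default_def)
  have degg: "degree g = k" by (intro antisym degree_le le_degree) (auto simp: g)
  have gfps: "fps_of_poly g = Z * W + Z * fps_X ^ k"
  proof (rule fps_ext)
    fix i
    show "fps_of_poly g $ i = (Z * W + Z * fps_X ^ k) $ i"
    proof (cases "i < k")
      case True
      then show ?thesis by (simp add: g fps_X_power_mult_right_nth)
    next
      case False
      then have "(Z * W) $ i + Z $ (i - k) = (if i = k then 1 else 0)"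
        using arg_cong[OF fix_Z, of "\<lambda>f. f $ (i - k)"] by (auto simp: fps_one_nth)
      then show ?thesis using False by (simp add: g fps_X_power_mult_right_nth)
    qed
  qed
  define t where "t = inverse Z * U"
  have t: "fps_le 1 t" using fps_le_mult[OF iZ(1) U(1)] by (simp add: t_def)
  have "fps_of_poly g * t = Z * inverse Z * (P * (U * inverse U) + fps_X ^ k * U)"
    unfolding gfps t_def W_def by (simp add: algebra_simps)
  then have Fgt: "fps_of_poly g * t = fps_of_poly F" by (simp add: F iZ iU)
  \<comment> \<open>\<open>t\<close> is \<open>F / g\<close> as a power series. Its difference
    \<open>v\<close> from the polynomial quotient satisfies \<open>g v = F mod g\<close>, a
    polynomial of degree below \<open>k\<close>.\<close>
  define v where "v = t - fps_of_poly (F div g)"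
  have gv: "fps_of_poly g * v = fps_of_poly (F mod g)"
  proof -
    have "F mod g = F - g * (F div g)" by (simp add: minus_mult_div_eq_mod)
    then show ?thesis
      unfolding v_def right_diff_distrib Fgt by (simp add: fps_of_poly_mult fps_of_poly_diff)
  qed
  have "g \<noteq> 0" using g[of k] by auto
  then have degm: "coeff (F mod g) (i + k) = 0" for i
    using degree_mod_less[of g F] degg coeff_eq_0[of "F mod g" "i + k"] by auto
  define B where "B = Max (insert 1 ((\<lambda>i. av (coeff (F div g) i)) ` {..degree (F div g)}))"
  have B: "1 \<le> B" unfolding B_def by (intro Max_ge) auto
  have "av (coeff (F div g) i) \<le> B" for i
  proof (cases "i \<le> degree (F div g)")
    case True
    then show ?thesis unfolding B_def by (intro Max_ge) auto
  next
    case False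
    then show ?thesis using B by (simp add: coeff_eq_0)
  qed
  then have vB: "fps_le B v"
    unfolding v_def by (intro fps_le_diff fps_le_mono[OF t B]) (simp add: fps_le_def)
  \<comment> \<open>Since \<open>g v\<close> vanishes at degree \<open>i + k\<close>, each
    \<open>v_i\<close> is a combination of coefficients of \<open>v\<close> with factors of size at
    most \<open>e\<close>; every bound on \<open>v\<close> thus improves by
    \<open>e\<close>.\<close>
  have "fps_le (e ^ n * B) v" for n
  proof (induction n)
    case (Suc n)
    show ?case
      unfolding fps_le_def
    proof
      fix i
      have "(fps_of_poly g * v) $ (i + k) = (\<Sum>j\<in>{0..i+k}. coeff g j * v $ (i + k - j))"
        by (simp add: fps_mult_nth)
      also have "\<dots> = (\<Sum>j\<in>{..<k} \<union> {k}. coeff g j * v $ (i + k - j))"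
        by (rule sum.mono_neutral_right) (auto simp: g)
      also have "\<dots> = v $ i + (\<Sum>j<k. (Z * W) $ j * v $ (i + k - j))"
        by (subst sum.union_disjoint) (auto simp: g intro!: sum.cong)
      finally have "v $ i = - (\<Sum>j<k. (Z * W) $ j * v $ (i + k - j))"
        using gv degm[of i] by (simp add: eq_neg_iff_add_eq_0)
      moreover have "av (\<Sum>j<k. (Z * W) $ j * v $ (i + k - j)) \<le> e * (e ^ n * B)"
        using ZW Suc e B by (intro av_sum_le) (auto simp: av_mult fps_le_def intro!: mult_mono)
      ultimately show "av (v $ i) \<le> e ^ Suc n * B" by (simp add: mult.assoc)
    qed
  qed (use vB in simp)
  then have "v = 0" using e by (rule fps_le_tendsto_0)
  then have "F mod g = 0" using gv by (simp add: fps_of_poly_eq_iff[of _ 0, simplified])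
  then show ?thesis using that degg by (auto simp: mod_eq_0_iff_dvd)
qed

text \<open>Otherwise, normalise by the first coefficient of maximal absolute value
  \<open>M > 1\<close>. Its index is neither 0 nor the degree, as the constant and leading
  coefficients have size at most 1, so \<open>hensel_factor\<close> yields a factor of forbidden
  degree.\<close>

lemma hensel_irreducible_integral:
  assumes lead: "lead_coeff f = 1" and irr: "\<And>g. g dvd f \<Longrightarrow> degree g = 0 \<or> degree g = degree f"
    and c0: "av (coeff f 0) \<le> 1"
  shows "av (coeff f i) \<le> 1"
proof (rule ccontr)
  assume i: "\<not> av (coeff f i) \<le> 1"
  define M where "M = Max ((\<lambda>i. av (coeff f i)) ` {..degree f})"
  have fin: "finite ((\<lambda>i. av (coeff f i)) ` {..degree f})" by simp
  have "M \<in> (\<lambda>i. av (coeff f i)) ` {..degree f}"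
    unfolding M_def by (intro Max_in) auto
  then obtain k0 where k0: "av (coeff f k0) = M" by blast
  have M: "av (coeff f j) \<le> M" if "j \<le> degree f" for j
    unfolding M_def using that by (intro Max_ge fin) auto
  have "i \<le> degree f" using i by (intro le_degree) auto
  then have M1: "M > 1" using M[of i] i by simp
  define k where "k = (LEAST k. av (coeff f k) = M)"
  have k: "av (coeff f k) = M" and kmin: "\<And>j. j < k \<Longrightarrow> av (coeff f j) \<noteq> M"
    unfolding k_def using LeastI[of "\<lambda>k. av (coeff f k) = M", OF k0] not_less_Least by blast+
  have ck: "coeff f k \<noteq> 0" using k M1 by auto
  define F where "F = Polynomial.smult (inverse (coeff f k)) f"
  have Fc: "av (coeff F j) = av (coeff f j) / M" for j
    by (simp add: F_def av_mult av_inverse k divide_inverse_commute)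
  have leM: "av (coeff f j) \<le> M" for j
    using M M1 by (cases "j \<le> degree f") (auto simp: coeff_eq_0)
  obtain g where g: "degree g = k" "g dvd F"
  proof (rule hensel_factor[of F k])
    show "av (coeff F j) \<le> 1" for j using leM[of j] M1 by (simp add: Fc)
    show "av (coeff F j) < 1" if "j < k" for j using leM[of j] kmin[OF that] M1 by (simp add: Fc)
    show "av (coeff F k) = 1" using k M1 by (simp add: Fc)
  qed (rule that)
  moreover have "k \<noteq> 0" "k \<noteq> degree f" using k c0 lead M1 by (cases "k = 0"; auto)+
  moreover have "g dvd f" using g(2) ck by (simp add: F_def dvd_smult_iff)
  ultimately show False using irr[of g] g(1) by simp
qed

end

section \<open>Galois orbits and the extended absolute value\<close>

definition galois_orbit :: "'l::field alg_closure \<Rightarrow> 'l alg_closure set" where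
  "galois_orbit x = {\<sigma> x | \<sigma>. \<sigma> \<in> galois_group}"

definition galois_pair_orbit ::
    "'l::field alg_closure \<Rightarrow> 'l alg_closure \<Rightarrow> ('l alg_closure \<times> 'l alg_closure) set" where
  "galois_pair_orbit x y = {(\<sigma> x, \<sigma> y) | \<sigma>. \<sigma> \<in> galois_group}"

lemma orbit_image: "galois_orbit x = (\<lambda>\<sigma>. \<sigma> x) ` galois_group"
  by (auto simp: galois_orbit_def)

lemma pair_orbit_image: "galois_pair_orbit x y = (\<lambda>\<sigma>. (\<sigma> x, \<sigma> y)) ` galois_group"
  by (auto simp: galois_pair_orbit_def)

lemma finite_orbit: "finite (galois_orbit x)"
  using finite_galois_orbit by (simp add: galois_orbit_def)

lemma finite_pair_orbit: "finite (galois_pair_orbit x y)"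
  by (rule finite_subset[of _ "galois_orbit x \<times> galois_orbit y"])
     (auto simp: galois_pair_orbit_def galois_orbit_def finite_orbit[unfolded galois_orbit_def])

lemma orbit_self: "x \<in> galois_orbit x" using galois_id by (auto simp: galois_orbit_def)

lemma pair_orbit_self: "(x, y) \<in> galois_pair_orbit x y"
  using galois_id by (auto simp: galois_pair_orbit_def)

lemma orbit_closed: "\<sigma> \<in> galois_group \<Longrightarrow> y \<in> galois_orbit x \<Longrightarrow> \<sigma> y \<in> galois_orbit x"
  using galois_comp[of \<sigma>] by (force simp: galois_orbit_def)

lemma pair_orbit_closed:
  "\<sigma> \<in> galois_group \<Longrightarrow> (y, z) \<in> galois_pair_orbit x x' \<Longrightarrow> (\<sigma> y, \<sigma> z) \<in> galois_pair_orbit x x'"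
  using galois_comp[of \<sigma>] by (force simp: galois_pair_orbit_def)

lemma orbit_galois:
  assumes "\<sigma> \<in> galois_group"
  shows "galois_orbit (\<sigma> x) = galois_orbit x"
proof -
  have "\<tau> x \<in> galois_orbit (\<sigma> x)" if "\<tau> \<in> galois_group" for \<tau>
  proof -
    have "\<tau> x = (\<lambda>z. \<tau> (inv_into UNIV \<sigma> z)) (\<sigma> x)"
      using galois_inv_apply[OF assms] by simp
    then show ?thesis using galois_comp[OF that galois_inv[OF assms]] unfolding galois_orbit_def
      by (metis (mono_tags, lifting) mem_Collect_eq)
  qed
  moreover have "galois_orbit (\<sigma> x) \<subseteq> galois_orbit x"
    using galois_comp[OF _ assms] by (auto simp: galois_orbit_def)
  ultimately show ?thesis by (auto simp: galois_orbit_def)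
qed

lemma bij_betw_galois:
  assumes "\<sigma> \<in> galois_group" "finite A" "\<And>x. x \<in> A \<Longrightarrow> \<sigma> x \<in> A"
  shows "bij_betw \<sigma> A A"
proof -
  have "inj_on \<sigma> A"
    using galoisD(2)[OF assms(1)] by (meson bij_is_inj inj_on_subset subset_UNIV)
  then show ?thesis using assms endo_inj_surj[of A \<sigma>] by (auto simp: bij_betw_def)
qed

lemma orbit_prod_rational:
  assumes char: "CHAR('l::field) = 0"
  shows "(\<Prod>y\<in>galois_orbit (x :: 'l alg_closure). y) \<in> range to_ac"
proof (rule galois_fixed[OF char])
  fix \<sigma> :: "'l alg_closure \<Rightarrow> 'l alg_closure" assume \<sigma>: "\<sigma> \<in> galois_group"
  have "bij_betw \<sigma> (galois_orbit x) (galois_orbit x)"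
    using bij_betw_galois[OF \<sigma> finite_orbit] orbit_closed[OF \<sigma>] by blast
  from prod.reindex_bij_betw[OF this, of "\<lambda>y. y"]
  show "\<sigma> (\<Prod>y\<in>galois_orbit x. y) = (\<Prod>y\<in>galois_orbit x. y)"
    by (simp add: rhom_prod[OF galoisD(1)[OF \<sigma>]])
qed

text \<open>The orbit product is the minimal polynomial: a nonconstant rational factor has a root in
  the orbit, hence vanishes on all of it and has full degree.\<close>

lemma orbit_poly_rational:
  assumes char: "CHAR('l::field) = 0"
  obtains f where "map_poly to_ac f = (\<Prod>y\<in>galois_orbit (x :: 'l alg_closure). [:- y, 1:])"
    "degree f = card (galois_orbit x)" "lead_coeff f = 1"
    "\<And>g. g dvd f \<Longrightarrow> degree g = 0 \<or> degree g = degree f"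
proof -
  let ?F = "\<Prod>y\<in>galois_orbit x. [:- y, 1:]"
  have "coeff ?F i \<in> range to_ac" for i
  proof (rule galois_fixed[OF char])
    fix \<sigma> :: "'l alg_closure \<Rightarrow> 'l alg_closure" assume \<sigma>: "\<sigma> \<in> galois_group"
    have b: "bij_betw \<sigma> (galois_orbit x) (galois_orbit x)"
      using bij_betw_galois[OF \<sigma> finite_orbit] orbit_closed[OF \<sigma>] by blast
    have "map_poly \<sigma> ?F = (\<Prod>y\<in>galois_orbit x. [:- \<sigma> y, 1:])"
      using poly_prod_roots_coeff_rhom[OF galoisD(1)[OF \<sigma>], of "\<lambda>y. y"] by simp
    also have "\<dots> = ?F" by (rule prod.reindex_bij_betw[OF b, of "\<lambda>y. [:- y, 1:]"])
    finally show "\<sigma> (coeff ?F i) = coeff ?F i"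
      using rhom_0[OF galoisD(1)[OF \<sigma>]] by (metis coeff_map_poly)
  qed
  then obtain f where f: "?F = map_poly to_ac f" "degree f = degree ?F"
    using poly_eq_map_to_ac by metis
  have dF: "degree ?F = card (galois_orbit x)" by (subst degree_prod_eq_sum_degree) auto
  have "to_ac (lead_coeff f) = lead_coeff ?F"
    unfolding f(2)[symmetric] by (simp add: f(1) coeff_map_poly degree_map_poly_rhom[OF rhom_to_ac])
  then have lead: "lead_coeff f = 1" by (simp add: lead_coeff_prod)
  have "degree g = 0 \<or> degree g = degree f" if g: "g dvd f" for g
  proof (cases "degree g = 0")
    case False
    let ?G = "map_poly to_ac g"
    have dG: "degree ?G = degree g" by (rule degree_map_poly_rhom[OF rhom_to_ac])
    then obtain z where z: "poly ?G z = 0" using False alg_closed_imp_poly_has_root[of ?G] by auto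
    have "?G dvd ?F"
      unfolding f(1) by (rule rhom_dvd[OF rhom_map_poly[OF rhom_to_ac] g])
    then have "poly ?F z = 0" using z by (auto elim!: dvdE)
    then have "z \<in> galois_orbit x" by (auto simp: poly_prod finite_orbit)
    then obtain \<tau> where "\<tau> \<in> galois_group" "z = \<tau> x"
      unfolding orbit_image by blast
    then have zo: "galois_orbit z = galois_orbit x" using orbit_galois by metis
    have "galois_orbit x \<subseteq> {y. poly ?G y = 0}"
      using rhom_fixing_root[OF _ _ z] unfolding zo[symmetric] by (auto simp: galois_orbit_def galois_iff)
    moreover have nz: "?G \<noteq> 0" using dG False by auto
    ultimately have "card (galois_orbit x) \<le> degree ?G"
      using card_mono[OF poly_roots_finite[OF nz]] card_poly_roots_bound[OF nz] by (meson order_trans)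
    moreover have "degree g \<le> degree f" using g lead by (intro dvd_imp_degree_le) auto
    ultimately show ?thesis using f(2) dF dG by simp
  qed simp
  then show ?thesis using that f dF lead by simp
qed

text \<open>Automorphisms carry fibres of \<open>\<phi>\<close> to fibres, so all have the same size
  \<open>m\<close>. This lets the norms of \<open>a\<close>, \<open>b\<close> and any expression in
  them be computed over one common orbit of pairs, in place of the field
  \<open>L(a, b)\<close>.\<close>

lemma pair_orbit_fibre_prod:
  fixes \<phi> :: "'l::field alg_closure \<times> 'l alg_closure \<Rightarrow> 'l alg_closure"
  assumes eqv: "\<And>\<sigma> y z. \<sigma> \<in> galois_group \<Longrightarrow> \<phi> (\<sigma> y, \<sigma> z) = \<sigma> (\<phi> (y, z))"
  obtains m where "m > 0" "card (galois_pair_orbit a b) = m * card (galois_orbit (\<phi> (a, b)))"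
    "(\<Prod>s\<in>galois_pair_orbit a b. \<phi> s) = (\<Prod>y\<in>galois_orbit (\<phi> (a, b)). y) ^ m"
proof
  let ?S = "galois_pair_orbit a b" and ?c = "\<phi> (a, b)"
  let ?T = "galois_orbit ?c"
  define m where "m = card {s \<in> ?S. \<phi> s = ?c}"
  have fin: "finite ?S" by (rule finite_pair_orbit)
  have img: "\<phi> ` ?S = ?T"
    unfolding pair_orbit_image orbit_image image_image using eqv by (intro image_cong refl) simp
  have fibre: "card {s \<in> ?S. \<phi> s = y} = m" if "y \<in> ?T" for y
  proof -
    from that obtain \<sigma> where \<sigma>: "\<sigma> \<in> galois_group" "y = \<sigma> ?c"
      by (auto simp: galois_orbit_def)
    have "bij_betw (\<lambda>(u, v). (\<sigma> u, \<sigma> v)) {s \<in> ?S. \<phi> s = ?c} {s \<in> ?S. \<phi> s = y}"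
    proof (rule bij_betw_byWitness[where f' = "\<lambda>(u, v). (inv_into UNIV \<sigma> u, inv_into UNIV \<sigma> v)"])
      show "(\<lambda>(u, v). (\<sigma> u, \<sigma> v)) ` {s \<in> ?S. \<phi> s = ?c} \<subseteq> {s \<in> ?S. \<phi> s = y}"
        using pair_orbit_closed[OF \<sigma>(1)] eqv[OF \<sigma>(1)] \<sigma>(2) by auto
      show "(\<lambda>(u, v). (inv_into UNIV \<sigma> u, inv_into UNIV \<sigma> v)) ` {s \<in> ?S. \<phi> s = y} \<subseteq> {s \<in> ?S. \<phi> s = ?c}"
        using pair_orbit_closed[OF galois_inv[OF \<sigma>(1)]] eqv[OF galois_inv[OF \<sigma>(1)]]
          galois_inv_apply[OF \<sigma>(1)] \<sigma>(2) by auto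
    qed (use galois_inv_apply[OF \<sigma>(1)] in auto)
    then show ?thesis
      unfolding m_def by (simp add: bij_betw_same_card)
  qed
  have "(a, b) \<in> {s \<in> ?S. \<phi> s = ?c}" by (simp add: pair_orbit_self)
  then show "m > 0"
    unfolding m_def using fin by (subst card_gt_0_iff) auto
  have "card ?S = (\<Sum>y\<in>\<phi> ` ?S. card {s \<in> ?S. \<phi> s = y})"
    using sum.image_gen[OF fin, of "\<lambda>_. 1::nat" \<phi>] by simp
  then show "card ?S = m * card ?T" by (simp add: img fibre mult.commute)
  have "prod \<phi> ?S = (\<Prod>y\<in>\<phi> ` ?S. prod \<phi> {s \<in> ?S. \<phi> s = y})"
    by (rule prod.image_gen[OF fin])
  also have "\<dots> = (\<Prod>y\<in>?T. y ^ m)"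
    unfolding img by (intro prod.cong refl) (simp add: fibre)
  finally show "prod \<phi> ?S = (\<Prod>y\<in>?T. y) ^ m" by (simp add: prod_power_distrib)
qed

locale complete_nonarch_0 = complete_nonarch av for av :: "'l::field \<Rightarrow> real" +
  assumes char_0: "CHAR('l) = 0"
begin

text \<open>The classical \<open>|N(x)|^(1/n)\<close>: the orbit product is the norm of
  \<open>x\<close> from \<open>L(x)\<close> to \<open>L\<close>, and the orbit size is the
  degree.\<close>

definition eabs :: "'l alg_closure \<Rightarrow> real" where
  "eabs x = root (card (galois_orbit x)) (av (of_ac (\<Prod>y\<in>galois_orbit x. y)))"

lemma card_orbit_pos: "card (galois_orbit (x :: 'l alg_closure)) > 0"
  using orbit_self finite_orbit by (metis card_gt_0_iff empty_iff)

lemma eabs_pair: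
  assumes eqv: "\<And>\<sigma> y z. \<sigma> \<in> galois_group \<Longrightarrow> \<phi> (\<sigma> y, \<sigma> z) = \<sigma> (\<phi> (y, z))"
  shows "(\<Prod>s\<in>galois_pair_orbit a b. \<phi> s) \<in> range to_ac"
    "eabs (\<phi> (a, b)) = root (card (galois_pair_orbit a b)) (av (of_ac (\<Prod>s\<in>galois_pair_orbit a b. \<phi> s)))"
proof -
  obtain m where m: "m > 0" "card (galois_pair_orbit a b) = m * card (galois_orbit (\<phi> (a, b)))"
    "(\<Prod>s\<in>galois_pair_orbit a b. \<phi> s) = (\<Prod>y\<in>galois_orbit (\<phi> (a, b)). y) ^ m"
    using pair_orbit_fibre_prod[of \<phi>, OF eqv] by metis
  obtain c where c: "(\<Prod>y\<in>galois_orbit (\<phi> (a, b)). y) = to_ac c"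
    using orbit_prod_rational[OF char_0] by blast
  show "(\<Prod>s\<in>galois_pair_orbit a b. \<phi> s) \<in> range to_ac"
    unfolding m(3) c by (metis rangeI to_ac_power)
  have "of_ac (to_ac c ^ m) = c ^ m" by (metis of_ac_to_ac to_ac_power)
  then show "eabs (\<phi> (a, b)) = root (card (galois_pair_orbit a b)) (av (of_ac (\<Prod>s\<in>galois_pair_orbit a b. \<phi> s)))"
    unfolding m(2,3) c eabs_def using m(1)
    by (simp only: mult.commute[of m] real_root_mult_exp av_power of_ac_to_ac real_root_power_cancel av_nonneg)
qed

lemma eabs_mult: "eabs (a * b) = eabs a * eabs b"
proof -
  let ?S = "galois_pair_orbit a b"
  have h: "\<sigma> (y * z) = \<sigma> y * \<sigma> z" if "\<sigma> \<in> galois_group" for \<sigma> and y z :: "'l alg_closure"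
    using rhom_mult[OF galoisD(1)[OF that]] .
  note 1 = eabs_pair[of fst a b, simplified] and 2 = eabs_pair[of snd a b, simplified]
    and 3 = eabs_pair[of "\<lambda>(y, z). y * z" a b, simplified, OF h[symmetric]]
  obtain c d where cd: "(\<Prod>s\<in>?S. fst s) = to_ac c" "(\<Prod>s\<in>?S. snd s) = to_ac d"
    using 1(1) 2(1) by (auto simp: image_iff)
  have "(\<Prod>s\<in>?S. case s of (y, z) \<Rightarrow> y * z) = to_ac (c * d)"
    by (simp add: case_prod_beta prod.distrib cd)
  then show ?thesis
    using 3(2) unfolding 1(2) 2(2) cd by (simp only: of_ac_to_ac av_mult real_root_mult)
qed

lemma eabs_to_ac [simp]: "eabs (to_ac c) = av c"
proof -
  have "galois_orbit (to_ac c) = {to_ac c}"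
    using galois_id galoisD(3) by (auto simp: galois_orbit_def)
  then show ?thesis by (simp add: eabs_def)
qed

lemma eabs_galois: "\<sigma> \<in> galois_group \<Longrightarrow> eabs (\<sigma> x) = eabs x"
  by (simp add: eabs_def orbit_galois)

lemma eabs_nonneg: "0 \<le> eabs x"
  unfolding eabs_def by (rule real_root_ge_zero) simp

lemma eabs_eq_0_iff: "eabs x = 0 \<longleftrightarrow> x = 0"
proof
  assume "eabs x = 0"
  then show "x = 0" using eabs_mult[of x "inverse x"] eabs_to_ac[of 1] by (cases "x = 0") auto
qed (use eabs_to_ac[of 0] in simp)

text \<open>Up to sign, the norm of \<open>1 + x\<close> is \<open>f(-1)\<close> for the minimal
  polynomial \<open>f\<close> of \<open>x\<close>. Its constant term is, up to sign, the norm of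
  \<open>x\<close> and hence integral, so by Hensel all of \<open>f\<close> is integral. The
  triangle inequality reduces to this case by dividing by the larger summand.\<close>

lemma eabs_one_add_le:
  assumes "eabs x \<le> 1"
  shows "eabs (1 + x) \<le> 1"
proof -
  let ?O = "galois_orbit x"
  obtain f where f: "map_poly to_ac f = (\<Prod>y\<in>?O. [:- y, 1:])"
    "degree f = card ?O" "lead_coeff f = 1"
    "\<And>g. g dvd f \<Longrightarrow> degree g = 0 \<or> degree g = degree f"
    using orbit_poly_rational[OF char_0] by metis
  have ev: "to_ac (poly f c) = (\<Prod>y\<in>?O. to_ac c - y)" for c
    using poly_rhom[OF rhom_to_ac, of f c] by (simp add: f poly_prod)
  have sgn: "(\<Prod>y\<in>A. - g y) = (-1) ^ card A * (\<Prod>y\<in>A. g y)" for A and g :: "'l alg_closure \<Rightarrow> 'l alg_closure"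
    using prod.distrib[of "\<lambda>_. -1" g A] by simp
  obtain c where c: "(\<Prod>y\<in>?O. y) = to_ac c" using orbit_prod_rational[OF char_0] by blast
  have "root (card ?O) (av c) \<le> 1" using assms by (simp add: eabs_def c)
  then have "av c \<le> 1" using card_orbit_pos[of x] by (simp add: real_root_le_1_iff)
  have av_sgn: "av ((-1) ^ n * z) = av z" for n z by (simp add: av_mult av_power)
  have "to_ac (coeff f 0) = to_ac ((-1) ^ card ?O * c)"
    using ev[of 0] sgn[of "\<lambda>y. y" ?O] by (simp add: c poly_0_coeff_0)
  then have "coeff f 0 = (-1) ^ card ?O * c" by (simp only: to_ac_eq_iff)
  then have "av (coeff f 0) \<le> 1" using \<open>av c \<le> 1\<close> by (simp only: av_sgn)
  then have "av (coeff f i) \<le> 1" for i using hensel_irreducible_integral[of f] f by blast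
  then have le: "av (poly f (-1)) \<le> 1" by (intro av_poly_le) auto
  have O1: "galois_orbit (1 + x) = (\<lambda>y. 1 + y) ` ?O"
    unfolding orbit_image image_image
    by (intro image_cong refl) (metis galoisD(1) rhom_add rhom_1)
  have inj: "inj_on (\<lambda>y. 1 + y) ?O" by (auto simp: inj_on_def)
  have "(\<Prod>y\<in>galois_orbit (1 + x). y) = (\<Prod>y\<in>?O. 1 + y)"
    unfolding O1 using prod.reindex[OF inj, of "\<lambda>y. y"] by simp
  also have "\<dots> = (\<Prod>y\<in>?O. - (to_ac (-1) - y))" by (intro prod.cong) auto
  also have "\<dots> = to_ac ((-1) ^ card ?O * poly f (-1))"
    unfolding sgn ev[symmetric] by simp
  finally have "eabs (1 + x) = root (card ?O) (av (poly f (-1)))"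
    unfolding eabs_def O1 card_image[OF inj] by (simp only: of_ac_to_ac av_sgn)
  then show ?thesis using le card_orbit_pos[of x] by (simp add: real_root_le_1_iff)
qed

lemma eabs_add: "eabs (x + y) \<le> max (eabs x) (eabs y)"
proof -
  have *: "eabs (x + y) \<le> eabs x" if "eabs y \<le> eabs x" for x y
  proof (cases "x = 0")
    case True
    then show ?thesis
      using that eabs_nonneg[of y] eabs_eq_0_iff by (metis add.left_neutral antisym)
  next
    case False
    have "eabs (y * inverse x) * eabs x = eabs y"
      using False by (simp add: mult.assoc flip: eabs_mult)
    then have "eabs (y * inverse x) \<le> 1"
      using that eabs_nonneg[of x] eabs_eq_0_iff[of x] False
        mult_le_cancel_right[of "eabs (y * inverse x)" "eabs x" 1] by auto
    then have "eabs (1 + y * inverse x) \<le> 1" by (rule eabs_one_add_le)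
    then have "eabs x * eabs (1 + y * inverse x) \<le> eabs x"
      using eabs_nonneg by (simp add: mult_left_le)
    moreover have "x * (1 + y * inverse x) = x + y" using False by (simp add: field_simps)
    ultimately show ?thesis by (simp flip: eabs_mult)
  qed
  then show ?thesis using *[of y x] *[of x y] by (simp add: max_def add.commute)
qed

sublocale ext: nonarch eabs by unfold_locales
     (auto simp: nonarch_abs_on_def eabs_nonneg eabs_eq_0_iff eabs_mult eabs_add)

end

section \<open>Unramified completions\<close>

text \<open>The inner binomial coefficients are divisible by \<open>l\<close>. The cofactor is kept
  explicit so that the identity serves both divisibility in polynomial rings and estimates of
  absolute values.\<close>

lemma add_power_prime:
  fixes x y :: "'a::comm_ring_1"
  assumes l: "prime l"
  shows "(x + y) ^ l = x ^ l + y ^ l +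
    of_nat l * (\<Sum>k\<in>{0<..<l}. of_nat ((l choose k) div l) * x ^ k * y ^ (l - k))"
proof -
  have "l > 0" using l by (simp add: prime_gt_0_nat)
  then have *: "{..l} = insert 0 (insert l {0<..<l})" by auto
  have split: "(\<Sum>k\<le>l. g k) = g l + (g 0 + (\<Sum>k\<in>{0<..<l}. g k))" for g :: "nat \<Rightarrow> 'a"
  proof -
    have "(\<Sum>k\<in>insert l {0<..<l}. g k) = g l + (\<Sum>k\<in>{0<..<l}. g k)"
      by (subst sum.insert) auto
    moreover have "(\<Sum>k\<le>l. g k) = g 0 + (\<Sum>k\<in>insert l {0<..<l}. g k)"
      unfolding * by (rule sum.insert) (use \<open>l > 0\<close> in auto)
    ultimately show ?thesis by (simp only: add.left_commute)
  qed
  have "(x + y) ^ l = (\<Sum>k\<le>l. of_nat (l choose k) * x ^ k * y ^ (l - k))"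
    by (rule binomial_ring)
  also have "\<dots> = of_nat (l choose l) * x ^ l * y ^ (l - l) + (of_nat (l choose 0) * x ^ 0 * y ^ (l - 0) +
      (\<Sum>k\<in>{0<..<l}. of_nat (l choose k) * x ^ k * y ^ (l - k)))" by (rule split)
  also have "of_nat (l choose l) * x ^ l * y ^ (l - l) = x ^ l" by simp
  also have "of_nat (l choose 0) * x ^ 0 * y ^ (l - 0) = y ^ l" by simp
  also have "(\<Sum>k\<in>{0<..<l}. of_nat (l choose k) * x ^ k * y ^ (l - k)) =
      of_nat l * (\<Sum>k\<in>{0<..<l}. of_nat ((l choose k) div l) * x ^ k * y ^ (l - k))"
    unfolding sum_distrib_left
  proof (intro sum.cong refl)
    fix k assume k: "k \<in> {0<..<l}"
    then have "l dvd l choose k" using l by (intro dvd_choose_prime) auto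
    then have "l * ((l choose k) div l) = l choose k" by (rule dvd_mult_div_cancel)
    then have "of_nat (l choose k) = (of_nat l * of_nat ((l choose k) div l) :: 'a)"
      by (simp only: of_nat_mult[symmetric])
    then show "of_nat (l choose k) * x ^ k * y ^ (l - k) =
        of_nat l * (of_nat ((l choose k) div l) * x ^ k * y ^ (l - k))" by (simp only: mult.assoc)
  qed
  finally show ?thesis by (simp only: add.assoc)
qed

lemma power_prime_power_cong:
  fixes x y z :: "'a::comm_ring_1"
  assumes l: "prime l" and xyz: "of_nat l dvd x - (y + z)"
  shows "of_nat l dvd x ^ l ^ n - (y ^ l ^ n + z ^ l ^ n)"
proof (induction n)
  case (Suc n)
  let ?q = "l ^ n"
  obtain t where t: "x ^ ?q = (y ^ ?q + z ^ ?q) + of_nat l * t"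
    using Suc by (metis add.commute diff_add_cancel dvdE)
  have dv: "of_nat l dvd a ^ l - (b ^ l + c ^ l)" if "a = b + c" for a b c :: 'a
    unfolding that add_power_prime[OF l] by simp
  have "of_nat l dvd (x ^ ?q) ^ l - ((y ^ ?q + z ^ ?q) ^ l + (of_nat l * t) ^ l)"
    by (rule dv[OF t])
  moreover have "of_nat l dvd (of_nat l * t) ^ l"
    using l by (simp add: power_mult_distrib prime_gt_0_nat dvd_power)
  moreover have "of_nat l dvd (y ^ ?q + z ^ ?q) ^ l - ((y ^ ?q) ^ l + (z ^ ?q) ^ l)"
    by (rule dv) simp
  ultimately have "of_nat l dvd
     ((x ^ ?q) ^ l - ((y ^ ?q + z ^ ?q) ^ l + (of_nat l * t) ^ l)) + (of_nat l * t) ^ l +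
     ((y ^ ?q + z ^ ?q) ^ l - ((y ^ ?q) ^ l + (z ^ ?q) ^ l))" by (intro dvd_add)
  then show ?case by (simp add: power_mult[symmetric] mult.commute algebra_simps)
qed (use xyz in simp)

lemma int_power_prime: 
  assumes l: "prime l"
  shows "int l dvd b ^ l - (b :: int)"
proof -
  have step: "int l dvd (b + 1) ^ l - (b + 1) \<longleftrightarrow> int l dvd b ^ l - b" for b :: int
  proof -
    obtain t where "(b + 1) ^ l = b ^ l + 1 ^ l + int l * t"
      using add_power_prime[OF l, of b 1] by blast
    then have "(b + 1) ^ l - (b + 1) = (b ^ l - b) + int l * t" by simp
    then show ?thesis by (metis dvd_add_left_iff dvd_triv_left)
  qed
  show ?thesis
  proof (induction b rule: int_induct[of _ 0])
    case base
    then show ?case using prime_gt_0_nat[OF l] by (simp add: power_0_left)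
  next
    case (step2 i)
    then show ?case using step[of "i - 1"] by simp
  qed (simp add: step)
qed

lemma int_power_prime_power: "prime l \<Longrightarrow> int l dvd a ^ l ^ n - (a :: int)"
proof (induction n)
  case (Suc n)
  have "int l dvd a ^ l ^ Suc n - a ^ l ^ n"
    using int_power_prime[OF Suc.prems, of "a ^ l ^ n"] by (simp add: mult.commute flip: power_mult)
  from dvd_add[OF this Suc.IH[OF Suc.prems]] show ?case by simp
qed simp

text \<open>Modulo \<open>l\<close> the \<open>l^n\<close>-th power is additive and fixes integers,
  so on integer polynomials it only acts on the variable.\<close>

lemma int_poly_frobenius:
  fixes f :: "int poly"
  assumes l: "prime l"
  shows "of_nat l dvd f ^ l ^ n - pcompose f ([:0, 1:] ^ l ^ n)"
proof (induction f)
  case (pCons a f)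
  let ?q = "l ^ n" and ?Y = "[:0, 1:] :: int poly"
  have "pCons a f = [:a:] + ?Y * f" by simp
  then have "of_nat l dvd pCons a f ^ ?q - ([:a:] ^ ?q + (?Y * f) ^ ?q)"
    by (intro power_prime_power_cong[OF l]) simp
  moreover have "of_nat l dvd [:a:] ^ ?q - [:a:]"
    using int_power_prime_power[OF l, of a n] rhom_dvd[OF rhom_const_poly, of "int l" "a ^ ?q - a"]
    by (simp add: poly_const_pow of_nat_poly)
  moreover have "of_nat l dvd ?Y ^ ?q * (f ^ ?q - pcompose f (?Y ^ ?q))"
    using pCons.IH by (rule dvd_mult)
  ultimately have "of_nat l dvd (pCons a f ^ ?q - ([:a:] ^ ?q + (?Y * f) ^ ?q)) +
     ([:a:] ^ ?q - [:a:]) + ?Y ^ ?q * (f ^ ?q - pcompose f (?Y ^ ?q))" by (intro dvd_add)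
  moreover have "(u - (a' + y * z)) + (a' - a0) + y * (z - P) = u - (a0 + y * P)"
    for u a' y z a0 P :: "int poly" by (simp add: algebra_simps)
  ultimately show ?case by (simp only: pcompose_pCons power_mult_distrib)
qed (use l in \<open>simp add: power_0_left prime_gt_0_nat\<close>)

lemma rhom_of_int': "rhom (of_int :: int \<Rightarrow> 'a::comm_ring_1)" by (rule rhomI) simp_all

text \<open>Elements of \<open>\<int>[w]\<close> are represented by integer polynomials, so that one
  polynomial can be evaluated at the root of unity in \<open>K\<close> and at its image in the
  completion.\<close>

definition int_eval :: "'a::field \<Rightarrow> int poly \<Rightarrow> 'a" where
  "int_eval w f = poly (map_poly of_int f) w"

lemma rhom_int_eval: "rhom (int_eval w)"
  unfolding int_eval_def by (rule rhom_poly_map[OF rhom_of_int'])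

lemma int_eval_const [simp]: "int_eval w [:a:] = of_int a"
  and int_eval_X [simp]: "int_eval w [:0, 1:] = w" by (simp_all add: int_eval_def map_poly_pCons)

lemma int_eval_pcompose: "int_eval w (pcompose f g) = int_eval (int_eval w g) f"
proof (rule rhom_poly_eqI[where f = f])
  show "rhom (\<lambda>f. int_eval w (pcompose f g))"
    by (rule rhom_comp[OF rhom_int_eval rhom_pcompose])
qed (simp_all add: rhom_int_eval pcompose_pCons)

text \<open>As \<open>w\<close> is fixed by the \<open>l^n\<close>-th power, Frobenius acts
  trivially on \<open>\<int>[w]\<close> modulo \<open>l\<close>.\<close>

lemma int_eval_frobenius:
  assumes "prime l" "w ^ l ^ n = w"
  obtains t where "int_eval w f ^ l ^ n = int_eval w f + of_nat l * int_eval w t"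
proof -
  obtain t where "f ^ l ^ n - pcompose f ([:0, 1:] ^ l ^ n) = of_nat l * t"
    using int_poly_frobenius[OF assms(1), where f = f and n = n] unfolding dvd_def by blast
  from arg_cong[OF this, of "int_eval w"]
  have "int_eval w f ^ l ^ n = int_eval w f + of_nat l * int_eval w t"
    by (simp add: rhom_simps[OF rhom_int_eval] rhom_of_nat[OF rhom_int_eval] int_eval_pcompose assms algebra_simps)
  then show ?thesis using that by blast
qed

lemma power_int_less_1_inj:
  fixes a :: real
  assumes a: "0 < a" "a < 1" and eq: "a powi m = a powi n"
  shows "m = n"
proof -
  have "exp (of_int m * ln a) = exp (of_int n * ln a)"
    using a eq by (simp add: powr_def flip: powr_real_of_int')
  then show ?thesis using a by simp
qed

text \<open>Here \<open>q\<close> is some power of \<open>l\<close> whose Frobenius fixes all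
  residues, not necessarily the residue cardinality; the application takes
  \<open>l ^ (p - 1)\<close>. The assumption \<open>value_group\<close> is the unramifiedness of
  \<open>l\<close>.\<close>

locale unramified = complete_nonarch_0 av for av :: "'l::field \<Rightarrow> real" +
  fixes p l q :: nat and w :: 'l
  assumes p: "prime p" "odd p" and l: "prime l" "l \<noteq> p"
    and q: "\<exists>n>0. q = l ^ n" "[q = 1] (mod p)"
    and w: "primitive_root_of_unity p w"
    and av_l: "av (of_nat l) < 1"
    and value_group: "\<And>x. x \<noteq> 0 \<Longrightarrow> \<exists>k. av x = av (of_nat l) powi k"
    and residue_power: "\<And>x. av x \<le> 1 \<Longrightarrow> av (x ^ q - x) < 1"

context nonarch
begin

lemma av_int_eval_le: "av w \<le> 1 \<Longrightarrow> av (int_eval w f) \<le> 1"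
  unfolding int_eval_def by (rule av_poly_le) (simp_all add: coeff_map_poly av_of_int_le)

text \<open>For a non-unit value the congruence \<open>f^q = f + l t\<close> reads
  \<open>f (f^(q-1) - 1) = l t\<close>, where the second factor is a unit, so one factor
  \<open>l\<close> splits off. The size of \<open>f(w)\<close> bounds how often this can happen.
  This replaces the factorisation of \<open>l\<close> in the ring of integers.\<close>

lemma int_eval_decompose:
  assumes l: "prime l" "av (of_nat l) < 1" "of_nat l \<noteq> (0::'k)" and w: "w ^ l ^ n = w" "av w = 1"
    and n: "n > 0" and f: "int_eval w f \<noteq> 0"
  obtains k u v where "av (int_eval w u) = 1" "av (int_eval w v) = 1"
    "int_eval w f * int_eval w v = of_nat l ^ k * int_eval w u"
proof -
  let ?\<epsilon> = "int_eval w" and ?l = "of_nat l :: 'k"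
  have l0: "0 < av ?l" using l by simp
  have *: "\<exists>k u v. av (?\<epsilon> u) = 1 \<and> av (?\<epsilon> v) = 1 \<and> ?\<epsilon> f * ?\<epsilon> v = ?l ^ k * ?\<epsilon> u"
    if "av ?l ^ m < av (?\<epsilon> f)" for m using that
  proof (induction m arbitrary: f)
    case 0
    then show ?case using av_int_eval_le[of w f] w by simp
  next
    case (Suc m)
    show ?case
    proof (cases "av (?\<epsilon> f) = 1")
      case True
      then show ?thesis
        using rhom_1[OF rhom_int_eval, of w] by (intro exI[of _ 0] exI[of _ f] exI[of _ 1]) simp
    next
      case False
      then have f1: "av (?\<epsilon> f) < 1" using av_int_eval_le[of w f] w by simp
      obtain t where t: "?\<epsilon> f ^ l ^ n = ?\<epsilon> f + ?l * ?\<epsilon> t"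
        using int_eval_frobenius[OF l(1) w(1)] by blast
      define g where "g = f ^ (l ^ n - 1) - 1"
      have q: "l ^ n > 1" using one_less_power[of l n] prime_gt_1_nat[OF l(1)] n by simp
      have "av (?\<epsilon> f ^ (l ^ n - 1)) < 1"
        using f1 q by (simp add: av_power power_less_one_iff)
      then have g: "av (?\<epsilon> g) = 1" using av_add_eq[of "?\<epsilon> f ^ (l ^ n - 1)" "-1"]
        by (simp add: g_def rhom_simps[OF rhom_int_eval])
      have fg: "?\<epsilon> f * ?\<epsilon> g = ?l * ?\<epsilon> t"
      proof -
        have "?\<epsilon> f * ?\<epsilon> f ^ (l ^ n - 1) = ?\<epsilon> f ^ Suc (l ^ n - 1)"
          by simp
        also have "Suc (l ^ n - 1) = l ^ n" using q by simp
        finally show ?thesis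
          using t by (simp only: g_def rhom_simps[OF rhom_int_eval] right_diff_distrib) simp
      qed
      then have "av (?\<epsilon> f) = av ?l * av (?\<epsilon> t)"
        using av_mult[of "?\<epsilon> f" "?\<epsilon> g"] av_mult[of ?l "?\<epsilon> t"] g by simp
      then have "av ?l ^ m < av (?\<epsilon> t)" using Suc.prems l0 by simp
      then obtain k u v where uv: "av (?\<epsilon> u) = 1" "av (?\<epsilon> v) = 1" "?\<epsilon> t * ?\<epsilon> v = ?l ^ k * ?\<epsilon> u"
        using Suc.IH by blast
      have "?\<epsilon> f * (?\<epsilon> g * ?\<epsilon> v) = (?\<epsilon> f * ?\<epsilon> g) * ?\<epsilon> v"
        by (simp only: mult.assoc)
      also have "\<dots> = ?l * (?\<epsilon> t * ?\<epsilon> v)"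
        unfolding fg by (simp only: mult.assoc)
      also have "\<dots> = ?l ^ Suc k * ?\<epsilon> u"
        unfolding uv(3) by simp
      finally have "?\<epsilon> f * (?\<epsilon> g * ?\<epsilon> v) = ?l ^ Suc k * ?\<epsilon> u" .
      with uv(1,2) show ?thesis using g by (intro exI[of _ "Suc k"] exI[of _ u] exI[of _ "g * v"])
          (simp add: rhom_mult[OF rhom_int_eval] av_mult)
    qed
  qed
  have "av (?\<epsilon> f) > 0" using f by simp
  then obtain m where "av ?l ^ m < av (?\<epsilon> f)" using l(2) real_arch_pow_inv by blast
  then show ?thesis using * that by blast
qed

end

lemma complex_of_rat_clear_denominator:
  obtains c :: int and g :: "int poly" where "c \<noteq> 0"
    "poly (map_poly of_rat f) (w :: complex) * of_int c = int_eval w g"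
proof -
  have "\<exists>c g. c \<noteq> (0::int) \<and> poly (map_poly of_rat f) w * of_int c = int_eval w g"
  proof (induction f)
    case 0
    show ?case by (intro exI[of _ 1] exI[of _ 0]) (simp add: rhom_0[OF rhom_int_eval])
  next
    case (pCons a f)
    obtain c g where cg: "c \<noteq> 0" "poly (map_poly of_rat f) w * of_int c = int_eval w g"
      using pCons.IH by blast
    obtain m n where mn: "quotient_of a = (m, n)" by force
    then have n: "n > 0" and a: "a = of_int m / of_int n"
      using quotient_of_denom_pos quotient_of_div by auto
    have "poly (map_poly of_rat (pCons a f)) w * of_int (c * n)
        = (of_rat a * of_int n) * of_int c + w * (poly (map_poly of_rat f) w * of_int c) * of_int n"
      by (simp add: map_poly_pCons algebra_simps)
    also have "of_rat a * of_int n = (of_int m :: complex)" using n by (simp add: a of_rat_divide)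
    also have "of_int m * of_int c + w * (poly (map_poly of_rat f) w * of_int c) * of_int n
       = int_eval w ([:m * c:] + [:0, 1:] * g * [:n:])"
      unfolding cg(2) rhom_add[OF rhom_int_eval] rhom_mult[OF rhom_int_eval] by simp
    finally show ?case using cg(1) n by (intro exI[of _ "c * n"] exI) auto
  qed
  then show ?thesis using that by blast
qed

lemma rat_adjoin_int_eval:
  assumes "a \<in> rat_adjoin (w :: complex)"
  obtains f g where "int_eval w g \<noteq> 0" "a * int_eval w g = int_eval w f"
proof -
  obtain f g where a: "a = poly (map_poly of_rat f) w / poly (map_poly of_rat g) w"
    using assms by (auto simp: rat_adjoin_def)
  obtain c F where F: "c \<noteq> 0" "poly (map_poly of_rat f) w * of_int c = int_eval w F"
    using complex_of_rat_clear_denominator by blast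
  obtain d G where G: "d \<noteq> 0" "poly (map_poly of_rat g) w * of_int d = int_eval w G"
    using complex_of_rat_clear_denominator by blast
  show ?thesis
  proof (cases "poly (map_poly of_rat g) w = 0")
    case True
    then show ?thesis
      using that[of 1 0] a by (simp add: rhom_1[OF rhom_int_eval] rhom_0[OF rhom_int_eval])
  next
    case False
    have "a * int_eval w ([:c:] * G) = int_eval w ([:d:] * F)"
      unfolding rhom_mult[OF rhom_int_eval] F(2)[symmetric] G(2)[symmetric]
      using False by (simp add: a)
    moreover have "int_eval w ([:c:] * G) \<noteq> 0"
      unfolding rhom_mult[OF rhom_int_eval] G(2)[symmetric] using False F(1) G(1) by simp
    ultimately show ?thesis using that by blast
  qed
qed

lemma int_eval_in_rat_adjoin: "int_eval w f \<in> rat_adjoin (w :: complex)"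
proof -
  have "map_poly of_rat (map_poly of_int f) = (map_poly of_int f :: complex poly)"
    by (simp add: poly_eq_iff coeff_map_poly)
  then have "int_eval w f = poly (map_poly of_rat (map_poly of_int f)) w / poly (map_poly of_rat 1) w"
    by (simp add: int_eval_def map_poly_1)
  then show ?thesis unfolding rat_adjoin_def by blast
qed

text \<open>By \<open>int_eval_decompose\<close> a nonzero element of \<open>K\<close> is a power of
  \<open>l\<close> times a quotient of units from \<open>\<int>[w]\<close>, and on those units the
  \<open>q\<close>-th power is trivial modulo \<open>l\<close>. Density carries both facts to the
  completion.\<close>

theorem unramified_completion:
  fixes av :: "'l::field \<Rightarrow> real" and \<iota> :: "complex \<Rightarrow> 'l"
  assumes p: "prime p" "odd p" and \<omega>: "primitive_root_of_unity p \<omega>"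
    and l: "prime l" "l \<noteq> p" and V: "place_above (rat_adjoin \<omega>) l V"
    and compl: "is_completion (rat_adjoin \<omega>) V \<iota> av"
  shows "unramified av p l (l ^ (p - 1)) (\<iota> \<omega>)"
proof -
  let ?K = "rat_adjoin \<omega>" and ?w = "\<iota> \<omega>" and ?q = "l ^ (p - 1)"
  have na: "nonarch_abs_on UNIV av"
    and h1: "\<iota> 1 = 1" and hadd: "\<And>a b. a \<in> ?K \<Longrightarrow> b \<in> ?K \<Longrightarrow> \<iota> (a + b) = \<iota> a + \<iota> b"
    and hmult: "\<And>a b. a \<in> ?K \<Longrightarrow> b \<in> ?K \<Longrightarrow> \<iota> (a * b) = \<iota> a * \<iota> b"
    and iso: "\<And>a. a \<in> ?K \<Longrightarrow> av (\<iota> a) = V a"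
    and dense: "\<And>z e. e > 0 \<Longrightarrow> \<exists>a\<in>?K. av (z - \<iota> a) < e"
    and complete: "\<And>s :: nat \<Rightarrow> 'l. (\<forall>e>0. \<exists>N. \<forall>m\<ge>N. \<forall>n\<ge>N. av (s m - s n) < e) \<Longrightarrow>
        (\<exists>z. (\<lambda>n. av (s n - z)) \<longlonglongrightarrow> 0)"
    using compl unfolding is_completion_def by blast+
  interpret nonarch av by unfold_locales (rule na)
  note [simp] = int_eval_in_rat_adjoin
  have V0: "V a = 0 \<longleftrightarrow> a = 0" if "a \<in> ?K" for a
    using V that by (auto simp: place_above_def nonarch_abs_on_def)
  have inj: "\<iota> a = 0 \<longleftrightarrow> a = 0" if "a \<in> ?K" for a
    using iso[OF that] V0[OF that] by (metis av_eq_0_iff)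
  have "\<iota> 0 = 0"
    using inj[of 0] int_eval_in_rat_adjoin[of \<omega> 0] by (simp add: rhom_0[OF rhom_int_eval])
  \<comment> \<open>\<open>\<iota>\<close> is known to be additive and multiplicative on
    \<open>K\<close> only; preceded by integer evaluation it becomes a homomorphism on a whole
    type.\<close>
  then have "rhom (\<lambda>f. \<iota> (int_eval \<omega> f))"
    by (intro rhomI) (simp_all add: rhom_simps[OF rhom_int_eval] h1 hadd hmult)
  note hom = this
  have \<iota>_eval: "\<iota> (int_eval \<omega> f) = int_eval ?w f" for f
  proof (rule rhom_poly_eqI[OF hom rhom_int_eval])
    show "\<iota> (int_eval \<omega> [:c:]) = int_eval ?w [:c:]" for c
      using rhom_of_int[OF hom, of c] by (simp add: of_int_poly rhom_of_int[OF rhom_int_eval])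
  qed simp
  have \<iota>_nat: "\<iota> (of_nat n) = of_nat n" for n
    using \<iota>_eval[of "of_nat n"] by (simp add: rhom_of_nat[OF rhom_int_eval])
  have of_nat_0: "of_nat n = (0::'l) \<longleftrightarrow> n = 0" for n
    using inj[of "of_nat n"] int_eval_in_rat_adjoin[of \<omega> "of_nat n"] \<iota>_nat[of n]
    by (simp add: rhom_of_nat[OF rhom_int_eval])
  then have char: "CHAR('l) = 0" by (metis of_nat_CHAR)
  have avl: "av (of_nat l) < 1"
    using iso[of "of_nat l"] V int_eval_in_rat_adjoin[of \<omega> "of_nat l"]
    by (simp add: \<iota>_nat rhom_of_nat[OF rhom_int_eval] place_above_def)
  have l0: "of_nat l \<noteq> (0::'l)" using l by (simp add: of_nat_0)
  have w: "primitive_root_of_unity p ?w"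
  proof -
    have "?w ^ k = \<iota> (\<omega> ^ k)" for k
      using \<iota>_eval[of "[:0, 1:] ^ k"] by (simp add: rhom_power[OF rhom_int_eval])
    moreover have "\<iota> (\<omega> ^ k) = 1 \<longleftrightarrow> \<omega> ^ k = 1" for k
      using inj[of "int_eval \<omega> ([:0, 1:] ^ k - 1)"] rhom_diff[OF hom, of "[:0, 1:] ^ k" 1]
        int_eval_in_rat_adjoin[of \<omega> "[:0, 1:] ^ k - 1"]
      by (simp add: rhom_simps[OF rhom_int_eval] h1 del: int_eval_in_rat_adjoin)
    ultimately show ?thesis using \<omega> by (simp add: primitive_root_of_unity_def h1)
  qed
  then have wp: "?w ^ p = 1" by (simp add: primitive_root_of_unity_def)
  have avw: "av ?w = 1" using av_root_of_unity[OF wp] p by (simp add: prime_gt_0_nat)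
  have q1: "[?q = 1] (mod p)"
    using fermat_theorem[OF p(1), of l] l(2) primes_dvd_imp_eq[OF p(1) l(1)] by blast
  then obtain m where "?q = 1 + m * p"
    using l by (metis cong_le_nat cong_sym mult.commute add.commute one_le_power prime_gt_0_nat less_eq_Suc_le One_nat_def)
  then have wq: "?w ^ ?q = ?w" by (simp add: power_add mult.commute[of m] power_mult wp)
  have n0: "p - 1 > 0" using p prime_gt_1_nat by auto
  note dec = int_eval_decompose[OF l(1) avl l0 wq avw n0]
  have quot: "\<exists>k u v. \<iota> a = of_nat l powi k * (int_eval ?w u / int_eval ?w v) \<and>
      av (int_eval ?w u) = 1 \<and> av (int_eval ?w v) = 1" if a: "a \<in> ?K" "a \<noteq> 0" for a
  proof -
    obtain f g where fg: "int_eval \<omega> g \<noteq> 0" "a * int_eval \<omega> g = int_eval \<omega> f"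
      using rat_adjoin_int_eval[OF a(1)] by blast
    then have fg': "\<iota> a * int_eval ?w g = int_eval ?w f" "int_eval ?w g \<noteq> 0"
      using hmult[OF a(1), of "int_eval \<omega> g"] \<iota>_eval inj[of "int_eval \<omega> g"] by auto
    then have f0: "int_eval ?w f \<noteq> 0" using inj[OF a(1)] a by auto
    obtain k u v where f: "av (int_eval ?w u) = 1" "av (int_eval ?w v) = 1"
      "int_eval ?w f * int_eval ?w v = of_nat l ^ k * int_eval ?w u" using dec[OF f0] by blast
    obtain k' u' v' where g: "av (int_eval ?w u') = 1" "av (int_eval ?w v') = 1"
      "int_eval ?w g * int_eval ?w v' = of_nat l ^ k' * int_eval ?w u'"
      using dec[OF fg'(2)] by blast
    have nz: "int_eval ?w u \<noteq> 0" "int_eval ?w v \<noteq> 0" "int_eval ?w u' \<noteq> 0" "int_eval ?w v' \<noteq> 0"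
      using f g by auto
    have "\<iota> a = int_eval ?w f / int_eval ?w g" using fg' by (simp add: field_simps)
    also have "int_eval ?w f = of_nat l ^ k * int_eval ?w u / int_eval ?w v"
      using f(3) nz by (simp add: field_simps)
    also have "int_eval ?w g = of_nat l ^ k' * int_eval ?w u' / int_eval ?w v'"
      using g(3) nz by (simp add: field_simps)
    finally have "\<iota> a = of_nat l powi (int k - int k') *
        (int_eval ?w (u * v') / int_eval ?w (v * u'))"
      using l0 nz by (simp add: power_int_diff rhom_mult[OF rhom_int_eval] field_simps)
    then show ?thesis
      using f g by (intro exI[of _ "int k - int k'"] exI[of _ "u * v'"] exI[of _ "v * u'"])
        (simp add: rhom_mult[OF rhom_int_eval] av_mult)
  qed
  have near: "\<exists>a\<in>?K. a \<noteq> 0 \<and> av (\<iota> a - z) < av z" if "z \<noteq> 0" for z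
  proof -
    obtain a where "a \<in> ?K" "av (z - \<iota> a) < av z"
      using dense[of "av z" z] \<open>z \<noteq> 0\<close> by auto
    then show ?thesis
      using \<open>\<iota> 0 = 0\<close> by (intro bexI[of _ a]) (auto simp: av_minus_commute)
  qed
  have frob: "av (int_eval ?w f ^ ?q - int_eval ?w f) < 1" for f
  proof -
    obtain t where "int_eval ?w f ^ ?q = int_eval ?w f + of_nat l * int_eval ?w t"
      using int_eval_frobenius[OF l(1) wq] by blast
    then have "av (int_eval ?w f ^ ?q - int_eval ?w f) = av (of_nat l) * av (int_eval ?w t)"
      by (simp add: av_mult)
    also have "\<dots> \<le> av (of_nat l)"
      using av_int_eval_le[of ?w t] avw by (simp add: mult_left_le)
    finally show ?thesis using avl by simp
  qed
  show ?thesis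
  proof unfold_locales
    show "\<exists>n>0. ?q = l ^ n" using n0 by blast
    show "\<exists>k. av z = av (of_nat l) powi k" if z: "z \<noteq> 0" for z
    proof -
      obtain a where a: "a \<in> ?K" "a \<noteq> 0" "av (\<iota> a - z) < av z"
        using near[OF z] by blast
      then have "av z = av (\<iota> a)" using av_close_eq by metis
      then show ?thesis using quot[OF a(1,2)] by (auto simp: av_mult av_divide av_powi)
    qed
    show "av (z ^ ?q - z) < 1" if z: "av z \<le> 1" for z
    proof (cases "av z < 1")
      case True
      have "av (z ^ ?q) < 1"
        using True l by (simp add: av_power power_less_one_iff prime_gt_0_nat)
      then show ?thesis using True by (rule av_diff_less)
    next
      case False
      then have z1: "av z = 1" "z \<noteq> 0" using z by auto
      obtain a where a: "a \<in> ?K" "a \<noteq> 0" "av (\<iota> a - z) < av z"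
        using near[OF z1(2)] by blast
      then have a1: "av (\<iota> a) = 1" using av_close_eq z1 by metis
      obtain k u v where uv: "\<iota> a = of_nat l powi k * (int_eval ?w u / int_eval ?w v)"
        "av (int_eval ?w u) = 1" "av (int_eval ?w v) = 1" using quot[OF a(1,2)] by blast
      \<comment> \<open>The approximating element is a unit, so no power of \<open>l\<close>
        remains, and it suffices to check \<open>x^q = x\<close> modulo small elements for numerator
        and denominator.\<close>
      have "av (of_nat l) powi k = 1" using a1 uv by (simp add: av_mult av_divide av_powi)
      then have "k = 0" using avl l0 power_int_less_1_inj[of "av (of_nat l)" k 0] by simp
      let ?u = "int_eval ?w u" and ?v = "int_eval ?w v"
      have au: "\<iota> a = ?u / ?v" using uv \<open>k = 0\<close> by simp
      have v0: "?v \<noteq> 0" using uv by auto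
      have "av ((?u ^ ?q - ?u) * ?v - ?u * (?v ^ ?q - ?v)) < 1"
        using frob uv by (intro av_diff_less) (auto simp: av_mult)
      moreover have "(\<iota> a) ^ ?q - \<iota> a = ((?u ^ ?q - ?u) * ?v - ?u * (?v ^ ?q - ?v)) / (?v ^ ?q * ?v)"
        unfolding au using v0 by (simp add: power_divide field_simps)
      ultimately have "av ((\<iota> a) ^ ?q - \<iota> a) < 1"
        by (simp add: av_divide av_mult av_power uv)
      moreover have "av (z ^ ?q - (\<iota> a) ^ ?q) < 1"
        using a(3) z1 a1 by (intro av_power_diff) (auto simp: av_minus_commute)
      moreover have "av (\<iota> a - z) < 1" using a z1 by simp
      ultimately show ?thesis using av_diff_trans_less by blast
    qed
  qed (use p l w avl char q1 complete in blast)+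
qed

section \<open>Divisors on the affine curve\<close>

lemma separable_split:
  fixes f :: "'a::alg_closed_field poly"
  assumes f: "lead_coeff f = 1" and sep: "\<And>x. poly f x = 0 \<Longrightarrow> poly (pderiv f) x \<noteq> 0"
  shows "f = (\<Prod>x | poly f x = 0. [:- x, 1:])" "card {x. poly f x = 0} = degree f"
proof -
  have f0: "f \<noteq> 0" using f by auto
  obtain A where A: "size A = degree f" "f = Polynomial.smult (lead_coeff f) (\<Prod>x\<in>#A. [:- x, 1:])"
    using alg_closed_imp_factorization[OF f0] by blast
  then have fA: "f = (\<Prod>x\<in>#A. [:- x, 1:])" using f by simp
  have "count A x \<le> 1" for x
  proof (rule ccontr)
    assume "\<not> count A x \<le> 1"
    then have "{#x, x#} \<subseteq># A" by (simp add: subseteq_mset_def)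
    then obtain B where "A = {#x, x#} + B" using mset_subset_eq_exists_conv by blast
    then have "f = [:- x, 1:] * ([:- x, 1:] * (\<Prod>x\<in>#B. [:- x, 1:]))" by (simp add: fA)
    moreover have "poly (pderiv ([:- x, 1:] * ([:- x, 1:] * g))) x = 0" for g
      by (simp only: pderiv_mult poly_mult poly_add) simp
    moreover have "poly ([:- x, 1:] * ([:- x, 1:] * g)) x = 0" for g
      by (simp only: poly_mult) simp
    ultimately have "poly f x = 0" "poly (pderiv f) x = 0" by metis+
    then show False using sep by blast
  qed
  then have "A = mset_set (set_mset A)"
    by (intro multiset_eqI) (metis count_mset_set(1) count_mset_set(3) finite_set_mset le_neq_implies_less
        less_one not_in_iff)
  moreover have "set_mset A = {x. poly f x = 0}"
    by (auto simp: fA poly_prod_mset prod_mset_zero_iff)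
  ultimately have Aeq: "A = mset_set {x. poly f x = 0}" by simp
  show "card {x. poly f x = 0} = degree f" using A(1) Aeq by (metis size_mset_set)
  have "f = (\<Prod>x\<in>#mset_set {x. poly f x = 0}. [:- x, 1:])" using fA Aeq by metis
  then show "f = (\<Prod>x | poly f x = 0. [:- x, 1:])" by (simp only: prod_unfold_prod_mset)
qed

lemma prod_power_int: "(\<Prod>x\<in>A. f x) powi k = (\<Prod>x\<in>A. (f x :: 'a::field) powi k)"
  by (induction A rule: infinite_finite_induct) (simp_all add: power_int_mult_distrib)

lemma prod_power_int_sum: "c \<noteq> 0 \<Longrightarrow> (\<Prod>x\<in>A. c powi f x) = (c :: 'a::field) powi (\<Sum>x\<in>A. f x)"
  by (induction A rule: infinite_finite_induct) (simp_all add: power_int_add)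

text \<open>If \<open>a^k e\<close> is a \<open>p\<close>-th power with \<open>k\<close> prime to
  \<open>p\<close>, then so is \<open>a\<close> times a power of \<open>e\<close>. On the curve
  \<open>x\<close> is the second coordinate \<open>b\<close>, with \<open>k = r\<close> for small
  \<open>a\<close> and \<open>k = r + 1\<close> for large \<open>a\<close>.\<close>

lemma power_int_bezout:
  fixes a e x :: "'a::field"
  assumes "a \<noteq> 0" "x ^ p = a ^ k * e" "int p * s + int k * t = 1"
  shows "(a powi s * x powi t) ^ p = a * e powi t"
proof -
  have "(a powi s * x powi t) ^ p = a powi (int p * s) * (x ^ p) powi t"
    by (simp add: power_mult_distrib power_int_power power_int_power' mult.commute)
  also have "(x ^ p) powi t = a powi (int k * t) * e powi t"
    unfolding assms(2) power_int_mult_distrib by (simp add: power_int_power)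
  also have "a powi (int p * s) * (a powi (int k * t) * e powi t) = a powi (int p * s + int k * t) * e powi t"
    using assms(1) by (simp add: power_int_add)
  finally show ?thesis using assms(3) by simp
qed

definition galois_invariant :: "('l::field alg_closure \<times> 'l alg_closure \<Rightarrow> int) \<Rightarrow> bool" where
  "galois_invariant m \<longleftrightarrow> (\<forall>\<sigma>\<in>galois_group. \<forall>a b. m (\<sigma> a, \<sigma> b) = m (a, b))"

lemma galois_pair_bij:
  assumes "\<sigma> \<in> galois_group" "galois_invariant m"
  shows "bij_betw (\<lambda>(a, b). (\<sigma> a, \<sigma> b)) {s. m s \<noteq> 0} {s. m s \<noteq> 0}"
  by (rule bij_betw_byWitness[where f' = "\<lambda>(a, b). (inv_into UNIV \<sigma> a, inv_into UNIV \<sigma> b)"])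
     (use assms galois_inv[OF assms(1)] galois_inv_apply[OF assms(1)] in \<open>auto simp: galois_invariant_def\<close>)

text \<open>An automorphism merely permutes the factors. Equivariance of \<open>\<phi>\<close> is
  demanded only on the support of \<open>m\<close>, since the functions used later are controlled
  only at points of the curve.\<close>

lemma equivariant_prod:
  fixes \<phi> :: "'l::field alg_closure \<times> 'l alg_closure \<Rightarrow> 'l alg_closure"
  assumes char: "CHAR('l) = 0" and m: "galois_invariant m"
    and \<phi>: "\<And>\<sigma> a b. \<sigma> \<in> galois_group \<Longrightarrow> m (a, b) \<noteq> 0 \<Longrightarrow> \<phi> (\<sigma> a, \<sigma> b) = \<sigma> (\<phi> (a, b))"
  shows "(\<Prod>s | m s \<noteq> 0. \<phi> s powi m s) \<in> range to_ac"
proof (rule galois_fixed[OF char])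
  fix \<sigma> :: "'l alg_closure \<Rightarrow> 'l alg_closure" assume \<sigma>: "\<sigma> \<in> galois_group"
  have "\<sigma> (\<Prod>s | m s \<noteq> 0. \<phi> s powi m s) = (\<Prod>s | m s \<noteq> 0. \<sigma> (\<phi> s) powi m s)"
    by (simp add: rhom_prod[OF galoisD(1)[OF \<sigma>]] rhom_powi[OF galoisD(1)[OF \<sigma>]])
  also have "\<dots> = (\<Prod>s | m s \<noteq> 0. (\<lambda>s. \<phi> s powi m s) ((\<lambda>(a, b). (\<sigma> a, \<sigma> b)) s))"
    using m \<sigma> by (intro prod.cong) (auto simp: \<phi> galois_invariant_def)
  also have "\<dots> = (\<Prod>s | m s \<noteq> 0. \<phi> s powi m s)"
    by (rule prod.reindex_bij_betw[OF galois_pair_bij[OF \<sigma> m]])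
  finally show "\<sigma> (\<Prod>s | m s \<noteq> 0. \<phi> s powi m s) = (\<Prod>s | m s \<noteq> 0. \<phi> s powi m s)" .
qed

text \<open>Divisors in coordinates: away from \<open>(0,0)\<close> and infinity a point is
  determined by the pair \<open>(a, b)\<close>, so the arithmetic part can forget valuations of the
  function field. The condition \<open>a \<noteq> 0\<close> removes exactly \<open>(0,0)\<close>
  from the affine curve.\<close>

definition curve_divisor :: "nat \<Rightarrow> nat \<Rightarrow> 'l::field \<Rightarrow> ('l alg_closure \<times> 'l alg_closure \<Rightarrow> int) \<Rightarrow> bool" where
  "curve_divisor p r d m \<longleftrightarrow> finite {s. m s \<noteq> 0} \<and> galois_invariant m \<and>
     (\<forall>a b. m (a, b) \<noteq> 0 \<longrightarrow> a \<noteq> 0 \<and> b ^ p = a ^ r * (to_ac d - a)) \<and> (\<Sum>s | m s \<noteq> 0. m s) = 0"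

definition divisor_value :: "('l::field alg_closure \<times> 'l alg_closure \<Rightarrow> int) \<Rightarrow> 'l alg_closure" where
  "divisor_value m = (\<Prod>s | m s \<noteq> 0. fst s powi m s)"

definition divisor_values :: "nat \<Rightarrow> nat \<Rightarrow> 'l::field \<Rightarrow> 'l set" where
  "divisor_values p r d = {u. \<exists>m. curve_divisor p r d m \<and> to_ac u = divisor_value m}"

lemma divisor_value_superset:
  assumes "finite A" "{s. m s \<noteq> 0} \<subseteq> A"
  shows "divisor_value m = (\<Prod>s\<in>A. fst s powi m s)"
  unfolding divisor_value_def using assms by (intro prod.mono_neutral_left) auto

lemma divisor_value_nonzero:
  "curve_divisor p r d m \<Longrightarrow> divisor_value m \<noteq> 0"
  by (auto simp: curve_divisor_def divisor_value_def)

lemma divisor_values_powi: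
  assumes "u \<in> divisor_values p r d"
  shows "u powi k \<in> divisor_values p r d"
proof -
  obtain m where m: "curve_divisor p r d m" "to_ac u = divisor_value m"
    using assms by (auto simp: divisor_values_def)
  show ?thesis
  proof (cases "k = 0")
    case True
    then show ?thesis
      by (auto simp: divisor_values_def curve_divisor_def galois_invariant_def divisor_value_def
          intro!: exI[of _ "\<lambda>_. 0"])
  next
    case False
    then have supp: "{s. k * m s \<noteq> 0} = {s. m s \<noteq> 0}" by auto
    have "curve_divisor p r d (\<lambda>s. k * m s)" using m(1) unfolding curve_divisor_def supp
      by (auto simp: galois_invariant_def sum_distrib_left[symmetric])
    moreover have "to_ac (u powi k) = divisor_value (\<lambda>s. k * m s)"
      unfolding divisor_value_def supp rhom_powi[OF rhom_to_ac] m(2)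
      by (simp add: prod_power_int mult.commute[of k] power_int_mult)
    ultimately show ?thesis unfolding divisor_values_def by blast
  qed
qed

section \<open>Frobenius and roots of unity modulo small elements\<close>

context nonarch
begin

context
  fixes l :: nat
  assumes l: "prime l" "av (of_nat l) < 1"
begin

lemma frob_add:
  assumes "av x \<le> 1" "av y \<le> 1"
  shows "av ((x + y) ^ l ^ n - (x ^ l ^ n + y ^ l ^ n)) < 1"
proof (induction n)
  case (Suc n)
  have *: "av ((a + b) ^ l - (a ^ l + b ^ l)) < 1" if "av a \<le> 1" "av b \<le> 1" for a b
  proof -
    have "av (\<Sum>k\<in>{0<..<l}. of_nat ((l choose k) div l) * a ^ k * b ^ (l - k)) \<le> 1"
      by (intro av_sum_le) (simp_all add: av_mult av_power mult_le_one power_le_one av_of_nat_le that)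
    then have "av (of_nat l * (\<Sum>k\<in>{0<..<l}. of_nat ((l choose k) div l) * a ^ k * b ^ (l - k))) < 1"
      unfolding av_mult using l(2) mult_left_le[of _ "av (of_nat l)"] by (meson av_nonneg order_le_less_trans)
    then show ?thesis
      unfolding add_power_prime[OF l(1), of a b] by simp
  qed
  let ?q = "l ^ n"
  have le: "av (x ^ ?q) \<le> 1" "av (y ^ ?q) \<le> 1" "av ((x + y) ^ ?q) \<le> 1"
    using assms av_add_le[OF assms] by (auto simp: av_power power_le_one)
  have "av (((x + y) ^ ?q) ^ l - (x ^ ?q + y ^ ?q) ^ l) < 1"
    by (rule av_power_diff[OF le(3) av_add_le[OF le(1,2)] Suc.IH])
  from av_diff_trans_less[OF this *[OF le(1,2)]] show ?case
    by (simp add: mult.commute flip: power_mult)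
qed simp

lemma frob_sum:
  assumes "\<And>i. i \<in> A \<Longrightarrow> av (f i) \<le> 1"
  shows "av ((\<Sum>i\<in>A. f i) ^ l ^ n - (\<Sum>i\<in>A. f i ^ l ^ n)) < 1" using assms
proof (induction A rule: infinite_finite_induct)
  case (insert x A)
  let ?q = "l ^ n"
  have 1: "av ((f x + sum f A) ^ ?q - (f x ^ ?q + sum f A ^ ?q)) < 1"
    using insert.prems by (intro frob_add av_sum_le) auto
  have 2: "av ((f x ^ ?q + sum f A ^ ?q) - (f x ^ ?q + (\<Sum>i\<in>A. f i ^ ?q))) < 1"
    using insert by simp
  show ?case using av_diff_trans_less[OF 1 2] insert.hyps by simp
qed (use l in \<open>simp_all add: power_0_left prime_gt_0_nat\<close>)

lemma frob_inj:
  assumes "av x \<le> 1" "av y \<le> 1" "av (x ^ l ^ n - y ^ l ^ n) < 1"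
  shows "av (x - y) < 1"
proof -
  have xy: "av (x - y) \<le> 1" using assms by (intro av_diff_le)
  have "av (((x - y) + y) ^ l ^ n - ((x - y) ^ l ^ n + y ^ l ^ n)) < 1"
    by (rule frob_add[OF xy assms(2)])
  from av_diff_less[OF assms(3) this] have "av ((x - y) ^ l ^ n) < 1" by simp
  then show ?thesis using xy by (metis av_power less_le power_one)
qed

end

text \<open>If \<open>z \<noteq> 1\<close>, the geometric sum of the powers of \<open>z\<close>
  would vanish; but it is congruent to \<open>N\<close>, a unit.\<close>

lemma root_of_unity_close:
  assumes "z ^ N = 1" "av (z - 1) < 1" "av (of_nat N) = 1"
  shows "z = 1"
proof -
  have "av z = 1" using av_close_eq[of z 1] assms(2) by simp
  have "(z - 1) * (\<Sum>i<N. z ^ i) = 0" using power_diff_1_eq[of z N] assms(1) by simp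
  moreover have "av ((\<Sum>i<N. z ^ i) - (\<Sum>i<N. 1)) < 1"
    unfolding sum_subtractf[symmetric]
    by (intro av_sum_less) (use av_power_diff[of z 1] assms \<open>av z = 1\<close> in auto)
  then have "av (\<Sum>i<N. z ^ i) = 1"
    using av_close_eq[of "\<Sum>i<N. z ^ i" "of_nat N"] assms(3) by simp
  then have "(\<Sum>i<N. z ^ i) \<noteq> 0" by auto
  ultimately show ?thesis by simp
qed

lemma integral_poly_prod:
  assumes "\<And>x. x \<in> A \<Longrightarrow> av (f x) \<le> 1"
  shows "av (coeff (\<Prod>x\<in>A. [:- f x, 1:]) i) \<le> 1" using assms
proof (induction A arbitrary: i rule: infinite_finite_induct)
  case (insert x A)
  have "av (coeff (\<Prod>x\<in>A. [:- f x, 1:]) j) \<le> 1" for j using insert by simp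
  then have "av (- (f x) * coeff (\<Prod>x\<in>A. [:- f x, 1:]) i) \<le> 1" for i
    unfolding av_mult using insert.prems by (simp add: mult_le_one)
  then have "av (- (f x * coeff (\<Prod>x\<in>A. [:- f x, 1:]) i)) \<le> 1" for i
    by (simp only: mult_minus_left)
  then show ?case
    using insert \<open>\<And>j. av (coeff (\<Prod>x\<in>A. [:- f x, 1:]) j) \<le> 1\<close>
    by (cases i) (auto intro!: av_add_le av_diff_le)
qed (auto simp: one_pCons coeff_pCons split: nat.split)

lemma av_of_int_coprime:
  assumes "prime l" "av (of_nat l) < 1" "\<not> int l dvd n"
  shows "av (of_int n) = 1"
proof -
  have "coprime (int l) n" using assms by (intro prime_imp_coprime) auto
  then obtain u v where uv: "u * int l + v * n = 1"
    using bezout_int[of "int l" n] by (auto simp: coprime_iff_gcd_eq_1)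
  have "\<not> av (of_int n) < 1"
  proof
    assume "av (of_int n) < 1"
    then have "av (of_int v * of_int n) < 1" "av (of_int u * of_nat l) < 1"
      unfolding av_mult using assms(2) av_of_int_le[of v] av_of_int_le[of u]
        mult_left_le_one_le[of "av (of_int n)" "av (of_int v)"]
        mult_left_le_one_le[of "av (of_nat l)" "av (of_int u)"] by auto
    then have "av (of_int u * of_nat l + of_int v * of_int n) < 1" by (intro av_add_less)
    moreover have "of_int u * of_nat l + of_int v * of_int n = (of_int (u * int l + v * n) :: 'k)"
      by simp
    ultimately show False using uv by simp
  qed
  then show ?thesis using av_of_int_le[of n] by simp
qed

end

section \<open>Canonical \<open>p\<close>-th roots and Teichmueller representatives\<close>

context unramified
begin

abbreviation "W \<equiv> to_ac w"

lemma p_gt: "p > 1" and l_gt: "l > 1"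
  using prime_gt_1_nat[OF p(1)] prime_gt_1_nat[OF l(1)] by auto

lemma W: "primitive_root_of_unity p W"
  using w unfolding primitive_root_of_unity_def by (metis to_ac_1 to_ac_eq_1_iff to_ac_power)

lemma of_nat_eq_0 [simp]: "of_nat n = (0 :: 'l) \<longleftrightarrow> n = 0" "of_nat n = (0 :: 'l alg_closure) \<longleftrightarrow> n = 0"
  using char_0 by (simp_all add: of_nat_eq_0_iff_char_dvd)

lemma eabs_of_nat: "eabs (of_nat n) = av (of_nat n)" by (metis eabs_to_ac to_ac_of_nat)

lemma av_of_nat_coprime: "\<not> l dvd n \<Longrightarrow> av (of_nat n) = 1"
  using av_of_int_coprime[of l "int n"] l av_l by simp

lemma eabs_p: "eabs (of_nat p) = 1"
  using av_of_nat_coprime[of p] primes_dvd_imp_eq[OF l(1) p(1)] l(2) by (auto simp: eabs_of_nat)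

text \<open>For any \<open>p\<close>-th root \<open>z\<close> the product of the
  \<open>z - W^j\<close> is \<open>u - 1\<close>, which is small, so \<open>z\<close> is close to
  some \<open>W^j\<close> and \<open>z / W^j\<close> is close to 1. Uniqueness is
  \<open>root_of_unity_close\<close>, as \<open>p\<close> is a unit.\<close>

lemma pth_root_close:
  assumes "eabs (u - 1) < 1"
  shows "\<exists>!z. z ^ p = u \<and> eabs (z - 1) < 1"
proof -
  have p0: "p > 0" using p_gt by simp
  obtain z where z: "z ^ p = u" using alg_closed_imp_poly_has_root[of "monom 1 p + [:- u:]"] p0
    by (auto simp: poly_monom degree_add_eq_left degree_monom_eq)
  have "(\<Prod>j<p. eabs (z - W ^ j * 1)) < 1"
    using assms primitive_root_prod[OF W p0, of z 1] by (simp add: z flip: ext.av_prod)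
  then obtain j where j: "j < p" "eabs (z - W ^ j) < 1"
    using prod_ge_1[of "{..<p}" "\<lambda>j. eabs (z - W ^ j)"] by (force simp: not_less)
  have Wp: "W ^ p = 1" and W0: "W \<noteq> 0"
    using W p0 by (auto simp: primitive_root_of_unity_def power_0_left)
  have aW: "eabs (W ^ j) = 1" using ext.av_root_of_unity[OF Wp p0] by (simp add: ext.av_power)
  have "z / W ^ j - 1 = (z - W ^ j) / W ^ j" using W0 by (simp add: field_simps)
  then have "eabs (z / W ^ j - 1) < 1" using j aW by (simp add: ext.av_divide)
  moreover have "(z / W ^ j) ^ p = u"
  proof -
    have "(W ^ j) ^ p = (W ^ p) ^ j" by (simp only: mult.commute flip: power_mult)
    then show ?thesis using z Wp by (simp add: power_divide)
  qed
  moreover have "x = y" if "x ^ p = u \<and> eabs (x - 1) < 1" "y ^ p = u \<and> eabs (y - 1) < 1" for x y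
  proof -
    have ay: "eabs y = 1" using ext.av_close_eq[of y 1] that by simp
    then have y0: "y \<noteq> 0" by auto
    have u0: "u \<noteq> 0" using assms by auto
    have "x / y - 1 = ((x - 1) - (y - 1)) / y" using y0 by (simp add: field_simps)
    then have "eabs (x / y - 1) < 1"
      using ext.av_diff_less[of "x - 1" 1 "y - 1"] that ay by (simp add: ext.av_divide)
    moreover have "(x / y) ^ p = 1" using that u0 by (simp add: power_divide)
    ultimately have "x / y = 1" using eabs_p ext.root_of_unity_close[of "x / y" p] by blast
    then show ?thesis using y0 by simp
  qed
  ultimately show ?thesis by blast
qed

definition rho :: "'l alg_closure \<Rightarrow> 'l alg_closure" where
  "rho u = (THE z. z ^ p = u \<and> eabs (z - 1) < 1)"

lemma rho:
  assumes "eabs (u - 1) < 1"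
  shows "rho u ^ p = u" "eabs (rho u - 1) < 1"
  using theI'[OF pth_root_close[OF assms]] by (simp_all add: rho_def)

lemma rho_eq: "z ^ p = u \<Longrightarrow> eabs (z - 1) < 1 \<Longrightarrow> eabs (u - 1) < 1 \<Longrightarrow> rho u = z"
  using pth_root_close[of u] rho[of u] by blast

lemma galois_close:
  assumes "\<sigma> \<in> galois_group"
  shows "eabs (\<sigma> x - \<sigma> y) = eabs (x - y)"
  using eabs_galois[OF assms, of "x - y"] rhom_diff[OF galoisD(1)[OF assms]] by simp

lemma galois_close_1:
  assumes "\<sigma> \<in> galois_group"
  shows "eabs (\<sigma> x - 1) = eabs (x - 1)"
  using galois_close[OF assms, of x 1] rhom_1[OF galoisD(1)[OF assms]] by simp

lemma rho_galois:
  assumes "\<sigma> \<in> galois_group" "eabs (u - 1) < 1"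
  shows "rho (\<sigma> u) = \<sigma> (rho u)"
  using rho[OF assms(2)] galois_close_1[OF assms(1)] assms(2)
  by (intro rho_eq) (simp_all flip: rhom_power[OF galoisD(1)[OF assms(1)]])

text \<open>Hensel's lemma for \<open>X^p - u\<close> over \<open>L\<close>, by descent: the
  distinguished root is unique in the closure and therefore fixed by the Galois group.\<close>

lemma pth_root_one_unit:
  assumes "av (u - 1) < 1"
  obtains z where "z ^ p = u" "av (z - 1) < 1"
proof -
  have u: "eabs (to_ac u - 1) < 1" using assms eabs_to_ac[of "u - 1"] by simp
  have "rho (to_ac u) \<in> range to_ac"
  proof (rule galois_fixed[OF char_0])
    show "\<sigma> (rho (to_ac u)) = rho (to_ac u)" if "\<sigma> \<in> galois_group" for \<sigma>
      using rho_galois[OF that u] galoisD(3)[OF that, of u] by simp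
  qed
  then obtain z where z: "rho (to_ac u) = to_ac z" by blast
  have "to_ac (z ^ p) = to_ac u" "eabs (to_ac (z - 1)) < 1" using rho[OF u] by (simp_all add: z)
  then show ?thesis using that[of z] by (simp only: to_ac_eq_iff eabs_to_ac)
qed

text \<open>Zero together with the roots of unity of order dividing \<open>l^n - 1\<close>: the
  Teichmueller lifts of the field with \<open>l^n\<close> elements, inside the closure.\<close>

definition T :: "nat \<Rightarrow> 'l alg_closure set" where
  "T n = {x. x ^ l ^ n = x}"

lemma ln_gt_1: "n > 0 \<Longrightarrow> l ^ n > 1" using one_less_power[OF l_gt] .

lemma T_unit:
  assumes "x \<in> T n" "n > 0" "x \<noteq> 0"
  shows "x ^ (l ^ n - 1) = 1" "eabs x = 1"
proof -
  have "x * x ^ (l ^ n - 1) = x ^ Suc (l ^ n - 1)" by simp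
  also have "Suc (l ^ n - 1) = l ^ n" using ln_gt_1[OF assms(2)] by simp
  finally show *: "x ^ (l ^ n - 1) = 1" using assms by (simp add: T_def)
  show "eabs x = 1" using ext.av_root_of_unity[OF *] ln_gt_1[OF assms(2)] by simp
qed

lemma T_le: "x \<in> T n \<Longrightarrow> n > 0 \<Longrightarrow> eabs x \<le> 1"
  using T_unit[of x n] by (cases "x = 0") auto

lemma T_I: "x ^ (l ^ n - 1) = 1 \<Longrightarrow> x \<in> T n"
  using power_Suc[of x "l ^ n - 1"] l_gt by (simp add: T_def)

lemma T_mono: "x \<in> T n \<Longrightarrow> x \<in> T (n * m)"
proof (induction m)
  case (Suc m)
  have "x ^ l ^ (n * Suc m) = (x ^ l ^ n) ^ l ^ (n * m)" by (simp add: power_add flip: power_mult)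
  then show ?case using Suc by (simp add: T_def)
qed (simp add: T_def)

text \<open>The quotient of two nonzero elements is a root of unity of order prime to
  \<open>l\<close>, so \<open>root_of_unity_close\<close> applies; a nonzero element is a unit and
  hence not close to 0.\<close>

lemma T_discrete:
  assumes "x \<in> T n" "y \<in> T m" "n > 0" "m > 0" "eabs (x - y) < 1"
  shows "x = y"
proof -
  let ?k = "n * m"
  have x: "x \<in> T ?k" and y: "y \<in> T ?k" and k: "?k > 0"
    using T_mono[OF assms(1), of m] T_mono[OF assms(2), of n] assms by (auto simp: mult.commute)
  show ?thesis
  proof (cases "x = 0 \<or> y = 0")
    case True
    have "eabs x < 1" if "y = 0" using assms(5) that by simp
    moreover have "eabs y < 1" if "x = 0" using assms(5) that by simp
    ultimately show ?thesis using True T_unit(2)[OF x k] T_unit(2)[OF y k] by (metis less_irrefl)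
  next
    case False
    have "x / y - 1 = (x - y) / y" using False by (simp add: field_simps)
    then have "eabs (x / y - 1) < 1"
      using assms(5) T_unit(2)[OF y k] False by (simp add: ext.av_divide)
    have "\<not> l dvd l ^ ?k - 1"
    proof
      assume "l dvd l ^ ?k - 1"
      moreover have "l dvd l ^ ?k" using k by (simp add: dvd_power)
      ultimately have "l dvd 1"
        using ln_gt_1[OF k] dvd_diff_nat[of l "l ^ ?k" "l ^ ?k - 1"] by simp
      then show False using l_gt by simp
    qed
    then have "av (of_nat (l ^ ?k - 1)) = 1" by (rule av_of_nat_coprime)
    then have N: "eabs (of_nat (l ^ ?k - 1)) = 1" by (simp only: eabs_of_nat)
    have "x ^ (l ^ ?k - 1) = 1" "y ^ (l ^ ?k - 1) = 1"
      using T_unit(1)[OF x k] T_unit(1)[OF y k] False by blast+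
    then have "(x / y) ^ (l ^ ?k - 1) = 1" by (simp only: power_divide) simp
    then have "x / y = 1"
      using \<open>eabs (x / y - 1) < 1\<close> N by (rule ext.root_of_unity_close)
    then show ?thesis using False by simp
  qed
qed

lemma T_poly:
  assumes "n > 0"
  shows "(\<Prod>t\<in>T n. x - t) = x ^ l ^ n - x" "card (T n) = l ^ n"
proof -
  let ?f = "monom 1 (l ^ n) - [:0, 1:] :: 'l alg_closure poly"
  have q: "l ^ n > 1" by (rule ln_gt_1[OF assms])
  have deg: "degree ?f = l ^ n"
  proof -
    have "?f = monom 1 (l ^ n) + [:0, - 1:]"
      by (simp only: diff_conv_add_uminus minus_pCons minus_zero)
    then show ?thesis
      using q assms by (simp only:) (subst degree_add_eq_left; simp add: degree_monom_eq)
  qed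
  have c: "coeff ?f (l ^ n) = 1" using q assms by (auto simp: coeff_pCons split: nat.split)
  have roots: "{x. poly ?f x = 0} = T n" by (auto simp: T_def poly_monom)
  have "poly (pderiv ?f) t \<noteq> 0" if "poly ?f t = 0" for t
  proof (cases "t = 0")
    case True
    then show ?thesis
      using q by (simp add: pderiv_diff pderiv_monom poly_monom pderiv_pCons power_0_left)
  next
    case False
    have 1: "t ^ (l ^ n - 1) = 1" using that False roots assms T_unit by blast
    have "of_nat (l ^ n) - 1 = (of_nat (l ^ n - 1) :: 'l alg_closure)"
      using q by (simp add: of_nat_diff)
    moreover have "of_nat (l ^ n - 1) \<noteq> (0 :: 'l alg_closure)"
      unfolding of_nat_eq_0 using q by simp
    ultimately have "of_nat (l ^ n) - 1 \<noteq> (0 :: 'l alg_closure)"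
      by (simp only: not_False_eq_True)
    then show ?thesis
      using 1 by (simp add: pderiv_diff pderiv_monom poly_monom pderiv_pCons del: of_nat_power)
  qed
  note sp = separable_split[of ?f, unfolded deg, OF c this, unfolded roots]
  show "card (T n) = l ^ n" using sp(2) by simp
  show "(\<Prod>t\<in>T n. x - t) = x ^ l ^ n - x"
    using arg_cong[OF sp(1), of "\<lambda>f. poly f x"] by (simp add: poly_prod poly_monom)
qed

lemma finite_T: "n > 0 \<Longrightarrow> finite (T n)"
  using T_poly(2)[of n] ln_gt_1[of n] by (intro card_ge_0_finite) linarith

text \<open>The product of the distances from \<open>x\<close> to \<open>T n\<close> is
  \<open>|x^(l^n) - x|\<close>; if it is below 1, some factor is.\<close>

lemma T_lift:
  assumes "n > 0" "eabs (x ^ l ^ n - x) < 1"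
  obtains t where "t \<in> T n" "eabs (x - t) < 1"
proof -
  have "(\<Prod>t\<in>T n. eabs (x - t)) < 1"
    using assms T_poly(1)[of n x] by (simp flip: ext.av_prod)
  then show ?thesis
    using prod_ge_1[of "T n" "\<lambda>t. eabs (x - t)"] that by (force simp: not_less)
qed

text \<open>The residue of \<open>c\<close> is algebraic over the residue field of \<open>L\<close>,
  which the \<open>q\<close>-th power fixes. So that power maps conjugates of \<open>c\<close> near
  conjugates, and a finite orbit forces periodicity. This makes every residue class contain a
  Teichmueller representative.\<close>

lemma integral_frobenius_period:
  assumes c: "eabs c \<le> 1"
  obtains n where "n > 0" "eabs (c ^ l ^ n - c) < 1"
proof -
  obtain k where k: "k > 0" "q = l ^ k" using q by blast
  let ?O = "galois_orbit c"
  obtain f where f: "map_poly to_ac f = (\<Prod>y\<in>?O. [:- y, 1:])"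
    using orbit_poly_rational[OF char_0] by metis
  have O: "eabs y = eabs c" if "y \<in> ?O" for y
    using that eabs_galois unfolding orbit_image by auto
  have co: "av (coeff f i) \<le> 1" for i
  proof -
    have "eabs (coeff (map_poly to_ac f) i) \<le> 1"
      unfolding f using O c by (intro ext.integral_poly_prod) auto
    then show ?thesis by (simp add: coeff_map_poly)
  qed
  have el: "eabs (of_nat l) < 1" using av_l by (simp add: eabs_of_nat)
  \<comment> \<open>With \<open>f\<close> the orbit polynomial, \<open>f(y)^q\<close> is congruent
    to \<open>f(y^q)\<close>, because \<open>q\<close> is a Frobenius power fixing the residues of
    the coefficients; so \<open>f(y^q)\<close> is small.\<close>
  have next_conj: "\<exists>z\<in>?O. eabs (y ^ q - z) < 1" if y: "y \<in> ?O" for y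
  proof -
    let ?d = "degree f" and ?a = "\<lambda>i. to_ac (coeff f i)"
    have ev: "poly (map_poly to_ac f) x = (\<Sum>i\<le>?d. ?a i * x ^ i)" for x
      by (simp add: poly_altdef degree_map_poly_rhom[OF rhom_to_ac] coeff_map_poly)
    have "(\<Sum>i\<le>?d. ?a i * y ^ i) = 0"
      unfolding ev[symmetric] f using y by (auto simp: poly_prod finite_orbit)
    moreover have "eabs ((\<Sum>i\<le>?d. ?a i * y ^ i) ^ q - (\<Sum>i\<le>?d. (?a i * y ^ i) ^ q)) < 1"
      unfolding k(2)
      by (rule ext.frob_sum[OF l(1) el]) (use co O[OF y] c in \<open>simp add: eabs_mult ext.av_power mult_le_one power_le_one\<close>)
    moreover have "q > 0" using k l_gt by simp
    ultimately have 1: "eabs (\<Sum>i\<le>?d. (?a i * y ^ i) ^ q) < 1" by (simp add: power_0_left)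
    have "eabs ((?a i * y ^ i) ^ q - ?a i * (y ^ q) ^ i) < 1" for i
    proof -
      have "(?a i * y ^ i) ^ q - ?a i * (y ^ q) ^ i = to_ac (coeff f i ^ q - coeff f i) * (y ^ q) ^ i"
        by (simp add: power_mult_distrib algebra_simps flip: power_mult)
      moreover have "eabs ((y ^ q) ^ i) \<le> 1"
        using O[OF y] c by (simp add: ext.av_power power_le_one)
      ultimately show ?thesis
        using residue_power[OF co[of i]] mult_left_le[of "eabs ((y ^ q) ^ i)" "av (coeff f i ^ q - coeff f i)"]
        by (simp add: eabs_mult del: to_ac_diff)
    qed
    then have "eabs ((\<Sum>i\<le>?d. (?a i * y ^ i) ^ q) - (\<Sum>i\<le>?d. ?a i * (y ^ q) ^ i)) < 1"
      unfolding sum_subtractf[symmetric] by (intro ext.av_sum_less) auto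
    from ext.av_diff_less[OF 1 this] have "eabs (poly (map_poly to_ac f) (y ^ q)) < 1"
      by (simp add: ev)
    then have "(\<Prod>z\<in>?O. eabs (y ^ q - z)) < 1"
      by (simp add: f poly_prod flip: ext.av_prod)
    then show ?thesis
      using prod_ge_1[of ?O "\<lambda>z. eabs (y ^ q - z)"] by (force simp: not_less)
  qed
  have iter: "\<exists>z\<in>?O. eabs (c ^ q ^ i - z) < 1" for i
  proof (induction i)
    case 0
    then show ?case using orbit_self[of c] by (intro bexI[of _ c]) auto
  next
    case (Suc i)
    then obtain y where y: "y \<in> ?O" "eabs (c ^ q ^ i - y) < 1" by blast
    obtain z where z: "z \<in> ?O" "eabs (y ^ q - z) < 1" using next_conj[OF y(1)] by blast
    have "eabs ((c ^ q ^ i) ^ q - y ^ q) < 1"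
      using y O[OF y(1)] c by (intro ext.av_power_diff) (auto simp: ext.av_power power_le_one)
    from ext.av_diff_trans_less[OF this z(2)] show ?case
      using z(1) by (intro bexI[of _ z]) (simp_all add: mult.commute flip: power_mult)
  qed
  then obtain g where g: "\<And>i. g i \<in> ?O" "\<And>i. eabs (c ^ q ^ i - g i) < 1" by metis
  \<comment> \<open>Pigeonhole gives \<open>c^(q^i)\<close> congruent to \<open>c^(q^j)\<close>;
    injectivity of Frobenius on residues then cancels the common \<open>q^i\<close>.\<close>
  have "\<not> inj g"
    using g(1) finite_orbit by (metis finite_imageD finite_subset image_subsetI infinite_UNIV_nat)
  then obtain i j where ij: "i < j" "g i = g j" by (metis injI linorder_neqE_nat)
  have "eabs (c ^ q ^ j - c ^ q ^ i) < 1"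
    using ext.av_diff_trans_less[OF g(2)[of j]] g(2)[of i] ij by (simp add: ext.av_minus_commute)
  moreover have "q ^ j = q ^ (j - i) * q ^ i" using ij by (simp flip: power_add)
  ultimately have "eabs ((c ^ q ^ (j - i)) ^ q ^ i - c ^ q ^ i) < 1" by (simp add: power_mult)
  moreover have "q ^ i = l ^ (k * i)" by (simp add: k(2) power_mult)
  ultimately have "eabs ((c ^ q ^ (j - i)) ^ l ^ (k * i) - c ^ l ^ (k * i)) < 1" by (simp only:)
  moreover have "eabs (c ^ q ^ (j - i)) \<le> 1" using c by (simp add: ext.av_power power_le_one)
  ultimately have "eabs (c ^ q ^ (j - i) - c) < 1" using c ext.frob_inj[OF l(1) el] by blast
  then show ?thesis using that[of "k * (j - i)"] ij k by (simp add: power_mult)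
qed

definition teich :: "'l alg_closure \<Rightarrow> 'l alg_closure" where
  "teich c = (THE t. (\<exists>n>0. t \<in> T n) \<and> eabs (c - t) < 1)"

lemma teich_ex1:
  assumes "eabs c \<le> 1"
  shows "\<exists>!t. (\<exists>n>0. t \<in> T n) \<and> eabs (c - t) < 1"
proof -
  obtain n where "n > 0" "eabs (c ^ l ^ n - c) < 1" using integral_frobenius_period[OF assms] .
  then obtain t where "n > 0" "t \<in> T n" "eabs (c - t) < 1" using T_lift by metis
  moreover have "t = t'" if "n > 0" "t \<in> T n" "eabs (c - t) < 1" "m > 0" "t' \<in> T m" "eabs (c - t') < 1"
    for n m t t'
    using that T_discrete[of t n t' m] ext.av_diff_trans_less[of t c 1 t'] by (simp add: ext.av_minus_commute)
  ultimately show ?thesis by blast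
qed

lemma teich:
  assumes "eabs c \<le> 1"
  shows "\<exists>n>0. teich c \<in> T n" "eabs (c - teich c) < 1"
  using theI'[OF teich_ex1[OF assms]] by (simp_all add: teich_def)

lemma teich_eq: "eabs c \<le> 1 \<Longrightarrow> t \<in> T n \<Longrightarrow> n > 0 \<Longrightarrow> eabs (c - t) < 1 \<Longrightarrow> teich c = t"
  unfolding teich_def by (rule the1_equality[OF teich_ex1]) auto

lemma T_galois: "\<sigma> \<in> galois_group \<Longrightarrow> t \<in> T n \<Longrightarrow> \<sigma> t \<in> T n"
  by (auto simp: T_def simp flip: rhom_power[OF galoisD(1)])

lemma teich_galois:
  assumes "\<sigma> \<in> galois_group" "eabs c \<le> 1"
  shows "teich (\<sigma> c) = \<sigma> (teich c)"
proof -
  obtain n where "n > 0" "teich c \<in> T n" using teich(1)[OF assms(2)] by blast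
  then show ?thesis using teich(2)[OF assms(2)] assms T_galois[OF assms(1)]
    by (intro teich_eq[of _ _ n]) (auto simp: eabs_galois galois_close)
qed

end

section \<open>Primes dividing the parameter of the curve\<close>

lemma bezout_coprime:
  assumes "coprime (p :: nat) k"
  obtains s t where "int p * s + int k * t = 1"
proof -
  obtain u v where "u * int p + v * int k = gcd (int p) (int k)" using bezout_int by blast
  moreover have "gcd (int p) (int k) = 1"
    using assms by (metis coprime_imp_gcd_eq_1 gcd_int_int_eq of_nat_1)
  ultimately show ?thesis using that[of u v] by (simp only: mult.commute)
qed

lemma coprime_prime_less: "prime (p :: nat) \<Longrightarrow> 0 < k \<Longrightarrow> k < p \<Longrightarrow> coprime p k"
  by (intro prime_imp_coprime) (auto dest: nat_dvd_not_less)

locale descent = unramified av p l q w for av :: "'l::field \<Rightarrow> real" and p l q w +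
  fixes r :: nat and \<delta> :: int
  assumes r: "1 \<le> r" "r \<le> p - 2" and \<delta>: "\<delta> \<noteq> 0" "\<forall>q::int. q ^ p dvd \<delta> \<longrightarrow> q dvd 1"
begin

abbreviation "d \<equiv> (of_int \<delta> :: 'l)"
abbreviation "D \<equiv> (of_int \<delta> :: 'l alg_closure)"

lemma p_gt_2: "p > 2"
  using p p_gt by (metis dvd_refl le_neq_implies_less less_eq_Suc_le numeral_2_eq_2 One_nat_def)

lemma of_int_eq_0 [simp]: "of_int n = (0 :: 'l) \<longleftrightarrow> n = 0" "of_int n = (0 :: 'l alg_closure) \<longleftrightarrow> n = 0"
proof -
  have *: "of_int n = (0 :: 'l) \<longleftrightarrow> n = 0" by (cases n rule: int_cases2) auto
  then show "of_int n = (0 :: 'l) \<longleftrightarrow> n = 0" "of_int n = (0 :: 'l alg_closure) \<longleftrightarrow> n = 0"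
    by (simp, metis to_ac_eq_0_iff to_ac_of_int)
qed

lemma eabs_of_int: "eabs (of_int n) = av (of_int n)" by (metis eabs_to_ac to_ac_of_int)

lemma coprime_r: "coprime p r" "coprime p (r + 1)"
  using r p_gt_2 by (auto intro!: coprime_prime_less p(1))

lemma exponents:
  obtains s0 t0 s1 t1 where "int p * s0 + int r * t0 = 1" "int p * s1 + int (r + 1) * t1 = 1"
  using bezout_coprime[OF coprime_r(1)] bezout_coprime[OF coprime_r(2)] by metis

lemma curve_divisorD:
  assumes "curve_divisor p r d m"
  shows "finite {s. m s \<noteq> 0}" "galois_invariant m" "(\<Sum>s | m s \<noteq> 0. m s) = 0"
    "m (a, b) \<noteq> 0 \<Longrightarrow> a \<noteq> 0" "m (a, b) \<noteq> 0 \<Longrightarrow> b ^ p = a ^ r * (D - a)"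
  using assms by (auto simp: curve_divisor_def)

lemma galois_D: "\<sigma> \<in> galois_group \<Longrightarrow> \<sigma> D = D"
  using galoisD(3)[of \<sigma> d] by simp

text \<open>Being free of \<open>p\<close>-th powers bounds the exponent of \<open>l\<close> in
  \<open>\<delta>\<close> by \<open>p - 1\<close>. It is therefore prime to \<open>p\<close>, which
  drives the divisibility argument in the ramified case.\<close>

lemma av_d:
  assumes "int l dvd \<delta>"
  obtains v where "av d = av (of_nat l) ^ v" "0 < v" "v < p"
proof -
  have pl: "prime (int l)" using l by simp
  obtain y where y: "\<delta> = int l ^ multiplicity (int l) \<delta> * y" "\<not> int l dvd y"
    using multiplicity_decompose'[of \<delta> "int l"] \<delta>(1) pl by (metis not_prime_unit)
  let ?v = "multiplicity (int l) \<delta>"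
  have "?v > 0" using assms y by (cases "?v = 0") auto
  moreover have "?v < p"
  proof (rule ccontr)
    assume "\<not> ?v < p"
    then have "int l ^ p dvd \<delta>" using y(1) by (metis dvd_mult2 le_imp_power_dvd not_less)
    then show False using \<delta>(2) pl not_prime_unit by blast
  qed
  moreover have "av d = av (of_nat l) ^ ?v"
  proof -
    have "d = of_nat l ^ ?v * of_int y" by (subst y(1)) simp
    then show ?thesis using av_of_int_coprime[OF l(1) av_l y(2)] by (simp add: av_mult av_power)
  qed
  ultimately show ?thesis using that by blast
qed

lemma odd_minus_power: "(- x) ^ p = - (x ^ p :: 'b::comm_ring_1)" using p(2) by simp

text \<open>The residue classes \<open>\<zeta>\<close> of the coordinate \<open>a / \<delta>\<close> are permuted by the Galois group. The product of
  the \<open>b\<close>-coordinates over one class lies in the unramified extension \<open>L(\<zeta>)\<close>, so its value is a power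
  of that of \<open>l\<close>; as \<open>|b|\<^sup>p = |\<delta>|\<^sup>r\<^sup>+\<^sup>1\<close>, the number of points in the class is divisible by \<open>p\<close>.\<close>

lemma ramified_unit_part:
  assumes ram: "int l dvd \<delta>" and fin: "finite {s. m s \<noteq> 0}" and inv: "galois_invariant m"
    and a: "\<And>a b. m (a, b) \<noteq> 0 \<Longrightarrow> eabs a = eabs D"
    and b: "\<And>a b. m (a, b) \<noteq> 0 \<Longrightarrow> eabs b ^ p = eabs D ^ (r + 1)"
  obtains z where "z \<in> range to_ac" "(\<Prod>s | m s \<noteq> 0. teich (fst s / D) powi m s) = z ^ p"
proof -
  let ?S = "{s. m s \<noteq> 0}"
  define \<zeta> where "\<zeta> s = teich (fst s / D)" for s :: "'l alg_closure \<times> 'l alg_closure"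
  have D0: "D \<noteq> 0" using \<delta> by simp
  have quot: "eabs (fst s / D) = 1" if "s \<in> ?S" for s
    using a[of "fst s" "snd s"] that D0 by (simp add: ext.av_divide)
  have \<zeta>T: "\<exists>n>0. \<zeta> s \<in> T n" if "s \<in> ?S" for s
    unfolding \<zeta>_def by (rule teich(1)) (use quot[OF that] in simp)
  have \<zeta>0: "\<zeta> s \<noteq> 0" if "s \<in> ?S" for s
    using teich(2)[of "fst s / D"] quot[OF that] by (auto simp: \<zeta>_def)
  have \<zeta>\<sigma>: "\<zeta> ((\<lambda>(a, b). (\<sigma> a, \<sigma> b)) s) = \<sigma> (\<zeta> s)" if "\<sigma> \<in> galois_group" "s \<in> ?S" for \<sigma> s
    using teich_galois[OF that(1), of "fst s / D"] quot[OF that(2)] galois_D[OF that(1)]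
    by (simp add: \<zeta>_def split_beta rhom_divide[OF galoisD(1)[OF that(1)]])
  \<comment> \<open>For a residue class labelled by its representative \<open>x\<close>,
    \<open>n x\<close> is the total multiplicity and \<open>P x\<close> the product of the second
    coordinates; both vary equivariantly with \<open>x\<close>.\<close>
  define n where "n x = (\<Sum>s\<in>?S. if \<zeta> s = x then m s else 0)" for x
  define P where "P x = (\<Prod>s\<in>?S. if \<zeta> s = x then snd s powi m s else 1)" for x
  have \<zeta>_iff: "\<zeta> ((\<lambda>(a, b). (\<sigma> a, \<sigma> b)) s) = \<sigma> x \<longleftrightarrow> \<zeta> s = x" if "\<sigma> \<in> galois_group" "s \<in> ?S" for \<sigma> s x
    unfolding \<zeta>\<sigma>[OF that] using rhom_inj[OF galoisD(1)[OF that(1)]] by blast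
  have minv: "m ((\<lambda>(a, b). (\<sigma> a, \<sigma> b)) s) = m s" if "\<sigma> \<in> galois_group" for \<sigma> s
    using inv that by (auto simp: galois_invariant_def split_beta)
  have n\<sigma>: "n (\<sigma> x) = n x" if \<sigma>: "\<sigma> \<in> galois_group" for \<sigma> x
  proof -
    have "n (\<sigma> x) = (\<Sum>s\<in>?S. (\<lambda>s. if \<zeta> s = \<sigma> x then m s else 0) ((\<lambda>(a, b). (\<sigma> a, \<sigma> b)) s))"
      unfolding n_def by (rule sum.reindex_bij_betw[OF galois_pair_bij[OF \<sigma> inv], symmetric])
    also have "\<dots> = n x"
      unfolding n_def by (intro sum.cong refl) (simp only: \<zeta>_iff[OF \<sigma>] minv[OF \<sigma>])
    finally show ?thesis .
  qed
  have P\<sigma>: "P (\<sigma> x) = \<sigma> (P x)" if \<sigma>: "\<sigma> \<in> galois_group" for \<sigma> x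
  proof -
    have "P (\<sigma> x) = (\<Prod>s\<in>?S. (\<lambda>s. if \<zeta> s = \<sigma> x then snd s powi m s else 1) ((\<lambda>(a, b). (\<sigma> a, \<sigma> b)) s))"
      unfolding P_def by (rule prod.reindex_bij_betw[OF galois_pair_bij[OF \<sigma> inv], symmetric])
    also have "\<dots> = (\<Prod>s\<in>?S. \<sigma> (if \<zeta> s = x then snd s powi m s else 1))"
    proof (intro prod.cong refl)
      fix s assume "s \<in> ?S"
      then show "(\<lambda>s. if \<zeta> s = \<sigma> x then snd s powi m s else 1) ((\<lambda>(a, b). (\<sigma> a, \<sigma> b)) s) =
          \<sigma> (if \<zeta> s = x then snd s powi m s else 1)"
        by (simp only: \<zeta>_iff[OF \<sigma>] minv[OF \<sigma>])
          (simp add: rhom_powi[OF galoisD(1)[OF \<sigma>]] rhom_1[OF galoisD(1)[OF \<sigma>]] split_beta)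
    qed
    also have "\<dots> = \<sigma> (P x)"
      unfolding P_def by (rule rhom_prod[OF galoisD(1)[OF \<sigma>], symmetric])
    finally show ?thesis .
  qed
  have Pabs: "eabs (P x) ^ p = eabs D powi (int (r + 1) * n x)" for x
  proof -
    have "eabs (if \<zeta> s = x then snd s powi m s else 1) ^ p =
        eabs D powi (int (r + 1) * (if \<zeta> s = x then m s else 0))" if "s \<in> ?S" for s
    proof (cases "\<zeta> s = x")
      case True
      have "eabs (snd s powi m s) ^ p = (eabs (snd s) ^ p) powi m s"
        by (simp add: ext.av_powi power_int_power power_int_power' mult.commute)
      also have "eabs (snd s) ^ p = eabs D ^ (r + 1)" using b[of "fst s" "snd s"] that by simp
      also have "(eabs D ^ (r + 1)) powi m s = eabs D powi (int (r + 1) * m s)"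
        by (simp only: power_int_power)
      finally show ?thesis using True by simp
    qed simp
    then have "eabs (P x) ^ p = (\<Prod>s\<in>?S. eabs D powi (int (r + 1) * (if \<zeta> s = x then m s else 0)))"
      unfolding P_def ext.av_prod prod_power_distrib by (intro prod.cong refl) blast
    also have "\<dots> = eabs D powi (\<Sum>s\<in>?S. int (r + 1) * (if \<zeta> s = x then m s else 0))"
      using D0 by (intro prod_power_int_sum) simp
    finally show ?thesis by (simp only: n_def sum_distrib_left)
  qed
  obtain v where v: "av d = av (of_nat l) ^ v" "0 < v" "v < p" using av_d[OF ram] .
  have l0: "0 < av (of_nat l)" using l_gt by simp
  have pn: "int p dvd n x" if x: "x \<in> \<zeta> ` ?S" for x
  proof -
    let ?O = "galois_orbit x"
    \<comment> \<open>\<open>P x\<close> is fixed only by automorphisms fixing \<open>x\<close>. Its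
      traces against powers of \<open>x\<close> lie in \<open>L\<close>, where absolute values are
      integral powers of that of \<open>l\<close>.\<close>
    define Y where "Y i = (\<Sum>y\<in>?O. P y * y ^ i)" for i
    have Yrat: "Y i \<in> range to_ac" for i
    proof (rule galois_fixed[OF char_0])
      fix \<sigma> :: "'l alg_closure \<Rightarrow> 'l alg_closure" assume \<sigma>: "\<sigma> \<in> galois_group"
      have "\<sigma> (Y i) = (\<Sum>y\<in>?O. P (\<sigma> y) * \<sigma> y ^ i)"
        by (simp add: Y_def rhom_sum[OF galoisD(1)[OF \<sigma>]] rhom_simps[OF galoisD(1)[OF \<sigma>]] P\<sigma>[OF \<sigma>])
      also have "\<dots> = Y i"
        unfolding Y_def using bij_betw_galois[OF \<sigma> finite_orbit orbit_closed[OF \<sigma>]]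
        by (rule sum.reindex_bij_betw)
      finally show "\<sigma> (Y i) = Y i" .
    qed
    have O: "\<exists>\<sigma>\<in>galois_group. y = \<sigma> x" if "y \<in> ?O" for y
      using that unfolding orbit_image by blast
    have PO: "eabs (P y) = eabs (P x)" if "y \<in> ?O" for y
      using O[OF that] P\<sigma> eabs_galois by metis
    obtain k where k: "k > 0" "x \<in> T k" using x \<zeta>T by blast
    have x0: "x \<noteq> 0" using x \<zeta>0 by auto
    have OT: "y \<in> T k" if "y \<in> ?O" for y using O[OF that] T_galois k by blast
    have Ole: "eabs y \<le> 1" if "y \<in> ?O" for y using T_le[OF OT[OF that] k(1)] .
    \<comment> \<open>Lagrange interpolation: \<open>g\<close> kills the other conjugates, so the
      combination of traces with the coefficients of \<open>g\<close> is \<open>P x * g(x)\<close>.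
      Distinct representatives are incongruent, so \<open>g(x)\<close> is a unit and some trace is
      as large as \<open>P x\<close>.\<close>
    define g where "g = (\<Prod>y\<in>?O - {x}. [:- y, 1:])"
    have gco: "eabs (coeff g i) \<le> 1" for i
      unfolding g_def using Ole by (intro ext.integral_poly_prod) auto
    have gx: "eabs (poly g x) = 1"
    proof -
      have "eabs (x - y) = 1" if y: "y \<in> ?O - {x}" for y
        using T_discrete[OF k(2) OT[of y] k(1) k(1)] y ext.av_diff_le[OF Ole[OF orbit_self] Ole[of y]]
        by (force simp: less_le)
      then show ?thesis by (simp add: g_def poly_prod ext.av_prod)
    qed
    have gy: "poly g y = 0" if "y \<in> ?O - {x}" for y
      unfolding g_def poly_prod using that finite_orbit[of x] by (intro prod_zero bexI[of _ y]) auto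
    have P0: "P x \<noteq> 0"
    proof -
      have "snd s \<noteq> 0" if "s \<in> ?S" for s
      proof
        have "eabs (snd s) ^ p = eabs D ^ (r + 1)" using b[of "fst s" "snd s"] that by simp
        moreover assume "snd s = 0"
        ultimately have "eabs D ^ (r + 1) = 0" using p_gt by (simp add: zero_power)
        then show False using D0 by simp
      qed
      then show ?thesis
        unfolding P_def prod_zero_iff[OF fin] by (force split: if_splits)
    qed
    have "(\<Sum>i\<le>degree g. coeff g i * Y i) = (\<Sum>y\<in>?O. P y * poly g y)"
      unfolding Y_def poly_altdef sum_distrib_left by (subst sum.swap) (simp add: ac_simps)
    also have "\<dots> = P x * poly g x"
      using gy finite_orbit orbit_self by (subst sum.remove[of _ x]) auto
    finally have Lag: "eabs (\<Sum>i\<le>degree g. coeff g i * Y i) = eabs (P x)"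
      by (simp add: eabs_mult gx)
    have "\<exists>i. eabs (Y i) \<ge> eabs (P x)"
    proof (rule ccontr)
      assume "\<not> ?thesis"
      then have "eabs (Y i) < eabs (P x)" for i by (simp add: not_le)
      moreover have "eabs (coeff g i * Y i) \<le> eabs (Y i)" for i
        unfolding eabs_mult using gco[of i] by (intro mult_left_le_one_le) auto
      ultimately have "eabs (coeff g i * Y i) < eabs (P x)" for i
        using order_le_less_trans by blast
      then have "eabs (\<Sum>i\<le>degree g. coeff g i * Y i) < eabs (P x)"
        using P0 by (intro ext.av_sum_less) auto
      then show False using Lag by simp
    qed
    then obtain i where i: "eabs (Y i) \<ge> eabs (P x)" by blast
    have "eabs (Y i) \<le> eabs (P x)"
      unfolding Y_def
      by (intro ext.av_sum_le) (auto simp: eabs_mult ext.av_power PO Ole mult_left_le power_le_one)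
    then have Yi: "eabs (Y i) = eabs (P x)" using i by simp
    obtain u where u: "Y i = to_ac u" using Yrat by blast
    then have "u \<noteq> 0" using Yi P0 by auto
    then obtain j where "av u = av (of_nat l) powi j" using value_group by blast
    \<comment> \<open>Comparing exponents of \<open>|l|\<close> gives
      \<open>p j = v (r + 1) n(x)\<close>, and \<open>p\<close> is prime to both \<open>v\<close>
      and \<open>r + 1\<close>.\<close>
    then have "(av (of_nat l) powi j) ^ p = (av (of_nat l) ^ v) powi (int (r + 1) * n x)"
      using Pabs[of x] Yi u v by (simp add: eabs_of_int)
    then have "av (of_nat l) powi (int p * j) = av (of_nat l) powi (int v * (int (r + 1) * n x))"
      by (simp only: power_int_power power_int_power' mult.commute[of j])
    then have "int p * j = int v * (int (r + 1) * n x)"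
      using power_int_less_1_inj[OF l0 av_l] by blast
    then have "int p dvd int v * (int (r + 1) * n x)" by (metis dvd_triv_left)
    moreover have "coprime (int p) (int v)" "coprime (int p) (int (r + 1))"
      using coprime_prime_less[OF p(1) v(2,3)] coprime_r(2) by (simp_all del: of_nat_Suc of_nat_add)
    ultimately show ?thesis by (metis coprime_dvd_mult_right_iff)
  qed
  define z where "z = (\<Prod>x\<in>\<zeta> ` ?S. x powi (n x div int p))"
  have "z \<in> range to_ac"
  proof (rule galois_fixed[OF char_0])
    fix \<sigma> :: "'l alg_closure \<Rightarrow> 'l alg_closure" assume \<sigma>: "\<sigma> \<in> galois_group"
    have bij: "bij_betw \<sigma> (\<zeta> ` ?S) (\<zeta> ` ?S)"
    proof (rule bij_betw_galois[OF \<sigma>])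
      fix x assume "x \<in> \<zeta> ` ?S"
      then obtain s where s: "s \<in> ?S" "x = \<zeta> s" by blast
      have "(\<lambda>(a, b). (\<sigma> a, \<sigma> b)) s \<in> ?S"
        using s(1) minv[OF \<sigma>, of s] by simp
      then show "\<sigma> x \<in> \<zeta> ` ?S"
        using \<zeta>\<sigma>[OF \<sigma> s(1)] s(2) by (metis imageI)
    qed (use fin in simp)
    have "\<sigma> z = (\<Prod>x\<in>\<zeta> ` ?S. \<sigma> x powi (n (\<sigma> x) div int p))"
      by (simp add: z_def rhom_prod[OF galoisD(1)[OF \<sigma>]] rhom_powi[OF galoisD(1)[OF \<sigma>]] n\<sigma>[OF \<sigma>])
    also have "\<dots> = z"
      unfolding z_def by (rule prod.reindex_bij_betw[OF bij])
    finally show "\<sigma> z = z" .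
  qed
  moreover have "(\<Prod>s\<in>?S. \<zeta> s powi m s) = z ^ p"
  proof -
    have "(\<Prod>s\<in>?S. \<zeta> s powi m s) = (\<Prod>x\<in>\<zeta> ` ?S. \<Prod>s | s \<in> ?S \<and> \<zeta> s = x. \<zeta> s powi m s)"
      by (rule prod.image_gen[OF fin])
    also have "\<dots> = (\<Prod>x\<in>\<zeta> ` ?S. (x powi (n x div int p)) ^ p)"
    proof (intro prod.cong refl)
      fix x assume x: "x \<in> \<zeta> ` ?S"
      then have x0: "x \<noteq> 0" using \<zeta>0 by auto
      have "(\<Prod>s | s \<in> ?S \<and> \<zeta> s = x. \<zeta> s powi m s) = (\<Prod>s | s \<in> ?S \<and> \<zeta> s = x. x powi m s)"
        by (intro prod.cong) auto
      also have "\<dots> = x powi (\<Sum>s | s \<in> ?S \<and> \<zeta> s = x. m s)"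
        by (rule prod_power_int_sum[OF x0])
      also have "(\<Sum>s | s \<in> ?S \<and> \<zeta> s = x. m s) = n x"
        unfolding n_def by (rule sum.inter_filter[OF fin])
      also have "x powi n x = (x powi (n x div int p)) ^ p"
        using pn[OF x] by (simp add: power_int_power')
      finally show "(\<Prod>s | s \<in> ?S \<and> \<zeta> s = x. \<zeta> s powi m s) = (x powi (n x div int p)) ^ p" .
    qed
    finally show ?thesis by (simp add: z_def prod_power_distrib)
  qed
  ultimately show ?thesis using that unfolding \<zeta>_def by blast
qed

text \<open>Every first coordinate is the \<open>p\<close>-th power of an equivariant
  \<open>\<phi>\<close> times a power of \<open>D\<close>, times \<open>teich (a / D)\<close> in the
  region \<open>U\<close>. The product of the \<open>\<phi>\<close> descends to \<open>L\<close>,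
  and the Teichmueller factors are absorbed by \<open>ramified_unit_part\<close>.\<close>

lemma ramified_upper:
  assumes ram: "int l dvd \<delta>" and u: "u \<in> divisor_values p r d"
  obtains k z where "z \<noteq> 0" "u = d powi k * z ^ p"
proof -
  obtain m where m: "curve_divisor p r d m" and um: "to_ac u = divisor_value m"
    using u by (auto simp: divisor_values_def)
  let ?S = "{s. m s \<noteq> 0}"
  note md = curve_divisorD[OF m]
  obtain s0 t0 s1 t1 where st: "int p * s0 + int r * t0 = 1" "int p * s1 + int (r + 1) * t1 = 1"
    using exponents .
  have D0: "D \<noteq> 0" using \<delta> by simp
  define A where "A a \<longleftrightarrow> eabs a < eabs D" for a
  define B where "B a \<longleftrightarrow> eabs a > eabs D" for a
  define C where "C a \<longleftrightarrow> eabs (a / D - 1) < 1" for a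
  \<comment> \<open>For \<open>|a| < |D|\<close>, \<open>b^p\<close> is \<open>a^r D\<close> times a
    one-unit; for \<open>|a| > |D|\<close> it is \<open>- a^(r+1)\<close> times a one-unit, the sign
    being absorbed as \<open>p\<close> is odd. Removing the one-unit with \<open>rho\<close>, Bezout
    solves for \<open>a\<close>; in the first case this leaves \<open>D^(- t0)\<close>.\<close>
  define \<phi> where "\<phi> s = (case s of (a, b) \<Rightarrow>
      if A a then a powi s0 * (b / rho (1 - a / D)) powi t0
      else if B a then a powi s1 * (- (b / rho (1 - D / a))) powi t1
      else if C a then rho (a / D) else rho (a / D / teich (a / D)))" for s
  define \<epsilon> where "\<epsilon> s = (if A (fst s) then - t0 else if B (fst s) then 0 else 1)"
    for s :: "'l alg_closure \<times> 'l alg_closure"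
  define U where "U a \<longleftrightarrow> \<not> A a \<and> \<not> B a \<and> \<not> C a" for a
  have ABC_galois: "A (\<sigma> a) = A a" "B (\<sigma> a) = B a" "C (\<sigma> a) = C a" "U (\<sigma> a) = U a"
    if "\<sigma> \<in> galois_group" for \<sigma> a
    using eabs_galois[OF that] galois_close_1[OF that, of "a / D"] galois_D[OF that]
    by (simp_all add: U_def A_def B_def C_def rhom_divide[OF galoisD(1)[OF that]])
  have small: "eabs ((1 - a / D) - 1) < 1" if "A a" for a
    using that D0 by (simp add: A_def ext.av_divide)
  have large: "eabs ((1 - D / a) - 1) < 1" "a \<noteq> 0" if "B a" for a
  proof -
    have "0 < eabs a" using that ext.av_nonneg[of D] unfolding B_def by linarith
    then show "a \<noteq> 0" by simp
    then show "eabs ((1 - D / a) - 1) < 1" using that by (simp add: B_def ext.av_divide)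
  qed
  have same: "eabs (a / D) = 1" if "\<not> A a" "\<not> B a" for a
  proof -
    have "eabs a = eabs D" using that by (simp add: A_def B_def)
    moreover have "eabs D \<noteq> 0" using D0 by simp
    ultimately show ?thesis by (simp only: ext.av_divide) simp
  qed
  have unit: "teich (a / D) \<noteq> 0" "eabs (a / D / teich (a / D) - 1) < 1" if "U a" for a
  proof -
    have 1: "eabs (a / D) = 1" using same that by (simp add: U_def)
    then have 2: "eabs (a / D - teich (a / D)) < 1" using teich(2)[of "a / D"] by simp
    then have 3: "eabs (teich (a / D)) = 1"
      using ext.av_close_eq[of "teich (a / D)" "a / D"] 1 by (simp add: ext.av_minus_commute)
    then show t0: "teich (a / D) \<noteq> 0" by auto
    have "a / D / teich (a / D) - 1 = (a / D - teich (a / D)) / teich (a / D)"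
      using t0 by (simp add: diff_divide_distrib)
    then show "eabs (a / D / teich (a / D) - 1) < 1"
      using 2 3 by (simp add: ext.av_divide[of "_ - _"])
  qed
  have fact: "fst s = \<phi> s ^ p * D powi \<epsilon> s * (if U (fst s) then teich (fst s / D) else 1)" and
    \<phi>0: "\<phi> s \<noteq> 0" if s: "s \<in> ?S" for s
  proof -
    obtain a b where ab: "s = (a, b)" by force
    have a0: "a \<noteq> 0" and b: "b ^ p = a ^ r * (D - a)" using md(4,5)[of a b] s ab by auto
    consider "A a" | "\<not> A a" "B a" | "\<not> A a" "\<not> B a" "C a" | "U a" by (auto simp: U_def)
    then have "a = \<phi> s ^ p * D powi \<epsilon> s * (if U a then teich (a / D) else 1)"
    proof cases
      case 1
      let ?\<rho> = "rho (1 - a / D)"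
      have "a \<noteq> D" using 1 by (auto simp: A_def)
      have "(b / ?\<rho>) ^ p = a ^ r * (D - a) / (1 - a / D)"
        by (simp add: power_divide b rho(1)[OF small[OF 1]])
      also have "\<dots> = a ^ r * D"
        using D0 \<open>a \<noteq> D\<close> by (simp add: field_simps)
      finally have "\<phi> s ^ p = a * D powi t0"
        using power_int_bezout[OF a0 _ st(1), of "b / ?\<rho>" D] 1 by (simp add: \<phi>_def ab)
      then show ?thesis using 1 D0 by (simp add: \<epsilon>_def ab U_def power_int_minus)
    next
      case 2
      let ?\<rho> = "rho (1 - D / a)"
      have "a \<noteq> D" using 2 by (auto simp: B_def)
      have "(- (b / ?\<rho>)) ^ p = - (a ^ r * (D - a) / (1 - D / a))"
        unfolding odd_minus_power by (simp add: power_divide b rho(1)[OF large(1)[OF 2(2)]])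
      also have "\<dots> = a ^ (r + 1) * 1"
        using a0 \<open>a \<noteq> D\<close> by (simp add: field_simps)
      finally have "\<phi> s ^ p = a * 1 powi t1"
        using power_int_bezout[OF a0 _ st(2), of "- (b / ?\<rho>)" 1] 2 by (simp add: \<phi>_def ab)
      then show ?thesis using 2 by (simp add: \<epsilon>_def ab U_def)
    next
      case 3
      then show ?thesis
        using rho(1)[of "a / D"] D0 by (simp add: C_def \<phi>_def \<epsilon>_def ab U_def)
    next
      case 4
      then show ?thesis
        using rho(1)[OF unit(2)[OF 4]] unit(1)[OF 4] D0 by (simp add: \<phi>_def \<epsilon>_def ab U_def)
    qed
    then show "fst s = \<phi> s ^ p * D powi \<epsilon> s * (if U (fst s) then teich (fst s / D) else 1)"
      by (simp only: ab fst_conv)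
    then show "\<phi> s \<noteq> 0" using a0 p_gt by (auto simp: ab zero_power)
  qed
  have "(\<Prod>s | m s \<noteq> 0. \<phi> s powi m s) \<in> range to_ac"
  proof (rule equivariant_prod[OF char_0 md(2)])
    fix \<sigma> :: "'l alg_closure \<Rightarrow> 'l alg_closure" and a b
    assume \<sigma>: "\<sigma> \<in> galois_group" and "m (a, b) \<noteq> 0"
    note h = galoisD(1)[OF \<sigma>]
    note hs = rhom_simps[OF h] rhom_divide[OF h] rhom_powi[OF h] galois_D[OF \<sigma>]
    have r1: "A a \<Longrightarrow> rho (1 - \<sigma> a / D) = \<sigma> (rho (1 - a / D))"
      using rho_galois[OF \<sigma> small] by (simp add: hs)
    have r2: "B a \<Longrightarrow> rho (1 - D / \<sigma> a) = \<sigma> (rho (1 - D / a))"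
      using rho_galois[OF \<sigma> large(1)] by (simp add: hs)
    have r3: "C a \<Longrightarrow> rho (\<sigma> a / D) = \<sigma> (rho (a / D))"
      using rho_galois[OF \<sigma>, of "a / D"] by (simp add: hs C_def)
    have r4: "U a \<Longrightarrow> rho (\<sigma> a / D / teich (\<sigma> a / D)) = \<sigma> (rho (a / D / teich (a / D)))"
      using rho_galois[OF \<sigma> unit(2)] teich_galois[OF \<sigma>, of "a / D"] same[of a] by (simp add: hs U_def)
    show "\<phi> (\<sigma> a, \<sigma> b) = \<sigma> (\<phi> (a, b))"
      using r1 r2 r3 r4 by (simp add: \<phi>_def ABC_galois[OF \<sigma>] hs U_def)
  qed
  then obtain z1 where z1: "(\<Prod>s\<in>?S. \<phi> s powi m s) = to_ac z1" by blast
  define m' where "m' s = (if U (fst s) then m s else 0)" for s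
  have supp': "{s. m' s \<noteq> 0} = {s \<in> ?S. U (fst s)}" by (auto simp: m'_def)
  obtain z2 where z2: "(\<Prod>s | m' s \<noteq> 0. teich (fst s / D) powi m' s) = (to_ac z2) ^ p"
  proof -
    have fin': "finite {s. m' s \<noteq> 0}"
      unfolding supp' using md(1) by simp
    have inv': "galois_invariant m'"
      using md(2) ABC_galois(4) by (auto simp: galois_invariant_def m'_def)
    have a': "eabs a = eabs D" if "m' (a, b) \<noteq> 0" for a b
      using that by (auto simp: m'_def U_def A_def B_def split: if_splits)
    \<comment> \<open>In the region \<open>U\<close> also \<open>1 - a / D\<close> is a unit, so
      \<open>|D - a| = |D|\<close> and the curve equation fixes \<open>|b|\<close>.\<close>
    have b': "eabs b ^ p = eabs D ^ (r + 1)" if "m' (a, b) \<noteq> 0" for a b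
    proof -
      have U: "U a" and "m (a, b) \<noteq> 0" using that by (auto simp: m'_def split: if_splits)
      then have b: "b ^ p = a ^ r * (D - a)" using md(5) by blast
      have aD: "eabs a = eabs D" using U by (simp add: U_def A_def B_def)
      have "eabs (a / D - 1) \<le> 1"
        using same[of a] U by (intro ext.av_diff_le) (auto simp: U_def)
      then have "eabs (a / D - 1) = 1" using U by (simp add: U_def C_def)
      moreover have "D - a = - (D * (a / D - 1))" using D0 by (simp add: field_simps)
      ultimately have "eabs (D - a) = eabs D" by (simp only: ext.av_minus eabs_mult mult_1_right)
      then show ?thesis using arg_cong[OF b, of eabs] by (simp add: ext.av_power eabs_mult aD)
    qed
    obtain z where "z \<in> range to_ac" "(\<Prod>s | m' s \<noteq> 0. teich (fst s / D) powi m' s) = z ^ p"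
      by (rule ramified_unit_part[OF ram fin' inv' a' b'])
    then show ?thesis using that by blast
  qed
  have "to_ac u = (\<Prod>s\<in>?S. fst s powi m s)" by (simp add: um divisor_value_def)
  also have "\<dots> = (\<Prod>s\<in>?S. (\<phi> s powi m s) ^ p * D powi (\<epsilon> s * m s) * teich (fst s / D) powi m' s)"
  proof (intro prod.cong refl)
    fix s assume s: "s \<in> ?S"
    have "fst s powi m s = (\<phi> s ^ p * D powi \<epsilon> s * (if U (fst s) then teich (fst s / D) else 1)) powi m s"
      by (rule arg_cong[OF fact[OF s], of "\<lambda>x. x powi m s"])
    also have "\<dots> = (\<phi> s ^ p) powi m s * (D powi \<epsilon> s) powi m s *
        (if U (fst s) then teich (fst s / D) else 1) powi m s"
      by (simp only: power_int_mult_distrib)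
    also have "(\<phi> s ^ p) powi m s = (\<phi> s powi m s) ^ p"
      by (simp only: power_int_power power_int_power' mult.commute)
    also have "(D powi \<epsilon> s) powi m s = D powi (\<epsilon> s * m s)"
      by (rule power_int_mult[symmetric])
    also have "(if U (fst s) then teich (fst s / D) else 1) powi m s = teich (fst s / D) powi m' s"
      by (simp add: m'_def)
    finally show "fst s powi m s =
        (\<phi> s powi m s) ^ p * D powi (\<epsilon> s * m s) * teich (fst s / D) powi m' s" .
  qed
  also have "\<dots> = to_ac z1 ^ p * D powi (\<Sum>s\<in>?S. \<epsilon> s * m s) * (\<Prod>s\<in>?S. teich (fst s / D) powi m' s)"
    using D0 by (simp add: prod.distrib prod_power_int_sum z1 flip: prod_power_distrib)
  also have "(\<Prod>s\<in>?S. teich (fst s / D) powi m' s) = to_ac z2 ^ p"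
    unfolding z2[symmetric] by (rule prod.mono_neutral_right) (use md(1) in \<open>auto simp: m'_def\<close>)
  finally have "to_ac u = to_ac (d powi (\<Sum>s\<in>?S. \<epsilon> s * m s) * (z1 * z2) ^ p)"
    by (simp add: power_mult_distrib rhom_powi[OF rhom_to_ac])
  then have eq: "u = d powi (\<Sum>s\<in>?S. \<epsilon> s * m s) * (z1 * z2) ^ p"
    by (simp only: to_ac_eq_iff)
  moreover have "u \<noteq> 0" using um divisor_value_nonzero[OF m] by auto
  then have "z1 * z2 \<noteq> 0" using eq p_gt by (auto simp: zero_power)
  ultimately show ?thesis using that by blast
qed

text \<open>The divisor is \<open>(D, 0) - (1, - z)\<close>: since \<open>l\<close> divides
  \<open>\<delta>\<close>, \<open>1 - d\<close> is a one-unit with a rational \<open>p\<close>-th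
  root \<open>z\<close>, so \<open>(1, - z)\<close> is a rational point, and the value is
  \<open>D / 1\<close>.\<close>

lemma ramified_lower:
  assumes ram: "int l dvd \<delta>"
  shows "d \<in> divisor_values p r d"
proof -
  obtain v where v: "av d = av (of_nat l) ^ v" "0 < v" "v < p" using av_d[OF ram] .
  then have d1: "av d < 1" using av_l by (simp add: power_less_one_iff)
  then obtain z where z: "z ^ p = 1 - d" "av (z - 1) < 1"
    using pth_root_one_unit[of "1 - d"] by auto
  have D0: "D \<noteq> 0" using \<delta> by simp
  have D1: "D \<noteq> 1" using d1 eabs_of_int[of \<delta>] by auto
  define m :: "'l alg_closure \<times> 'l alg_closure \<Rightarrow> int" where
    "m s = (if s = (D, 0) then 1 else if s = (1, to_ac (- z)) then - 1 else 0)" for s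
  have supp: "{s. m s \<noteq> 0} = {(D, 0), (1, to_ac (- z))}" by (auto simp: m_def)
  have "galois_invariant m"
    unfolding galois_invariant_def
  proof (intro ballI allI)
    fix \<sigma> :: "'l alg_closure \<Rightarrow> 'l alg_closure" and a b assume \<sigma>: "\<sigma> \<in> galois_group"
    note h = galoisD(1)[OF \<sigma>]
    have fixed: "(\<sigma> a, \<sigma> b) = (x, y) \<longleftrightarrow> (a, b) = (x, y)" if "\<sigma> x = x" "\<sigma> y = y" for x y
      using rhom_inj[OF h] that by (metis prod.inject)
    show "m (\<sigma> a, \<sigma> b) = m (a, b)"
      unfolding m_def fixed[OF galois_D[OF \<sigma>] rhom_0[OF h]] fixed[OF rhom_1[OF h] galoisD(3)[OF \<sigma>]]
      by (rule refl)
  qed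
  moreover have "(- to_ac z) ^ p = D - 1"
    using arg_cong[OF z(1), of to_ac] unfolding odd_minus_power by simp
  ultimately have "curve_divisor p r d m"
    unfolding curve_divisor_def supp using D0 D1 p_gt
    by (auto simp: m_def zero_power split: if_splits)
  moreover have "to_ac d = divisor_value m"
    unfolding divisor_value_def supp using D1 by (simp add: m_def)
  ultimately show ?thesis unfolding divisor_values_def by blast
qed

text \<open>With \<open>|D| = 1\<close> the curve equation gives \<open>|b|^p = |a|^r\<close> for
  \<open>|a| < 1\<close> and \<open>|b|^p = |a|^(r+1)\<close> for \<open>|a| > 1\<close>; Bezout
  turns this into an equivariant \<open>\<phi>\<close> with \<open>|\<phi>|^p = |a|\<close>. Points
  with \<open>|a| = 1\<close> get \<open>\<phi> = 1\<close>.\<close>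

lemma unramified_upper:
  assumes unram: "\<not> int l dvd \<delta>" and u: "u \<in> divisor_values p r d"
  obtains z where "z \<noteq> 0" "av (u / z ^ p) = 1"
proof -
  obtain m where m: "curve_divisor p r d m" and um: "to_ac u = divisor_value m"
    using u by (auto simp: divisor_values_def)
  let ?S = "{s. m s \<noteq> 0}"
  note md = curve_divisorD[OF m]
  obtain s0 t0 s1 t1 where st: "int p * s0 + int r * t0 = 1" "int p * s1 + int (r + 1) * t1 = 1"
    using exponents .
  have D1: "eabs D = 1" using av_of_int_coprime[OF l(1) av_l unram] by (simp add: eabs_of_int)
  define \<phi> where "\<phi> s = (case s of (a, b) \<Rightarrow> if eabs a < 1 then a powi s0 * b powi t0
      else if eabs a > 1 then a powi s1 * b powi t1 else 1)" for s
  have \<phi>: "eabs (\<phi> s) ^ p = eabs (fst s)" if s: "s \<in> ?S" for s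
  proof -
    obtain a b where ab: "s = (a, b)" by force
    have a0: "a \<noteq> 0" and b: "b ^ p = a ^ r * (D - a)" using md(4,5)[of a b] s ab by auto
    have eb: "eabs b ^ p = eabs a ^ r * eabs (D - a)"
      using arg_cong[OF b, of eabs] by (simp add: ext.av_power eabs_mult)
    have bez: "(eabs a powi s * eabs b powi t) ^ p = eabs a"
      if "eabs b ^ p = eabs a ^ k" "int p * s + int k * t = 1" for s t k
      using power_int_bezout[of "eabs a" "eabs b" p k 1 s t] that a0 by simp
    consider "eabs a < 1" | "eabs a > 1" | "eabs a = 1" by linarith
    then show ?thesis
    proof cases
      case 1
      then have "eabs (D - a) = 1" using ext.av_add_eq[of "- a" D] D1 by simp
      then show ?thesis
        using 1 bez[OF _ st(1)] eb by (simp add: ab \<phi>_def eabs_mult ext.av_powi)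
    next
      case 2
      then have "eabs (D - a) = eabs a" using ext.av_add_eq[of D "- a"] D1 by simp
      then show ?thesis
        using 2 bez[OF _ st(2)] eb by (simp add: ab \<phi>_def eabs_mult ext.av_powi mult.commute)
    qed (simp add: ab \<phi>_def)
  qed
  have "(\<Prod>s | m s \<noteq> 0. \<phi> s powi m s) \<in> range to_ac"
    by (rule equivariant_prod[OF char_0 md(2)])
       (simp add: \<phi>_def eabs_galois rhom_mult[OF galoisD(1)] rhom_powi[OF galoisD(1)] rhom_1[OF galoisD(1)])
  then obtain z where z: "(\<Prod>s\<in>?S. \<phi> s powi m s) = to_ac z" by blast
  have "av u = eabs (divisor_value m)" using um by (metis eabs_to_ac)
  also have "\<dots> = (\<Prod>s\<in>?S. eabs (fst s) powi m s)"
    by (simp add: divisor_value_def ext.av_prod ext.av_powi)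
  also have "\<dots> = (\<Prod>s\<in>?S. (eabs (\<phi> s) ^ p) powi m s)"
    by (intro prod.cong) (simp_all add: \<phi>)
  also have "\<dots> = eabs (\<Prod>s\<in>?S. \<phi> s powi m s) ^ p"
    by (simp add: ext.av_prod ext.av_powi power_int_power power_int_power' mult.commute prod_power_distrib)
  finally have au: "av u = av z ^ p" by (simp add: z)
  have "u \<noteq> 0" using um divisor_value_nonzero[OF m] by auto
  then have "av z \<noteq> 0" using au p_gt by (auto simp: zero_power)
  then show ?thesis using that[of z] au by (simp add: av_divide av_power)
qed

end

section \<open>Primes not dividing the parameter of the curve\<close>

lemma card_roots_of_unity:
  assumes "of_nat d \<noteq> (0 :: 'a::alg_closed_field)"
  shows "card {x :: 'a. x ^ d = 1} = d"
proof -
  have d: "d > 0" using assms by (intro gr0I) auto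
  let ?f = "monom 1 d + [:- 1:] :: 'a poly"
  have deg: "degree ?f = d" using d by (subst degree_add_eq_left) (simp_all add: degree_monom_eq)
  have lead: "lead_coeff ?f = 1"
    unfolding deg using d by (simp add: coeff_pCons split: nat.split)
  have "poly (pderiv ?f) x \<noteq> 0" if "poly ?f x = 0" for x
  proof -
    have "x ^ d = 1" using that by (simp add: poly_monom)
    then have "x \<noteq> 0" using d by (auto simp: power_0_left)
    then show ?thesis using assms by (simp add: pderiv_add pderiv_monom pderiv_pCons poly_monom)
  qed
  from separable_split(2)[OF lead this] show ?thesis
    unfolding deg by (simp add: poly_monom)
qed

lemma primitive_root_of_unity_unique_order:
  fixes x :: "'a::field"
  assumes "primitive_root_of_unity m x" "m > 0" "x ^ n = 1"
  shows "m dvd n"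
proof -
  have "x ^ n = (x ^ m) ^ (n div m) * x ^ (n mod m)" by (simp flip: power_mult power_add)
  then have "x ^ (n mod m) = 1" using assms by (simp add: primitive_root_of_unity_def)
  then have "n mod m = 0"
    using assms mod_less_divisor[of m n] by (auto simp: primitive_root_of_unity_def)
  then show ?thesis by auto
qed

text \<open>Sorting the \<open>d\<close>-th roots of unity by exact order gives the recursion that
  also determines the totient, so there are \<open>totient N > 0\<close> primitive ones.\<close>

lemma primitive_root_exists:
  assumes char: "CHAR('a::alg_closed_field) = 0" and N: "N > 0"
  obtains g :: "'a::alg_closed_field" where "primitive_root_of_unity N g"
proof -
  define Prm where "Prm d = {x :: 'a. primitive_root_of_unity d x}" for d
  have fin: "finite {x :: 'a. x ^ d = 1}" if "d > 0" for d
    using card_roots_of_unity[where 'a = 'a, of d] that char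
    by (intro card_ge_0_finite) (simp add: of_nat_eq_0_iff_char_dvd)
  have finP: "finite (Prm d)" if "d > 0" for d
    using fin[OF that] by (rule finite_subset[rotated]) (auto simp: Prm_def primitive_root_of_unity_def)
  have split: "{x :: 'a. x ^ d = 1} = (\<Union>e\<in>{e. e dvd d}. Prm e)" if d: "d > 0" for d
  proof (intro equalityI subsetI)
    fix x :: 'a assume "x \<in> {x. x ^ d = 1}"
    then have x: "x ^ d = 1" by simp
    define e where "e = (LEAST k. 0 < k \<and> x ^ k = 1)"
    have e: "0 < e \<and> x ^ e = 1"
      unfolding e_def using d x by (intro LeastI[of "\<lambda>k. 0 < k \<and> x ^ k = 1" d]) simp
    have "x ^ k \<noteq> 1" if "0 < k" "k < e" for k
      using not_less_Least[of k "\<lambda>k. 0 < k \<and> x ^ k = 1"] that by (auto simp: e_def)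
    then have prim: "primitive_root_of_unity e x"
      using e by (auto simp: primitive_root_of_unity_def)
    then show "x \<in> (\<Union>e\<in>{e. e dvd d}. Prm e)"
      using primitive_root_of_unity_unique_order[OF prim _ x] e by (auto simp: Prm_def)
  next
    fix x :: 'a assume "x \<in> (\<Union>e\<in>{e. e dvd d}. Prm e)"
    then obtain e where "e dvd d" "x ^ e = 1" by (auto simp: Prm_def primitive_root_of_unity_def)
    then show "x \<in> {x. x ^ d = 1}" by (auto elim!: dvdE simp: power_mult)
  qed
  have count: "(\<Sum>e | e dvd d. card (Prm e)) = d" if d: "d > 0" for d
  proof -
    have "card (\<Union>e\<in>{e. e dvd d}. Prm e) = (\<Sum>e | e dvd d. card (Prm e))"
    proof (rule card_UN_disjoint)
      show "\<forall>i\<in>{e. e dvd d}. finite (Prm i)" using finP d by (auto intro: dvd_pos_nat)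
      show "\<forall>i\<in>{e. e dvd d}. \<forall>j\<in>{e. e dvd d}. i \<noteq> j \<longrightarrow> Prm i \<inter> Prm j = {}"
      proof (intro ballI impI, rule ccontr)
        fix i j assume ij: "i \<in> {e. e dvd d}" "j \<in> {e. e dvd d}" "i \<noteq> j" "Prm i \<inter> Prm j \<noteq> {}"
        then obtain x :: 'a where x: "primitive_root_of_unity i x" "primitive_root_of_unity j x"
          unfolding Prm_def by blast
        have "i > 0" "j > 0" using ij d by (auto intro: dvd_pos_nat)
        then have "i dvd j" "j dvd i"
          using x primitive_root_of_unity_unique_order by (auto simp: primitive_root_of_unity_def)
        then show False using ij(3) dvd_antisym by blast
      qed
    qed (use d in simp)
    then show ?thesis using split[OF d] card_roots_of_unity[where 'a = 'a, of d] d char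
      by (simp add: of_nat_eq_0_iff_char_dvd)
  qed
  have "card (Prm d) = totient d" if "d > 0" for d using that
  proof (induction d rule: less_induct)
    case (less d)
    have *: "{e. e dvd d} = insert d {e. e dvd d \<and> e < d}"
      using less.prems by (auto dest: dvd_imp_le)
    have fin: "finite {e. e dvd d \<and> e < d}" by simp
    have "card (Prm d) + (\<Sum>e | e dvd d \<and> e < d. card (Prm e)) = d"
      using count[OF less.prems] fin unfolding * by simp
    moreover have "totient d + (\<Sum>e | e dvd d \<and> e < d. totient e) = d"
      using totient_divisor_sum[of d] fin unfolding * by simp
    moreover have "(\<Sum>e | e dvd d \<and> e < d. card (Prm e)) = (\<Sum>e | e dvd d \<and> e < d. totient e)"
      using less by (intro sum.cong) (auto intro: dvd_pos_nat)
    ultimately show ?case by simp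
  qed
  then have "card (Prm N) > 0" using N by simp
  then obtain g where "g \<in> Prm N" by (metis card.empty ex_in_conv less_irrefl)
  then show ?thesis using that by (simp add: Prm_def)
qed

section \<open>The Galois action on Teichmueller representatives\<close>

context nonarch
begin

text \<open>Elementary symmetric functions are integer polynomials, so Frobenius passes through them
  modulo \<open>l\<close>; the induction adds one linear factor at a time.\<close>

lemma frob_coeff:
  assumes l: "prime l" "av (of_nat l) < 1" and f: "\<And>x. x \<in> A \<Longrightarrow> av (f x) \<le> 1"
  shows "av (coeff (\<Prod>x\<in>A. [:- f x, 1:]) i ^ l - coeff (\<Prod>x\<in>A. [:- (f x ^ l), 1:]) i) < 1"
  using f
proof (induction A arbitrary: i rule: infinite_finite_induct)
  case (insert x A)
  let ?P = "\<Prod>x\<in>A. [:- f x, 1:]" and ?Q = "\<Prod>x\<in>A. [:- (f x ^ l), 1:]"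
  have cP: "av (coeff ?P j) \<le> 1" for j by (rule integral_poly_prod) (use insert.prems in auto)
  have fx: "av (f x) \<le> 1" using insert.prems by simp
  have IH: "av (coeff ?P j ^ l - coeff ?Q j) < 1" for j using insert by auto
  define b where "b j = (if j = 0 then 0 else coeff ?P (j - 1))" for j
  define b' where "b' j = (if j = 0 then 0 else coeff ?Q (j - 1))" for j
  have bb: "av (b j) \<le> 1" "av (b j ^ l - b' j) < 1" for j
    using cP IH l by (auto simp: b_def b'_def power_0_left prime_gt_0_nat)
  have c: "coeff (\<Prod>x\<in>insert x A. [:- f x, 1:]) i = b i - f x * coeff ?P i"
    using insert.hyps by (cases i) (auto simp: b_def)
  have c': "coeff (\<Prod>x\<in>insert x A. [:- (f x ^ l), 1:]) i = b' i - f x ^ l * coeff ?Q i"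
    using insert.hyps by (cases i) (auto simp: b'_def)
  \<comment> \<open>The coefficient is the difference \<open>b i - f x * coeff ?P i\<close>;
    splitting \<open>b i\<close> as \<open>?u + ?v\<close> lets additivity of Frobenius be used
    without a minus sign, which for \<open>l = 2\<close> would change its shape.\<close>
  let ?u = "b i - f x * coeff ?P i" and ?v = "f x * coeff ?P i"
  have v: "av ?v \<le> 1" using fx cP by (simp add: av_mult mult_le_one)
  have u: "av ?u \<le> 1" using bb v by (intro av_diff_le)
  have 1: "av ((?u + ?v) ^ l - (?u ^ l + ?v ^ l)) < 1" using frob_add[OF l u v, of 1] by simp
  have "av (f x ^ l * (coeff ?P i ^ l - coeff ?Q i)) < 1"
    using mult_left_le_one_le[of "av (coeff ?P i ^ l - coeff ?Q i)" "av (f x ^ l)"] IH[of i] fx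
    by (simp add: av_mult av_power power_le_one)
  from av_diff_less[OF av_diff_less[OF bb(2)[of i] this] 1]
  have "av ((b i ^ l - b' i) - f x ^ l * (coeff ?P i ^ l - coeff ?Q i) - ((?u + ?v) ^ l - (?u ^ l + ?v ^ l))) < 1" .
  moreover have "(b i ^ l - b' i) - f x ^ l * (coeff ?P i ^ l - coeff ?Q i) - ((?u + ?v) ^ l - (?u ^ l + ?v ^ l))
     = ?u ^ l - (b' i - f x ^ l * coeff ?Q i)"
  proof -
    have "?u + ?v = b i" "?v ^ l = f x ^ l * coeff ?P i ^ l" by (simp_all add: power_mult_distrib)
    then show ?thesis by (simp only: right_diff_distrib) simp
  qed
  ultimately show ?case by (simp only: c c')
qed (use l in \<open>auto simp: one_pCons coeff_pCons power_0_left prime_gt_0_nat split: nat.split\<close>)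

end

context unramified
begin

lemma el: "eabs (of_nat l) < 1" using av_l by (simp add: eabs_of_nat)

text \<open>The representatives of \<open>0, ..., l - 1\<close> are pairwise distinct and so exhaust
  the \<open>l\<close> elements of \<open>T 1\<close>; being attached to integers they are fixed by
  the Galois group.\<close>

lemma T1_rational: "T 1 \<subseteq> range to_ac"
proof -
  define \<tau> where "\<tau> i = teich (of_nat i)" for i
  have int: "eabs (of_nat i) \<le> 1" for i by (rule ext.av_of_nat_le)
  have close: "eabs (of_nat i ^ l ^ 1 - of_nat i) < 1" for i
  proof -
    obtain k where "int i ^ l - int i = int l * k" using int_power_prime[OF l(1)] by (metis dvdE)
    then have "of_int (int i ^ l - int i) = (of_nat l * of_int k :: 'l alg_closure)" by simp
    then have "eabs (of_nat i ^ l ^ 1 - of_nat i) = eabs (of_nat l) * eabs (of_int k)"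
      by (simp add: eabs_mult)
    also have "\<dots> \<le> eabs (of_nat l)"
      using ext.av_of_int_le[of k] by (simp add: mult_left_le)
    finally show ?thesis using el by simp
  qed
  have \<tau>: "\<tau> i \<in> T 1" "eabs (of_nat i - \<tau> i) < 1" for i
  proof -
    obtain t where t: "t \<in> T 1" "eabs (of_nat i - t) < 1" using T_lift[OF _ close] by auto
    then have "\<tau> i = t"
      unfolding \<tau>_def using int by (intro teich_eq[of _ _ 1]) auto
    then show "\<tau> i \<in> T 1" "eabs (of_nat i - \<tau> i) < 1" using t by auto
  qed
  have "inj_on \<tau> {..<l}"
  proof -
    have "i = j" if "i \<le> j" "j < l" "\<tau> i = \<tau> j" for i j
    proof (rule ccontr)
      assume "i \<noteq> j"
      then have "\<not> l dvd j - i" using that dvd_imp_le[of l "j - i"] by auto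
      then have "eabs (of_nat (j - i)) = 1" by (simp add: eabs_of_nat av_of_nat_coprime)
      moreover have "eabs (of_nat j - of_nat i) < 1"
        using ext.av_diff_trans_less[OF \<tau>(2)[of j], of "of_nat i"] \<tau>(2)[of i] that(3)
        by (simp add: ext.av_minus_commute)
      ultimately show False using that(1) by (simp add: of_nat_diff)
    qed
    then show ?thesis by (intro inj_onI) (metis lessThan_iff linorder_le_cases)
  qed
  then have "card (\<tau> ` {..<l}) = card (T 1)" using T_poly(2)[of 1] by (simp add: card_image)
  moreover have "\<tau> ` {..<l} \<subseteq> T 1" using \<tau> by blast
  ultimately have "\<tau> ` {..<l} = T 1" using finite_T[of 1] by (intro card_subset_eq) auto
  moreover have "\<tau> i \<in> range to_ac" for i
  proof (rule galois_fixed[OF char_0])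
    fix \<sigma> :: "'l alg_closure \<Rightarrow> 'l alg_closure" assume "\<sigma> \<in> galois_group"
    then show "\<sigma> (\<tau> i) = \<tau> i"
      using teich_galois[of \<sigma> "of_nat i"] int[of i] galoisD(1) unfolding \<tau>_def
      by (simp add: rhom_of_nat[OF galoisD(1)])
  qed
  ultimately show ?thesis by (metis image_subsetI)
qed

text \<open>The polynomial \<open>H\<close> with roots \<open>x, x^l, x^(l^2), ...\<close> is
  Frobenius-stable, so its coefficients are congruent to elements of \<open>T 1\<close>, hence to
  rational ones. An automorphism moves them only slightly, so \<open>\<sigma> x\<close> is close to
  a root of \<open>H\<close>, and discreteness makes it one.\<close>

lemma galois_frobenius_pointwise:
  assumes \<sigma>: "\<sigma> \<in> galois_group" and n: "n > 0" and x: "x \<in> T n"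
  obtains j where "\<sigma> x = x ^ l ^ j"
proof -
  note h = galoisD(1)[OF \<sigma>]
  define H where "H = (\<Prod>j<n. [:- (x ^ l ^ j), 1:])"
  have xj: "eabs (x ^ l ^ j) \<le> 1" for j
    using T_le[OF x n] by (simp add: ext.av_power power_le_one)
  \<comment> \<open>Raising the roots to the \<open>l\<close>-th power is a cyclic shift because
    \<open>x^(l^n) = x\<close>; it is read off by removing the first or the last factor from the
    product over \<open>Suc n\<close>.\<close>
  have "(\<Prod>j<n. [:- ((x ^ l ^ j) ^ l), 1:]) = H"
  proof -
    let ?F = "\<lambda>j. [:- (x ^ l ^ j), 1:]"
    have "?F n = ?F 0" using x by (simp add: T_def)
    moreover have "(\<Prod>j<Suc n. ?F j) = ?F 0 * (\<Prod>j<n. ?F (Suc j))"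
      by (rule prod.lessThan_Suc_shift)
    moreover have "(\<Prod>j<Suc n. ?F j) = H * ?F n" by (simp only: H_def prod.lessThan_Suc)
    ultimately have "?F 0 * (\<Prod>j<n. ?F (Suc j)) = ?F 0 * H" by (simp only: mult.commute)
    moreover have "?F 0 \<noteq> 0" by simp
    ultimately have "(\<Prod>j<n. ?F (Suc j)) = H" by (meson mult_left_cancel)
    then show ?thesis by (simp add: mult.commute flip: power_mult)
  qed
  then have "eabs (coeff H i ^ l ^ 1 - coeff H i) < 1" for i
    using ext.frob_coeff[OF l(1) el, of "{..<n}" "\<lambda>j. x ^ l ^ j" i] xj by (simp add: H_def)
  then have lift: "\<exists>c. eabs (coeff H i - to_ac c) < 1" for i
    using T_lift[of 1 "coeff H i"] T1_rational by (metis imageE less_numeral_extra(1) subsetD)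
  have fixed: "eabs (\<sigma> (coeff H i) - coeff H i) < 1" for i
  proof -
    obtain c where c: "eabs (coeff H i - to_ac c) < 1" using lift by blast
    then have "eabs (\<sigma> (coeff H i) - to_ac c) < 1"
      using galois_close[OF \<sigma>, of "coeff H i" "to_ac c"] galoisD(3)[OF \<sigma>] by simp
    then show ?thesis using ext.av_diff_trans_less c ext.av_minus_commute by metis
  qed
  have "poly H x = 0"
    unfolding H_def poly_prod using n by (intro prod_zero) (auto intro!: bexI[of _ 0])
  then have "poly (map_poly \<sigma> H) (\<sigma> x) = 0"
    using poly_rhom[OF h, of H x] rhom_0[OF h] by simp
  moreover have "eabs (poly (map_poly \<sigma> H - H) (\<sigma> x)) < 1"
    unfolding poly_altdef
  proof (rule ext.av_sum_less)
    fix i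
    have "eabs (\<sigma> x ^ i) \<le> 1"
      using T_le[OF x n] by (simp add: ext.av_power power_le_one eabs_galois[OF \<sigma>])
    then show "eabs (coeff (map_poly \<sigma> H - H) i * \<sigma> x ^ i) < 1"
      using fixed[of i] mult_left_le[of "eabs (\<sigma> x ^ i)" "eabs (\<sigma> (coeff H i) - coeff H i)"]
      by (simp add: eabs_mult coeff_map_poly rhom_0[OF h])
  qed simp
  ultimately have "eabs (poly H (\<sigma> x)) < 1" by simp
  then have "(\<Prod>j<n. eabs (\<sigma> x - x ^ l ^ j)) < 1"
    by (simp add: H_def poly_prod flip: ext.av_prod)
  then obtain j where j: "eabs (\<sigma> x - x ^ l ^ j) < 1"
    using prod_ge_1[of "{..<n}" "\<lambda>j. eabs (\<sigma> x - x ^ l ^ j)"] by (force simp: not_less)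
  have "(x ^ l ^ j) ^ l ^ n = (x ^ l ^ n) ^ l ^ j" by (simp only: mult.commute flip: power_mult)
  then have "x ^ l ^ j \<in> T n" using x by (simp add: T_def)
  then have "\<sigma> x = x ^ l ^ j" using T_discrete[OF T_galois[OF \<sigma> x] _ n n j] by blast
  then show ?thesis using that by blast
qed

text \<open>A primitive root of unity of order \<open>l^n - 1\<close> generates the nonzero elements
  of \<open>T n\<close>, so the exponent found for it serves them all.\<close>

lemma galois_frobenius:
  assumes \<sigma>: "\<sigma> \<in> galois_group" and n: "n > 0"
  obtains j where "\<And>x. x \<in> T n \<Longrightarrow> \<sigma> x = x ^ l ^ j"
proof -
  note h = galoisD(1)[OF \<sigma>]
  let ?N = "l ^ n - 1"
  have N: "?N > 0" using ln_gt_1[OF n] by simp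
  have char: "CHAR('l alg_closure) = 0" using char_0 by simp
  obtain g :: "'l alg_closure" where g: "primitive_root_of_unity ?N g"
    using primitive_root_exists[OF char N] .
  then have "g ^ ?N = 1" by (simp add: primitive_root_of_unity_def)
  then have gT: "g \<in> T n" by (rule T_I)
  obtain j where j: "\<sigma> g = g ^ l ^ j" using galois_frobenius_pointwise[OF \<sigma> n gT] .
  have gi: "(g ^ i) ^ ?N = 1" for i
    using \<open>g ^ ?N = 1\<close> by (metis mult.commute power_mult power_one)
  have inj: "inj_on (\<lambda>i. g ^ i) {..<?N}"
    using primitive_root_power_eq_iff[OF g] by (auto simp: inj_on_def)
  have sub: "(\<lambda>i. g ^ i) ` {..<?N} \<subseteq> {x. x ^ ?N = 1}" using gi by auto
  have cardR: "card {x :: 'l alg_closure. x ^ ?N = 1} = ?N"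
    by (intro card_roots_of_unity, unfold of_nat_eq_0) (use N in simp)
  then have "finite {x :: 'l alg_closure. x ^ ?N = 1}" using N by (intro card_ge_0_finite) simp
  moreover have "card ((\<lambda>i. g ^ i) ` {..<?N}) = ?N"
    using card_image[OF inj] by (simp only: card_lessThan)
  ultimately have "(\<lambda>i. g ^ i) ` {..<?N} = {x. x ^ ?N = 1}"
    using card_subset_eq[OF _ sub] cardR by presburger
  then have gen: "\<exists>i. x = g ^ i" if "x \<in> T n" "x \<noteq> 0" for x
    using T_unit(1)[OF that(1) n that(2)] by blast
  have "\<sigma> x = x ^ l ^ j" if x: "x \<in> T n" for x
  proof (cases "x = 0")
    case True
    then show ?thesis using rhom_0[OF h] l_gt by simp
  next
    case False
    then obtain i where "x = g ^ i" using gen x by blast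
    then show ?thesis by (simp only: rhom_power[OF h] j power_mult[symmetric] mult.commute)
  qed
  then show ?thesis using that by blast
qed

text \<open>The Galois group acts on \<open>T n\<close> through the powers of some Frobenius \<open>x \<mapsto> x\<^bsup>l^e\<^esup>\<close>, whose fixed
  points form the residue field of \<open>L\<close>.\<close>

lemma frobenius_generator:
  assumes n: "n > 0"
  obtains e \<sigma> where "e > 0" "e dvd n" "\<sigma> \<in> galois_group" "\<And>x. x \<in> T n \<Longrightarrow> \<sigma> x = x ^ l ^ e"
    "\<And>\<tau>. \<tau> \<in> galois_group \<Longrightarrow> \<exists>a. \<forall>x\<in>T n. \<tau> x = x ^ l ^ (e * a)"
    "T e = T n \<inter> range to_ac"
proof -
  \<comment> \<open>The exponents whose Frobenius power on \<open>T n\<close> is induced by an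
    automorphism. The identity contributes \<open>n\<close>, so a least positive exponent
    exists.\<close>
  define J where "J j \<longleftrightarrow> (\<exists>\<sigma>\<in>galois_group. \<forall>x\<in>T n. \<sigma> x = x ^ l ^ j)" for j
  have Jn: "J n"
    unfolding J_def using galois_id by (intro bexI[of _ "\<lambda>x. x"]) (auto simp: T_def)
  define e where "e = (LEAST j. 0 < j \<and> J j)"
  have e: "0 < e" "J e"
    using LeastI[of "\<lambda>j. 0 < j \<and> J j" n] Jn n by (auto simp: e_def)
  have min: "\<not> J j" if "0 < j" "j < e" for j
    using not_less_Least[of j "\<lambda>j. 0 < j \<and> J j"] that by (auto simp: e_def)
  have Jadd: "J (i + j)" if "J i" "J j" for i j
  proof -
    obtain \<sigma> \<tau> where \<sigma>: "\<sigma> \<in> galois_group" "\<And>x. x \<in> T n \<Longrightarrow> \<sigma> x = x ^ l ^ i"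
      and \<tau>: "\<tau> \<in> galois_group" "\<And>x. x \<in> T n \<Longrightarrow> \<tau> x = x ^ l ^ j"
      using \<open>J i\<close> \<open>J j\<close> unfolding J_def by blast
    have "\<sigma> (\<tau> x) = x ^ l ^ (i + j)" if "x \<in> T n" for x
    proof -
      have "(x ^ l ^ j) ^ l ^ i = x ^ l ^ (i + j)"
        by (simp only: power_mult[symmetric] power_add[symmetric] add.commute)
      then show ?thesis
        using \<sigma>(2)[OF T_galois[OF \<tau>(1) that]] \<tau>(2)[OF that] by simp
    qed
    then show ?thesis
      unfolding J_def by (intro bexI[OF _ galois_comp[OF \<sigma>(1) \<tau>(1)]] ballI)
  qed
  have J0: "J 0"
    unfolding J_def using galois_id by (intro bexI[of _ "\<lambda>x. x"]) auto
  have Jmult: "J (i * a)" if "J i" for i a by (induction a) (simp_all add: J0 Jadd that)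
  have Tn: "x ^ l ^ (n * a) = x" if "x \<in> T n" for x a
    using T_mono[OF that, of a] by (simp add: T_def)
  have Jred: "J b" if "J (b + n * a)" for a b
  proof -
    have "x ^ l ^ (b + n * a) = x ^ l ^ b" if "x \<in> T n" for x
    proof -
      have "x ^ l ^ (b + n * a) = (x ^ l ^ (n * a)) ^ l ^ b"
        by (simp add: power_add mult.commute flip: power_mult)
      then show ?thesis using Tn[OF that] by simp
    qed
    then show ?thesis using that unfolding J_def by (metis (no_types, lifting))
  qed
  have dvd: "e dvd j" if "J j" for j
  proof (rule ccontr)
    assume "\<not> e dvd j"
    then have b: "0 < j mod e" "j mod e < e" using e(1) by (auto simp: dvd_eq_mod_eq_0)
    \<comment> \<open>On \<open>T n\<close> exponents matter only modulo \<open>n\<close>; adding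
      \<open>(n - 1)\<close> copies of a multiple of \<open>e\<close> therefore acts as subtracting
      it, and \<open>j mod e\<close> would be a smaller exponent.\<close>
    have "n * (e * (j div e)) = e * (j div e) + e * ((n - 1) * (j div e))"
      using n by (cases n) (auto simp: algebra_simps)
    then have "j + e * ((n - 1) * (j div e)) = j mod e + n * (e * (j div e))"
      using mult_div_mod_eq[of e j] by linarith
    moreover have "J (j + e * ((n - 1) * (j div e)))" by (intro Jadd that Jmult e(2))
    ultimately have "J (j mod e)" using Jred by metis
    then show False using min b by blast
  qed
  obtain \<sigma> where \<sigma>: "\<sigma> \<in> galois_group" "\<And>x. x \<in> T n \<Longrightarrow> \<sigma> x = x ^ l ^ e"
    using e(2) unfolding J_def by blast
  have all: "\<exists>a. \<forall>x\<in>T n. \<tau> x = x ^ l ^ (e * a)" if \<tau>: "\<tau> \<in> galois_group" for \<tau>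
  proof -
    obtain j where j: "\<And>x. x \<in> T n \<Longrightarrow> \<tau> x = x ^ l ^ j"
      using galois_frobenius[OF \<tau> n] by blast
    then have "J j" unfolding J_def using \<tau> by blast
    then obtain a where "j = e * a" using dvd by (metis dvdE)
    then show ?thesis using j by blast
  qed
  have "T e = T n \<inter> range to_ac"
  proof (intro equalityI subsetI)
    fix x assume x: "x \<in> T e"
    obtain k where "n = e * k" using dvd[OF Jn] by (metis dvdE)
    then have xn: "x \<in> T n" using T_mono[OF x] by simp
    have "x \<in> range to_ac"
    proof (rule galois_fixed[OF char_0])
      fix \<tau> :: "'l alg_closure \<Rightarrow> 'l alg_closure" assume "\<tau> \<in> galois_group"
      then obtain a where "\<tau> x = x ^ l ^ (e * a)" using all xn by blast
      then show "\<tau> x = x" using T_mono[OF x, of a] by (simp add: T_def)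
    qed
    then show "x \<in> T n \<inter> range to_ac" using xn by blast
  next
    fix x assume x: "x \<in> T n \<inter> range to_ac"
    then have "\<sigma> x = x" using galoisD(3)[OF \<sigma>(1)] by auto
    then show "x \<in> T e" using \<sigma>(2)[of x] x by (simp add: T_def)
  qed
  then show ?thesis using that[OF e(1) dvd[OF Jn] \<sigma>(1) \<sigma>(2) all] by blast
qed

end

section \<open>Counting residues with prescribed power characters\<close>

text \<open>Cauchy-Schwarz against the constant function, from the nonnegative double sum of squared
  differences.\<close>

lemma sum_squared_le_card_mult:
  fixes f :: "'a \<Rightarrow> real"
  assumes "finite I"
  shows "(\<Sum>i\<in>I. f i)\<^sup>2 \<le> card I * (\<Sum>i\<in>I. (f i)\<^sup>2)"
proof -
  have "0 \<le> (\<Sum>i\<in>I. \<Sum>j\<in>I. (f i - f j)\<^sup>2)" by (intro sum_nonneg) auto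
  also have "\<dots> = (\<Sum>i\<in>I. \<Sum>j\<in>I. ((f i)\<^sup>2 + (f j)\<^sup>2) - 2 * (f i * f j))"
    by (intro sum.cong refl) (simp add: power2_diff)
  also have "\<dots> = 2 * (card I * (\<Sum>i\<in>I. (f i)\<^sup>2)) - 2 * (\<Sum>i\<in>I. f i)\<^sup>2"
    by (simp add: sum_subtractf sum.distrib power2_eq_square sum_product flip: sum_distrib_left)
  finally show ?thesis by simp
qed

context unramified
begin

text \<open>The second moment of the numbers of \<open>x\<close> with \<open>x\<close> and \<open>1 - x\<close> in prescribed cosets of the \<open>p\<close>-th
  powers is elementary: for \<open>x \<noteq> y\<close> in the same cell, \<open>(x, y)\<close> is determined by the pair of \<open>p\<close>-th
  powers \<open>(x / y, (1 - x) / (1 - y))\<close>. This variance bound leaves no room for an empty cell.\<close>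

lemma residue_count:
  assumes n: "n > 0" and M: "l ^ n - 1 = p * h" and h: "h > p ^ 3"
    and ab: "\<alpha> ^ p = 1" "\<beta> ^ p = 1"
  obtains x y where "x \<in> T n" "y \<in> T n" "eabs (1 - x - y) < 1" "x \<noteq> 0" "y \<noteq> 0" "x ^ h = \<alpha>" "y ^ h = \<beta>"
proof -
  let ?Q = "l ^ n"
  have Q: "?Q = p * h + 1" using M ln_gt_1[OF n] by simp
  have p0: "p > 0" using p_gt by simp
  have h0: "h > 0" using h by simp
  have T01: "0 \<in> T n" "1 \<in> T n" using l_gt by (auto simp: T_def)
  define T' where "T' = T n - {0, 1}"
  have finT: "finite (T n)" by (rule finite_T[OF n])
  have cardT': "card T' = p * h - 1"
    using T01 T_poly(2)[OF n] Q finT by (simp add: T'_def card_Diff_subset)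
  have T'D: "x \<in> T n" "x \<noteq> 0" "x \<noteq> 1" if "x \<in> T'" for x
    using that by (auto simp: T'_def)
  have close: "x = y" if "x \<in> T n" "y \<in> T n" "eabs (x - y) < 1" for x y
    using T_discrete that n by blast
  have ex: "\<exists>y. y \<in> T n \<and> eabs (1 - x - y) < 1" if x: "x \<in> T n" for x
  proof -
    have z: "eabs (1 - x) \<le> 1" using T_le[OF x n] by (intro ext.av_diff_le) auto
    have "eabs (((1 - x) + x) ^ ?Q - ((1 - x) ^ ?Q + x ^ ?Q)) < 1"
      by (rule ext.frob_add[OF l(1) el z T_le[OF x n]])
    then have "eabs (1 - ((1 - x) ^ ?Q + x)) < 1" using x by (simp add: T_def)
    moreover have "1 - ((1 - x) ^ ?Q + x) = - ((1 - x) ^ ?Q - (1 - x))" by simp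
    ultimately have "eabs ((1 - x) ^ ?Q - (1 - x)) < 1" by (simp only: ext.av_minus)
    then show ?thesis using T_lift[OF n] by blast
  qed
  \<comment> \<open>The representative of the residue of \<open>1 - x\<close>, which turns
    conditions on \<open>1 - x\<close> into conditions inside \<open>T n\<close>.\<close>
  define N where "N x = (SOME y. y \<in> T n \<and> eabs (1 - x - y) < 1)" for x
  have N: "N x \<in> T n" "eabs (1 - x - N x) < 1" if "x \<in> T n" for x
    using someI_ex[OF ex[OF that]] by (simp_all add: N_def)
  have N0: "N x \<noteq> 0" "N x \<noteq> 1" if "x \<in> T'" for x
  proof -
    show "N x \<noteq> 0"
    proof
      assume "N x = 0"
      then have "eabs (1 - x) < 1" using N(2)[of x] T'D[OF that] by simp
      then have "1 = x" using close T01 T'D[OF that] by blast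
      then show False using T'D[OF that] by simp
    qed
    show "N x \<noteq> 1"
    proof
      assume "N x = 1"
      then have "eabs (x - 0) < 1" using N(2)[of x] T'D[OF that] by simp
      then have "x = 0" using close T01 T'D[OF that] by blast
      then show False using T'D[OF that] by simp
    qed
  qed
  have xp: "(x ^ h) ^ p = 1" if "x \<in> T n" "x \<noteq> 0" for x
    using T_unit(1)[OF that(1) n that(2)] M by (simp add: mult.commute flip: power_mult)
  define \<mu> where "\<mu> = {z :: 'l alg_closure. z ^ p = 1}"
  have card\<mu>: "card \<mu> = p"
    unfolding \<mu>_def using p0 by (intro card_roots_of_unity) simp
  then have fin\<mu>: "finite \<mu>" using p0 by (intro card_ge_0_finite) simp
  define c where "c x = (x ^ h, N x ^ h)" for x
  have c\<mu>: "c x \<in> \<mu> \<times> \<mu>" if "x \<in> T'" for x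
    using xp[of x] xp[of "N x"] N[of x] N0[OF that] T'D[OF that] by (auto simp: c_def \<mu>_def)
  have finT': "finite T'" using finT by (simp add: T'_def)
  have "\<exists>x\<in>T'. c x = (\<alpha>, \<beta>)"
  proof (rule ccontr)
    assume no: "\<not> ?thesis"
    \<comment> \<open>With one cell empty, the \<open>p h - 2 + 1\<close> elements of
      \<open>T'\<close> are spread over only \<open>p^2 - 1\<close> cells, so Cauchy-Schwarz forces
      many pairs in a common cell.\<close>
    define I where "I = \<mu> \<times> \<mu> - {(\<alpha>, \<beta>)}"
    have I: "finite I" "card I = p ^ 2 - 1"
      using fin\<mu> card\<mu> ab by (simp_all add: I_def \<mu>_def card_cartesian_product power2_eq_square)
    have cI: "c ` T' \<subseteq> I"
    proof (rule image_subsetI)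
      fix x assume x: "x \<in> T'"
      then show "c x \<in> I" using c\<mu>[OF x] no unfolding I_def by (metis Diff_iff singletonD)
    qed
    define f where "f i = card {x \<in> T'. c x = i}" for i
    define E where "E = {(x, y) \<in> T' \<times> T'. c x = c y}"
    have sum1: "(\<Sum>i\<in>I. f i) = card T'"
      unfolding f_def using sum.group[OF finT' I(1) cI, of "\<lambda>_. 1::nat"] by simp
    have sum2: "(\<Sum>i\<in>I. (f i)\<^sup>2) = card E"
    proof -
      have "E = (\<Union>i\<in>I. {x \<in> T'. c x = i} \<times> {x \<in> T'. c x = i})"
        using cI by (auto simp: E_def)
      then have "card E = (\<Sum>i\<in>I. card ({x \<in> T'. c x = i} \<times> {x \<in> T'. c x = i}))"
        by (simp only:) (intro card_UN_disjoint; use I finT' in auto)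
      then show ?thesis by (simp add: f_def card_cartesian_product power2_eq_square)
    qed
    have "card E \<le> card T' + (h - 1)\<^sup>2"
    proof -
      \<comment> \<open>The nontrivial \<open>h\<close>-th roots of unity, that is,
        \<open>p\<close>-th powers in a cyclic group of order \<open>p h\<close>; two elements of a
        common cell have both ratios there.\<close>
      define S where "S = {s :: 'l alg_closure. s ^ h = 1} - {1}"
      have cS: "card {s :: 'l alg_closure. s ^ h = 1} = h"
        using h0 by (intro card_roots_of_unity) simp
      then have finS: "finite {s :: 'l alg_closure. s ^ h = 1}"
        using h0 by (intro card_ge_0_finite) simp
      have S: "finite S" "card S = h - 1" using finS cS by (simp_all add: S_def)
      define E1 where "E1 = {(x, y) \<in> E. x \<noteq> y}"
      define g where "g = (\<lambda>(x, y). (x / y, N x / N y))"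
      have g_im: "g ` E1 \<subseteq> S \<times> S"
      proof (rule image_subsetI)
        fix s assume s: "s \<in> E1"
        obtain x y where s_eq: "s = (x, y)" by force
        then have xy: "x \<in> T'" "y \<in> T'" "x \<noteq> y" "x ^ h = y ^ h" "N x ^ h = N y ^ h"
          using s by (auto simp: E1_def E_def c_def)
        have "N x \<noteq> N y"
        proof
          assume "N x = N y"
          have "eabs ((1 - y - N y) - (1 - x - N x)) < 1"
            by (rule ext.av_diff_less[OF N(2)[OF T'D(1)[OF xy(2)]] N(2)[OF T'D(1)[OF xy(1)]]])
          then have "eabs (x - y) < 1" using \<open>N x = N y\<close> by simp
          then show False using close T'D xy by blast
        qed
        then show "g s \<in> S \<times> S"
          unfolding s_eq using xy T'D N0 by (auto simp: g_def S_def power_divide)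
      qed
      have E1T: "x / y \<in> T n" "N x / N y \<in> T n" if "x \<in> T'" "y \<in> T'" for x y
        using T'D N[of x] N[of y] that by (auto simp: T_def power_divide)
      have g_inj: "inj_on g E1"
      proof (rule inj_onI, clarify)
        fix x y x' y' assume 1: "(x, y) \<in> E1" "(x', y') \<in> E1" and eq: "g (x, y) = g (x', y')"
        define s t where "s = x / y" and "t = N x / N y"
        have xy: "x \<in> T'" "y \<in> T'" "x' \<in> T'" "y' \<in> T'"
          using 1 by (auto simp: E1_def E_def)
        have "(s, t) \<in> S \<times> S" using g_im 1 by (force simp: g_def s_def t_def)
        then have t1: "t \<noteq> 1" by (auto simp: S_def)
        \<comment> \<open>From \<open>u = s v\<close> and \<open>1 - u\<close> congruent to
          \<open>t (1 - v)\<close> follows the congruence of \<open>1 - t\<close> and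
          \<open>(s - t) v\<close>. As \<open>t \<noteq> 1\<close>, this determines \<open>v\<close>
          from the two ratios, which is the injectivity of \<open>g\<close>.\<close>
        have rel: "eabs ((1 - t) - (s - t) * v) < 1" if "u \<in> T'" "v \<in> T'" "u = s * v" "N u = t * N v" for u v
        proof -
          have "t \<in> T n" using E1T xy by (simp add: t_def)
          then have "eabs (t * (1 - v - N v)) < 1" using T_le[of t] n N(2)[of v] T'D[OF that(2)]
              mult_left_le_one_le[of "eabs (1 - v - N v)" "eabs t"] by (simp add: eabs_mult)
          then have "eabs (t * (1 - v - N v) - (1 - u - N u)) < 1"
            by (rule ext.av_diff_less[OF _ N(2)[OF T'D(1)[OF that(1)]]])
          moreover have "t * (1 - v - N v) - (1 - u - N u) = - ((1 - t) - (s - t) * v)"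
            using that by (simp add: algebra_simps)
          ultimately show ?thesis by (simp only: ext.av_minus)
        qed
        have r1: "eabs ((1 - t) - (s - t) * y) < 1"
          using xy T'D N0 by (intro rel[of x]) (auto simp: s_def t_def)
        have r2: "eabs ((1 - t) - (s - t) * y') < 1"
          using xy T'D N0 eq by (intro rel[of x']) (auto simp: s_def t_def g_def)
        have st: "s \<in> T n" "t \<in> T n" using E1T xy by (auto simp: s_def t_def)
        have "s \<noteq> t"
        proof
          assume "s = t"
          then have "eabs (1 - t) < 1" using r1 by simp
          then show False using close[of 1 t] T01 st t1 by blast
        qed
        then have "\<not> eabs (s - t) < 1" using close st by blast
        then have st1: "eabs (s - t) \<ge> 1" by simp
        have "eabs (((1 - t) - (s - t) * y') - ((1 - t) - (s - t) * y)) < 1"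
          using r2 r1 by (rule ext.av_diff_less)
        moreover have "((1 - t) - (s - t) * y') - ((1 - t) - (s - t) * y) = (s - t) * (y - y')"
          by (simp add: algebra_simps)
        ultimately have "eabs (s - t) * eabs (y - y') < 1" by (simp only: eabs_mult)
        moreover have "eabs (y - y') \<le> eabs (s - t) * eabs (y - y')"
          using mult_right_mono[OF st1, of "eabs (y - y')"] by simp
        ultimately have "eabs (y - y') < 1" by linarith
        then have "y = y'" using close xy T'D by blast
        moreover have "y \<noteq> 0" "y' \<noteq> 0" using xy T'D(2) by blast+
        moreover from this have "x = s * y" by (simp add: s_def)
        moreover have "s = x' / y'" using eq by (simp add: s_def g_def)
        then have "x' = s * y'" using \<open>y' \<noteq> 0\<close> by simp
        ultimately show "x = x' \<and> y = y'" by simp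
      qed
      have "card E1 \<le> card (S \<times> S)" using card_inj_on_le[OF g_inj g_im] S by simp
      then have "card E1 \<le> (h - 1)\<^sup>2"
        using S by (simp add: card_cartesian_product power2_eq_square)
      moreover have "E = (\<lambda>x. (x, x)) ` T' \<union> E1" by (auto simp: E_def E1_def)
      then have "card E \<le> card ((\<lambda>x. (x, x)) ` T') + card E1"
        by (simp only: card_Un_le)
      moreover have "card ((\<lambda>x. (x, x)) ` T') \<le> card T'"
        by (rule card_image_le[OF finT'])
      ultimately show ?thesis by linarith
    qed
    moreover have "(real (card T'))\<^sup>2 \<le> real (card I) * real (card E)"
      using sum_squared_le_card_mult[OF I(1), of "\<lambda>i. real (f i)"] sum1 sum2
      by (simp flip: of_nat_sum of_nat_power)
    ultimately have "(real (card T'))\<^sup>2 \<le> real (card I) * (real (card T') + (real h - 1)\<^sup>2)"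
      using h0 by (smt (verit) mult_left_mono of_nat_0_le_iff of_nat_add of_nat_diff of_nat_le_iff of_nat_power
          One_nat_def Suc_leI of_nat_1)
    moreover have "real (card T') = real p * real h - 1"
    proof -
      have "p * h \<ge> 1" using p0 h0 by (simp add: Suc_leI)
      then show ?thesis unfolding cardT' by (simp add: of_nat_diff)
    qed
    moreover have "real (card I) = (real p)\<^sup>2 - 1"
      using I(2) p0 h0 by (simp add: of_nat_diff)
    ultimately have "(real p * h - 1)\<^sup>2 \<le> ((real p)\<^sup>2 - 1) * ((real p * h - 1) + (real h - 1)\<^sup>2)"
      by (simp only:)
    \<comment> \<open>The terms \<open>p^2 h^2\<close> cancel. A square of \<open>h\<close> is then
      bounded by \<open>h\<close> times something below \<open>p^3\<close>, against
      \<open>h > p^3\<close>.\<close>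
    then have "(real h)\<^sup>2 + 1 \<le> real h * ((real p) ^ 3 - 2 * (real p)\<^sup>2 + p + 2)"
      by (simp add: algebra_simps power2_eq_square power3_eq_cube)
    moreover have "2 * (real p)\<^sup>2 \<ge> p + 2"
    proof -
      have p2: "real p \<ge> 2" using p_gt by simp
      have "real p * 2 \<le> real p * real p" by (rule mult_left_mono) (use p2 in simp_all)
      then have "2 + real p \<le> 2 * (real p * real p)" using p2 by linarith
      then show ?thesis by (simp add: power2_eq_square)
    qed
    then have "real h * ((real p) ^ 3 - 2 * (real p)\<^sup>2 + p + 2) \<le> real h * (real p) ^ 3"
      by (intro mult_left_mono) auto
    moreover have "real h * (real p) ^ 3 \<le> real h * real h"
      using h by (intro mult_left_mono) (simp_all flip: of_nat_power)
    ultimately show False by (simp add: power2_eq_square)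
  qed
  then obtain x where x: "x \<in> T'" "x ^ h = \<alpha>" "N x ^ h = \<beta>" by (auto simp: c_def)
  then show ?thesis using that[of x "N x"] T'D[OF x(1)] N[of x] N0[OF x(1)] by blast
qed

lemma roots_of_unity_powers: "z ^ p = 1 \<Longrightarrow> \<exists>j. (z :: 'l alg_closure) = W ^ j"
  using primitive_root_prod[OF W, of z 1] p_gt by (auto simp: prod_zero_iff)

end

section \<open>Realising all unit classes\<close>

context descent
begin

text \<open>The divisor consists of the Frobenius conjugates of a point with first coordinate
  \<open>D c\<close>, minus the same number of copies of \<open>(D, 0)\<close>. Its value is the
  norm of \<open>c\<close> to the residue field of \<open>L\<close>. The count makes the power
  character of \<open>c\<close> equal to \<open>W\<close>, and at the same time makes the right-hand
  side of the curve equation a \<open>p\<close>-th power, so that the second coordinate needs no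
  larger field.\<close>

lemma unramified_lower_nonresidue:
  assumes unram: "\<not> int l dvd \<delta>" and k0: "k0 > 0" "q = l ^ k0"
  obtains u e where "u \<in> divisor_values p r d" "e > 0" "T e = T k0 \<inter> range to_ac"
    "to_ac u \<in> T e" "u \<noteq> 0" "p dvd l ^ e - 1" "to_ac u ^ ((l ^ e - 1) div p) = W"
proof -
  have D0: "D \<noteq> 0" using \<delta> by simp
  have D1: "eabs D = 1" using av_of_int_coprime[OF l(1) av_l unram] by (simp add: eabs_of_int)
  \<comment> \<open>A multiple of \<open>k0\<close>, so that residues of \<open>L\<close> and
    \<open>W\<close> lie in \<open>T n\<close>. The factor exceeds \<open>p^4\<close>, so
    \<open>p h = l^n - 1 \<ge> n > p^4\<close> and the count applies.\<close>
  define n where "n = k0 * (p ^ 4 + 1)"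
  have n: "n > 0" using k0 by (simp add: n_def)
  obtain e \<sigma> where e: "e > 0" "e dvd n" "\<sigma> \<in> galois_group" "\<And>x. x \<in> T n \<Longrightarrow> \<sigma> x = x ^ l ^ e"
    "\<And>\<tau>. \<tau> \<in> galois_group \<Longrightarrow> \<exists>a. \<forall>x\<in>T n. \<tau> x = x ^ l ^ (e * a)"
    "T e = T n \<inter> range to_ac" using frobenius_generator[OF n] by metis
  have rat: "T n \<inter> range to_ac = T k0 \<inter> range to_ac"
  proof -
    have "to_ac t \<in> T k0" if "to_ac t \<in> T n" for t
    proof -
      have "av t \<le> 1" using T_le[OF that n] by simp
      then have "eabs (to_ac (t ^ q - t)) < 1" using residue_power by (simp only: eabs_to_ac)
      then have "eabs (to_ac t ^ l ^ k0 - to_ac t) < 1" by (simp add: k0(2))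
      then obtain x where x: "x \<in> T k0" "eabs (to_ac t - x) < 1" using T_lift[OF k0(1)] by blast
      then have "to_ac t = x" using T_discrete[OF that x(1) n k0(1)] by blast
      then show ?thesis using x by simp
    qed
    then show ?thesis using T_mono[of _ k0 "p ^ 4 + 1"] unfolding n_def by blast
  qed
  define q0 where "q0 = l ^ e"
  have q0: "q0 > 1" unfolding q0_def by (rule ln_gt_1[OF e(1)])
  have Wp: "W ^ p = 1" using W by (simp add: primitive_root_of_unity_def)
  have "w ^ q = w"
  proof -
    obtain a where "q = 1 + a * p"
      using q(2) k0 l_gt by (metis cong_le_nat cong_sym mult.commute add.commute one_le_power less_imp_le)
    then show ?thesis using w by (simp add: power_add mult.commute[of a] power_mult primitive_root_of_unity_def)
  qed
  then have "W \<in> T k0" by (simp add: T_def k0(2) flip: to_ac_power)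
  then have We: "W \<in> T e" using e(6) rat by blast
  have W0: "W \<noteq> 0" using Wp p_gt by (auto simp: power_0_left)
  have pq0: "p dvd q0 - 1"
    using primitive_root_of_unity_unique_order[OF W, of "q0 - 1"] T_unit(1)[OF We e(1) W0] p_gt
    by (simp add: q0_def)
  obtain k where k: "n = e * k" using e(2) by (metis dvdE)
  have k_pos: "k > 0" using n k by simp
  have Qk: "l ^ n = q0 ^ k" by (simp add: k q0_def power_mult)
  \<comment> \<open>The norm exponent \<open>1 + q0 + ... + q0^(k-1)\<close>: raising to it maps
    nonzero elements of \<open>T n\<close> into \<open>T e\<close>.\<close>
  define G where "G = (\<Sum>i<k. q0 ^ i)"
  have G: "(q0 - 1) * G = l ^ n - 1"
  proof -
    have "int (q0 - 1) * int G = int q0 ^ k - 1"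
      using power_diff_1_eq[of "int q0" k] q0 by (simp add: G_def of_nat_diff)
    then have "int ((q0 - 1) * G) = int (l ^ n - 1)"
      using ln_gt_1[OF n] by (simp add: Qk of_nat_diff)
    then show ?thesis by linarith
  qed
  define h0 where "h0 = (q0 - 1) div p"
  have h0: "q0 - 1 = p * h0" using pq0 by (simp add: h0_def)
  define h where "h = h0 * G"
  have M: "l ^ n - 1 = p * h" using G unfolding h0 h_def by (simp only: mult.assoc)
  have "p ^ 4 < h * p"
  proof -
    have "n < l ^ n" using power_gt_expt[of l n] l_gt by simp
    moreover have "p ^ 4 + 1 \<le> n" using mult_le_mono1[of 1 k0 "p ^ 4 + 1"] k0 by (simp add: n_def)
    ultimately show ?thesis using M by (simp add: mult.commute)
  qed
  then have hp: "h > p ^ 3" using p_gt by (simp add: power_Suc2[of p 3, simplified] eval_nat_numeral)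
  have eD: "\<exists>d0. d0 \<in> T k0 \<and> eabs (D - d0) < 1"
  proof -
    have "eabs (to_ac (d ^ q - d)) < 1"
      using residue_power[of d] D1 by (simp only: eabs_to_ac) (simp add: eabs_of_int)
    then have "eabs (D ^ l ^ k0 - D) < 1" by (simp add: k0(2))
    then show ?thesis using T_lift[OF k0(1)] by blast
  qed
  then obtain d0 where d0: "d0 \<in> T k0" "eabs (D - d0) < 1" by blast
  have d0n: "d0 \<in> T n" using T_mono[OF d0(1), of "p ^ 4 + 1"] by (simp only: n_def)
  have d0u: "eabs d0 = 1"
    using ext.av_close_eq[of d0 D] d0(2) D1 by (simp add: ext.av_minus_commute)
  then have d00: "d0 \<noteq> 0" by auto
  have d0h: "(d0 ^ h) ^ p = 1"
    using T_unit(1)[OF d0n n d00] M by (simp add: mult.commute flip: power_mult)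
  \<comment> \<open>The value of \<open>y^h\<close> that forces \<open>A^h = 1\<close>, so that all
    \<open>p\<close>-th roots of \<open>A\<close> lie in \<open>T n\<close>.\<close>
  define \<beta> where "\<beta> = inverse ((d0 ^ h) ^ (r + 1) * W ^ r)"
  have "((d0 ^ h) ^ (r + 1)) ^ p = 1" "(W ^ r) ^ p = 1"
    using d0h Wp by (metis mult.commute power_mult power_one)+
  then have \<beta>: "\<beta> ^ p = 1"
    unfolding \<beta>_def power_inverse power_mult_distrib by simp
  obtain c y where cy: "c \<in> T n" "y \<in> T n" "eabs (1 - c - y) < 1" "c \<noteq> 0" "y \<noteq> 0" "c ^ h = W" "y ^ h = \<beta>"
    using residue_count[OF n M hp Wp \<beta>] by metis
  define A where "A = d0 ^ (r + 1) * c ^ r * y"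
  have Ah: "A ^ h = 1"
  proof -
    have sw: "(x ^ a) ^ h = (x ^ h) ^ a" for x :: "'l alg_closure" and a
      by (simp only: mult.commute flip: power_mult)
    have "A ^ h = (d0 ^ h) ^ (r + 1) * (c ^ h) ^ r * y ^ h"
      unfolding A_def power_mult_distrib sw[of d0 "r + 1"] sw[of c r] by (rule refl)
    moreover have "(d0 ^ h) ^ (r + 1) * W ^ r \<noteq> 0" using d00 W0 by simp
    ultimately show ?thesis
      unfolding cy(6,7) \<beta>_def by (metis right_inverse)
  qed
  obtain b1 where b1: "b1 ^ p = A"
    using alg_closed_imp_poly_has_root[of "monom 1 p + [:- A:]"] p_gt
    by (auto simp: poly_monom degree_add_eq_left degree_monom_eq)
  have "b1 ^ (l ^ n - 1) = 1" using Ah b1 unfolding M by (simp add: power_mult)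
  then have b1n: "b1 \<in> T n" by (rule T_I)
  have A1: "eabs A = 1" "A \<noteq> 0"
    using T_unit(2)[OF cy(1) n cy(4)] T_unit(2)[OF cy(2) n cy(5)] d0u d00 cy
    by (auto simp: A_def eabs_mult ext.av_power)
  \<comment> \<open>The exact right-hand side at first coordinate \<open>D c\<close>;
    \<open>A\<close> approximates it by Teichmueller representatives. The root \<open>b1\<close> of
    \<open>A\<close> is corrected by the canonical root of the one-unit
    \<open>B / A\<close>.\<close>
  define B where "B = D ^ (r + 1) * c ^ r * (1 - c)"
  have "eabs (B - A) < 1"
  proof -
    have "eabs (D ^ (r + 1) - d0 ^ (r + 1)) < 1" using d0 D1 d0u by (intro ext.av_power_diff) auto
    then have 1: "eabs (c ^ r * (1 - c) * (D ^ (r + 1) - d0 ^ (r + 1))) < 1"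
    proof -
      have "eabs (c ^ r * (1 - c)) \<le> 1" using T_le[OF cy(1) n] ext.av_diff_le[of 1 1 c]
        by (simp add: eabs_mult ext.av_power mult_le_one power_le_one)
      then show ?thesis using \<open>eabs (D ^ (r + 1) - d0 ^ (r + 1)) < 1\<close>
          mult_left_le_one_le[of "eabs (D ^ (r + 1) - d0 ^ (r + 1))" "eabs (c ^ r * (1 - c))"]
        by (simp add: eabs_mult del: power_Suc)
    qed
    have 2: "eabs (d0 ^ (r + 1) * c ^ r * (1 - c - y)) < 1"
      using cy(3) T_unit(2)[OF cy(1) n cy(4)] d0u by (simp add: eabs_mult ext.av_power)
    have "B - A = c ^ r * (1 - c) * (D ^ (r + 1) - d0 ^ (r + 1)) + d0 ^ (r + 1) * c ^ r * (1 - c - y)"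
      unfolding A_def B_def by (simp add: algebra_simps)
    then show ?thesis using ext.av_add_less[OF 1 2] by (simp only:)
  qed
  then have BA: "eabs (B / A - 1) < 1"
  proof -
    have "B / A - 1 = (B - A) / A" using A1 by (simp add: diff_divide_distrib)
    then show ?thesis using \<open>eabs (B - A) < 1\<close> A1 by (simp only: ext.av_divide div_by_1)
  qed
  define b where "b = b1 * rho (B / A)"
  have bp: "b ^ p = B"
    unfolding b_def power_mult_distrib b1 rho(1)[OF BA] using A1 by simp
  have b10: "eabs b1 = 1"
    using T_unit(2)[OF b1n n] b1 A1 p_gt by (cases "b1 = 0") (auto simp: power_0_left)
  have bb1: "eabs (b - b1) < 1"
  proof -
    have "b - b1 = b1 * (rho (B / A) - 1)" by (simp add: b_def algebra_simps)
    then show ?thesis using rho(2)[OF BA] b10 by (simp only: eabs_mult)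
  qed
  have b0: "eabs b = 1" using ext.av_close_eq[of b b1] bb1 b10 by simp
  have curve: "b ^ p = (D * c) ^ r * (D - D * c)"
    unfolding bp B_def by (simp add: power_mult_distrib algebra_simps)
  define \<sigma>' where "\<sigma>' i = (\<sigma> ^^ i)" for i :: nat
  have \<sigma>': "\<sigma>' i \<in> galois_group" for i
    unfolding \<sigma>'_def
  proof (induction i)
    case 0
    then show ?case using galois_id by (simp add: id_def)
  next
    case (Suc i)
    then show ?case using galois_comp[OF e(3) Suc] by (simp add: comp_def)
  qed
  have \<sigma>'T: "\<sigma>' i x = x ^ q0 ^ i" if x: "x \<in> T n" for i x
  proof (induction i)
    case (Suc i)
    have "\<sigma>' (Suc i) x = \<sigma> (\<sigma>' i x)" by (simp add: \<sigma>'_def)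
    also have "\<dots> = (\<sigma>' i x) ^ l ^ e" using T_galois[OF \<sigma>' x] by (rule e(4))
    finally show ?case using Suc by (simp add: q0_def mult.commute flip: power_mult)
  qed (simp add: \<sigma>'_def)
  define P where "P i = (\<sigma>' i (D * c), \<sigma>' i b)" for i
  have P1: "fst (P i) = D * c ^ q0 ^ i" for i
    using galois_D[OF \<sigma>'] \<sigma>'T[OF cy(1)] by (simp add: P_def rhom_mult[OF galoisD(1)[OF \<sigma>']])
  have Tper: "x ^ q0 ^ (i mod k) = x ^ q0 ^ i" if x: "x \<in> T n" for x i
  proof -
    have "x ^ q0 ^ (k * j) = x" for j
      using T_mono[OF x, of j] by (simp add: T_def k q0_def mult.assoc flip: power_mult)
    then have "x ^ q0 ^ (i mod k) = (x ^ q0 ^ (k * (i div k))) ^ q0 ^ (i mod k)" by simp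
    also have "\<dots> = x ^ q0 ^ (k * (i div k) + i mod k)"
      by (simp only: power_add power_mult[symmetric])
    finally show ?thesis by simp
  qed
  \<comment> \<open>On \<open>T n\<close> each automorphism is a power of the
    \<open>q0\<close>-Frobenius, which shifts the index. The second coordinates are
    \<open>p\<close>-th roots of the same element and are congruent through \<open>b1\<close>, hence
    equal.\<close>
  have stable: "\<exists>a. \<forall>i. (\<tau> (fst (P i)), \<tau> (snd (P i))) = P ((i + a) mod k)" if \<tau>: "\<tau> \<in> galois_group" for \<tau>
  proof -
    obtain a where a: "\<And>x. x \<in> T n \<Longrightarrow> \<tau> x = x ^ q0 ^ a"
      using e(5)[OF \<tau>] by (metis q0_def power_mult)
    have \<tau>\<sigma>: "\<tau> (\<sigma>' i x) = \<sigma>' ((i + a) mod k) x" if x: "x \<in> T n" for i x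
      using a[OF T_galois[OF \<sigma>' x]] \<sigma>'T[OF x] Tper[OF x, of "i + a"]
      by (simp add: power_add flip: power_mult)
    have "(\<tau> (fst (P i)), \<tau> (snd (P i))) = P ((i + a) mod k)" for i
    proof -
      let ?j = "(i + a) mod k" and ?z = "\<tau> (\<sigma>' i b)"
      have h1: "\<tau> (\<sigma>' i (D * c)) = \<sigma>' ?j (D * c)"
        using \<tau>\<sigma>[OF cy(1)] galois_D[OF \<tau>] galois_D[OF \<sigma>']
        by (simp add: rhom_mult[OF galoisD(1)[OF \<sigma>']] rhom_mult[OF galoisD(1)[OF \<tau>]])
      have eq: "?z ^ p = (\<sigma>' ?j b) ^ p"
      proof -
        have "?z ^ p = \<tau> (\<sigma>' i (b ^ p))"
          by (simp add: rhom_power[OF galoisD(1)[OF \<sigma>']] rhom_power[OF galoisD(1)[OF \<tau>]])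
        also have "\<dots> = (\<tau> (\<sigma>' i (D * c))) ^ r * (D - \<tau> (\<sigma>' i (D * c)))"
          unfolding curve
          by (simp only: rhom_simps[OF galoisD(1)[OF \<sigma>']] rhom_simps[OF galoisD(1)[OF \<tau>]]
              galois_D[OF \<tau>] galois_D[OF \<sigma>'])
        also have "\<dots> = \<sigma>' ?j (b ^ p)"
          unfolding curve h1
          by (simp only: rhom_simps[OF galoisD(1)[OF \<sigma>']] galois_D[OF \<sigma>'])
        finally show ?thesis by (simp only: rhom_power[OF galoisD(1)[OF \<sigma>']])
      qed
      have c1: "eabs (?z - \<tau> (\<sigma>' i b1)) < 1" "eabs (\<sigma>' ?j b - \<sigma>' ?j b1) < 1"
        using bb1 by (simp_all add: galois_close[OF \<tau>] galois_close[OF \<sigma>'])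
      have "\<tau> (\<sigma>' i b1) = \<sigma>' ?j b1" by (rule \<tau>\<sigma>[OF b1n])
      then have c2: "eabs (?z - \<sigma>' ?j b) < 1" using ext.av_diff_less[OF c1] by simp
      have u: "eabs (\<sigma>' ?j b) = 1" using b0 eabs_galois[OF \<sigma>'] by simp
      then have nz: "\<sigma>' ?j b \<noteq> 0" by auto
      have "?z / \<sigma>' ?j b - 1 = (?z - \<sigma>' ?j b) / \<sigma>' ?j b"
        using nz by (simp add: diff_divide_distrib)
      then have "eabs (?z / \<sigma>' ?j b - 1) < 1" using c2 u by (simp only: ext.av_divide)
      moreover have "(?z / \<sigma>' ?j b) ^ p = 1"
        unfolding power_divide eq using nz by simp
      ultimately have "?z / \<sigma>' ?j b = 1" using eabs_p ext.root_of_unity_close by blast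
      then show ?thesis using nz h1 by (simp add: P_def)
    qed
    then show ?thesis by blast
  qed
  \<comment> \<open>Indices are counted rather than points, because the conjugates may coincide;
    this keeps the degree of the first part equal to \<open>k\<close>.\<close>
  define m :: "'l alg_closure \<times> 'l alg_closure \<Rightarrow> int" where
    "m s = int (card {i. i < k \<and> P i = s}) - (if s = (D, 0) then int k else 0)" for s
  have supp: "{s. m s \<noteq> 0} \<subseteq> insert (D, 0) (P ` {..<k})"
  proof (rule subsetI, rule ccontr)
    fix s assume s: "s \<in> {s. m s \<noteq> 0}" "s \<notin> insert (D, 0) (P ` {..<k})"
    then have "{i. i < k \<and> P i = s} = {}" by auto
    then show False using s by (simp add: m_def)
  qed
  have finA: "finite (insert (D, 0) (P ` {..<k}))" by simp
  have curveP: "snd (P i) ^ p = fst (P i) ^ r * (D - fst (P i))" for i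
    using arg_cong[OF curve, of "\<sigma>' i"] galois_D[OF \<sigma>']
    by (simp add: P_def rhom_simps[OF galoisD(1)[OF \<sigma>']])
  have bP: "snd (P i) \<noteq> 0" for i
    using b0 eabs_galois[OF \<sigma>', of i b] by (auto simp: P_def)
  have DP: "(D, 0) \<noteq> P i" for i
  proof
    assume "(D, 0) = P i"
    then have "snd (P i) = 0" by (metis snd_conv)
    then show False using bP by blast
  qed
  have inv1: "card {i. i < k \<and> P i = (a, b)} \<le> card {i. i < k \<and> P i = (\<tau> a, \<tau> b)}"
    if \<tau>: "\<tau> \<in> galois_group" for \<tau> a b
  proof -
    obtain t where t: "\<And>i. (\<tau> (fst (P i)), \<tau> (snd (P i))) = P ((i + t) mod k)"
      using stable[OF \<tau>] by blast
    have "inj_on (\<lambda>i. (i + t) mod k) {i. i < k \<and> P i = (a, b)}"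
    proof (rule inj_onI)
      fix i j assume ij: "i \<in> {i. i < k \<and> P i = (a, b)}" "j \<in> {i. i < k \<and> P i = (a, b)}"
        "(i + t) mod k = (j + t) mod k"
      then have "[i + t = j + t] (mod k)" by (simp add: cong_def)
      then have "[i = j] (mod k)" by (simp add: cong_add_rcancel_nat)
      then show "i = j" using ij by (simp add: cong_def)
    qed
    moreover have "(\<lambda>i. (i + t) mod k) ` {i. i < k \<and> P i = (a, b)} \<subseteq> {i. i < k \<and> P i = (\<tau> a, \<tau> b)}"
      using t k_pos by (auto simp flip: t)
    ultimately show ?thesis by (intro card_inj_on_le) auto
  qed
  have "galois_invariant m"
    unfolding galois_invariant_def
  proof (intro ballI allI)
    fix \<tau> :: "'l alg_closure \<Rightarrow> 'l alg_closure" and a b assume \<tau>: "\<tau> \<in> galois_group"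
    have "card {i. i < k \<and> P i = (\<tau> a, \<tau> b)} = card {i. i < k \<and> P i = (a, b)}"
      using inv1[OF \<tau>, of a b] inv1[OF galois_inv[OF \<tau>], of "\<tau> a" "\<tau> b"] galois_inv_apply[OF \<tau>]
      by simp
    moreover have "(\<tau> a, \<tau> b) = (D, 0) \<longleftrightarrow> (a, b) = (D, 0)"
      using rhom_inj[OF galoisD(1)[OF \<tau>]] galois_D[OF \<tau>] rhom_0[OF galoisD(1)[OF \<tau>]]
      by (metis prod.inject)
    ultimately show "m (\<tau> a, \<tau> b) = m (a, b)" by (simp only: m_def)
  qed
  moreover have "(\<Sum>s | m s \<noteq> 0. m s) = 0"
  proof -
    have "(\<Sum>s | m s \<noteq> 0. m s) = (\<Sum>s\<in>insert (D, 0) (P ` {..<k}). m s)"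
      using supp by (intro sum.mono_neutral_left finA) auto
    also have "\<dots> = m (D, 0) + (\<Sum>s\<in>P ` {..<k}. m s)"
      using DP DP[THEN not_sym] by (subst sum.insert) auto
    also have "m (D, 0) = - int k" using DP DP[THEN not_sym] by (auto simp: m_def)
    also have "(\<Sum>s\<in>P ` {..<k}. m s) = (\<Sum>s\<in>P ` {..<k}. int (card {i \<in> {..<k}. P i = s}))"
      using DP DP[THEN not_sym] by (intro sum.cong refl) (auto simp: m_def)
    also have "\<dots> = int k"
      using sum.image_gen[of "{..<k}" "\<lambda>_. 1::nat" P] by (simp flip: of_nat_sum)
    finally show ?thesis by simp
  qed
  moreover have "a \<noteq> 0 \<and> b' ^ p = a ^ r * (to_ac d - a)" if "m (a, b') \<noteq> 0" for a b'
  proof -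
    have D: "to_ac d = D" by simp
    have "(a, b') = (D, 0) \<or> (\<exists>i. (a, b') = P i)" using supp that by blast
    then consider "a = D" "b' = 0" | i where "a = fst (P i)" "b' = snd (P i)" by (metis fst_conv snd_conv)
    then show ?thesis
    proof cases
      case 1
      then show ?thesis using D0 p_gt unfolding D by (simp add: power_0_left)
    next
      case 2
      have "a \<noteq> 0"
      proof
        assume "a = 0"
        then have "snd (P i) ^ p = 0" using curveP[of i] 2 r by (simp add: power_0_left)
        then show False using bP[of i] by simp
      qed
      then show ?thesis unfolding D using curveP[of i] 2 by blast
    qed
  qed
  ultimately have cd: "curve_divisor p r d m"
    unfolding curve_divisor_def using finite_subset[OF supp finA] by blast
  have "divisor_value m = (\<Prod>s\<in>insert (D, 0) (P ` {..<k}). fst s powi m s)"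
    by (rule divisor_value_superset[OF finA supp])
  also have "\<dots> = D powi m (D, 0) * (\<Prod>s\<in>P ` {..<k}. fst s powi m s)"
    using DP DP[THEN not_sym] by (subst prod.insert) auto
  also have "m (D, 0) = - int k" using DP DP[THEN not_sym] by (auto simp: m_def)
  also have "(\<Prod>s\<in>P ` {..<k}. fst s powi m s) = (\<Prod>s\<in>P ` {..<k}. \<Prod>i | i \<in> {..<k} \<and> P i = s. fst (P i))"
  proof (intro prod.cong refl)
    fix s assume "s \<in> P ` {..<k}"
    then have "m s = int (card {i. i < k \<and> P i = s})" using DP DP[THEN not_sym] by (auto simp: m_def)
    then show "fst s powi m s = (\<Prod>i | i \<in> {..<k} \<and> P i = s. fst (P i))" by simp
  qed
  also have "\<dots> = (\<Prod>i<k. fst (P i))" by (rule prod.image_gen[symmetric]) simp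
  also have "\<dots> = D ^ k * c ^ G" by (simp add: P1 prod.distrib G_def power_sum)
  \<comment> \<open>The factor \<open>D^k\<close> of the conjugates cancels against the multiplicity
    \<open>- k\<close> at \<open>(D, 0)\<close>.\<close>
  finally have val: "divisor_value m = c ^ G" using D0 by (simp add: power_int_minus)
  have "divisor_value m \<in> range to_ac"
    unfolding divisor_value_def
    using cd by (intro equivariant_prod[OF char_0]) (auto simp: curve_divisor_def)
  then obtain u where u: "to_ac u = c ^ G" using val by auto
  have "u \<in> divisor_values p r d"
    unfolding divisor_values_def using cd u val by auto
  moreover have "to_ac u \<in> T e"
  proof (rule T_I)
    show "to_ac u ^ (l ^ e - 1) = 1" using T_unit(1)[OF cy(1) n cy(4)] G unfolding u
      by (simp add: q0_def mult.commute flip: power_mult)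
  qed
  moreover have "to_ac u ^ h0 = W"
    unfolding u using cy(6) by (simp add: h_def mult.commute flip: power_mult)
  moreover have "u \<noteq> 0" using u cy(4) by auto
  ultimately show ?thesis using that[of u e] e(1,6) rat pq0 by (simp add: q0_def h0_def)
qed

text \<open>The unit \<open>v\<close> is congruent to some \<open>x\<close> in \<open>T e\<close>,
  whose power character is some \<open>W^j\<close>. Dividing by \<open>u^j\<close> trivialises the
  character, so a \<open>p\<close>-th root lies in \<open>T e\<close>, and what remains is a
  one-unit, again a \<open>p\<close>-th power.\<close>

lemma unramified_lower:
  assumes unram: "\<not> int l dvd \<delta>" and v: "av v = 1"
  obtains u z where "u \<in> divisor_values p r d" "z \<noteq> 0" "v = u * z ^ p"
proof -
  obtain k0 where k0: "k0 > 0" "q = l ^ k0" using q by blast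
  obtain u e where u: "u \<in> divisor_values p r d" "e > 0" "T e = T k0 \<inter> range to_ac"
    "to_ac u \<in> T e" "u \<noteq> 0" "p dvd l ^ e - 1" "to_ac u ^ ((l ^ e - 1) div p) = W"
    using unramified_lower_nonresidue[OF unram k0] .
  let ?h = "(l ^ e - 1) div p"
  have hp: "?h * p = l ^ e - 1" using u(6) by simp
  obtain x where x: "x \<in> T k0" "eabs (to_ac v - x) < 1"
  proof -
    have "eabs (to_ac (v ^ q - v)) < 1" using residue_power[of v] v by (simp only: eabs_to_ac)
    then have "eabs (to_ac v ^ l ^ k0 - to_ac v) < 1" by (simp add: k0(2))
    then show ?thesis using T_lift[OF k0(1)] that by blast
  qed
  have "x \<in> range to_ac"
  proof (rule galois_fixed[OF char_0])
    fix \<tau> :: "'l alg_closure \<Rightarrow> 'l alg_closure" assume \<tau>: "\<tau> \<in> galois_group"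
    have "eabs (to_ac v - \<tau> x) < 1"
      using galois_close[OF \<tau>, of "to_ac v" x] x(2) galoisD(3)[OF \<tau>] by simp
    then have "eabs (\<tau> x - x) < 1"
      using ext.av_diff_trans_less x(2) ext.av_minus_commute by metis
    then show "\<tau> x = x" using T_discrete[OF T_galois[OF \<tau> x(1)] x(1)] k0 by blast
  qed
  then have xe: "x \<in> T e" using x u(3) by blast
  have x1: "eabs x = 1"
    using ext.av_close_eq[of x "to_ac v"] x(2) v by (simp add: ext.av_minus_commute)
  then have x0: "x \<noteq> 0" by auto
  have "(x ^ ?h) ^ p = 1" using T_unit(1)[OF xe u(2) x0] hp by (simp flip: power_mult)
  then obtain j where j: "x ^ ?h = W ^ j" using roots_of_unity_powers by blast
  define y where "y = x / to_ac u ^ j"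
  have u1: "eabs (to_ac u) = 1" using T_unit(2)[OF u(4) u(2)] u(5) by simp
  have W0: "W \<noteq> 0" using w p_gt by (auto simp: primitive_root_of_unity_def power_0_left)
  have yh: "y ^ ?h = 1"
  proof -
    have "(to_ac u ^ j) ^ ?h = (to_ac u ^ ?h) ^ j" by (simp only: mult.commute flip: power_mult)
    then show ?thesis using u(7) W0 j by (simp add: y_def power_divide)
  qed
  obtain b where b: "b ^ p = y" using alg_closed_imp_poly_has_root[of "monom 1 p + [:- y:]"] p_gt
    by (auto simp: poly_monom degree_add_eq_left degree_monom_eq)
  have "b ^ (l ^ e - 1) = 1" using yh b by (metis hp mult.commute power_mult)
  then have "b \<in> T e" by (rule T_I)
  then obtain b' where b': "b = to_ac b'" using u(3) by blast
  have y1: "eabs y = 1" using x1 u1 by (simp add: y_def ext.av_divide ext.av_power)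
  have "to_ac v / (to_ac u ^ j * b ^ p) = to_ac v / x" using u(5) by (simp add: b y_def)
  moreover have "to_ac v / x - 1 = (to_ac v - x) / x" using x0 by (simp add: diff_divide_distrib)
  moreover have "to_ac (v / (u ^ j * b' ^ p) - 1) = to_ac v / (to_ac u ^ j * b ^ p) - 1"
    by (simp add: b')
  ultimately have "eabs (to_ac (v / (u ^ j * b' ^ p) - 1)) = eabs ((to_ac v - x) / x)"
    by (simp only:)
  then have "eabs (to_ac (v / (u ^ j * b' ^ p) - 1)) < 1"
    using x(2) x1 by (simp only: ext.av_divide div_by_1)
  then have "av (v / (u ^ j * b' ^ p) - 1) < 1" by (simp only: eabs_to_ac)
  then obtain z where z: "z ^ p = v / (u ^ j * b' ^ p)" "av (z - 1) < 1"
    using pth_root_one_unit by blast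
  have b0: "b' \<noteq> 0" using y1 b b' p_gt by (auto simp: power_0_left)
  have "v = u ^ j * (b' * z) ^ p"
    unfolding power_mult_distrib z(1) using u(5) b0 by simp
  moreover have "u ^ j \<in> divisor_values p r d"
    using divisor_values_powi[OF u(1), of "int j"] by simp
  moreover have "b' * z \<noteq> 0" using b0 z(2) by auto
  ultimately show ?thesis using that by blast
qed

end

section \<open>The function field of the curve\<close>

text \<open>Substitution of Laurent series \<open>U\<close>, \<open>Y\<close> for the two variables;
  along a parametrisation of the curve, the order of the result is the valuation of a point.\<close>

definition eval2 :: "'a::field fls \<Rightarrow> 'a fls \<Rightarrow> 'a poly poly \<Rightarrow> 'a fls" where
  "eval2 U Y g = poly (map_poly (\<lambda>c. poly (map_poly fls_const c) U) g) Y"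

abbreviation "polyx \<equiv> [:[:0, 1:]:]"
abbreviation "polyy \<equiv> [:0, 1:]"

lemma rhom_fls_const: "rhom (fls_const :: 'a::field \<Rightarrow> 'a fls)"
  by (rule rhomI) (simp_all add: fls_plus_const fls_const_mult_const)

lemma rhom_eval_x: "rhom (\<lambda>c. poly (map_poly fls_const c) (U :: 'a::field fls))"
  by (rule rhom_poly_map[OF rhom_fls_const])

lemma rhom_eval2: "rhom (eval2 U Y)"
  unfolding eval2_def by (rule rhom_poly_map[OF rhom_eval_x])

lemma eval2_const: "eval2 U Y [:c:] = poly (map_poly fls_const c) U"
  by (simp add: eval2_def map_poly_pCons_rhom[OF rhom_eval_x])

lemma eval2_const_const: "eval2 U Y [:[:c:]:] = fls_const c"
  by (simp add: eval2_const map_poly_pCons_rhom[OF rhom_fls_const])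

lemma eval2_x: "eval2 U Y polyx = U"
  by (simp add: eval2_const map_poly_pCons_rhom[OF rhom_fls_const])

lemma eval2_y: "eval2 U Y polyy = Y"
  by (simp add: eval2_def map_poly_pCons_rhom[OF rhom_eval_x] rhom_0[OF rhom_eval_x] rhom_1[OF rhom_eval_x])

text \<open>Terms of different valuation cannot cancel. The valuation is abstract here, to serve
  orders of Laurent series as well as points of the curve.\<close>

lemma sum_distinct_valuation:
  fixes v :: "'a::comm_monoid_add \<Rightarrow> int"
  assumes min: "\<And>a b. a \<in> S \<Longrightarrow> b \<in> S \<Longrightarrow> v a \<noteq> v b \<Longrightarrow> a + b \<in> S \<and> v (a + b) = min (v a) (v b)"
    and J: "finite J" "J \<noteq> {}" "\<And>j. j \<in> J \<Longrightarrow> f j \<in> S" "inj_on (\<lambda>j. v (f j)) J"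
  shows "(\<Sum>j\<in>J. f j) \<in> S \<and> v (\<Sum>j\<in>J. f j) = Min ((\<lambda>j. v (f j)) ` J)"
  using J
proof (induction J rule: finite_ne_induct)
  case (insert x J)
  have IH: "(\<Sum>j\<in>J. f j) \<in> S" "v (\<Sum>j\<in>J. f j) = Min ((\<lambda>j. v (f j)) ` J)"
    using insert by (auto simp: inj_on_def)
  have "Min ((\<lambda>j. v (f j)) ` J) \<in> (\<lambda>j. v (f j)) ` J"
    using insert by (intro Min_in) auto
  then have "v (f x) \<noteq> v (\<Sum>j\<in>J. f j)"
    using IH(2) insert.prems(2) insert.hyps(3) by (auto simp: inj_on_def)
  then show ?case using min[of "f x" "\<Sum>j\<in>J. f j"] insert IH by (simp add: Min_insert)
qed auto

lemma fls_subdegree_add_distinct: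
  assumes "a \<noteq> 0" "b \<noteq> 0" "fls_subdegree a \<noteq> fls_subdegree (b :: 'a::field fls)"
  shows "a + b \<noteq> 0 \<and> fls_subdegree (a + b) = min (fls_subdegree a) (fls_subdegree b)"
proof -
  have *: "a + b \<noteq> 0 \<and> fls_subdegree (a + b) = fls_subdegree a"
    if "fls_subdegree a < fls_subdegree b" "a \<noteq> 0" for a b :: "'a fls"
  proof -
    have "fls_nth (a + b) (fls_subdegree a) \<noteq> 0" using that by simp
    moreover have "fls_nth (a + b) k = 0" if "k < fls_subdegree a" for k
      using that \<open>fls_subdegree a < fls_subdegree b\<close> by simp
    ultimately show ?thesis by (metis fls_subdegree_eqI fls_zero_nth)
  qed
  show ?thesis
    using *[of a b] *[of b a] assms by (cases "fls_subdegree a < fls_subdegree b") (auto simp: add.commute)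
qed

lemma fls_sum_distinct_subdegree:
  fixes f :: "'b \<Rightarrow> 'a::field fls"
  assumes "finite J" "J \<noteq> {}" "\<And>j. j \<in> J \<Longrightarrow> f j \<noteq> 0" "inj_on (\<lambda>j. fls_subdegree (f j)) J"
  shows "(\<Sum>j\<in>J. f j) \<noteq> 0 \<and> fls_subdegree (\<Sum>j\<in>J. f j) = Min ((\<lambda>j. fls_subdegree (f j)) ` J)"
  using sum_distinct_valuation[of "{f. f \<noteq> 0}" fls_subdegree J f] fls_subdegree_add_distinct assms by auto

lemma poly_as_sum_support:
  fixes c :: "'a::comm_ring_1 poly"
  assumes h: "rhom h"
  shows "poly (map_poly h c) x = (\<Sum>i | coeff c i \<noteq> 0. h (coeff c i) * x ^ i)"
proof -
  have "poly (map_poly h c) x = (\<Sum>i\<le>degree c. h (coeff c i) * x ^ i)"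
  proof -
    have d: "degree (map_poly h c) \<le> degree c"
      by (intro degree_le) (simp add: coeff_map_poly coeff_eq_0 rhom_0[OF h])
    have "poly (map_poly h c) x = (\<Sum>i\<le>degree (map_poly h c). coeff (map_poly h c) i * x ^ i)"
      by (simp add: poly_altdef)
    also have "\<dots> = (\<Sum>i\<le>degree c. coeff (map_poly h c) i * x ^ i)"
      using d by (intro sum.mono_neutral_left) (auto simp: coeff_eq_0)
    finally show ?thesis by (simp add: coeff_map_poly rhom_0[OF h])
  qed
  also have "\<dots> = (\<Sum>i | coeff c i \<noteq> 0. h (coeff c i) * x ^ i)"
    by (rule sum.mono_neutral_right) (auto simp: le_degree rhom_0[OF h])
  finally show ?thesis .
qed

lemma finite_coeff_support: "finite {i. coeff c i \<noteq> 0}"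
  by (rule finite_subset[of _ "{..degree c}"]) (auto simp: le_degree)

lemma eval_x_subdegree:
  fixes U :: "'a::field fls"
  assumes U: "fls_subdegree U = s" "s \<noteq> 0" and c: "c \<noteq> 0"
  shows "poly (map_poly fls_const c) U \<noteq> 0" "s dvd fls_subdegree (poly (map_poly fls_const c) U)"
proof -
  have X0: "U \<noteq> 0" using U by auto
  let ?J = "{i. coeff c i \<noteq> 0}" and ?f = "\<lambda>i. fls_const (coeff c i) * U ^ i"
  have sd: "fls_subdegree (?f i) = int i * s" if "i \<in> ?J" for i
    using that U X0 by (simp add: fls_subdegree_pow)
  have "coeff c (degree c) \<noteq> 0" using c by simp
  then have J: "finite ?J" "?J \<noteq> {}" by (blast intro: finite_coeff_support)+
  have *: "(\<Sum>i\<in>?J. ?f i) \<noteq> 0 \<and> fls_subdegree (\<Sum>i\<in>?J. ?f i) = Min ((\<lambda>i. fls_subdegree (?f i)) ` ?J)"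
    using J X0 sd U by (intro fls_sum_distinct_subdegree) (auto simp: inj_on_def)
  have "Min ((\<lambda>i. fls_subdegree (?f i)) ` ?J) \<in> (\<lambda>i. fls_subdegree (?f i)) ` ?J"
    using J by (intro Min_in) auto
  then show "poly (map_poly fls_const c) U \<noteq> 0" "s dvd fls_subdegree (poly (map_poly fls_const c) U)"
    unfolding poly_as_sum_support[OF rhom_fls_const] using * sd by auto
qed

text \<open>After the translation by \<open>a\<close>, powers of \<open>U - a\<close> have distinct
  orders and no cancellation is possible; so \<open>U\<close> is transcendental over the
  constants.\<close>

lemma eval_x_nonzero:
  fixes U :: "'a::field fls"
  assumes U: "fls_subdegree (U - fls_const a) \<noteq> 0" and c: "c \<noteq> 0"
  shows "poly (map_poly fls_const c) U \<noteq> 0"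
proof -
  have "poly (map_poly fls_const c) U = poly (map_poly fls_const (pcompose c [:a, 1:])) (U - fls_const a)"
  proof (rule rhom_poly_eqI[OF rhom_eval_x])
    show "rhom (\<lambda>c. poly (map_poly fls_const (pcompose c [:a, 1:])) (U - fls_const a))"
      by (rule rhom_comp[OF rhom_eval_x rhom_pcompose])
  qed (simp_all add: map_poly_pCons_rhom[OF rhom_fls_const] pcompose_pCons)
  moreover have "pcompose c [:a, 1:] \<noteq> 0" using c by (simp add: pcompose_eq_0_iff)
  ultimately show ?thesis using eval_x_subdegree(1)[OF refl U] by simp
qed

locale superelliptic =
  fixes p r :: nat and d w :: "'a::alg_closed_field"
  assumes p: "prime p" "odd p" and r: "1 \<le> r" "r \<le> p - 2" and d: "d \<noteq> 0"
    and char: "of_nat p \<noteq> (0 :: 'a)" and w: "primitive_root_of_unity p w"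
begin

definition A :: "'a poly" where "A = [:0, 1:] ^ r * [:d, -1:]"
abbreviation F :: "'a poly poly" where "F \<equiv> curve_poly p r d"

lemma F_eq: "F = polyy ^ p - [:A:]" by (simp add: curve_poly_def A_def)

lemma poly_A: "poly A a = a ^ r * (d - a)" by (simp add: A_def algebra_simps)

lemma p_gt_2: "p > 2"
  using p by (metis prime_gt_1_nat dvd_refl le_neq_implies_less less_eq_Suc_le numeral_2_eq_2 One_nat_def)

lemma p_pos: "p > 0" using p_gt_2 by simp

lemma wp: "w ^ p = 1" and w0: "w \<noteq> 0"
  using w p_pos by (auto simp: primitive_root_of_unity_def power_0_left)

lemma F_monom: "F = monom 1 p + [:- A:]" by (simp add: F_eq monom_altdef)

lemma degree_F: "degree F = p"
  unfolding F_monom using p_pos by (subst degree_add_eq_left) (simp_all add: degree_monom_eq)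

lemma coeff_F: "coeff F p = 1"
  unfolding F_monom using p_pos by (simp add: coeff_pCons split: nat.split)

lemma F_not_dvd:
  assumes "g \<noteq> 0" "degree g < p"
  shows "\<not> F dvd g" using dvd_imp_degree_le[of F g] assms by (auto simp: degree_F)

lemma F_not_dvd_const: "c \<noteq> 0 \<Longrightarrow> \<not> F dvd [:c:]"
  using p_pos by (intro F_not_dvd) auto

lemma reduce_mod_F: "\<exists>h. F dvd g - h \<and> degree h < p"
proof (induction g)
  case 0
  then show ?case using p_pos by (intro exI[of _ 0]) simp
next
  case (pCons a g)
  then obtain h where h: "F dvd g - h" "degree h < p" by blast
  define c where "c = coeff h (p - 1)"
  define k where "k = pCons a h - Polynomial.smult c F"
  have "pCons a g - k = polyy * (g - h) + Polynomial.smult c F" by (simp add: k_def)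
  then have "F dvd pCons a g - k" by (simp only:) (intro dvd_add dvd_mult dvd_smult dvd_refl h(1))
  moreover have "coeff k i = 0" if "i \<ge> p" for i
  proof (cases "i = p")
    case True
    then show ?thesis using p_pos coeff_F by (cases p) (auto simp: k_def c_def)
  next
    case False
    then have "coeff F i = 0" "coeff (pCons a h) i = 0"
      using that h(2) by (auto simp: degree_F coeff_eq_0 coeff_pCons split: nat.split)
    then show ?thesis by (simp add: k_def)
  qed
  then have "degree k < p" using p_pos by (intro le_less_trans[OF degree_le[of "p - 1"]]) auto
  ultimately show ?case by blast
qed

text \<open>The second condition makes \<open>U\<close> nonconstant: the order of the zero series is
  0 by convention, and so is that of a nonzero constant.\<close>

definition par :: "'a fls \<Rightarrow> 'a fls \<Rightarrow> bool" where
  "par U Y \<longleftrightarrow> Y ^ p = U ^ r * (fls_const d - U) \<and> (\<exists>a. fls_subdegree (U - fls_const a) \<noteq> 0)"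

lemma par_nonzero: "par U Y \<Longrightarrow> c \<noteq> 0 \<Longrightarrow> poly (map_poly fls_const c) U \<noteq> 0"
  using eval_x_nonzero by (auto simp: par_def)

lemma eval2_F:
  assumes "par U Y"
  shows "eval2 U Y F = 0"
proof -
  have "poly (map_poly fls_const A) U = U ^ r * (fls_const d - U)"
    unfolding A_def rhom_mult[OF rhom_map_poly[OF rhom_fls_const]] rhom_power[OF rhom_map_poly[OF rhom_fls_const]]
    by (simp add: map_poly_pCons_rhom[OF rhom_fls_const] rhom_minus[OF rhom_fls_const] algebra_simps)
  then show ?thesis
    using assms by (simp add: F_eq rhom_simps[OF rhom_eval2] eval2_y eval2_const par_def)
qed

lemma eval2_dvd: "par U Y \<Longrightarrow> F dvd g \<Longrightarrow> eval2 U Y g = 0"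
  using eval2_F by (auto elim!: dvdE simp: rhom_mult[OF rhom_eval2])

lemma coprime_r: "coprime p r" and coprime_r1: "coprime p (r + 1)"
  using r p_gt_2 by (auto intro!: prime_imp_coprime[OF p(1)] dest: dvd_imp_le)

text \<open>Coefficients in \<open>x\<close> have order divisible by \<open>p\<close>, while the
  multiples \<open>j * ord Y\<close> for \<open>j < p\<close> are distinct modulo \<open>p\<close>.
  So the terms of a reduced \<open>g\<close> have distinct orders and cannot sum to zero.\<close>

lemma eval2_distinct_kernel:
  assumes U: "fls_subdegree U = int p * m" "m \<noteq> 0" and Y: "Y \<noteq> 0" "coprime (int p) (fls_subdegree Y)"
    and g: "degree g < p" "eval2 U Y g = 0"
  shows "g = 0"
proof (rule ccontr)
  assume "g \<noteq> 0"
  let ?J = "{j. coeff g j \<noteq> 0}" and ?f = "\<lambda>j. poly (map_poly fls_const (coeff g j)) U * Y ^ j"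
  have ps: "int p * m \<noteq> 0" using U p_pos by simp
  have nz: "?f j \<noteq> 0" if "j \<in> ?J" for j
    using eval_x_subdegree(1)[OF U(1) ps] Y(1) that by simp
  have "coeff g (degree g) \<noteq> 0" using \<open>g \<noteq> 0\<close> by simp
  then have J: "finite ?J" "?J \<noteq> {}" by (blast intro: finite_coeff_support)+
  have "inj_on (\<lambda>j. fls_subdegree (?f j)) ?J"
  proof (rule inj_onI)
    fix i j assume ij: "i \<in> ?J" "j \<in> ?J" "fls_subdegree (?f i) = fls_subdegree (?f j)"
    have lt: "k < p" if "k \<in> ?J" for k using that g(1) le_degree[of g k] by simp
    have sd: "\<exists>k. fls_subdegree (?f i) = int p * k + int i * fls_subdegree Y" if i: "i \<in> ?J" for i
    proof -
      have "int p dvd fls_subdegree (poly (map_poly fls_const (coeff g i)) U)"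
        using eval_x_subdegree(2)[OF U(1) ps, of "coeff g i"] i dvd_trans by fastforce
      then show ?thesis using nz[OF i] by (auto simp: fls_subdegree_pow elim!: dvdE)
    qed
    obtain k k' where "fls_subdegree (?f i) = int p * k + int i * fls_subdegree Y"
      "fls_subdegree (?f j) = int p * k' + int j * fls_subdegree Y" using sd ij by metis
    then have "int p * (k - k') = (int j - int i) * fls_subdegree Y"
      using ij(3) by (simp add: algebra_simps)
    then have "int p dvd (int j - int i) * fls_subdegree Y" by (metis dvd_triv_left)
    then have "int p dvd int j - int i" using Y(2) by (simp add: coprime_dvd_mult_left_iff)
    moreover have "\<bar>int j - int i\<bar> < int p" using lt[OF ij(1)] lt[OF ij(2)] by simp
    ultimately show "i = j"
      using zdvd_not_zless[of "\<bar>int j - int i\<bar>" "int p"] by (cases "i = j") auto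
  qed
  then have "(\<Sum>j\<in>?J. ?f j) \<noteq> 0"
    using fls_sum_distinct_subdegree[OF J, of ?f] nz by blast
  then show False using g(2) unfolding eval2_def poly_as_sum_support[OF rhom_eval_x] by simp
qed

definition tau :: "nat \<Rightarrow> 'a poly poly \<Rightarrow> 'a poly poly" where
  "tau j g = pcompose g [:0, [:w ^ j:]:]"

lemma rhom_tau: "rhom (tau j)"
  unfolding tau_def by (rule rhom_pcompose)

lemma tau_const: "tau j [:c:] = [:c:]" and tau_y: "tau j polyy = [:[:w ^ j:]:] * polyy"
  by (simp_all add: tau_def pcompose_pCons)

lemma tau_tau: "tau i (tau j g) = tau (i + j) g"
  by (rule rhom_poly_eqI[OF rhom_comp[OF rhom_tau rhom_tau] rhom_tau])
     (simp_all add: tau_def pcompose_pCons power_add mult.commute)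

lemma tau_mod: "tau (j mod p) g = tau j g"
proof -
  have "w ^ j = w ^ (j mod p)"
    using wp by (metis mod_mult_div_eq mult_1_right power_add power_mult power_one)
  then show ?thesis by (simp add: tau_def)
qed

lemma tau_0: "tau 0 g = g"
  unfolding tau_def using pcompose_idR[of g] by (simp add: one_pCons)

lemma tau_F: "tau j F = F"
proof -
  have "(w ^ j) ^ p = 1" using wp by (metis mult.commute power_mult power_one)
  then have "([:[:w ^ j:]:] * polyy :: 'a poly poly) ^ p = polyy ^ p"
    unfolding power_mult_distrib by (simp add: poly_const_pow flip: one_pCons)
  then show ?thesis
    unfolding F_eq rhom_diff[OF rhom_tau] rhom_power[OF rhom_tau] tau_y tau_const by simp
qed

lemma tau_dvd: "F dvd tau j g \<longleftrightarrow> F dvd g"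
proof
  assume "F dvd g"
  then show "F dvd tau j g" using rhom_dvd[OF rhom_tau, of F g j] by (simp add: tau_F)
next
  assume "F dvd tau j g"
  then have "F dvd tau (j * (p - 1)) (tau j g)"
    using rhom_dvd[OF rhom_tau, of F "tau j g" "j * (p - 1)"] by (simp add: tau_F)
  moreover have "j * (p - 1) + j = p * j" using p_pos by (cases p) auto
  ultimately show "F dvd g" using tau_mod[of "p * j" g] by (simp add: tau_tau tau_0)
qed

text \<open>The norm of \<open>g\<close> to the field of rational functions in \<open>x\<close>: only the powers \<open>y\<^sup>p\<^sup>i \<equiv> A\<^sup>i\<close> occur in
  the product of the conjugates of \<open>g\<close>.\<close>

lemma norm_exists: "\<exists>N. F dvd (\<Prod>j<p. tau j g) - [:N:]"
proof -
  define G where "G = (\<Prod>j<p. tau j g)"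
  have "tau 1 G = (\<Prod>j<p. tau (Suc j) g)" by (simp add: G_def rhom_prod[OF rhom_tau] tau_tau)
  also have "\<dots> = G"
  proof (cases "g = 0")
    case False
    have "tau 0 g * (\<Prod>j<p. tau (Suc j) g) = G * tau p g"
      using prod.lessThan_Suc_shift[of "\<lambda>j. tau j g" p] by (simp only: prod.lessThan_Suc G_def)
    then show ?thesis using tau_mod[of p g] False by (simp add: tau_0)
  qed (use p_pos in \<open>simp add: G_def rhom_0[OF rhom_tau]\<close>)
  finally have inv: "tau 1 G = G" .
  have co: "coeff (tau 1 h) i = [:w ^ i:] * coeff h i" for h i
    by (simp add: tau_def coeff_pcompose_linear poly_const_pow)
  have zero: "coeff G i = 0" if "\<not> p dvd i" for i
  proof -
    have "w ^ i \<noteq> 1" using primitive_root_of_unity_unique_order[OF w p_pos] that by blast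
    moreover have "[:w ^ i:] * coeff G i = coeff G i" using co[of G i] by (simp only: inv)
    then have "Polynomial.smult (w ^ i - 1) (coeff G i) = 0" by (simp add: smult_diff_left)
    ultimately show ?thesis by simp
  qed
  have "\<exists>N. F dvd monom (coeff G i) i - [:N:]" for i
  proof (cases "p dvd i")
    case True
    then obtain j where j: "i = p * j" by blast
    have "F dvd (polyy ^ p) ^ j - [:A:] ^ j"
      using power_diff_sumr2[of "polyy ^ p" j "[:A:]"] by (simp add: F_eq)
    then have "F dvd [:coeff G i:] * ((polyy ^ p) ^ j - [:A:] ^ j)" by (rule dvd_mult)
    moreover have "[:coeff G i:] * ((polyy ^ p) ^ j - [:A:] ^ j) = monom (coeff G i) i - [:coeff G i * A ^ j:]"
      by (simp add: j monom_altdef power_mult poly_const_pow smult_diff_right)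
    ultimately show ?thesis by metis
  next
    case False
    then show ?thesis by (intro exI[of _ 0]) (simp add: zero)
  qed
  then obtain n where n: "\<And>i. F dvd monom (coeff G i) i - [:n i:]" by metis
  have "F dvd (\<Sum>i\<le>degree G. monom (coeff G i) i - [:n i:])" by (intro dvd_sum n)
  also have "\<dots> = G - [:\<Sum>i\<le>degree G. n i:]"
    unfolding sum_subtractf poly_as_sum_of_monoms by (simp add: rhom_sum[OF rhom_const_poly])
  finally show ?thesis unfolding G_def[symmetric] by blast
qed

definition nm :: "'a poly poly \<Rightarrow> 'a poly" where
  "nm g = (SOME N. F dvd (\<Prod>j<p. tau j g) - [:N:])"

lemma nm: "F dvd (\<Prod>j<p. tau j g) - [:nm g:]"
  unfolding nm_def by (rule someI_ex[OF norm_exists])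

end

lemma rhom_fps_to_fls: "rhom (fps_to_fls :: 'a::field fps \<Rightarrow> 'a fls)"
  by (rule rhomI) (simp_all add: fls_times_fps_to_fls)

text \<open>Local expansions at \<open>(0,0)\<close> and at infinity, with \<open>k\<close> and
  \<open>e\<close> from Bezout: \<open>x = d^k t^p\<close>, \<open>y = d^e t^r S0\<close>,
  respectively \<open>x = t^(-p)\<close>, \<open>y = - t^(-r-1) Si\<close>. The scaling by powers of
  \<open>d\<close>, rather than by roots of it, keeps all leading coefficients rational over the
  ground field.\<close>

locale superelliptic_expansion = superelliptic p r d w for p r and d w :: "'a::alg_closed_field" +
  fixes k e :: nat and S0 Si :: "'a fps"
  assumes ke: "k \<ge> 1" "r * k + 1 = p * e"
    and S0: "S0 ^ p = 1 - fps_const (d ^ (k - 1)) * fps_X ^ p" "S0 $ 0 = 1"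
    and Si: "Si ^ p = 1 - fps_const d * fps_X ^ p" "Si $ 0 = 1"
begin

definition U0 :: "'a fls" where "U0 = fls_const (d ^ k) * fls_X ^ p"
definition Y0 :: "'a fls" where "Y0 = fls_const (d ^ e) * fls_X ^ r * fps_to_fls S0"
definition Ui :: "'a fls" where "Ui = fls_X_inv ^ p"
definition Yi :: "'a fls" where "Yi = - (fls_X_inv ^ (r + 1) * fps_to_fls Si)"

lemma S_subdegree: "fls_subdegree (fps_to_fls S0) = 0" "fls_subdegree (fps_to_fls Si) = 0"
  and S_nonzero: "S0 \<noteq> 0" "Si \<noteq> 0"
proof -
  show "S0 \<noteq> 0" "Si \<noteq> 0" using S0(2) Si(2) by auto
  have "subdegree S0 = 0" "subdegree Si = 0" using S0(2) Si(2) by (simp_all add: subdegree_eq_0_iff)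
  then show "fls_subdegree (fps_to_fls S0) = 0" "fls_subdegree (fps_to_fls Si) = 0"
    by (simp_all add: fls_subdegree_fls_to_fps)
qed

lemma subdegrees: "fls_subdegree U0 = int p" "fls_subdegree Y0 = int r"
    "fls_subdegree Ui = - int p" "fls_subdegree Yi = - int (r + 1)"
  and nonzero: "U0 \<noteq> 0" "Y0 \<noteq> 0" "Ui \<noteq> 0" "Yi \<noteq> 0"
proof -
  show nz: "U0 \<noteq> 0" "Y0 \<noteq> 0" "Ui \<noteq> 0" "Yi \<noteq> 0"
    using d S_nonzero by (simp_all add: U0_def Y0_def Ui_def Yi_def)
  show "fls_subdegree U0 = int p" "fls_subdegree Y0 = int r"
    "fls_subdegree Ui = - int p" "fls_subdegree Yi = - int (r + 1)" using d S_nonzero S_subdegree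
    by (simp_all add: U0_def Y0_def Ui_def Yi_def fls_subdegree_pow del: power_Suc)
qed

lemma fls_S: "fps_to_fls S0 ^ p = 1 - fls_const (d ^ (k - 1)) * fls_X ^ p"
    "fps_to_fls Si ^ p = 1 - fls_const d * fls_X ^ p"
  using arg_cong[OF S0(1), of fps_to_fls] arg_cong[OF Si(1), of fps_to_fls]
  by (simp_all add: rhom_simps[OF rhom_fps_to_fls])

lemma par0: "par U0 Y0"
  unfolding par_def
proof
  have 1: "fls_const (d ^ e) ^ p = fls_const (d ^ k) ^ r * fls_const d"
  proof -
    have "(d ^ e) ^ p = d ^ (r * k + 1)" by (simp only: ke(2) mult.commute[of p] power_mult)
    also have "\<dots> = (d ^ k) ^ r * d"
      by (simp only: power_add power_one_right mult.commute[of r] power_mult)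
    finally show ?thesis by (simp only: fls_const_power[symmetric] fls_const_mult_const)
  qed
  have 2: "fls_const d * fls_const (d ^ (k - 1)) = fls_const (d ^ k)"
    using ke(1) by (simp add: fls_const_mult_const flip: power_Suc)
  have "Y0 ^ p = (fls_const (d ^ k) ^ r * fls_const d) * (fls_X ^ r) ^ p * (1 - fls_const (d ^ (k - 1)) * fls_X ^ p)"
    by (simp only: Y0_def power_mult_distrib 1 fls_S)
  also have "(fls_X ^ r) ^ p = (fls_X ^ p :: 'a fls) ^ r"
    by (simp only: mult.commute flip: power_mult)
  also have "(fls_const (d ^ k) ^ r * fls_const d) * (fls_X ^ p) ^ r * (1 - fls_const (d ^ (k - 1)) * fls_X ^ p)
     = (fls_const (d ^ k) * fls_X ^ p) ^ r * (fls_const d - (fls_const d * fls_const (d ^ (k - 1))) * fls_X ^ p)"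
    by (simp only: power_mult_distrib) (simp only: algebra_simps mult_1_left)
  also have "\<dots> = U0 ^ r * (fls_const d - U0)" by (simp only: 2 U0_def)
  finally show "Y0 ^ p = U0 ^ r * (fls_const d - U0)" .
  show "\<exists>a. fls_subdegree (U0 - fls_const a) \<noteq> 0"
    using p_pos by (intro exI[of _ 0]) (simp add: subdegrees)
qed

lemma pari: "par Ui Yi"
  unfolding par_def
proof
  have 1: "fls_X_inv ^ p * fls_X ^ p = (1 :: 'a fls)"
    by (simp flip: power_mult_distrib fls_inverse_X)
  have "Yi ^ p = - ((fls_X_inv ^ (r + 1)) ^ p * (1 - fls_const d * fls_X ^ p))"
    using p(2) by (simp add: Yi_def power_mult_distrib fls_S)
  also have "(fls_X_inv ^ (r + 1)) ^ p = (fls_X_inv ^ p :: 'a fls) ^ r * fls_X_inv ^ p"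
    by (simp only: power_mult[symmetric] power_add[symmetric]) (simp add: algebra_simps)
  also have "- ((fls_X_inv ^ p) ^ r * fls_X_inv ^ p * (1 - fls_const d * fls_X ^ p)) =
      (fls_X_inv ^ p) ^ r * (fls_const d * (fls_X_inv ^ p * fls_X ^ p) - fls_X_inv ^ p)"
    by (simp only: algebra_simps) simp
  finally show "Yi ^ p = Ui ^ r * (fls_const d - Ui)" by (simp only: 1 Ui_def mult_1_right)
  show "\<exists>a. fls_subdegree (Ui - fls_const a) \<noteq> 0"
    using p_pos by (intro exI[of _ 0]) (simp add: subdegrees)
qed

text \<open>One injective expansion of the coordinate ring into the field of Laurent series;
  primality of \<open>F\<close> drops out of it.\<close>

lemma kernel0: "eval2 U0 Y0 g = 0 \<longleftrightarrow> F dvd g"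
proof
  assume g: "eval2 U0 Y0 g = 0"
  obtain h where h: "F dvd g - h" "degree h < p" using reduce_mod_F by blast
  have "eval2 U0 Y0 h = 0" using eval2_dvd[OF par0 h(1)] g by (simp add: rhom_diff[OF rhom_eval2])
  moreover have "coprime (int p) (int r)" using coprime_r by simp
  ultimately have "h = 0"
    using eval2_distinct_kernel[of U0 1 Y0 h] h(2) subdegrees nonzero by simp
  then show "F dvd g" using h(1) by simp
qed (rule eval2_dvd[OF par0])

lemma F_prime: "F dvd g * h \<Longrightarrow> F dvd g \<or> F dvd h"
  unfolding kernel0[symmetric] rhom_mult[OF rhom_eval2] by simp

lemma F_prime_prod: "finite B \<Longrightarrow> F dvd (\<Prod>i\<in>B. f i) \<Longrightarrow> \<exists>i\<in>B. F dvd f i"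
proof (induction B rule: finite_induct)
  case empty
  then show ?case using F_not_dvd_const[of 1] by (simp add: one_pCons)
qed (use F_prime in auto)

lemma nm_nonzero: "\<not> F dvd g \<Longrightarrow> nm g \<noteq> 0"
  using nm[of g] F_prime_prod[of "{..<p}" "\<lambda>j. tau j g"] tau_dvd by auto

text \<open>For an arbitrary parametrisation the norm reduces injectivity to polynomials in
  \<open>x\<close> alone, where \<open>U\<close> is transcendental.\<close>

lemma kernel:
  assumes "par U Y"
  shows "eval2 U Y g = 0 \<longleftrightarrow> F dvd g"
proof
  assume g: "eval2 U Y g = 0"
  show "F dvd g"
  proof (rule ccontr)
    assume nd: "\<not> F dvd g"
    have "eval2 U Y (\<Prod>j<p. tau j g) = 0"
      unfolding rhom_prod[OF rhom_eval2] using g p_pos by (intro prod_zero bexI[of _ 0]) (auto simp: tau_0)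
    then have "eval2 U Y [:nm g:] = 0"
      using eval2_dvd[OF assms nm[of g]] by (simp add: rhom_diff[OF rhom_eval2])
    then show False using par_nonzero[OF assms nm_nonzero[OF nd]] by (simp add: eval2_const)
  qed
qed (rule eval2_dvd[OF assms])

definition valn :: "'a fls \<Rightarrow> 'a fls \<Rightarrow> 'a point" where
  "valn U Y g = fls_subdegree (eval2 U Y g)"

abbreviation "CP \<equiv> curve_points F"

lemma valn_point:
  assumes UY: "par U Y" and gh: "\<not> F dvd g" "\<not> F dvd h" "valn U Y g - valn U Y h = 1"
  shows "valn U Y \<in> CP"
  unfolding curve_points_def
proof (intro CollectI conjI allI impI)
  show "valn U Y 0 = 0" by (simp add: valn_def rhom_0[OF rhom_eval2])
  show "valn U Y g = valn U Y h" if "F dvd g - h" for g h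
    using kernel[OF UY, of "g - h"] that by (simp add: valn_def rhom_diff[OF rhom_eval2])
  show "valn U Y (g * h) = valn U Y g + valn U Y h" if "\<not> F dvd g \<and> \<not> F dvd h" for g h
    using that kernel[OF UY] by (simp add: valn_def rhom_mult[OF rhom_eval2])
  show "min (valn U Y g) (valn U Y h) \<le> valn U Y (g + h)"
    if "\<not> F dvd g \<and> \<not> F dvd h \<and> \<not> F dvd g + h" for g h
    using that kernel[OF UY, of "g + h"] fls_plus_subdegree[of "eval2 U Y g" "eval2 U Y h"]
    by (simp add: valn_def rhom_add[OF rhom_eval2])
  show "valn U Y [:[:c:]:] = 0" if "c \<noteq> 0" for c by (simp add: valn_def eval2_const_const)
  show "\<exists>g h. \<not> F dvd g \<and> \<not> F dvd h \<and> valn U Y g - valn U Y h = 1"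
    using gh by blast
qed

lemma tau_prod_valuation: "curve_aut (w ^ j) v g = v (tau j g)"
  by (simp add: curve_aut_def tau_def)

lemma prod_y: "(\<Prod>j<p. [:[:- (w ^ j * b):], 1:]) = polyy ^ p - [:[:b ^ p:]:]"
proof -
  have c: "rhom (map_poly (\<lambda>c. [:c:]) :: 'a poly \<Rightarrow> 'a poly poly)" by (rule rhom_map_poly[OF rhom_const_poly])
  have "map_poly (\<lambda>c. [:c:]) (\<Prod>j<p. [:- (w ^ j * b), 1:]) = map_poly (\<lambda>c. [:c:]) ([:0, 1:] ^ p - [:b ^ p:])"
    by (simp only: primitive_root_poly[OF w p_pos])
  then show ?thesis
    unfolding rhom_prod[OF c] rhom_diff[OF c] rhom_power[OF c] map_poly_pCons_rhom[OF rhom_const_poly] 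
    by (simp add: one_pCons)
qed

lemma bivariate_decomposition:
  fixes g :: "'a poly poly"
  shows "\<exists>g1 g2. g - [:[:poly (poly g [:b:]) a:]:] = [:[:- b:], 1:] * g1 + [:[:- a, 1:]:] * [:g2:]"
proof -
  let ?c = "poly (poly g [:b:]) a"
  have "[:- [:b:], 1:] dvd g - [:poly g [:b:]:]"
    unfolding poly_eq_0_iff_dvd[symmetric] by simp
  then obtain g1 where g1: "g - [:poly g [:b:]:] = [:- [:b:], 1:] * g1" by (auto elim: dvdE)
  have "[:- a, 1:] dvd poly g [:b:] - [:?c:]" by (simp flip: poly_eq_0_iff_dvd)
  then obtain g2 where g2: "poly g [:b:] - [:?c:] = [:- a, 1:] * g2" by (auto elim: dvdE)
  have "[:poly g [:b:]:] - [:[:?c:]:] = [:[:- a, 1:]:] * [:g2:]"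
    using arg_cong[OF g2, of "\<lambda>c. [:c:]"]
    by (simp only: rhom_diff[OF rhom_const_poly] rhom_mult[OF rhom_const_poly])
  moreover have "[:- [:b:], 1:] = [:[:- b:], 1:]" by simp
  moreover have "g - [:[:?c:]:] = (g - [:poly g [:b:]:]) + ([:poly g [:b:]:] - [:[:?c:]:])"
    by (simp only: add_diff_eq diff_add_cancel)
  ultimately have "g - [:[:?c:]:] = [:[:- b:], 1:] * g1 + [:[:- a, 1:]:] * [:g2:]"
    using g1 by metis
  then show ?thesis by blast
qed

section \<open>Valuations at a point of the curve\<close>

context
  fixes v :: "'a point"
  assumes v: "v \<in> CP"
begin

lemma v_zero: "v 0 = 0"
  and v_cong: "F dvd g - h \<Longrightarrow> v g = v h"
  and v_mult: "\<not> F dvd g \<Longrightarrow> \<not> F dvd h \<Longrightarrow> v (g * h) = v g + v h"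
  and v_add: "\<not> F dvd g \<Longrightarrow> \<not> F dvd h \<Longrightarrow> \<not> F dvd g + h \<Longrightarrow> min (v g) (v h) \<le> v (g + h)"
  and v_const: "c \<noteq> 0 \<Longrightarrow> v [:[:c:]:] = 0"
  and v_normal: "\<exists>g h. \<not> F dvd g \<and> \<not> F dvd h \<and> v g - v h = 1"
  using v unfolding curve_points_def by blast+

lemma v_dvd: "F dvd g \<Longrightarrow> v g = 0" using v_cong[of g 0] v_zero by simp

lemma v_const_const: "v [:[:c:]:] = 0" using v_const v_zero by (cases "c = 0") auto

lemma v_minus: "v (- g) = v g"
proof (cases "F dvd g")
  case False
  have "v ([:[:-1:]:] * g) = v [:[:-1:]:] + v g"
    using F_not_dvd_const[of "[:-1:]"] False by (intro v_mult) auto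
  moreover have "[:-1:] = (- 1 :: 'a poly)" by (simp add: one_pCons)
  then have "[:[:-1:]:] * g = - g" by simp
  ultimately show ?thesis using v_const[of "-1"] by simp
qed (simp add: v_dvd)

lemma v_add_ge:
  assumes "v g \<ge> 0" "v h \<ge> 0"
  shows "v (g + h) \<ge> 0"
proof -
  have "v (g + h) = v h" if "F dvd g" using that by (intro v_cong) simp
  moreover have "v (g + h) = v g" if "F dvd h" using that by (intro v_cong) simp
  ultimately show ?thesis using v_add[of g h] v_dvd[of "g + h"] assms
    by (cases "F dvd g + h"; cases "F dvd g"; cases "F dvd h") auto
qed

lemma v_mult_ge: "v g \<ge> 0 \<Longrightarrow> v h \<ge> 0 \<Longrightarrow> v (g * h) \<ge> 0"
  using v_mult[of g h] v_dvd[of "g * h"] by (cases "F dvd g \<or> F dvd h") auto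

lemma v_power: "\<not> F dvd g \<Longrightarrow> \<not> F dvd g ^ n \<and> v (g ^ n) = int n * v g"
proof (induction n)
  case 0
  then show ?case using F_not_dvd_const[of 1] v_const[of 1] by (simp add: one_pCons)
next
  case (Suc n)
  then show ?case using F_prime[of g "g ^ n"] v_mult[of g "g ^ n"] by (auto simp: algebra_simps)
qed

lemma v_prod: "finite B \<Longrightarrow> (\<And>i. i \<in> B \<Longrightarrow> \<not> F dvd f i) \<Longrightarrow> v (\<Prod>i\<in>B. f i) = (\<Sum>i\<in>B. v (f i))"
proof (induction B rule: finite_induct)
  case empty
  then show ?case using v_const[of 1] by (simp add: one_pCons)
next
  case (insert x B)
  then have "\<not> F dvd prod f B" using F_prime_prod[of B f] by auto
  then show ?case using insert v_mult by simp
qed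

lemma v_add_distinct:
  assumes "\<not> F dvd g" "\<not> F dvd h" "v g \<noteq> v h"
  shows "\<not> F dvd g + h \<and> v (g + h) = min (v g) (v h)"
proof -
  have *: "\<not> F dvd g + h \<and> v (g + h) = v g" if "v g < v h" "\<not> F dvd g" "\<not> F dvd h" for g h
  proof -
    have nd: "\<not> F dvd g + h"
    proof
      assume "F dvd g + h"
      then have "v g = v (- h)" by (intro v_cong) simp
      then show False using that by (simp add: v_minus)
    qed
    have "v (g + h) \<ge> v g" using v_add[OF that(2,3) nd] that by simp
    moreover have "v g \<ge> min (v (g + h)) (v h)"
      using v_add[of "g + h" "- h"] nd that v_minus[of h] by simp
    ultimately show ?thesis using nd that by simp
  qed
  then show ?thesis
    using *[of g h] *[of h g] assms by (cases "v g < v h") (auto simp: add.commute)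
qed

lemma v_norm: "\<not> F dvd g \<Longrightarrow> (\<Sum>j<p. v (tau j g)) = v [:nm g:]"
  using v_prod[of "{..<p}" "\<lambda>j. tau j g"] v_cong[OF nm[of g]] tau_dvd by simp

lemma v_y: "int p * v polyy = v [:A:]"
proof -
  have "\<not> F dvd polyy" using p_gt_2 by (intro F_not_dvd) auto
  then have "v (polyy ^ p) = int p * v polyy" using v_power by blast
  moreover have "v (polyy ^ p) = v [:A:]" by (rule v_cong) (simp add: F_eq)
  ultimately show ?thesis by simp
qed

lemma v_nonneg_x: "v polyx \<ge> 0 \<Longrightarrow> v [:c:] \<ge> 0"
proof (induction c)
  case 0
  then show ?case by (simp add: v_zero)
next
  case (pCons a c)
  have "[:pCons a c:] = [:[:a:]:] + polyx * [:c:]" by simp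
  then show ?case using pCons v_const_const[of a] by (simp only: v_add_ge v_mult_ge order_refl)
qed

lemma v_nonneg: "v polyx \<ge> 0 \<Longrightarrow> v polyy \<ge> 0 \<Longrightarrow> v g \<ge> 0"
proof (induction g)
  case 0
  then show ?case by (simp add: v_zero)
next
  case (pCons c g)
  have "pCons c g = [:c:] + polyy * g" by simp
  then show ?case using pCons v_nonneg_x[of c] by (simp only: v_add_ge v_mult_ge)
qed

lemma v_y_nonneg: "v polyx \<ge> 0 \<Longrightarrow> v polyy \<ge> 0"
  using v_y v_nonneg_x[of A] p_pos by (metis mult_pos_neg not_less of_nat_0_less_iff)

lemma v_polyx_pos: "v [:[:- a, 1:]:] > 0 \<Longrightarrow> v polyx \<ge> 0"
proof -
  assume "v [:[:- a, 1:]:] > 0"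
  moreover have "polyx = [:[:- a, 1:]:] + [:[:a:]:]" by simp
  ultimately show ?thesis
    using v_add_ge[of "[:[:- a, 1:]:]" "[:[:a:]:]"] v_const_const[of a] by simp
qed

text \<open>Vanishing at the point. Multiples of \<open>F\<close> are included by hand, because
  valuations take the conventional value 0 on them instead of infinity.\<close>

definition vpos :: "'a poly poly \<Rightarrow> bool" where "vpos g \<longleftrightarrow> F dvd g \<or> v g > 0"

lemma vpos_add:
  assumes "vpos g" "vpos h"
  shows "vpos (g + h)"
proof -
  have "v (g + h) = v h" if "F dvd g" using that by (intro v_cong) simp
  moreover have "v (g + h) = v g" if "F dvd h" using that by (intro v_cong) simp
  ultimately show ?thesis using v_add[of g h] assms unfolding vpos_def
    by (cases "F dvd g + h"; cases "F dvd g"; cases "F dvd h") (auto simp: min_def split: if_splits)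
qed

lemma vpos_mult: "vpos g \<Longrightarrow> v h \<ge> 0 \<Longrightarrow> vpos (g * h)"
  using v_mult[of g h] unfolding vpos_def by (cases "F dvd g"; cases "F dvd h") auto

lemma vpos_const: "vpos [:[:c:]:] \<longleftrightarrow> c = 0"
  using v_const[of c] F_not_dvd_const[of "[:c:]"] unfolding vpos_def by (cases "c = 0") auto

text \<open>After splitting off all factors \<open>x - a\<close>, the cofactor is a nonzero constant
  plus something vanishing at the point, hence has value 0.\<close>

lemma v_root:
  assumes a: "v [:[:- a, 1:]:] > 0" and N: "N \<noteq> 0"
  shows "v [:N:] = int (order a N) * v [:[:- a, 1:]:]"
proof -
  obtain Q where Q: "N = [:- a, 1:] ^ order a N * Q" "\<not> [:- a, 1:] dvd Q"
    using order_decomp[OF N] by blast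
  have Qa: "poly Q a \<noteq> 0" using Q(2) by (simp add: poly_eq_0_iff_dvd)
  have "[:- a, 1:] dvd Q - [:poly Q a:]" by (simp flip: poly_eq_0_iff_dvd)
  then obtain R where R0: "Q - [:poly Q a:] = [:- a, 1:] * R" by (rule dvdE)
  have R: "Q = [:poly Q a:] + [:- a, 1:] * R" using R0 by (simp only: diff_eq_eq add.commute)
  have "vpos ([:[:- a, 1:]:] * [:R:])"
    using a v_nonneg_x[OF v_polyx_pos[OF a]] by (intro vpos_mult) (simp_all add: vpos_def)
  moreover have "[:Q:] = [:[:poly Q a:]:] + [:[:- a, 1:]:] * [:R:]"
    using arg_cong[OF R, of "\<lambda>c. [:c:]"]
    by (simp only: rhom_add[OF rhom_const_poly] rhom_mult[OF rhom_const_poly])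
  moreover have "\<not> F dvd [:[:poly Q a:]:]" "v [:[:poly Q a:]:] = 0"
    using Qa F_not_dvd_const v_const by auto
  ultimately have vQ: "v [:Q:] = 0"
  proof (cases "F dvd [:[:- a, 1:]:] * [:R:]")
    case True
    then have "F dvd [:Q:] - [:[:poly Q a:]:]"
      using \<open>[:Q:] = _\<close> by (simp only: add_diff_cancel_left')
    from v_cong[OF this] show ?thesis using \<open>v [:[:poly Q a:]:] = 0\<close> by (simp only:)
  next
    case False
    then show ?thesis
      using \<open>vpos _\<close> \<open>[:Q:] = _\<close> \<open>v [:[:poly Q a:]:] = 0\<close> \<open>\<not> F dvd [:[:poly Q a:]:]\<close>
        v_add_distinct[of "[:[:poly Q a:]:]" "[:[:- a, 1:]:] * [:R:]"] by (simp only: vpos_def) simp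
  qed
  have nd: "\<not> F dvd [:[:- a, 1:]:]" "\<not> F dvd [:Q:]"
    using Q(2) by (auto intro!: F_not_dvd_const)
  have "[:N:] = [:[:- a, 1:]:] ^ order a N * [:Q:]"
    using arg_cong[OF Q(1), of "\<lambda>c. [:c:]"]
    by (simp only: rhom_mult[OF rhom_const_poly] rhom_power[OF rhom_const_poly])
  moreover have "v ([:[:- a, 1:]:] ^ order a N * [:Q:]) = v ([:[:- a, 1:]:] ^ order a N) + v [:Q:]"
    by (rule v_mult) (use v_power[OF nd(1)] nd(2) in blast)+
  ultimately have "v [:N:] = v ([:[:- a, 1:]:] ^ order a N) + v [:Q:]" by (simp only:)
  then show ?thesis using v_power[OF nd(1), of "order a N"] vQ by simp
qed

lemma v_pole:
  assumes x: "v polyx < 0"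
  shows "N \<noteq> 0 \<Longrightarrow> v [:N:] = int (degree N) * v polyx"
proof (induction N)
  case (pCons a N)
  show ?case
  proof (cases "N = 0")
    case True
    then show ?thesis using pCons v_const[of a] by simp
  next
    case False
    have nd: "\<not> F dvd polyx" "\<not> F dvd [:N:]" using False by (auto intro!: F_not_dvd_const)
    then have nd2: "\<not> F dvd polyx * [:N:]" using F_prime by blast
    have vN: "v (polyx * [:N:]) = int (Suc (degree N)) * v polyx"
      using v_mult[OF nd] pCons.IH[OF False] by (simp add: algebra_simps)
    then have neg: "v (polyx * [:N:]) < 0" using x by (simp add: mult_less_0_iff)
    have eq: "[:pCons a N:] = [:[:a:]:] + polyx * [:N:]" by simp
    have "v [:pCons a N:] = v (polyx * [:N:])"
    proof (cases "a = 0")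
      case False
      then have "v ([:[:a:]:] + polyx * [:N:]) = min (v [:[:a:]:]) (v (polyx * [:N:]))"
        using v_add_distinct[of "[:[:a:]:]" "polyx * [:N:]"] F_not_dvd_const[of "[:a:]"] v_const[of a] nd2 neg
        by simp
      then show ?thesis unfolding eq using v_const[OF False] neg by simp
    qed (simp add: eq)
    then show ?thesis using vN False by simp
  qed
qed simp

lemma lies_above_nonneg: "lies_above v a b \<Longrightarrow> v g \<ge> 0"
  unfolding lies_above_def using v_nonneg[OF v_polyx_pos v_y_nonneg[OF v_polyx_pos]] by blast

text \<open>Modulo \<open>y - b\<close> and \<open>x - a\<close> every polynomial is its value at
  \<open>(a, b)\<close>, and a constant vanishes at the point only if it is 0.\<close>

lemma lies_above_eval:
  assumes ab: "lies_above v a b"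
  shows "vpos g \<longleftrightarrow> poly (poly g [:b:]) a = 0"
proof -
  let ?c = "poly (poly g [:b:]) a"
  obtain g1 g2 where "g - [:[:?c:]:] = [:[:- b:], 1:] * g1 + [:[:- a, 1:]:] * [:g2:]"
    using bivariate_decomposition by blast
  moreover have "vpos ([:[:- b:], 1:] * g1)" "vpos ([:[:- a, 1:]:] * [:g2:])"
    by (rule vpos_mult[OF _ lies_above_nonneg[OF ab]]; use ab in \<open>simp add: vpos_def lies_above_def\<close>)+
  ultimately have *: "vpos (g - [:[:?c:]:])" using vpos_add by simp
  have mone: "v [:[:-1:]:] \<ge> 0" by (simp add: v_const_const)
  show ?thesis
  proof
    assume "vpos g"
    then have "vpos (g + (g - [:[:?c:]:]) * [:[:-1:]:])"
      using vpos_add vpos_mult[OF * mone] by blast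
    moreover have "[:[:-1:]:] = (- 1 :: 'a poly poly)" by (simp add: one_pCons)
    then have "g + (g - [:[:?c:]:]) * [:[:-1:]:] = [:[:?c:]:]" by (simp only:) simp
    ultimately have "vpos [:[:?c:]:]" by (simp only:)
    then show "?c = 0" by (simp only: vpos_const)
  next
    assume "?c = 0"
    then show "vpos g" using * by simp
  qed
qed

lemma lies_above_curve:
  assumes "lies_above v a b"
  shows "b ^ p = poly A a"
proof -
  have "vpos F" by (simp add: vpos_def)
  then show ?thesis using lies_above_eval[OF assms, of F] by (simp add: F_eq poly_const_pow)
qed

lemma lies_above_unique:
  assumes "lies_above v a b" "lies_above v a' b'"
  shows "a = a'" "b = b'"
proof -
  have "vpos [:[:- a', 1:]:]" "vpos [:[:- b':], 1:]"
    using assms(2) by (auto simp: vpos_def lies_above_def)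
  then show "a = a'" "b = b'" using lies_above_eval[OF assms(1)] by auto
qed

text \<open>Otherwise all nonzero polynomials in \<open>x\<close> have value 0, in particular all
  norms. The values of the conjugates are nonnegative with sum 0, so \<open>v\<close> is trivial,
  against the normalisation.\<close>

lemma v_x_zero_exists:
  assumes x: "v polyx \<ge> 0"
  shows "\<exists>a. v [:[:- a, 1:]:] > 0"
proof (rule ccontr)
  have nonneg: "v g \<ge> 0" for g by (rule v_nonneg[OF x v_y_nonneg[OF x]])
  assume neg: "\<not> (\<exists>a. v [:[:- a, 1:]:] > 0)"
  have lin: "v [:[:- a, 1:]:] = 0" for a
  proof -
    have "\<not> v [:[:- a, 1:]:] > 0" using neg by blast
    then show ?thesis using nonneg[of "[:[:- a, 1:]:]"] by linarith
  qed
  have pol: "v [:N:] = 0" if "N \<noteq> 0" for N using that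
  proof (induction "degree N" arbitrary: N)
    case 0
    then obtain c where "N = [:c:]" by (metis degree_eq_zeroE)
    then show ?case using v_const_const by simp
  next
    case (Suc n)
    have "degree N > 0" using Suc.hyps(2) by linarith
    then obtain a where "poly N a = 0" using alg_closed_imp_poly_has_root by blast
    then have "[:- a, 1:] dvd N" by (simp only: poly_eq_0_iff_dvd)
    then obtain M where M: "N = [:- a, 1:] * M" by (rule dvdE)
    have M0: "M \<noteq> 0" using M Suc.prems by (metis mult_zero_right)
    have "degree N = degree [:- a, 1:] + degree M" 
      unfolding M by (rule degree_mult_eq) (use M0 in auto)
    then have "n = degree M" using Suc.hyps(2) by simp
    then have "v [:M:] = 0" by (rule Suc.hyps(1)[OF _ M0])
    moreover have "[:N:] = [:[:- a, 1:]:] * [:M:]"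
      unfolding M by (rule rhom_mult[OF rhom_const_poly])
    moreover have "v ([:[:- a, 1:]:] * [:M:]) = v [:[:- a, 1:]:] + v [:M:]"
      by (rule v_mult; rule F_not_dvd_const) (use M0 in auto)
    ultimately show ?case using lin[of a] by (simp only:) 
  qed
  have "v g = 0" if "\<not> F dvd g" for g
  proof -
    have "(\<Sum>j<p. v (tau j g)) = 0" using v_norm[OF that] pol[OF nm_nonzero[OF that]] by simp
    then have "v (tau 0 g) = 0"
      using sum_nonneg_eq_0_iff[of "{..<p}" "\<lambda>j. v (tau j g)"] nonneg p_pos by blast
    then show ?thesis by (simp add: tau_0)
  qed
  then show False using v_normal by (metis diff_self zero_neq_one)
qed

text \<open>The product of the \<open>y - w^j b0\<close> over a \<open>p\<close>-th root
  \<open>b0\<close> of \<open>A(a)\<close> is \<open>F + A - A(a)\<close>, which vanishes at the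
  point; so some factor does.\<close>

lemma v_y_zero_exists:
  assumes a: "v [:[:- a, 1:]:] > 0" 
  shows "\<exists>b. v [:[:- b:], 1:] > 0"
proof (rule ccontr)
  have x: "v polyx \<ge> 0" by (rule v_polyx_pos[OF a])
  have nonneg: "v g \<ge> 0" for g by (rule v_nonneg[OF x v_y_nonneg[OF x]])
  obtain b0 where b0: "b0 ^ p = poly A a" using nth_root_exists[OF p_pos] by blast
  assume neg: "\<not> (\<exists>b. v [:[:- b:], 1:] > 0)"
  have z: "v [:[:- b:], 1:] = 0" for b
  proof -
    have "\<not> v [:[:- b:], 1:] > 0" using neg by blast
    then show ?thesis using nonneg[of "[:[:- b:], 1:]"] by linarith
  qed
  have nd: "\<not> F dvd [:[:- b:], 1:]" for b using p_gt_2 by (intro F_not_dvd) auto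
  define P where "P = (\<Prod>j<p. [:[:- (w ^ j * b0):], 1:])"
  have vP: "v P = 0"
    unfolding P_def using v_prod[of "{..<p}" "\<lambda>j. [:[:- (w ^ j * b0):], 1:]"] nd z by simp
  have ndP: "\<not> F dvd P" unfolding P_def using F_prime_prod[of "{..<p}"] nd by blast
  have P: "P = F + ([:A:] - [:[:poly A a:]:])" by (simp add: P_def prod_y b0 F_eq)
  have "[:- a, 1:] dvd A - [:poly A a:]" by (simp flip: poly_eq_0_iff_dvd)
  then obtain R where R: "A - [:poly A a:] = [:- a, 1:] * R" by (rule dvdE)
  have AR: "[:A:] - [:[:poly A a:]:] = [:[:- a, 1:]:] * [:R:]"
    using arg_cong[OF R, of "\<lambda>c. [:c:]"] by (simp only: rhom_diff[OF rhom_const_poly] rhom_mult[OF rhom_const_poly])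
  have "vpos [:[:- a, 1:]:]" "vpos F" using a by (simp_all add: vpos_def)
  then have "vpos P"
    unfolding P AR by (intro vpos_add vpos_mult nonneg)
  then show False using vP ndP by (simp add: vpos_def)
qed

lemma point_cases: "v polyx < 0 \<or> (\<exists>a b. lies_above v a b)"
  unfolding lies_above_def using v_x_zero_exists v_y_zero_exists by (meson not_less)

end

end

section \<open>Points of the curve\<close>

lemma alg_closed_decompose:
  fixes N :: "'a::alg_closed_field poly"
  assumes "N \<noteq> 0"
  shows "N = Polynomial.smult (lead_coeff N) (\<Prod>a | poly N a = 0. [:- a, 1:] ^ order a N)"
  using assms
proof (induction N rule: poly_root_order_induct)
  case (no_roots q)
  then have "\<not> degree q > 0" using alg_closed_imp_poly_has_root by blast
  then obtain c where "q = [:c:]" by (metis degree_eq_zeroE gr0I)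
  then show ?case using no_roots by simp
next
  case (root q x n)
  have q: "q \<noteq> 0" using root by auto
  let ?N = "[:- x, 1:] ^ n * q"
  have N: "?N \<noteq> 0" using q by simp
  have x: "order x q = 0" using root by (simp add: order_0I)
  have ord: "order a ?N = (if a = x then n else order a q)" for a
    using x N by (simp add: order_mult order_power_n_n order_0I)
  have roots: "{a. poly ?N a = 0} = insert x {a. poly q a = 0}"
    using root by (auto simp: poly_power)
  have "(\<Prod>a | poly ?N a = 0. [:- a, 1:] ^ order a ?N)
      = [:- x, 1:] ^ n * (\<Prod>a | poly q a = 0. [:- a, 1:] ^ order a ?N)"
  proof -
    have "x \<notin> {a. poly q a = 0}" using root by simp
    then have "(\<Prod>a\<in>insert x {a. poly q a = 0}. [:- a, 1:] ^ order a ?N)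
        = [:- x, 1:] ^ order x ?N * (\<Prod>a | poly q a = 0. [:- a, 1:] ^ order a ?N)"
      by (rule prod.insert[OF poly_roots_finite[OF q]])
    then show ?thesis unfolding roots ord[of x] by (simp only: if_True refl)
  qed
  also have "(\<Prod>a | poly q a = 0. [:- a, 1:] ^ order a ?N) = (\<Prod>a | poly q a = 0. [:- a, 1:] ^ order a q)"
    using root by (intro prod.cong) (auto simp: ord)
  finally have eq: "(\<Prod>a | poly ?N a = 0. [:- a, 1:] ^ order a ?N)
      = [:- x, 1:] ^ n * (\<Prod>a | poly q a = 0. [:- a, 1:] ^ order a q)" .
  have "Polynomial.smult (lead_coeff q) (\<Prod>a | poly ?N a = 0. [:- a, 1:] ^ order a ?N) = ?N"
    unfolding eq mult_smult_right[symmetric] root.IH[OF q, symmetric] by (rule refl)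
  moreover have "lead_coeff ?N = lead_coeff q" by (simp add: lead_coeff_mult lead_coeff_power)
  ultimately show ?case by simp
qed simp

lemma alg_closed_sum_order:
  fixes N :: "'a::alg_closed_field poly"
  assumes "N \<noteq> 0"
  shows "(\<Sum>a | poly N a = 0. order a N) = degree N"
proof -
  have "degree N = degree (\<Prod>a | poly N a = 0. [:- a, 1:] ^ order a N)"
    by (subst alg_closed_decompose[OF assms]) (use assms in simp)
  also have "\<dots> = (\<Sum>a | poly N a = 0. order a N)"
    by (subst degree_prod_eq_sum_degree) (auto simp: degree_power_eq)
  finally show ?thesis by simp
qed

lemma pos_subdegree_fps:
  assumes "B $ 0 = 0" "fps_to_fls B \<noteq> 0"
  shows "fls_subdegree (fps_to_fls B) > 0"
proof -
  have "B \<noteq> 0" using assms(2) by auto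
  then have "subdegree B > 0" using assms(1) by (metis gr0I nth_subdegree_nonzero)
  then show ?thesis by (simp add: fls_subdegree_fls_to_fps)
qed

section \<open>Ramified and unramified points over the \<open>x\<close>-line\<close>

context superelliptic_expansion
begin

lemma poly_as_sum_y: "(\<Sum>j | coeff g j \<noteq> 0. [:coeff g j:] * polyy ^ j) = g"
proof (rule poly_eqI)
  fix n
  have "coeff (\<Sum>j | coeff g j \<noteq> 0. [:coeff g j:] * polyy ^ j) n
      = (\<Sum>j | coeff g j \<noteq> 0. if j = n then coeff g j else 0)"
    unfolding coeff_sum by (rule sum.cong) (simp_all flip: monom_altdef)
  then show "coeff (\<Sum>j | coeff g j \<noteq> 0. [:coeff g j:] * polyy ^ j) n = coeff g n"
    by (simp add: finite_coeff_support)
qed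

lemma y_not_dvd: "\<not> F dvd [:[:b:], 1:]" using p_gt_2 by (intro F_not_dvd) auto

lemma A_not_0: "A \<noteq> 0" using d by (simp only: A_def mult_eq_0_iff power_eq_0_iff) simp

text \<open>Points with ramification index \<open>p\<close> over the \<open>x\<close>-line: \<open>q\<close> is the order function of the
  \<open>x\<close>-line, and \<open>s\<close> the order of \<open>y\<close>.\<close>

definition ramified :: "'a point \<Rightarrow> int \<Rightarrow> ('a poly \<Rightarrow> int) \<Rightarrow> int \<Rightarrow> bool" where
  "ramified v m q s \<longleftrightarrow> v \<in> CP \<and> m > 0 \<and> coprime (int p) s \<and>
     (\<forall>c. c \<noteq> 0 \<longrightarrow> v [:c:] = int p * m * q c) \<and> v polyy = s * m"

lemma ramified_terms:
  assumes R: "ramified v m q s" and g: "degree g < p"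
  shows "\<And>j. coeff g j \<noteq> 0 \<Longrightarrow> \<not> F dvd [:coeff g j:] * polyy ^ j"
    and "\<And>j. coeff g j \<noteq> 0 \<Longrightarrow> v ([:coeff g j:] * polyy ^ j) = m * (int p * q (coeff g j) + s * int j)"
    and "inj_on (\<lambda>j. v ([:coeff g j:] * polyy ^ j)) {j. coeff g j \<noteq> 0}"
proof -
  have v: "v \<in> CP" using R by (simp add: ramified_def)
  have nd: "\<not> F dvd polyy ^ j \<and> v (polyy ^ j) = int j * v polyy" for j
    using v_power[OF v, of polyy j] y_not_dvd[of 0] by simp
  show 1: "\<not> F dvd [:coeff g j:] * polyy ^ j" if "coeff g j \<noteq> 0" for j
    using F_prime[of "[:coeff g j:]" "polyy ^ j"] F_not_dvd_const[OF that] nd by blast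
  show 2: "v ([:coeff g j:] * polyy ^ j) = m * (int p * q (coeff g j) + s * int j)" if "coeff g j \<noteq> 0" for j
  proof -
    have "v ([:coeff g j:] * polyy ^ j) = v [:coeff g j:] + v (polyy ^ j)"
      by (rule v_mult[OF v F_not_dvd_const[OF that]]) (use nd in blast)
    then show ?thesis using nd[of j] R that by (simp only: ramified_def) (simp add: algebra_simps)
  qed
  show "inj_on (\<lambda>j. v ([:coeff g j:] * polyy ^ j)) {j. coeff g j \<noteq> 0}"
  proof (rule inj_onI)
    fix i j assume "i \<in> {j. coeff g j \<noteq> 0}" "j \<in> {j. coeff g j \<noteq> 0}"
      and eq: "v ([:coeff g i:] * polyy ^ i) = v ([:coeff g j:] * polyy ^ j)"
    then have i: "coeff g i \<noteq> 0" and j: "coeff g j \<noteq> 0" by auto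
    have "m * (int p * q (coeff g i) + s * int i) = m * (int p * q (coeff g j) + s * int j)"
      using eq 2[OF i] 2[OF j] by (simp only:)
    then have "int p * q (coeff g i) + s * int i = int p * q (coeff g j) + s * int j"
      using R by (simp add: ramified_def)
    then have "s * (int i - int j) = int p * (q (coeff g j) - q (coeff g i))"
      by (simp add: algebra_simps)
    then have "int p dvd s * (int i - int j)" by (metis dvd_triv_left)
    then have "int p dvd int i - int j"
      using R by (simp add: ramified_def coprime_dvd_mult_right_iff)
    moreover have "i < p" "j < p" using i j g le_degree[of g i] le_degree[of g j] by linarith+
    then have "\<bar>int i - int j\<bar> < int p" by linarith
    ultimately show "i = j"
      using zdvd_not_zless[of "\<bar>int i - int j\<bar>" "int p"] by (cases "i = j") auto
  qed
qed

lemma ramified_value: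
  assumes R: "ramified v m q s" and g: "degree g < p" "g \<noteq> 0"
  shows "v g = Min ((\<lambda>j. m * (int p * q (coeff g j) + s * int j)) ` {j. coeff g j \<noteq> 0})"
proof -
  let ?J = "{j. coeff g j \<noteq> 0}" and ?f = "\<lambda>j. [:coeff g j:] * polyy ^ j"
  have v: "v \<in> CP" using R by (simp add: ramified_def)
  have "degree g \<in> ?J" using g(2) by simp
  then have J: "finite ?J" "?J \<noteq> {}" by (blast intro: finite_coeff_support)+
  have "v (\<Sum>j\<in>?J. ?f j) = Min ((\<lambda>j. v (?f j)) ` ?J)"
    by (rule sum_distinct_valuation[of "{g. \<not> F dvd g}" v, THEN conjunct2])
       (use v_add_distinct[OF v] ramified_terms[OF R g(1)] J in auto)
  also have "(\<lambda>j. v (?f j)) ` ?J = (\<lambda>j. m * (int p * q (coeff g j) + s * int j)) ` ?J"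
    by (rule image_cong[OF refl]) (use ramified_terms(2)[OF R g(1)] in blast)
  finally show ?thesis unfolding poly_as_sum_y .
qed

lemma nonzero_reduction:
  assumes "\<not> F dvd g"
  obtains h where "F dvd g - h" "degree h < p" "h \<noteq> 0"
  using reduce_mod_F[of g] assms by (metis diff_zero)

text \<open>All values are multiples of \<open>m\<close>, and the normalisation requires a value
  difference of 1.\<close>

lemma ramified_index:
  assumes R: "ramified v m q s"
  shows "m = 1"
proof -
  have v: "v \<in> CP" using R by (simp add: ramified_def)
  have dv: "m dvd v g" if "\<not> F dvd g" for g
  proof -
    obtain h where h: "F dvd g - h" "degree h < p" "h \<noteq> 0" using nonzero_reduction[OF \<open>\<not> F dvd g\<close>] .
    have "degree h \<in> {j. coeff h j \<noteq> 0}" using h(3) by simp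
    then have "Min ((\<lambda>j. m * (int p * q (coeff h j) + s * int j)) ` {j. coeff h j \<noteq> 0})
        \<in> (\<lambda>j. m * (int p * q (coeff h j) + s * int j)) ` {j. coeff h j \<noteq> 0}"
      using finite_coeff_support[of h] by (intro Min_in) blast+
    then show ?thesis using v_cong[OF v h(1)] ramified_value[OF R h(2,3)] by auto
  qed
  obtain g h where "\<not> F dvd g" "\<not> F dvd h" "v g - v h = 1" using v_normal[OF v] by blast
  then have "m dvd 1" using dv dvd_diff by metis
  then show ?thesis using R by (simp add: ramified_def)
qed

lemma ramified_unique:
  assumes R: "ramified v m q s" "ramified v' m' q s"
  shows "v = v'"
proof
  fix g
  have v: "v \<in> CP" "v' \<in> CP" using R by (simp_all add: ramified_def)
  have m: "m = 1" "m' = 1" using R ramified_index by blast+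
  show "v g = v' g"
  proof (cases "F dvd g")
    case True
    then show ?thesis using v_dvd[OF v(1) True] v_dvd[OF v(2) True] by simp
  next
    case False
    then obtain h where h: "F dvd g - h" "degree h < p" "h \<noteq> 0" using nonzero_reduction by blast
    then show ?thesis
      using v_cong[OF v(1) h(1)] v_cong[OF v(2) h(1)] ramified_value[OF R(1) h(2,3)]
        ramified_value[OF R(2) h(2,3)] m by simp
  qed
qed

text \<open>The curve equation gives \<open>p v(y) = (r + 1) v(x)\<close>, so \<open>p\<close>
  divides \<open>v(x)\<close>; this is total ramification, from \<open>r + 1\<close> being prime to
  \<open>p\<close>.\<close>

lemma ramified_pole:
  assumes v: "v \<in> CP" and x: "v polyx < 0"
  shows "\<exists>m. ramified v m (\<lambda>c. - int (degree c)) (- int (r + 1))"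
proof -
  have "degree A = r + 1"
    unfolding A_def by (subst degree_mult_eq) (simp_all add: degree_power_eq)
  then have "int p * v polyy = int (r + 1) * v polyx"
    using v_y[OF v] v_pole[OF v x A_not_0] by simp
  moreover from this have "int p dvd v polyx"
    using coprime_r1 by (metis coprime_dvd_mult_right_iff coprime_int_iff dvd_triv_left)
  then obtain n where n: "v polyx = int p * n" by blast
  ultimately have "int p * v polyy = int p * (int (r + 1) * n)" by (simp only: mult.left_commute)
  then have "v polyy = int (r + 1) * n" using p_pos by simp
  moreover have "n < 0" using x n by (simp add: mult_less_0_iff)
  moreover have "v [:c:] = int p * (- n) * (- int (degree c))" if "c \<noteq> 0" for c
    using v_pole[OF v x that] n by simp
  moreover have "coprime (int p) (- int (r + 1))"
    using coprime_r1 by (simp only: coprime_minus_right_iff coprime_int_iff)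
  ultimately show ?thesis
    unfolding ramified_def using v by (intro exI[of _ "- n"]) (simp add: algebra_simps)
qed

lemma ramified_zero:
  assumes v: "v \<in> CP" and x: "v [:[:- a, 1:]:] > 0" and s: "coprime p (order a A)"
  shows "\<exists>m. ramified v m (\<lambda>c. int (order a c)) (int (order a A))"
proof -
  let ?x = "v [:[:- a, 1:]:]"
  have "int p * v polyy = int (order a A) * ?x" using v_y[OF v] v_root[OF v x A_not_0] by simp
  moreover from this have "int p dvd ?x"
    using s by (metis coprime_dvd_mult_right_iff coprime_int_iff dvd_triv_left)
  then obtain n where n: "?x = int p * n" by blast
  ultimately have "int p * v polyy = int p * (int (order a A) * n)" by (simp only: mult.left_commute)
  then have "v polyy = int (order a A) * n" using p_pos by simp
  moreover have "n > 0" using x n by (simp add: zero_less_mult_iff)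
  moreover have "v [:c:] = int p * n * int (order a c)" if "c \<noteq> 0" for c
    using v_root[OF v x that] n by simp
  ultimately show ?thesis
    unfolding ramified_def using v s by (intro exI[of _ n]) simp
qed

lemma order_A: "order 0 A = r" "order d A = 1" "a \<noteq> 0 \<Longrightarrow> a \<noteq> d \<Longrightarrow> order a A = 0"
proof -
  have A: "order a A = order a ([:0, 1:] ^ r) + order a [:d, -1:]" for a
    using A_not_0 unfolding A_def by (rule order_mult)
  have "order 0 ([:- 0, 1:] ^ r :: 'a poly) = r" by (rule order_power_n_n)
  moreover have "order 0 [:d, -1:] = 0" using d by (intro order_0I) simp
  ultimately show "order 0 A = r" using A by simp
  have "[:d, -1:] = - ([:- d, 1:] ^ 1)" by simp
  then have "order d [:d, -1:] = 1" by (simp only: order_uminus order_power_n_n)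
  moreover have "order d ([:0, 1:] ^ r :: 'a poly) = 0" using d by (intro order_0I) (simp add: poly_power)
  ultimately show "order d A = 1" using A by simp
  show "order a A = 0" if "a \<noteq> 0" "a \<noteq> d" for a
    using that by (intro order_0I) (simp add: poly_A)
qed

lemma point_comp:
  assumes v: "v \<in> CP" and f: "rhom f" "\<And>g. F dvd f g \<longleftrightarrow> F dvd g" "\<And>g. \<exists>h. f h = g"
    and c: "\<And>c. c \<noteq> 0 \<Longrightarrow> \<exists>c'. c' \<noteq> 0 \<and> f [:[:c:]:] = [:[:c':]:]"
  shows "(\<lambda>g. v (f g)) \<in> CP"
proof -
  have 1: "F dvd f g - f h" if "F dvd g - h" for g h
    using that f(2)[of "g - h"] by (simp add: rhom_diff[OF f(1)])
  obtain g h where gh: "\<not> F dvd g" "\<not> F dvd h" "v g - v h = 1" using v_normal[OF v] by blast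
  then have "\<exists>g h. \<not> F dvd g \<and> \<not> F dvd h \<and> v (f g) - v (f h) = 1"
    using f(2,3) by metis
  moreover have "min (v (f g)) (v (f h)) \<le> v (f (g + h))"
    if "\<not> F dvd g \<and> \<not> F dvd h \<and> \<not> F dvd g + h" for g h
    using v_add[OF v, of "f g" "f h"] that f(2)[of "g + h"] f(2)[of g] f(2)[of h]
    by (simp only: rhom_add[OF f(1)]) blast
  moreover have "v (f (g * h)) = v (f g) + v (f h)" if "\<not> F dvd g \<and> \<not> F dvd h" for g h
    using v_mult[OF v, of "f g" "f h"] that f(2) by (simp only: rhom_mult[OF f(1)]) blast
  moreover have "v (f [:[:a:]:]) = 0" if "a \<noteq> 0" for a
    using c[OF that] v_const[OF v] by auto
  ultimately show ?thesis
    unfolding curve_points_def using v_zero[OF v] v_cong[OF v 1] by (simp add: rhom_0[OF f(1)])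
qed

lemma curve_aut_point:
  assumes v: "v \<in> CP"
  shows "curve_aut (w ^ j) v \<in> CP"
proof -
  have "\<exists>h. tau j h = g" for g
  proof -
    have "j + j * (p - 1) = j * p" using p_pos by (cases p) auto
    then obtain n where "j + n = j * p" by blast
    then have "tau j (tau n g) = g" using tau_mod[of "j * p" g] by (simp add: tau_tau tau_0)
    then show ?thesis by blast
  qed
  then have "(\<lambda>g. v (tau j g)) \<in> CP"
    by (intro point_comp[OF v rhom_tau tau_dvd]) (auto simp: tau_const)
  then show ?thesis by (simp add: curve_aut_def tau_def)
qed

text \<open>The point is determined by its ramification data and so is fixed by the automorphisms;
  all \<open>p\<close> conjugates of \<open>g\<close> have the same value, and that of the norm is
  \<open>p\<close> times it.\<close>

lemma ramified_norm:
  assumes R: "ramified v m q s" and g: "\<not> F dvd g"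
  shows "curve_aut (w ^ j) v = v" "v g = q (nm g)"
proof -
  have v: "v \<in> CP" using R by (simp add: ramified_def)
  have m: "m = 1" using R ramified_index by blast
  have inv: "curve_aut (w ^ j) v = v" for j
  proof (rule ramified_unique[OF _ R])
    have "v ([:[:w ^ j:]:] * polyy) = v [:[:w ^ j:]:] + v polyy"
      using w0 by (intro v_mult[OF v] F_not_dvd_const y_not_dvd[of 0, simplified]) auto
    then have "v (tau j polyy) = v polyy"
      using v_const[OF v, of "w ^ j"] w0 by (simp only: tau_y) simp
    then show "ramified (curve_aut (w ^ j) v) m q s"
      using R curve_aut_point[OF v] unfolding ramified_def tau_prod_valuation by (simp add: tau_const)
  qed
  then show "curve_aut (w ^ j) v = v" .
  have "v (tau j g) = v g" for j using tau_prod_valuation[of j v g] inv by simp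
  then have "int p * v g = v [:nm g:]" using v_norm[OF v g] by simp
  then show "v g = q (nm g)" using R m nm_nonzero[OF g] p_pos by (simp add: ramified_def)
qed

text \<open>For \<open>b \<noteq> 0\<close> the function \<open>x - a\<close> is a uniformiser:
  \<open>S = (y^p - b^p) / (y - b)\<close> takes the nonzero value \<open>p b^(p-1)\<close> at the
  point, and \<open>(y - b) S\<close> is a multiple of \<open>x - a\<close> modulo \<open>F\<close>.
  So \<open>y - b\<close>, like any function vanishing there, is divisible by \<open>x - a\<close>
  up to the factor \<open>S\<close>.\<close>

lemma unramified_division:
  assumes b: "b ^ p = poly A a" "b \<noteq> 0" and g: "poly (poly g [:b:]) a = 0"
  shows "\<exists>S h. poly (poly S [:b:]) a \<noteq> 0 \<and> F dvd S * g - [:[:- a, 1:]:] * h"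
proof -
  let ?b = "[:[:b:]:] :: 'a poly poly"
  define S where "S = (\<Sum>i<p. ?b ^ (p - Suc i) * polyy ^ i)"
  have yb: "[:[:- b:], 1:] = polyy - ?b" by simp
  have SF: "[:[:- b:], 1:] * S = polyy ^ p - [:[:poly A a:]:]"
    unfolding S_def yb power_diff_sumr2[symmetric] b(1)[symmetric]
    by (simp only: rhom_power[OF rhom_const_poly])
  have "[:- a, 1:] dvd A - [:poly A a:]" by (simp flip: poly_eq_0_iff_dvd)
  then obtain R where R: "A - [:poly A a:] = [:- a, 1:] * R" by (rule dvdE)
  have AR: "[:A:] - [:[:poly A a:]:] = [:[:- a, 1:]:] * [:R:]"
    using arg_cong[OF R, of "\<lambda>c. [:c:]"] by (simp only: rhom_diff[OF rhom_const_poly] rhom_mult[OF rhom_const_poly])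
  have "polyy ^ p - [:[:poly A a:]:] = F + ([:A:] - [:[:poly A a:]:])" by (simp add: F_eq)
  then have S: "[:[:- b:], 1:] * S = F + [:[:- a, 1:]:] * [:R:]" by (simp only: SF AR)
  have S0: "poly (poly S [:b:]) a = of_nat p * b ^ (p - 1)"
  proof -
    have "poly (poly S [:b:]) a = (\<Sum>i<p. b ^ (p - Suc i) * b ^ i)"
      by (simp add: S_def poly_sum)
    also have "\<dots> = (\<Sum>i<p. b ^ (p - 1))" by (rule sum.cong) (simp_all flip: power_add)
    finally show ?thesis by simp
  qed
  obtain g1 g2 where g12: "g - [:[:poly (poly g [:b:]) a:]:] = [:[:- b:], 1:] * g1 + [:[:- a, 1:]:] * [:g2:]"
    using bivariate_decomposition by blast
  have "g = [:[:- b:], 1:] * g1 + [:[:- a, 1:]:] * [:g2:]" using g12 unfolding g by (metis diff_zero pCons_0_0)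
  then have "S * g = ([:[:- b:], 1:] * S) * g1 + [:[:- a, 1:]:] * (S * [:g2:])"
    by (simp only: distrib_left mult.assoc mult.left_commute mult.commute)
  then have "S * g - [:[:- a, 1:]:] * ([:R:] * g1 + S * [:g2:]) = F * g1"
    unfolding S by (simp only: distrib_left distrib_right mult.assoc add_diff_cancel_right' add_ac)
  then have "F dvd S * g - [:[:- a, 1:]:] * ([:R:] * g1 + S * [:g2:])" by (metis dvd_triv_left)
  moreover have "poly (poly S [:b:]) a \<noteq> 0" using S0 char b(2) by simp
  ultimately show ?thesis by blast
qed

text \<open>Factors \<open>x - a\<close> are split off until the function no longer vanishes at
  \<open>(a, b)\<close>. Doing this for two valuations at once shows that both are multiples of the
  same order function.\<close>

lemma unramified_value:
  assumes v: "v \<in> CP" "lies_above v a b" and v': "v' \<in> CP" "lies_above v' a b" and b: "b \<noteq> 0"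
    and g: "\<not> F dvd g"
  shows "\<exists>k. v g = k * v [:[:- a, 1:]:] \<and> v' g = k * v' [:[:- a, 1:]:]" using g
proof (induction "nat (v g)" arbitrary: g rule: less_induct)
  case (less g)
  show ?case
  proof (cases "poly (poly g [:b:]) a = 0")
    case False
    then have "v g = 0" "v' g = 0"
      using lies_above_eval[OF v, of g] lies_above_eval[OF v', of g] less.prems
        lies_above_nonneg[OF v, of g] lies_above_nonneg[OF v', of g]
      by (auto simp: vpos_def[OF v(1)] vpos_def[OF v'(1)])
    then show ?thesis by (intro exI[of _ 0]) simp
  next
    case True
    let ?x = "[:[:- a, 1:]:] :: 'a poly poly"
    obtain S h where S: "poly (poly S [:b:]) a \<noteq> 0" and h: "F dvd S * g - ?x * h"
      using unramified_division[OF lies_above_curve[OF v] b True] by blast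
    have Sv: "\<not> F dvd S \<and> u S = 0" if u: "u \<in> CP" "lies_above u a b" for u
      using lies_above_eval[OF u, of S] S lies_above_nonneg[OF u, of S] by (auto simp: vpos_def[OF u(1)])
    have ndS: "\<not> F dvd S" using Sv[OF v] by blast
    then have ndSg: "\<not> F dvd S * g" using F_prime less.prems by blast
    have ndh: "\<not> F dvd h"
    proof
      assume "F dvd h"
      then have "F dvd ?x * h" by (rule dvd_mult)
      then have "F dvd S * g - ?x * h + ?x * h" using h by (rule dvd_add[rotated])
      then show False using ndSg by (simp only: diff_add_cancel)
    qed
    have ndx: "\<not> F dvd ?x" by (rule F_not_dvd_const) simp
    have eq: "u g = u ?x + u h" if u: "u \<in> CP" "lies_above u a b" for u
      using v_cong[OF u(1) h] v_mult[OF u(1) ndS less.prems] v_mult[OF u(1) ndx ndh] Sv[OF u] by linarith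
    have x: "v ?x > 0" using v(2) by (simp add: lies_above_def)
    have "nat (v h) < nat (v g)" using eq[OF v] x lies_above_nonneg[OF v, of h] by linarith
    then obtain k where "v h = k * v ?x" "v' h = k * v' ?x" using less.hyps[OF _ ndh] by blast
    then show ?thesis using eq[OF v] eq[OF v'] by (intro exI[of _ "k + 1"]) (simp add: algebra_simps)
  qed
qed

lemma unramified_unique:
  assumes v: "v \<in> CP" "lies_above v a b" and v': "v' \<in> CP" "lies_above v' a b" and b: "b \<noteq> 0"
  shows "v [:[:- a, 1:]:] = 1" "v = v'"
proof -
  have *: "u [:[:- a, 1:]:] = 1" if u: "u \<in> CP" "lies_above u a b" for u
  proof -
    have dv: "u [:[:- a, 1:]:] dvd u g" if "\<not> F dvd g" for g
      using unramified_value[OF u u b that] by auto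
    obtain g h where "\<not> F dvd g" "\<not> F dvd h" "u g - u h = 1" using v_normal[OF u(1)] by blast
    then have "u [:[:- a, 1:]:] dvd 1" using dv dvd_diff by metis
    then show ?thesis using u(2) by (simp add: lies_above_def)
  qed
  show "v [:[:- a, 1:]:] = 1" using *[OF v] .
  show "v = v'"
  proof
    fix g
    show "v g = v' g"
    proof (cases "F dvd g")
      case True
      then show ?thesis using v_dvd[OF v(1) True] v_dvd[OF v'(1) True] by simp
    next
      case False
      then show ?thesis using unramified_value[OF v v' b False] *[OF v] *[OF v'] by auto
    qed
  qed
qed

end

section \<open>The two special points and the fibres of \<open>x\<close>\<close>

context superelliptic_expansion
begin

abbreviation "P0 \<equiv> valn U0 Y0"
abbreviation "P_inf \<equiv> valn Ui Yi"

lemma valn_x: "valn U Y polyx = fls_subdegree U"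
  and valn_y: "valn U Y polyy = fls_subdegree Y" by (simp_all add: valn_def eval2_x eval2_y)

lemma valn_power:
  assumes "par U Y"
  shows "valn U Y (polyx ^ i) = int i * fls_subdegree U" "valn U Y (polyy ^ i) = int i * fls_subdegree Y"
    "\<not> F dvd polyx ^ i" "\<not> F dvd polyy ^ i"
proof -
  have "U \<noteq> 0" "Y \<noteq> 0"
    using kernel[OF assms, of polyx] kernel[OF assms, of polyy] y_not_dvd[of 0] F_not_dvd_const[of "[:0,1:]"]
    by (auto simp: eval2_x eval2_y)
  then show "valn U Y (polyx ^ i) = int i * fls_subdegree U" "valn U Y (polyy ^ i) = int i * fls_subdegree Y"
    "\<not> F dvd polyx ^ i" "\<not> F dvd polyy ^ i"
    unfolding kernel[OF assms, symmetric] valn_def rhom_power[OF rhom_eval2]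
    by (simp_all add: eval2_x eval2_y fls_subdegree_pow)
qed

text \<open>The normalisation is witnessed by \<open>x^e / y^k\<close>, of order
  \<open>p e - r k = 1\<close>.\<close>

lemma P0_point: "P0 \<in> CP"
proof (rule valn_point[OF par0 valn_power(3,4)[OF par0]])
  have "int (r * k + 1) = int (p * e)" using ke(2) by simp
  then show "P0 (polyx ^ e) - P0 (polyy ^ k) = 1"
    unfolding valn_power(1,2)[OF par0] subdegrees by (simp add: algebra_simps)
qed

lemma P0_above: "lies_above P0 0 0"
  using r p_pos by (simp add: lies_above_def valn_x valn_y subdegrees)

lemma P_inf_point: "P_inf \<in> CP"
proof -
  have "p \<noteq> 0" using p_pos by simp
  then obtain i j where "p * i = (r + 1) * j + gcd p (r + 1)" using bezout_nat by blast
  moreover have "gcd p (r + 1) = 1" using coprime_r1 by (simp only: coprime_iff_gcd_eq_1)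
  ultimately have "int (p * i) = int ((r + 1) * j + 1)" by simp
  then have "P_inf (polyy ^ j) - P_inf (polyx ^ i) = 1"
    unfolding valn_power(1,2)[OF pari] subdegrees by (simp add: algebra_simps)
  then show ?thesis by (rule valn_point[OF pari valn_power(4,3)[OF pari]])
qed

lemma P_inf_pole: "P_inf polyx < 0" using p_pos by (simp add: valn_x subdegrees)

text \<open>A local parameter is \<open>x - a\<close> for \<open>b \<noteq> 0\<close>, where
  \<open>y\<close> is a root of a power series. For \<open>b = 0\<close> the only new point is
  \<open>(d, 0)\<close>, where \<open>x = d - t^p\<close> and \<open>y\<close> is \<open>t\<close>
  times a unit.\<close>

lemma point_exists:
  assumes b: "b ^ p = poly A a"
  shows "\<exists>v\<in>CP. lies_above v a b"
proof (cases "b = 0")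
  case False
  define G where "G = (fps_const a + fps_X) ^ r * (fps_const d - (fps_const a + fps_X))"
  have "G $ 0 = b ^ p" by (simp add: G_def fps_nth_power_0 b poly_A)
  then obtain B where B: "B ^ p = G" "B $ 0 = b" using fps_root_exists[OF char False] by blast
  let ?U = "fls_const a + fls_X" and ?Y = "fps_to_fls B"
  have par: "par ?U ?Y"
    unfolding par_def
  proof
    have "?Y ^ p = fps_to_fls G" by (simp add: rhom_power[OF rhom_fps_to_fls, symmetric] B)
    then show "?Y ^ p = ?U ^ r * (fls_const d - ?U)"
      by (simp add: G_def rhom_simps[OF rhom_fps_to_fls])
    show "\<exists>a'. fls_subdegree (?U - fls_const a') \<noteq> 0" by (intro exI[of _ a]) simp
  qed
  have x: "eval2 ?U ?Y [:[:- a, 1:]:] = fls_X"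
    by (simp add: eval2_const map_poly_pCons_rhom[OF rhom_fls_const] rhom_minus[OF rhom_fls_const])
  have "[:[:- b:], 1:] = polyy - [:[:b:]:]" by simp
  then have y: "eval2 ?U ?Y [:[:- b:], 1:] = fps_to_fls (B - fps_const b)"
    by (simp only: rhom_diff[OF rhom_eval2] eval2_y eval2_const_const rhom_diff[OF rhom_fps_to_fls]) simp
  have "fps_to_fls (B - fps_const b) \<noteq> 0"
    using kernel[OF par, of "[:[:- b:], 1:]"] y_not_dvd[of "- b"] unfolding y by blast
  then have "valn ?U ?Y [:[:- b:], 1:] > 0"
    unfolding valn_def y by (rule pos_subdegree_fps[rotated]) (simp add: B)
  moreover have v: "valn ?U ?Y [:[:- a, 1:]:] = 1" unfolding valn_def x by simp
  moreover have "valn ?U ?Y \<in> CP"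
  proof (rule valn_point[OF par])
    show "valn ?U ?Y [:[:- a, 1:]:] - valn ?U ?Y [:[:1:]:] = 1"
      unfolding v by (simp add: valn_def eval2_const_const)
  qed (rule F_not_dvd_const; simp)+
  ultimately have "lies_above (valn ?U ?Y) a b" "valn ?U ?Y \<in> CP" by (simp_all add: lies_above_def)
  then show ?thesis by blast
next
  case True
  then have "a = 0 \<or> a = d" using b p_pos r by (auto simp: poly_A power_0_left)
  then show ?thesis
  proof
    assume "a = 0"
    then show ?thesis using P0_point P0_above True by blast
  next
    assume a: "a = d"
    obtain s where s: "s ^ p = d ^ r" using nth_root_exists[OF p_pos] by blast
    have "s \<noteq> 0"
    proof
      assume "s = 0"
      then have "d ^ r = 0" using s p_pos by (simp add: power_0_left)
      then show False using d by simp
    qed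
    define G where "G = (fps_const d - fps_X ^ p) ^ r"
    have "G $ 0 = s ^ p" using p_pos by (simp add: G_def fps_nth_power_0 s power_0_left)
    then obtain B where B: "B ^ p = G" "B $ 0 = s"
      using fps_root_exists[OF char \<open>s \<noteq> 0\<close>] by blast
    let ?U = "fls_const d - fls_X ^ p" and ?Y = "fls_X * fps_to_fls B"
    have U: "?U - fls_const d = - (fls_X ^ p)" by simp
    have par: "par ?U ?Y"
      unfolding par_def
    proof
      have "fps_to_fls B ^ p = fps_to_fls G"
        by (simp add: rhom_power[OF rhom_fps_to_fls, symmetric] B)
      also have "\<dots> = ?U ^ r" by (simp add: G_def rhom_simps[OF rhom_fps_to_fls])
      finally show "?Y ^ p = ?U ^ r * (fls_const d - ?U)"
        by (simp add: power_mult_distrib mult.commute)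
      show "\<exists>a'. fls_subdegree (?U - fls_const a') \<noteq> 0"
        using p_pos by (intro exI[of _ d]) (simp add: U fls_subdegree_pow)
    qed
    have x: "eval2 ?U ?Y [:[:- d, 1:]:] = - (fls_X ^ p)"
      by (simp add: eval2_const map_poly_pCons_rhom[OF rhom_fls_const] rhom_minus[OF rhom_fls_const])
    have "B \<noteq> 0" "subdegree B = 0"
      using B \<open>s \<noteq> 0\<close> by (auto simp: subdegree_eq_0_iff)
    then have v: "valn ?U ?Y polyy = 1" by (simp add: valn_y fls_subdegree_fls_to_fps)
    have "valn ?U ?Y [:[:- d, 1:]:] > 0" unfolding valn_def x using p_pos by (simp add: fls_subdegree_pow)
    moreover have "valn ?U ?Y \<in> CP"
    proof (rule valn_point[OF par])
      show "valn ?U ?Y polyy - valn ?U ?Y [:[:1:]:] = 1"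
        unfolding v by (simp add: valn_def eval2_const_const)
      show "\<not> F dvd polyy" using y_not_dvd[of 0] by simp
    qed (rule F_not_dvd_const; simp)
    ultimately have "lies_above (valn ?U ?Y) a b" "valn ?U ?Y \<in> CP"
      using v True a by (simp_all add: lies_above_def)
    then show ?thesis by blast
  qed
qed

lemma P_inf_ramified: "ramified P_inf 1 (\<lambda>c. - int (degree c)) (- int (r + 1))"
  using ramified_pole[OF P_inf_point P_inf_pole] ramified_index by metis

lemma P_inf_unique: "v \<in> CP \<Longrightarrow> v polyx < 0 \<Longrightarrow> v = P_inf"
  using ramified_pole ramified_unique P_inf_ramified by metis

lemma P_inf_value: "\<not> F dvd g \<Longrightarrow> P_inf g = - int (degree (nm g))"
  using ramified_norm(2)[OF P_inf_ramified] by simp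

definition fibre :: "'a \<Rightarrow> 'a point set" where
  "fibre a = {v \<in> CP. \<exists>b. lies_above v a b}"

lemma coprime_order_A: "coprime p (order 0 A)" "coprime p (order d A)"
  using coprime_r by (simp_all add: order_A)

lemma fibre_ramified:
  assumes a: "a = 0 \<or> a = d"
  shows "\<exists>v. fibre a = {v} \<and> ramified v 1 (\<lambda>c. int (order a c)) (int (order a A))"
proof -
  have A: "poly A a = 0" using a r by (auto simp: poly_A)
  have R: "ramified v 1 (\<lambda>c. int (order a c)) (int (order a A))" if "v \<in> fibre a" for v
  proof -
    have "\<exists>m. ramified v m (\<lambda>c. int (order a c)) (int (order a A))"
      using that a coprime_order_A by (intro ramified_zero) (auto simp: fibre_def lies_above_def)
    then show ?thesis using ramified_index by metis
  qed
  obtain v where v: "v \<in> fibre a" using point_exists[of 0 a] A p_pos by (auto simp: fibre_def)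
  then have "fibre a = {v}" using R ramified_unique by blast
  then show ?thesis using R v by blast
qed

lemma fibre_0: "fibre 0 = {P0}"
proof -
  have "P0 \<in> fibre 0" using P0_point P0_above by (auto simp: fibre_def)
  moreover obtain v where "fibre 0 = {v}" using fibre_ramified[of 0] by auto
  ultimately show ?thesis by simp
qed

lemma P0_ramified: "ramified P0 1 (\<lambda>c. int (order 0 c)) (int r)"
  using fibre_ramified[of 0] fibre_0 order_A(1) by auto

lemma P0_value: "\<not> F dvd g \<Longrightarrow> P0 g = int (order 0 (nm g))"
  using ramified_norm(2)[OF P0_ramified] by simp

lemma lies_above_aut:
  assumes v: "v \<in> CP" and ab: "lies_above v a b"
  shows "lies_above (curve_aut (w ^ j) v) a (w ^ j * b)"
proof -
  have "tau j [:[:- (w ^ j * b):], 1:] = [:[:w ^ j:]:] * [:[:- b:], 1:]"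
    using w0 by (simp add: tau_def pcompose_pCons)
  moreover have "v ([:[:w ^ j:]:] * [:[:- b:], 1:]) = v [:[:w ^ j:]:] + v [:[:- b:], 1:]"
    using w0 by (intro v_mult[OF v] F_not_dvd_const y_not_dvd) simp
  moreover have "v [:[:w ^ j:]:] = 0" using v_const[OF v] w0 by simp
  ultimately show ?thesis
    using ab unfolding lies_above_def tau_prod_valuation by (simp add: tau_const)
qed

lemma fibre_unramified:
  assumes a: "a \<noteq> 0" "a \<noteq> d"
  obtains v b where "v \<in> CP" "lies_above v a b" "b \<noteq> 0" "inj_on (\<lambda>j. curve_aut (w ^ j) v) {..<p}"
    "fibre a = (\<lambda>j. curve_aut (w ^ j) v) ` {..<p}"
proof -
  obtain b where b: "b ^ p = poly A a" using nth_root_exists[OF p_pos] by blast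
  then have b0: "b \<noteq> 0" using a p_pos by (auto simp: poly_A power_0_left)
  obtain v where v: "v \<in> CP" "lies_above v a b" using point_exists[OF b] by blast
  note above = lies_above_aut[OF v]
  have weq: "w ^ i = w ^ j \<longleftrightarrow> i = j" if "i < p" "j < p" for i j
    by (rule primitive_root_power_eq_iff[OF w that])
  have "inj_on (\<lambda>j. curve_aut (w ^ j) v) {..<p}"
  proof (rule inj_onI)
    fix i j assume ij: "i \<in> {..<p}" "j \<in> {..<p}" "curve_aut (w ^ i) v = curve_aut (w ^ j) v"
    then have "w ^ i * b = w ^ j * b"
      using lies_above_unique(2)[OF curve_aut_point[OF v(1)] above[of i]] above[of j] by metis
    then have "w ^ i = w ^ j" using b0 by simp
    then show "i = j" using weq ij by blast
  qed
  moreover have "fibre a = (\<lambda>j. curve_aut (w ^ j) v) ` {..<p}"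
  proof
    show "(\<lambda>j. curve_aut (w ^ j) v) ` {..<p} \<subseteq> fibre a"
      using above curve_aut_point[OF v(1)] by (auto simp: fibre_def)
    show "fibre a \<subseteq> (\<lambda>j. curve_aut (w ^ j) v) ` {..<p}"
    proof
      fix u assume "u \<in> fibre a"
      then obtain c where u: "u \<in> CP" "lies_above u a c" by (auto simp: fibre_def)
      have c: "c ^ p = b ^ p" using lies_above_curve[OF u] b by simp
      then have "poly ([:0, 1:] ^ p - [:b ^ p:]) c = 0" by simp
      then have "poly (\<Prod>j<p. [:- (w ^ j * b), 1:]) c = 0"
        by (simp only: primitive_root_poly[OF w p_pos])
      then obtain j where j: "j < p" "c = w ^ j * b" by (auto simp: poly_prod prod_zero_iff)
      then have "u = curve_aut (w ^ j) v"
        using unramified_unique(2)[OF u curve_aut_point[OF v(1), of j]] above[of j] b0 w0 by simp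
      then show "u \<in> (\<lambda>j. curve_aut (w ^ j) v) ` {..<p}" using j by blast
    qed
  qed
  ultimately show thesis using that v b0 by blast
qed

text \<open>A fibre is either one totally ramified point or \<open>p\<close> conjugates of an
  unramified one; in both cases the sum of values is the order of the norm.\<close>

lemma fibre_sum:
  assumes g: "\<not> F dvd g"
  shows "finite (fibre a)" "(\<Sum>v\<in>fibre a. v g) = int (order a (nm g))"
proof -
  have "finite (fibre a) \<and> (\<Sum>v\<in>fibre a. v g) = int (order a (nm g))"
  proof (cases "a = 0 \<or> a = d")
    case True
    then obtain v where "fibre a = {v}" "ramified v 1 (\<lambda>c. int (order a c)) (int (order a A))"
      using fibre_ramified by blast
    then show ?thesis using ramified_norm(2)[OF _ g] by simp
  next
    case False
    then obtain v b where v: "v \<in> CP" "lies_above v a b" "b \<noteq> 0"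
      and inj: "inj_on (\<lambda>j. curve_aut (w ^ j) v) {..<p}"
      and fib: "fibre a = (\<lambda>j. curve_aut (w ^ j) v) ` {..<p}"
      using fibre_unramified by blast
    have x: "v [:[:- a, 1:]:] = 1" using unramified_unique(1)[OF v(1,2) v] .
    have "(\<Sum>u\<in>fibre a. u g) = (\<Sum>j<p. v (tau j g))"
      unfolding fib sum.reindex[OF inj] by (simp add: tau_prod_valuation)
    also have "\<dots> = v [:nm g:]" by (rule v_norm[OF v(1) g])
    also have "\<dots> = int (order a (nm g))"
      using v_root[OF v(1) _ nm_nonzero[OF g], of a] x by simp
    finally show ?thesis by (simp add: fib)
  qed
  then show "finite (fibre a)" "(\<Sum>v\<in>fibre a. v g) = int (order a (nm g))" by blast+
qed

lemma fibre_disjoint: "v \<in> fibre a \<Longrightarrow> v \<in> fibre a' \<Longrightarrow> a = a'"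
  using lies_above_unique(1) by (auto simp: fibre_def)

lemma fibre_pole: "v \<in> fibre a \<Longrightarrow> v \<noteq> P_inf"
  using lies_above_nonneg[of v a _ polyx] P_inf_pole by (auto simp: fibre_def)

lemma point_fibre: "v \<in> CP \<Longrightarrow> v = P_inf \<or> (\<exists>a. v \<in> fibre a)"
  using point_cases P_inf_unique by (auto simp: fibre_def)

lemma fibre_zero:
  assumes g: "\<not> F dvd g" and a: "poly (nm g) a \<noteq> 0" and v: "v \<in> fibre a"
  shows "v g = 0"
proof -
  have "(\<Sum>v\<in>fibre a. v g) = 0" using fibre_sum(2)[OF g] a by (simp add: order_0I)
  moreover have "u g \<ge> 0" if "u \<in> fibre a" for u
    using that lies_above_nonneg by (auto simp: fibre_def)
  ultimately show ?thesis
    using sum_nonneg_eq_0_iff[OF fibre_sum(1)[OF g], of a "\<lambda>v. v g"] v by blast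
qed

lemma support_subset:
  assumes g: "\<not> F dvd g"
  shows "{v \<in> CP. v g \<noteq> 0} \<subseteq> insert P_inf (\<Union>a\<in>{a. poly (nm g) a = 0}. fibre a)"
  using fibre_zero[OF g] point_fibre by blast

lemma finite_support: "\<not> F dvd g \<Longrightarrow> finite {v \<in> CP. v g \<noteq> 0}"
  by (rule finite_subset[OF support_subset]) (auto intro!: poly_roots_finite nm_nonzero fibre_sum(1))

text \<open>Summing over the fibres gives the number of roots of the norm with multiplicity, which
  is its degree, and the value at infinity is minus that degree.\<close>

lemma degree_zero:
  assumes g: "\<not> F dvd g"
  shows "(\<Sum>v | v \<in> CP \<and> v g \<noteq> 0. v g) = 0"
proof -
  let ?R = "{a. poly (nm g) a = 0}"
  have R: "finite ?R" using poly_roots_finite[OF nm_nonzero[OF g]] .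
  have fin: "finite (\<Union>a\<in>?R. fibre a)" using R fibre_sum(1)[OF g] by blast
  have CPs: "(\<Union>a\<in>?R. fibre a) \<subseteq> CP" by (auto simp: fibre_def)
  have "(\<Sum>v | v \<in> CP \<and> v g \<noteq> 0. v g) = (\<Sum>v\<in>insert P_inf (\<Union>a\<in>?R. fibre a). v g)"
    using support_subset[OF g] fin CPs P_inf_point by (intro sum.mono_neutral_left) auto
  also have "\<dots> = P_inf g + (\<Sum>v\<in>(\<Union>a\<in>?R. fibre a). v g)"
    using fin fibre_pole by (subst sum.insert) blast+
  also have "(\<Sum>v\<in>(\<Union>a\<in>?R. fibre a). v g) = (\<Sum>a\<in>?R. \<Sum>v\<in>fibre a. v g)"
    using R fibre_sum(1)[OF g] fibre_disjoint by (intro sum.UNION_disjoint) blast+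
  also have "\<dots> = int (degree (nm g))"
    using fibre_sum(2)[OF g] alg_closed_sum_order[OF nm_nonzero[OF g]] by (simp flip: of_nat_sum)
  finally show ?thesis using P_inf_value[OF g] by simp
qed

end

section \<open>Norms and their leading coefficients\<close>

definition lc :: "'a::zero fls \<Rightarrow> 'a" where
  "lc f = fls_nth f (fls_subdegree f)"

lemma lc_mult: "f \<noteq> 0 \<Longrightarrow> g \<noteq> 0 \<Longrightarrow> lc (f * g) = lc f * lc (g :: 'a::field fls)"
  by (simp add: lc_def)

lemma lc_1: "lc (1 :: 'a::field fls) = 1" by (simp add: lc_def)

lemma lc_const: "lc (fls_const c :: 'a::field fls) = c" by (cases "c = 0") (simp_all add: lc_def)

lemma lc_prod: "finite B \<Longrightarrow> (\<And>i. i \<in> B \<Longrightarrow> f i \<noteq> 0) \<Longrightarrow> lc (\<Prod>i\<in>B. f i) = (\<Prod>i\<in>B. lc (f i :: 'a::field fls))"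
  by (induction B rule: finite_induct) (auto simp: lc_1 lc_mult)

lemma lc_power: "f \<noteq> 0 \<Longrightarrow> lc (f ^ n) = lc (f :: 'a::field fls) ^ n"
  by (induction n) (auto simp: lc_1 lc_mult)

lemma lc_add:
  assumes "a \<noteq> 0" "b = 0 \<or> fls_subdegree a < fls_subdegree (b :: 'a::field fls)"
  shows "lc (a + b) = lc a"
proof (cases "b = 0")
  case False
  then have "fls_subdegree (a + b) = fls_subdegree a"
    using fls_subdegree_add_distinct[OF assms(1) False] assms(2) by simp
  then show ?thesis using False assms(2) by (simp add: lc_def)
qed simp

lemma lc_sum:
  fixes f :: "'b \<Rightarrow> 'a::field fls"
  assumes J: "finite J" "m \<in> J" "\<And>j. j \<in> J \<Longrightarrow> f j \<noteq> 0" "inj_on (\<lambda>j. fls_subdegree (f j)) J"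
    and m: "\<And>j. j \<in> J \<Longrightarrow> fls_subdegree (f m) \<le> fls_subdegree (f j)"
  shows "(\<Sum>j\<in>J. f j) \<noteq> 0" "lc (\<Sum>j\<in>J. f j) = lc (f m)"
proof -
  let ?n = "fls_subdegree (f m)"
  have ne: "J \<noteq> {}" using J(2) by blast
  have min: "Min ((\<lambda>j. fls_subdegree (f j)) ` J) = ?n" using J m by (intro Min_eqI) auto
  have S: "(\<Sum>j\<in>J. f j) \<noteq> 0 \<and> fls_subdegree (\<Sum>j\<in>J. f j) = ?n"
    using fls_sum_distinct_subdegree[OF J(1) ne J(3,4)] min by simp
  have nth: "fls_nth (\<Sum>j\<in>B. f j) n = (\<Sum>j\<in>B. fls_nth (f j) n)" if "finite B" for B n
    using that by (induction B rule: finite_induct) auto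
  have "fls_nth (\<Sum>j\<in>J. f j) ?n = (\<Sum>j\<in>J. if j = m then fls_nth (f m) ?n else 0)"
    unfolding nth[OF J(1)]
  proof (rule sum.cong[OF refl])
    fix j assume j: "j \<in> J"
    show "fls_nth (f j) ?n = (if j = m then fls_nth (f m) ?n else 0)"
    proof (cases "j = m")
      case False
      then have "?n < fls_subdegree (f j)" using m[OF j] inj_onD[OF J(4) _ j J(2)] by force
      then show ?thesis using False by simp
    qed simp
  qed
  then show "(\<Sum>j\<in>J. f j) \<noteq> 0" "lc (\<Sum>j\<in>J. f j) = lc (f m)"
    using S J(1,2) by (simp_all add: lc_def)
qed

definition low_coeff :: "'a::idom poly \<Rightarrow> 'a" where
  "low_coeff N = coeff N (order 0 N)"

lemma eval_x_pCons: "poly (map_poly fls_const (pCons a M)) U = fls_const a + U * poly (map_poly fls_const M) (U :: 'a::field fls)"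
  by (simp add: map_poly_pCons_rhom[OF rhom_fls_const])

lemma eval_x_low:
  fixes U :: "'a::field fls"
  assumes U: "fls_subdegree U > 0"
  shows "N \<noteq> 0 \<Longrightarrow> fls_subdegree (poly (map_poly fls_const N) U) = fls_subdegree U * int (order 0 N) \<and>
    lc (poly (map_poly fls_const N) U) = low_coeff N * lc U ^ order 0 N"
proof (induction N)
  case (pCons a M)
  have U0: "U \<noteq> 0" using U by auto
  let ?M = "poly (map_poly fls_const M) U"
  have M0: "?M \<noteq> 0" if "M \<noteq> 0" using eval_x_subdegree(1)[of U "fls_subdegree U" M] U that by simp
  show ?case
  proof (cases "a = 0")
    case True
    then have M: "M \<noteq> 0" using pCons by auto
    have "order 0 (pCons 0 M) = order 0 ([:- 0, 1:] ^ 1 * M)" by simp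
    also have "\<dots> = Suc (order 0 M)"
    proof -
      have "[:- 0, 1:] ^ 1 * M \<noteq> 0" using M by simp
      then have "order 0 ([:- 0, 1:] ^ 1 * M) = order 0 ([:- 0, 1:] ^ 1 :: 'a poly) + order 0 M" by (rule order_mult)
      then show ?thesis by (simp only: order_power_n_n plus_1_eq_Suc)
    qed
    finally have o: "order 0 (pCons 0 M) = Suc (order 0 M)" .
    show ?thesis using pCons.IH[OF M] M0[OF M] U0 True
      by (simp add: eval_x_pCons o low_coeff_def lc_mult algebra_simps)
  next
    case False
    then have o: "order 0 (pCons a M) = 0" by (intro order_0I) simp
    have c: "fls_const a \<noteq> 0" "fls_subdegree (fls_const a) = 0" using False by auto
    have *: "U * ?M = 0 \<or> fls_subdegree (fls_const a) < fls_subdegree (U * ?M)"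
    proof (cases "M = 0")
      case False
      have "0 \<le> fls_subdegree U * int (order 0 M)" using U by simp
      then show ?thesis using pCons.IH[OF False] M0[OF False] U0 U c by (simp add: add_pos_nonneg)
    qed simp
    have "lc (fls_const a + U * ?M) = a" using lc_add[OF c(1) *] lc_const[of a] by simp
    moreover have "fls_subdegree (fls_const a + U * ?M) = 0"
      using fls_subdegree_add_distinct[OF c(1), of "U * ?M"] * c(2) by (cases "U * ?M = 0") auto
    ultimately show ?thesis by (simp only: eval_x_pCons o low_coeff_def) simp
  qed
qed simp

lemma eval_x_lead:
  fixes U :: "'a::field fls"
  assumes U: "fls_subdegree U < 0"
  shows "N \<noteq> 0 \<Longrightarrow> fls_subdegree (poly (map_poly fls_const N) U) = fls_subdegree U * int (degree N) \<and>
    lc (poly (map_poly fls_const N) U) = lead_coeff N * lc U ^ degree N"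
proof (induction N)
  case (pCons a M)
  have U0: "U \<noteq> 0" using U by auto
  let ?M = "poly (map_poly fls_const M) U"
  show ?case
  proof (cases "M = 0")
    case True
    then show ?thesis by (simp add: eval_x_pCons lc_const)
  next
    case False
    then have M0: "?M \<noteq> 0" using eval_x_subdegree(1)[of U "fls_subdegree U" M] U by simp
    have sd: "fls_subdegree (U * ?M) = fls_subdegree U * int (degree (pCons a M))"
      using pCons.IH[OF False] M0 U0 False by (simp add: algebra_simps)
    have "fls_subdegree U * int (degree (pCons a M)) < 0"
      using U False by (simp add: mult_less_0_iff)
    then have *: "fls_const a = 0 \<or> fls_subdegree (U * ?M) < fls_subdegree (fls_const a)" using sd by simp
    have UM: "U * ?M \<noteq> 0" using U0 M0 by simp
    have "lc (U * ?M + fls_const a) = lc U * lc ?M" using lc_add[OF UM *] lc_mult[OF U0 M0] by simp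
    moreover have "fls_subdegree (U * ?M + fls_const a) = fls_subdegree (U * ?M)"
      using fls_subdegree_add_distinct[OF UM, of "fls_const a"] * by (cases "fls_const a = 0") auto
    ultimately show ?thesis
      using sd pCons.IH[OF False] False by (simp add: eval_x_pCons add.commute)
  qed
qed simp

text \<open>Vieta's formula after removing the power of \<open>X\<close>. The set \<open>R\<close>
  may be larger than the set of nonzero roots, so that one \<open>R\<close> can serve two
  polynomials.\<close>

lemma low_coeff_formula:
  fixes N :: "'a::alg_closed_field poly"
  assumes N: "N \<noteq> 0" and R: "finite R" "0 \<notin> R" "{a. a \<noteq> 0 \<and> poly N a = 0} \<subseteq> R"
  shows "low_coeff N = lead_coeff N * (- 1) ^ (degree N - order 0 N) * (\<Prod>a\<in>R. a ^ order a N)"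
proof -
  define n where "n = order 0 N"
  obtain Q where Q: "N = [:- 0, 1:] ^ n * Q" "\<not> [:- 0, 1:] dvd Q"
    using order_decomp[OF N, of 0] unfolding n_def by blast
  have Q': "N = monom 1 n * Q" using Q(1) by (simp add: monom_altdef)
  have Q0: "poly Q 0 \<noteq> 0" using Q(2) by (simp add: poly_eq_0_iff_dvd)
  have Qn: "Q \<noteq> 0" using Q0 by auto
  have "low_coeff N = poly Q 0"
    unfolding low_coeff_def n_def[symmetric] by (simp add: Q' coeff_monom_mult poly_0_coeff_0)
  also have "\<dots> = lead_coeff Q * (\<Prod>a | poly Q a = 0. (- a) ^ order a Q)"
    by (subst alg_closed_decompose[OF Qn]) (simp add: poly_prod poly_power)
  also have "(\<Prod>a | poly Q a = 0. (- a) ^ order a Q) = (\<Prod>a | poly Q a = 0. (- 1) ^ order a Q * a ^ order a Q)"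
    by (rule prod.cong) (simp_all flip: power_mult_distrib)
  also have "\<dots> = (- 1) ^ degree Q * (\<Prod>a | poly Q a = 0. a ^ order a Q)"
    by (simp add: prod.distrib alg_closed_sum_order[OF Qn] flip: power_sum)
  also have "(\<Prod>a | poly Q a = 0. a ^ order a Q) = (\<Prod>a\<in>R. a ^ order a N)"
  proof -
    have ord: "order a N = order a Q" if "a \<noteq> 0" for a
    proof -
      have "order a (monom 1 n :: 'a poly) = 0" using that by (intro order_0I) (simp add: poly_monom)
      then show ?thesis using N unfolding Q' by (subst order_mult) auto
    qed
    have sub: "{a. poly Q a = 0} \<subseteq> R" using R(3) Q0 by (auto simp: Q' poly_monom)
    have "(\<Prod>a | poly Q a = 0. a ^ order a Q) = (\<Prod>a\<in>R. a ^ order a Q)"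
      using sub R(1) by (intro prod.mono_neutral_left) (auto simp: order_0I)
    also have "\<dots> = (\<Prod>a\<in>R. a ^ order a N)"
      by (rule prod.cong[OF refl]) (use R(2) ord in metis)
    finally show ?thesis .
  qed
  also have "lead_coeff Q = lead_coeff N"
  proof -
    have "lead_coeff N = lead_coeff (monom 1 n :: 'a poly) * lead_coeff Q"
      unfolding Q' by (rule lead_coeff_mult)
    then show ?thesis by (simp add: degree_monom_eq)
  qed
  also have "degree Q = degree N - n"
  proof -
    have "degree N = degree (monom 1 n :: 'a poly) + degree Q"
      unfolding Q' by (rule degree_mult_eq) (use Qn in simp_all)
    then show ?thesis by (simp add: degree_monom_eq)
  qed
  finally show ?thesis by (simp add: n_def)
qed

context superelliptic_expansion
begin

text \<open>The terms \<open>c_j(x) y^j\<close> have distinct orders, and passing to a conjugate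
  multiplies them by constants only. So the same index \<open>j\<close> supplies the leading
  coefficient of every conjugate.\<close>

lemma lead_conjugates:
  assumes UY: "par U Y" and R: "ramified (valn U Y) m q s" and g: "degree g < p" "g \<noteq> 0"
  shows "\<exists>j. coeff g j \<noteq> 0 \<and>
    (\<forall>i. lc (eval2 U Y (tau i g)) = (w ^ i) ^ j * (lc (poly (map_poly fls_const (coeff g j)) U) * lc Y ^ j))"
proof -
  let ?J = "{j. coeff g j \<noteq> 0}" and ?T = "\<lambda>j. [:coeff g j:] * polyy ^ j"
  let ?c = "\<lambda>j. poly (map_poly fls_const (coeff g j)) U"
  have "degree g \<in> ?J" using g(2) by simp
  then have J: "finite ?J" "?J \<noteq> {}" by (blast intro: finite_coeff_support)+
  have "Y \<noteq> 0" using kernel[OF UY, of polyy] y_not_dvd[of 0] by (auto simp: eval2_y)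
  have T: "eval2 U Y (tau i (?T j)) = fls_const ((w ^ i) ^ j) * (?c j * Y ^ j)" for i j
    unfolding rhom_mult[OF rhom_tau] rhom_power[OF rhom_tau] tau_y tau_const rhom_mult[OF rhom_eval2]
      rhom_power[OF rhom_eval2] eval2_const_const eval2_y power_mult_distrib
    unfolding eval2_const by (simp only: fls_const_power mult.left_commute)
  have c: "?c j \<noteq> 0" if "j \<in> ?J" for j using par_nonzero[OF UY] that by simp
  have nz: "eval2 U Y (tau i (?T j)) \<noteq> 0" if "j \<in> ?J" for i j
    unfolding T using c[OF that] w0 \<open>Y \<noteq> 0\<close> by simp
  have T0: "eval2 U Y (?T j) = ?c j * Y ^ j" for j using T[of 0 j] by (simp add: tau_0)
  have sd: "fls_subdegree (eval2 U Y (tau i (?T j))) = valn U Y (?T j)" if "j \<in> ?J" for i j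
    unfolding T valn_def T0 using c[OF that] w0 \<open>Y \<noteq> 0\<close> by simp
  obtain j where j: "j \<in> ?J" "\<And>l. l \<in> ?J \<Longrightarrow> valn U Y (?T j) \<le> valn U Y (?T l)"
  proof -
    have "Min ((\<lambda>j. valn U Y (?T j)) ` ?J) \<in> (\<lambda>j. valn U Y (?T j)) ` ?J"
      using J by (intro Min_in) auto
    then obtain j where "j \<in> ?J" "valn U Y (?T j) = Min ((\<lambda>j. valn U Y (?T j)) ` ?J)" by auto
    moreover from this have "valn U Y (?T j) \<le> valn U Y (?T l)" if "l \<in> ?J" for l
      using that J by (simp only:) (intro Min_le; blast)
    ultimately show ?thesis using that by blast
  qed
  have "lc (eval2 U Y (tau i g)) = (w ^ i) ^ j * (lc (?c j) * lc Y ^ j)" for i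
  proof -
    have "eval2 U Y (tau i g) = eval2 U Y (tau i (\<Sum>j\<in>?J. ?T j))" unfolding poly_as_sum_y ..
    also have "\<dots> = (\<Sum>j\<in>?J. eval2 U Y (tau i (?T j)))"
      unfolding rhom_sum[OF rhom_tau] rhom_sum[OF rhom_eval2] ..
    finally have "eval2 U Y (tau i g) = (\<Sum>j\<in>?J. eval2 U Y (tau i (?T j)))" .
    moreover have "lc (\<Sum>j\<in>?J. eval2 U Y (tau i (?T j))) = lc (eval2 U Y (tau i (?T j)))"
    proof (rule lc_sum(2)[OF J(1) j(1) nz])
      show "inj_on (\<lambda>j. fls_subdegree (eval2 U Y (tau i (?T j)))) ?J"
        using ramified_terms(3)[OF R g(1)] sd by (simp only: inj_on_def) metis
      show "fls_subdegree (eval2 U Y (tau i (?T j))) \<le> fls_subdegree (eval2 U Y (tau i (?T l)))"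
        if "l \<in> ?J" for l
        unfolding sd[OF j(1)] sd[OF that] by (rule j(2)[OF that])
    qed
    ultimately show ?thesis
      unfolding T using c[OF j(1)] w0 \<open>Y \<noteq> 0\<close> by (simp add: lc_mult lc_const lc_power)
  qed
  then show ?thesis using j(1) by blast
qed

text \<open>Multiplying the conjugates, the roots of unity combine to a power of
  \<open>w^(p(p-1)/2)\<close>, which is 1 because \<open>p\<close> is odd; a pure
  \<open>p\<close>-th power is left.\<close>

lemma lead_norm:
  assumes UY: "par U Y" and R: "ramified (valn U Y) m q s" and g: "degree h < p" "h \<noteq> 0" "F dvd g - h"
  shows "\<exists>j. coeff h j \<noteq> 0 \<and>
    lc (poly (map_poly fls_const (nm g)) U) = (lc (poly (map_poly fls_const (coeff h j)) U) * lc Y ^ j) ^ p"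
proof -
  obtain j where j: "coeff h j \<noteq> 0"
    "\<And>i. lc (eval2 U Y (tau i h)) = (w ^ i) ^ j * (lc (poly (map_poly fls_const (coeff h j)) U) * lc Y ^ j)"
    using lead_conjugates[OF UY R g(1,2)] by blast
  let ?b = "lc (poly (map_poly fls_const (coeff h j)) U) * lc Y ^ j"
  have gh: "eval2 U Y (tau i g) = eval2 U Y (tau i h)" for i
  proof -
    have "F dvd tau i g - tau i h" using g(3) tau_dvd[of i "g - h"] by (simp only: rhom_diff[OF rhom_tau])
    then show ?thesis using eval2_dvd[OF UY] by (fastforce simp: rhom_diff[OF rhom_eval2])
  qed
  have nd: "\<not> F dvd h" by (rule F_not_dvd[OF g(2,1)])
  have "eval2 U Y [:nm g:] = eval2 U Y (\<Prod>i<p. tau i g)"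
    using eval2_dvd[OF UY nm[of g]] by (simp add: rhom_diff[OF rhom_eval2])
  also have "\<dots> = (\<Prod>i<p. eval2 U Y (tau i h))" by (simp add: rhom_prod[OF rhom_eval2] gh)
  finally have "poly (map_poly fls_const (nm g)) U = (\<Prod>i<p. eval2 U Y (tau i h))" by (simp add: eval2_const)
  moreover have "eval2 U Y (tau i h) \<noteq> 0" for i using kernel[OF UY] nd tau_dvd by blast
  ultimately have "lc (poly (map_poly fls_const (nm g)) U) = (\<Prod>i<p. lc (eval2 U Y (tau i h)))"
    by (simp add: lc_prod)
  also have "\<dots> = (\<Prod>i<p. (w ^ i) ^ j) * ?b ^ p" by (simp add: j(2) prod.distrib)
  also have "(\<Prod>i<p. (w ^ i) ^ j) = (w ^ (\<Sum>i<p. i)) ^ j" by (simp add: prod_power_distrib power_sum)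
  also have "w ^ (\<Sum>i<p. i) = 1"
  proof -
    have "even (p - 1)" using p p_pos by simp
    then obtain c where c: "p - 1 = 2 * c" by (rule evenE)
    have "(\<Sum>i<p. i) = p * (p - 1) div 2"
      using Sum_Ico_nat[of 0 p] by (simp add: lessThan_atLeast0)
    also have "\<dots> = p * c" unfolding c by simp
    finally show ?thesis by (simp add: power_mult wp)
  qed
  finally show ?thesis using j(1) by auto
qed

text \<open>The extra power of \<open>d^k\<close> stems from the leading coefficient of
  \<open>x = d^k t^p\<close>; it will cancel between numerator and denominator of a function of
  order 0 at \<open>(0,0)\<close>.\<close>

lemma low_norm:
  assumes g: "degree h < p" "h \<noteq> 0" "F dvd g - h"
  shows "\<exists>j. coeff h j \<noteq> 0 \<and>
    low_coeff (nm g) * (d ^ k) ^ order 0 (nm g) = (low_coeff (coeff h j) * (d ^ k) ^ order 0 (coeff h j) * (d ^ e) ^ j) ^ p"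
proof -
  have "\<not> F dvd h" by (rule F_not_dvd[OF g(2,1)])
  then have nd: "\<not> F dvd g" using g(3) by (metis diff_add_cancel dvd_add_right_iff)
  have U: "lc U0 = d ^ k" using d by (simp add: U0_def lc_mult lc_const lc_power) (simp add: lc_def)
  have "lc (fps_to_fls S0) = 1" using S_subdegree S0(2) by (simp add: lc_def)
  moreover have "lc (fls_X :: 'a fls) = 1" by (simp add: lc_def)
  ultimately have Y: "lc Y0 = d ^ e"
    using d S_nonzero by (simp add: Y0_def lc_mult lc_const lc_power)
  have sd: "fls_subdegree U0 > 0" using p_pos by (simp add: subdegrees)
  obtain j where j: "coeff h j \<noteq> 0"
    "lc (poly (map_poly fls_const (nm g)) U0) = (lc (poly (map_poly fls_const (coeff h j)) U0) * lc Y0 ^ j) ^ p"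
    using lead_norm[OF par0 P0_ramified g] by blast
  then show ?thesis
    using eval_x_low[OF sd j(1)] eval_x_low[OF sd nm_nonzero[OF nd]] unfolding U Y by auto
qed

lemma high_norm:
  assumes g: "degree h < p" "h \<noteq> 0" "F dvd g - h"
  shows "\<exists>j. coeff h j \<noteq> 0 \<and> lead_coeff (nm g) = (lead_coeff (coeff h j) * (- 1) ^ j) ^ p"
proof -
  have "\<not> F dvd h" by (rule F_not_dvd[OF g(2,1)])
  then have nd: "\<not> F dvd g" using g(3) by (metis diff_add_cancel dvd_add_right_iff)
  have X: "lc (fls_X_inv :: 'a fls) = 1" by (simp add: lc_def)
  then have U: "lc Ui = 1" by (simp add: Ui_def lc_power)
  have "lc (fps_to_fls Si) = 1" using S_subdegree Si(2) by (simp add: lc_def)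
  then have "lc (fls_X_inv ^ (r + 1) * fps_to_fls Si) = 1"
    using S_nonzero X by (subst lc_mult) (auto simp: lc_power simp del: power_Suc)
  then have Y: "lc Yi = - 1" by (simp add: Yi_def lc_def del: power_Suc)
  have sd: "fls_subdegree Ui < 0" using p_pos by (simp add: subdegrees)
  obtain j where j: "coeff h j \<noteq> 0"
    "lc (poly (map_poly fls_const (nm g)) Ui) = (lc (poly (map_poly fls_const (coeff h j)) Ui) * lc Yi ^ j) ^ p"
    using lead_norm[OF pari P_inf_ramified g] by blast
  then show ?thesis
    using eval_x_lead[OF sd j(1)] eval_x_lead[OF sd nm_nonzero[OF nd]] unfolding U Y by auto
qed

lemma x_coord_fibre: "v \<in> fibre a \<Longrightarrow> x_coord v = a"
  unfolding x_coord_def fibre_def using lies_above_unique(1) by (intro the_equality) blast+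

text \<open>The norms of \<open>g\<close> and \<open>h\<close> have the same degree and the same
  order at 0, as the function has order 0 at both special points; so the signs in the two formulas
  of Vieta type agree and cancel.\<close>

lemma x_product:
  assumes gh: "\<not> F dvd g" "\<not> F dvd h" and P: "P0 g = P0 h" "P_inf g = P_inf h"
  shows "(\<Prod>v | v \<in> CP \<and> v g - v h \<noteq> 0. x_coord v powi (v g - v h))
    = low_coeff (nm g) / lead_coeff (nm g) / (low_coeff (nm h) / lead_coeff (nm h))"
proof -
  define R where "R = {a. a \<noteq> 0 \<and> (poly (nm g) a = 0 \<or> poly (nm h) a = 0)}"
  have "R \<subseteq> {a. poly (nm g) a = 0} \<union> {a. poly (nm h) a = 0}" by (auto simp: R_def)
  then have finR: "finite R" by (rule finite_subset) (simp add: poly_roots_finite nm_nonzero gh)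
  have R0: "0 \<notin> R" by (simp add: R_def)
  have fin: "finite (\<Union>a\<in>R. fibre a)" using finR fibre_sum(1)[OF gh(1)] by blast
  have CPs: "(\<Union>a\<in>R. fibre a) \<subseteq> CP" by (auto simp: fibre_def)
  have sub: "{v. v \<in> CP \<and> v g - v h \<noteq> 0} \<subseteq> (\<Union>a\<in>R. fibre a)"
  proof
    fix v assume "v \<in> {v. v \<in> CP \<and> v g - v h \<noteq> 0}"
    then have v: "v \<in> CP" "v g \<noteq> v h" by auto
    then have "v \<noteq> P_inf" using P by auto
    then obtain a where a: "v \<in> fibre a" using point_fibre v by blast
    have "a \<noteq> 0" using a fibre_0 v P by auto
    moreover have "poly (nm g) a = 0 \<or> poly (nm h) a = 0"
      using fibre_zero[OF gh(1) _ a] fibre_zero[OF gh(2) _ a] v(2) by metis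
    ultimately show "v \<in> (\<Union>a\<in>R. fibre a)" using a by (auto simp: R_def)
  qed
  have "(\<Prod>v | v \<in> CP \<and> v g - v h \<noteq> 0. x_coord v powi (v g - v h)) = (\<Prod>v\<in>(\<Union>a\<in>R. fibre a). x_coord v powi (v g - v h))"
    using sub fin CPs by (intro prod.mono_neutral_left) auto
  also have "\<dots> = (\<Prod>a\<in>R. \<Prod>v\<in>fibre a. x_coord v powi (v g - v h))"
    using finR fibre_sum(1)[OF gh(1)] fibre_disjoint by (intro prod.UNION_disjoint) blast+
  also have "\<dots> = (\<Prod>a\<in>R. a ^ order a (nm g) / a ^ order a (nm h))"
  proof (rule prod.cong[OF refl])
    fix a assume "a \<in> R"
    then have a: "a \<noteq> 0" by (simp add: R_def)
    have "(\<Prod>v\<in>fibre a. x_coord v powi (v g - v h)) = (\<Prod>v\<in>fibre a. a powi (v g - v h))"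
      by (rule prod.cong[OF refl]) (simp add: x_coord_fibre)
    also have "\<dots> = a powi (\<Sum>v\<in>fibre a. v g - v h)"
      by (rule prod_power_int_sum[OF a])
    also have "\<dots> = a ^ order a (nm g) / a ^ order a (nm h)"
      using a by (simp add: sum_subtractf fibre_sum(2) gh power_int_diff)
    finally show "(\<Prod>v\<in>fibre a. x_coord v powi (v g - v h)) = a ^ order a (nm g) / a ^ order a (nm h)" .
  qed
  also have "\<dots> = (\<Prod>a\<in>R. a ^ order a (nm g)) / (\<Prod>a\<in>R. a ^ order a (nm h))" by (rule prod_dividef)
  also have "\<dots> = low_coeff (nm g) / lead_coeff (nm g) / (low_coeff (nm h) / lead_coeff (nm h))"
  proof -
    have e: "degree (nm g) = degree (nm h)" "order 0 (nm g) = order 0 (nm h)"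
      using P by (simp_all add: P0_value P_inf_value gh)
    have g: "low_coeff (nm g) = lead_coeff (nm g) * (- 1) ^ (degree (nm g) - order 0 (nm g)) * (\<Prod>a\<in>R. a ^ order a (nm g))"
      and h0: "low_coeff (nm h) = lead_coeff (nm h) * (- 1) ^ (degree (nm h) - order 0 (nm h)) * (\<Prod>a\<in>R. a ^ order a (nm h))"
      by (rule low_coeff_formula[OF nm_nonzero finR R0]; auto simp: gh R_def)+
    then have h: "low_coeff (nm h) = lead_coeff (nm h) * (- 1) ^ (degree (nm g) - order 0 (nm g)) * (\<Prod>a\<in>R. a ^ order a (nm h))"
      by (simp only: e)
    have "(- 1 :: 'a) ^ (degree (nm g) - order 0 (nm g)) \<noteq> 0" by simp
    moreover have "lead_coeff (nm g) \<noteq> 0" "lead_coeff (nm h) \<noteq> 0" using nm_nonzero gh by simp_all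
    ultimately show ?thesis unfolding g h by (simp del: leading_coeff_0_iff)
  qed
  finally show ?thesis .
qed

end

section \<open>Principal divisors and the Jacobian\<close>

lemma curve_poly_monic:
  assumes "p > 0"
  shows "degree (curve_poly p r d) = p" "lead_coeff (curve_poly p r d) = 1"
proof -
  have e: "curve_poly p r d = monom 1 p + [:- ([:0, 1:] ^ r * [:d, -1:]):]"
    by (simp add: curve_poly_def monom_altdef)
  show deg: "degree (curve_poly p r d) = p"
    unfolding e using assms by (subst degree_add_eq_left) (simp_all add: degree_monom_eq)
  show "lead_coeff (curve_poly p r d) = 1"
    unfolding deg unfolding e using assms by (simp add: coeff_pCons split: nat.split)
qed

text \<open>The coefficients lie in a polynomial ring rather than in a field, hence pseudo-division;
  it is exact because the divisor is monic in \<open>y\<close>.\<close>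

lemma curve_poly_reduction:
  assumes "p > 0"
  obtains q h where "g = curve_poly p r d * q + h" "degree h < p"
proof -
  let ?F = "curve_poly p r d"
  have nz: "?F \<noteq> 0" using curve_poly_monic(2)[OF assms, of r d] by auto
  obtain q h where qh: "pseudo_divmod g ?F = (q, h)" by (cases "pseudo_divmod g ?F")
  have l: "coeff ?F (degree ?F) = 1" by (rule curve_poly_monic(2)[OF assms])
  have "g = ?F * q + h" using pseudo_divmod(1)[OF nz qh] unfolding l by simp
  moreover have "degree h < p"
    using pseudo_divmod(2)[OF nz qh] assms by (auto simp: curve_poly_monic)
  ultimately show thesis using that by blast
qed

definition lift :: "'l::field poly poly \<Rightarrow> 'l alg_closure poly poly" where
  "lift g = map_poly (map_poly to_ac) g"

lemma rhom_lift: "rhom lift"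
  unfolding lift_def by (intro rhom_map_poly rhom_to_ac)

lemma lift_pCons: "lift (pCons c g) = pCons (map_poly to_ac c) (lift g)"
  unfolding lift_def by (rule map_poly_pCons_rhom[OF rhom_map_poly[OF rhom_to_ac]])

lemma lift_const: "lift [:[:c:]:] = [:[:to_ac c:]:]"
  and lift_x: "lift [:[:c, 1:]:] = [:[:to_ac c, 1:]:]"
  and lift_y: "lift [:[:c:], 1:] = [:[:to_ac c:], 1:]"
  by (simp_all add: lift_pCons map_poly_pCons_rhom[OF rhom_to_ac] rhom_0[OF rhom_lift] one_pCons
      rhom_0[OF rhom_to_ac] rhom_1[OF rhom_to_ac])

lemma lift_curve_poly: "lift (curve_poly p r d) = curve_poly p r (to_ac d)"
proof -
  have c: "lift [:g:] = [:map_poly to_ac g:]" for g :: "'a poly"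
    by (simp add: lift_pCons rhom_0[OF rhom_lift])
  have m: "rhom (map_poly to_ac :: 'a poly \<Rightarrow> _)" by (rule rhom_map_poly[OF rhom_to_ac])
  show ?thesis
    unfolding curve_poly_def rhom_diff[OF rhom_lift] rhom_power[OF rhom_lift] c rhom_mult[OF m] rhom_power[OF m]
    by (simp add: lift_pCons map_poly_pCons_rhom[OF rhom_to_ac] rhom_0[OF rhom_lift] one_pCons
      rhom_minus[OF rhom_to_ac])
qed

text \<open>The geometry lives over the closure; here the parameters \<open>d\<close> and
  \<open>w\<close> come from the ground field, which makes rationality of functions and divisors
  meaningful.\<close>

locale jacobian_curve = superelliptic_expansion p r "to_ac d" "to_ac w" k e S0 Si
  for p r and d w :: "'l::field" and k e S0 Si +
  assumes char0: "CHAR('l) = 0"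
begin

abbreviation "FL \<equiv> curve_poly p r d"

text \<open>The reduction is carried out before lifting, so the reduced representative keeps
  coefficients in the ground field.\<close>

lemma lift_reduction:
  assumes "\<not> FL dvd g"
  obtains h where "degree h < p" "h \<noteq> 0" "F dvd lift g - lift h" "degree (lift h) < p" "lift h \<noteq> 0"
proof -
  obtain q h where h: "g = FL * q + h" "degree h < p" using curve_poly_reduction[OF p_pos] .
  have "h \<noteq> 0" using h(1) assms by auto
  have "lift g - lift h = F * lift q" by (simp add: h(1) rhom_simps[OF rhom_lift] lift_curve_poly)
  moreover have "map_poly to_ac c = 0 \<longleftrightarrow> c = 0" for c :: "'l poly"
    by (rule map_poly_eq_0_rhom[OF rhom_to_ac])
  then have "degree (lift h) = degree h" "lift h \<noteq> 0"
    unfolding lift_def using \<open>h \<noteq> 0\<close> by (simp_all add: degree_map_poly map_poly_eq_0_iff)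
  ultimately show thesis using that h(2) \<open>h \<noteq> 0\<close> by (metis dvd_triv_left)
qed

lemma lift_not_dvd: "\<not> FL dvd g \<Longrightarrow> \<not> F dvd lift g"
  using lift_reduction[of g] F_not_dvd by (metis diff_add_cancel dvd_add_right_iff)

lemma FL_prime:
  assumes "\<not> FL dvd g" "\<not> FL dvd h"
  shows "\<not> FL dvd g * h"
proof
  assume "FL dvd g * h"
  then have "F dvd lift g * lift h"
    using rhom_dvd[OF rhom_lift, of FL "g * h"] by (simp add: lift_curve_poly rhom_mult[OF rhom_lift])
  then show False using F_prime lift_not_dvd assms by blast
qed

definition pdiv :: "'l poly poly \<Rightarrow> 'l poly poly \<Rightarrow> 'l divisor" where
  "pdiv g h = (\<lambda>P. if P \<in> CP then P (lift g) - P (lift h) else 0)"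

abbreviation "Prin \<equiv> principal_divisors p r d"
abbreviation "Div0 \<equiv> carrier (div0_group p r d)"

lemma Prin_iff: "D \<in> Prin \<longleftrightarrow> (\<exists>g h. D = pdiv g h \<and> \<not> FL dvd g \<and> \<not> FL dvd h)"
  unfolding principal_divisors_def pdiv_def lift_def by blast

lemma pdiv_mult:
  assumes "\<not> FL dvd g" "\<not> FL dvd h" "\<not> FL dvd g'" "\<not> FL dvd h'"
  shows "pdiv (g * g') (h * h') = (\<lambda>P. pdiv g h P + pdiv g' h' P)"
  using assms by (auto simp: fun_eq_iff pdiv_def rhom_mult[OF rhom_lift] v_mult lift_not_dvd)

lemma Prin_add: "D \<in> Prin \<Longrightarrow> E \<in> Prin \<Longrightarrow> (\<lambda>P. D P + E P) \<in> Prin"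
proof -
  assume "D \<in> Prin" "E \<in> Prin"
  then obtain g h g' h' where D: "D = pdiv g h" "\<not> FL dvd g" "\<not> FL dvd h"
    and E: "E = pdiv g' h'" "\<not> FL dvd g'" "\<not> FL dvd h'"
    unfolding Prin_iff by blast
  have "(\<lambda>P. D P + E P) = pdiv (g * g') (h * h')"
    using pdiv_mult[OF D(2,3) E(2,3)] D(1) E(1) by simp
  then show ?thesis unfolding Prin_iff using FL_prime D(2,3) E(2,3) by blast
qed

lemma Prin_minus: "D \<in> Prin \<Longrightarrow> (\<lambda>P. - D P) \<in> Prin"
proof -
  have "(\<lambda>P. - pdiv g h P) = pdiv h g" for g h by (simp add: fun_eq_iff pdiv_def)
  then show "D \<in> Prin \<Longrightarrow> (\<lambda>P. - D P) \<in> Prin" unfolding Prin_iff by metis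
qed

lemma FL_not_dvd: "g \<noteq> 0 \<Longrightarrow> degree g < p \<Longrightarrow> \<not> FL dvd g"
  using dvd_imp_degree_le[of FL g] by (auto simp: curve_poly_monic(1)[OF p_pos])

lemma Prin_0: "(\<lambda>P. 0) \<in> Prin"
  unfolding Prin_iff using FL_not_dvd[of 1] p_pos by (intro exI[of _ 1]) (simp add: fun_eq_iff pdiv_def)

lemma Prin_scale: "D \<in> Prin \<Longrightarrow> (\<lambda>P. n * D P) \<in> Prin"
proof -
  assume D: "D \<in> Prin"
  have nat: "(\<lambda>P. int n * D P) \<in> Prin" for n
  proof (induction n)
    case (Suc n)
    then show ?case using Prin_add[OF D Suc] by (simp add: algebra_simps)
  qed (use Prin_0 in simp)
  show ?thesis
  proof (cases "n \<ge> 0")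
    case False
    then show ?thesis using Prin_minus[OF nat[of "nat (- n)"]] by simp
  qed (use nat[of "nat n"] in simp)
qed

definition galois_lift :: "('l alg_closure \<Rightarrow> 'l alg_closure) \<Rightarrow> 'l alg_closure poly poly \<Rightarrow> 'l alg_closure poly poly" where
  "galois_lift \<sigma> g = map_poly (map_poly \<sigma>) g"

context
  fixes \<sigma> :: "'l alg_closure \<Rightarrow> 'l alg_closure"
  assumes \<sigma>: "\<sigma> \<in> galois_group"
begin

lemma galois_act_eq: "galois_act \<sigma> P = (\<lambda>g. P (galois_lift \<sigma> g))"
  by (simp add: galois_act_def galois_lift_def)

lemma rhom_galois_lift: "rhom (galois_lift \<sigma>)"
  unfolding galois_lift_def by (intro rhom_map_poly galoisD(1)[OF \<sigma>])

lemma galois_lift_lift: "galois_lift \<sigma> (lift g) = lift g"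
  using galois_map_poly[OF \<sigma>] rhom_0[OF rhom_map_poly[OF galoisD(1)[OF \<sigma>]]] rhom_0[OF rhom_map_poly[OF rhom_to_ac]]
  by (simp add: lift_def galois_lift_def poly_eq_iff coeff_map_poly)

lemma galois_lift_pCons: "galois_lift \<sigma> (pCons c g) = pCons (map_poly \<sigma> c) (galois_lift \<sigma> g)"
  unfolding galois_lift_def by (rule map_poly_pCons_rhom[OF rhom_map_poly[OF galoisD(1)[OF \<sigma>]]])

lemma galois_lift_const: "galois_lift \<sigma> [:[:c:]:] = [:[:\<sigma> c:]:]"
  and galois_lift_x: "galois_lift \<sigma> [:[:c, 1:]:] = [:[:\<sigma> c, 1:]:]"
  and galois_lift_y: "galois_lift \<sigma> [:[:c:], 1:] = [:[:\<sigma> c:], 1:]"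
  by (simp_all add: galois_lift_pCons map_poly_pCons_rhom[OF galoisD(1)[OF \<sigma>]] rhom_0[OF rhom_galois_lift] one_pCons
      rhom_0[OF galoisD(1)[OF \<sigma>]] rhom_1[OF galoisD(1)[OF \<sigma>]])

end

lemma galois_lift_inv:
  assumes \<sigma>: "\<sigma> \<in> galois_group"
  shows "galois_lift \<sigma> (galois_lift (inv_into UNIV \<sigma>) g) = g" "galois_lift (inv_into UNIV \<sigma>) (galois_lift \<sigma> g) = g"
proof -
  note i = galois_inv[OF \<sigma>]
  have z: "\<sigma> 0 = 0" "inv_into UNIV \<sigma> 0 = 0" using galoisD(1)[OF \<sigma>] galoisD(1)[OF i] by (blast intro: rhom_0)+
  then show "galois_lift \<sigma> (galois_lift (inv_into UNIV \<sigma>) g) = g" "galois_lift (inv_into UNIV \<sigma>) (galois_lift \<sigma> g) = g"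
    using galois_inv_apply[OF \<sigma>] by (simp_all add: galois_lift_def poly_eq_iff coeff_map_poly)
qed

lemma galois_lift_dvd:
  assumes \<sigma>: "\<sigma> \<in> galois_group"
  shows "F dvd galois_lift \<sigma> g \<longleftrightarrow> F dvd g"
proof -
  have *: "F dvd galois_lift \<tau> g" if "\<tau> \<in> galois_group" "F dvd g" for \<tau> g
    using rhom_dvd[OF rhom_galois_lift[OF that(1)] that(2)] galois_lift_lift[OF that(1), of FL]
    by (simp add: lift_curve_poly)
  show ?thesis
    using *[OF \<sigma>, of g] *[OF galois_inv[OF \<sigma>], of "galois_lift \<sigma> g"] galois_lift_inv[OF \<sigma>] by auto
qed

lemma galois_act_inv:
  fixes \<sigma> :: "'l alg_closure \<Rightarrow> 'l alg_closure"
  assumes \<sigma>: "\<sigma> \<in> galois_group"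
  shows "galois_act (inv_into UNIV \<sigma>) (galois_act \<sigma> P) = P" "galois_act \<sigma> (galois_act (inv_into UNIV \<sigma>) P) = P"
  by (simp_all add: galois_act_eq[OF \<sigma>] galois_act_eq[OF galois_inv[OF \<sigma>]] galois_lift_inv[OF \<sigma>])

lemma galois_act_point:
  fixes \<sigma> :: "'l alg_closure \<Rightarrow> 'l alg_closure"
  assumes \<sigma>: "\<sigma> \<in> galois_group"
  shows "galois_act \<sigma> P \<in> CP \<longleftrightarrow> P \<in> CP"
proof -
  have *: "galois_act \<tau> P \<in> CP" if \<tau>: "\<tau> \<in> galois_group" and P: "P \<in> CP" for \<tau> P
    unfolding galois_act_eq[OF \<tau>]
  proof (rule point_comp[OF P rhom_galois_lift[OF \<tau>] galois_lift_dvd[OF \<tau>]])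
    show "\<exists>h. galois_lift \<tau> h = g" for g using galois_lift_inv(1)[OF \<tau>] by blast
    show "\<exists>c'. c' \<noteq> 0 \<and> galois_lift \<tau> [:[:c:]:] = [:[:c':]:]" if "c \<noteq> 0" for c
      using that by (intro exI[of _ "\<tau> c"]) (simp add: galois_lift_const[OF \<tau>] rhom_field_eq_0[OF galoisD(1)[OF \<tau>]])
  qed
  show ?thesis using *[OF \<sigma>] *[OF galois_inv[OF \<sigma>]] galois_act_inv[OF \<sigma>] by metis
qed

lemma galois_act_above:
  fixes \<sigma> :: "'l alg_closure \<Rightarrow> 'l alg_closure"
  assumes \<sigma>: "\<sigma> \<in> galois_group"
  shows "lies_above (galois_act \<sigma> P) a b \<longleftrightarrow> lies_above P (\<sigma> a) (\<sigma> b)"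
  by (simp add: lies_above_def galois_act_eq[OF \<sigma>] galois_lift_x[OF \<sigma>] galois_lift_y[OF \<sigma>] rhom_minus[OF galoisD(1)[OF \<sigma>]])

lemma div_degree_superset:
  assumes "finite S" "{P. D P \<noteq> 0} \<subseteq> S"
  shows "div_degree D = (\<Sum>P\<in>S. D P)"
  unfolding div_degree_def using assms by (intro sum.mono_neutral_left) auto

lemma Div0_iff:
  "D \<in> Div0 \<longleftrightarrow> finite {P. D P \<noteq> 0} \<and> {P. D P \<noteq> 0} \<subseteq> CP \<and> rational_divisor D \<and> div_degree D = 0"
  by (auto simp: div0_group_def divisors_def)

lemma Div0_add:
  assumes "D \<in> Div0" "E \<in> Div0"
  shows "(\<lambda>P. D P + E P) \<in> Div0"
proof -
  let ?S = "{P. D P \<noteq> 0} \<union> {P. E P \<noteq> 0}"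
  have S: "finite ?S" using assms by (simp add: Div0_iff)
  have sub: "{P. D P + E P \<noteq> 0} \<subseteq> ?S" by auto
  have "div_degree (\<lambda>P. D P + E P) = div_degree D + div_degree E"
    using div_degree_superset[OF S sub] div_degree_superset[OF S, of D] div_degree_superset[OF S, of E]
    by (simp add: sum.distrib)
  then show ?thesis
    using finite_subset[OF sub S] sub assms by (auto simp: Div0_iff rational_divisor_def)
qed

lemma Prin_Div0:
  assumes "D \<in> Prin"
  shows "D \<in> Div0"
proof -
  obtain g h where D: "D = pdiv g h" and gh: "\<not> FL dvd g" "\<not> FL dvd h" using assms by (auto simp: Prin_iff)
  note ndg = lift_not_dvd[OF gh(1)] and ndh = lift_not_dvd[OF gh(2)]
  let ?S = "{v \<in> CP. v (lift g) \<noteq> 0} \<union> {v \<in> CP. v (lift h) \<noteq> 0}"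
  have S: "finite ?S" using finite_support[OF ndg] finite_support[OF ndh] by blast
  have sub: "{P. D P \<noteq> 0} \<subseteq> ?S" by (auto simp: D pdiv_def split: if_splits)
  have deg: "(\<Sum>v\<in>?S. v (lift f)) = 0" if "f = g \<or> f = h" for f
  proof -
    have "(\<Sum>v\<in>?S. v (lift f)) = (\<Sum>v | v \<in> CP \<and> v (lift f) \<noteq> 0. v (lift f))"
      using S that by (intro sum.mono_neutral_right) auto
    then show ?thesis using degree_zero ndg ndh that by auto
  qed
  have "div_degree D = (\<Sum>P\<in>?S. P (lift g) - P (lift h))"
    unfolding div_degree_superset[OF S sub] by (rule sum.cong) (auto simp: D pdiv_def)
  then have "div_degree D = 0" using deg[of g] deg[of h] by (simp add: sum_subtractf)
  moreover have "rational_divisor D"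
    unfolding rational_divisor_def D pdiv_def
    by (simp add: galois_act_point) (simp add: galois_act_eq galois_lift_lift)
  ultimately show ?thesis using finite_subset[OF sub S] sub by (auto simp: Div0_iff)
qed

text \<open>By \<open>x_product\<close> the value is a quotient of lowest and leading coefficients
  of norms. Each is, up to a common power of \<open>d^k\<close>, the \<open>p\<close>-th power of a
  coefficient of the reduced representative times powers of \<open>d\<close> or \<open>-1\<close>,
  all of which lie in \<open>L\<close>.\<close>

lemma principal_power:
  assumes gh: "\<not> FL dvd g" "\<not> FL dvd h" and D: "pdiv g h P0 = 0" "pdiv g h P_inf = 0"
  shows "\<exists>z. z \<noteq> 0 \<and> x_value (pdiv g h) = to_ac z ^ p"
proof -
  have P: "P0 (lift g) = P0 (lift h)" "P_inf (lift g) = P_inf (lift h)"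
    using D P0_point P_inf_point by (simp_all add: pdiv_def)
  note nd = lift_not_dvd[OF gh(1)] lift_not_dvd[OF gh(2)]
  have o: "order 0 (nm (lift g)) = order 0 (nm (lift h))" using P(1) by (simp add: P0_value nd)
  have ac: "coeff (coeff (lift f) j) i = to_ac (coeff (coeff f j) i)" for f :: "'l poly poly" and i j
    by (simp add: lift_def coeff_map_poly rhom_0[OF rhom_to_ac])
  have low: "\<exists>x. low_coeff (nm (lift f)) * (to_ac d ^ k) ^ order 0 (nm (lift f)) = to_ac x ^ p"
    and high: "\<exists>x. lead_coeff (nm (lift f)) = to_ac x ^ p" if f: "\<not> FL dvd f" for f
  proof -
    obtain f' where f': "F dvd lift f - lift f'" "degree (lift f') < p" "lift f' \<noteq> 0"
      using lift_reduction[OF f] by blast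
    show "\<exists>x. low_coeff (nm (lift f)) * (to_ac d ^ k) ^ order 0 (nm (lift f)) = to_ac x ^ p"
      using low_norm[OF f'(2,3,1)] unfolding low_coeff_def ac
      by (auto simp flip: to_ac_power to_ac_mult)
    have m1: "(- 1 :: 'l alg_closure) = to_ac (- 1)" by simp
    show "\<exists>x. lead_coeff (nm (lift f)) = to_ac x ^ p"
      using high_norm[OF f'(2,3,1)] unfolding ac m1
      by (auto simp flip: to_ac_power to_ac_mult simp del: to_ac_minus)
  qed
  obtain a b where a: "low_coeff (nm (lift g)) * (to_ac d ^ k) ^ order 0 (nm (lift g)) = to_ac a ^ p"
    and b: "low_coeff (nm (lift h)) * (to_ac d ^ k) ^ order 0 (nm (lift h)) = to_ac b ^ p"
    using low gh by metis
  obtain a' b' where a': "lead_coeff (nm (lift g)) = to_ac a' ^ p" and b': "lead_coeff (nm (lift h)) = to_ac b' ^ p"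
    using high gh by metis
  let ?z = "a / a' / (b / b')"
  define c where "c = (to_ac d ^ k) ^ order 0 (nm (lift h))"
  have c: "c \<noteq> 0" using d by (simp add: c_def)
  have "x_value (pdiv g h) = (\<Prod>v | v \<in> CP \<and> v (lift g) - v (lift h) \<noteq> 0. x_coord v powi (v (lift g) - v (lift h)))"
    unfolding x_value_def by (rule prod.cong) (auto simp: pdiv_def)
  also have "\<dots> = low_coeff (nm (lift g)) / lead_coeff (nm (lift g)) / (low_coeff (nm (lift h)) / lead_coeff (nm (lift h)))"
    by (rule x_product[OF nd P])
  also have "\<dots> = (low_coeff (nm (lift g)) * c) / lead_coeff (nm (lift g)) / ((low_coeff (nm (lift h)) * c) / lead_coeff (nm (lift h)))"
    using c by simp
  also have "\<dots> = to_ac a ^ p / to_ac a' ^ p / (to_ac b ^ p / to_ac b' ^ p)"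
    using a b unfolding o c_def[symmetric] a' b' by (simp only:)
  also have "\<dots> = to_ac ?z ^ p" by (simp only: rhom_divide[OF rhom_to_ac] power_divide)
  finally have x: "x_value (pdiv g h) = to_ac ?z ^ p" .
  have nz: "lead_coeff (nm (lift g)) \<noteq> 0" "lead_coeff (nm (lift h)) \<noteq> 0" using nm_nonzero nd by simp_all
  have low_nz: "low_coeff N \<noteq> 0" if "N \<noteq> 0" for N :: "'l alg_closure poly"
    using low_coeff_formula[OF that, of "{a. a \<noteq> 0 \<and> poly N a = 0}"] that poly_roots_finite[OF that] by simp
  have "to_ac a \<noteq> 0" "to_ac b \<noteq> 0" "to_ac a' \<noteq> 0" "to_ac b' \<noteq> 0"
    using a b a' b' nz low_nz nm_nonzero nd d p_pos by (auto simp: power_0_left)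
  then have "?z \<noteq> 0" by auto
  then show ?thesis using x by blast
qed

end

lemma carrier_field_units: "carrier (field_units :: 'a::field monoid) = {x. x \<noteq> 0}"
proof -
  have "\<exists>y. y * x = 1 \<and> x * y = 1" if "x \<noteq> 0" for x :: 'a
    using that by (intro exI[of _ "inverse x"]) simp
  then show ?thesis by (auto simp: units_of_def Units_def ring_of_type_algebra_def)
qed

lemma mult_field_units: "x \<otimes>\<^bsub>field_units\<^esub> y = x * (y :: 'a::field)"
  and one_field_units: "\<one>\<^bsub>field_units\<^esub> = (1 :: 'a::field)"
  by (simp_all add: units_of_def ring_of_type_algebra_def)

lemma pow_field_units: "x [^]\<^bsub>field_units\<^esub> (n :: nat) = (x :: 'a::field) ^ n"
  by (induction n) (simp_all add: nat_pow_def one_field_units mult_field_units mult.commute)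

lemma power_coset_field: "power_coset field_units p u = {z ^ p * u | z. z \<noteq> (0 :: 'a::field)}"
  by (auto simp: power_coset_def pth_powers_def r_coset_def carrier_field_units mult_field_units pow_field_units)

lemma power_coset_eqI:
  assumes "u = u' * z ^ p" "z \<noteq> (0 :: 'a::field)"
  shows "power_coset field_units p u = power_coset field_units p u'"
proof -
  have "\<exists>y'. y ^ p * (u' * z ^ p) = y' ^ p * u' \<and> y' \<noteq> 0" if "y \<noteq> 0" for y
    using that assms(2) by (intro exI[of _ "y * z"]) (simp add: power_mult_distrib)
  moreover have "\<exists>y'. y ^ p * u' = y' ^ p * (u' * z ^ p) \<and> y' \<noteq> 0" if "y \<noteq> 0" for y
    using that assms(2) by (intro exI[of _ "y / z"]) (simp add: power_divide)
  ultimately show ?thesis unfolding power_coset_field assms(1) by blast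
qed

section \<open>Translating divisors of valuations into coordinates\<close>

context jacobian_curve
begin

abbreviation "W \<equiv> to_ac w"

lemma points_unique:
  assumes v: "v \<in> CP" "lies_above v a b" and v': "v' \<in> CP" "lies_above v' a b"
  shows "v = v'"
proof (cases "b = 0")
  case True
  then have "poly A a = 0" using lies_above_curve[OF v] p_pos by (simp add: power_0_left)
  then have "a = 0 \<or> a = to_ac d" using r by (auto simp: poly_A)
  then obtain u where "fibre a = {u}" using fibre_ramified by blast
  moreover have "v \<in> fibre a" "v' \<in> fibre a" using v v' by (auto simp: fibre_def)
  ultimately show ?thesis by simp
qed (rule unramified_unique(2)[OF v v'])

definition affine_points :: "'l alg_closure point set" where
  "affine_points = {P \<in> CP. \<exists>a b. (a, b) \<noteq> (0, 0) \<and> lies_above P a b}"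

definition affine_curve :: "('l alg_closure \<times> 'l alg_closure) set" where
  "affine_curve = {(a, b). a \<noteq> 0 \<and> b ^ p = a ^ r * (to_ac d - a)}"

definition coords :: "'l alg_closure point \<Rightarrow> 'l alg_closure \<times> 'l alg_closure" where
  "coords P = (x_coord P, THE b. \<exists>a. lies_above P a b)"

lemma coords_eq:
  assumes "P \<in> CP" "lies_above P a b"
  shows "coords P = (a, b)" "x_coord P = a"
proof -
  show x: "x_coord P = a"
    unfolding x_coord_def using lies_above_unique(1)[OF assms(1)] assms(2) by (intro the_equality) blast+
  have "(THE b. \<exists>a. lies_above P a b) = b"
    using lies_above_unique(2)[OF assms(1)] assms(2) by (intro the_equality) blast+
  then show "coords P = (a, b)" using x by (simp add: coords_def)
qed

lemma affine_point_cases: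
  assumes "P \<in> affine_points"
  obtains a b where "P \<in> CP" "lies_above P a b" "a \<noteq> 0" "(a, b) \<in> affine_curve"
proof -
  obtain a b where P: "P \<in> CP" "(a, b) \<noteq> (0, 0)" "lies_above P a b" using assms by (auto simp: affine_points_def)
  have b: "b ^ p = a ^ r * (to_ac d - a)" using lies_above_curve[OF P(1,3)] by (simp add: poly_A)
  have "a \<noteq> 0"
  proof
    assume "a = 0"
    then have "b ^ p = 0" using b r by (simp add: power_0_left)
    then have "b = 0" by simp
    then show False using P(2) \<open>a = 0\<close> by simp
  qed
  then show thesis using that P b by (simp add: affine_curve_def)
qed

lemma affine_pointI: "P \<in> CP \<Longrightarrow> lies_above P a b \<Longrightarrow> a \<noteq> 0 \<Longrightarrow> P \<in> affine_points"
  by (auto simp: affine_points_def)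

lemma affine_points_eq: "affine_points = CP - {P0, P_inf}"
proof
  show "affine_points \<subseteq> CP - {P0, P_inf}"
  proof
    fix P assume "P \<in> affine_points"
    then obtain a b where P: "P \<in> CP" "lies_above P a b" "a \<noteq> 0" by (rule affine_point_cases)
    then have "P \<noteq> P_inf" using fibre_pole by (auto simp: fibre_def)
    moreover have "P \<noteq> P0" using P lies_above_unique(1)[OF P0_point P0_above] by auto
    ultimately show "P \<in> CP - {P0, P_inf}" using P by blast
  qed
  show "CP - {P0, P_inf} \<subseteq> affine_points"
  proof
    fix P assume P: "P \<in> CP - {P0, P_inf}"
    then obtain a where a: "P \<in> fibre a" using point_fibre by blast
    then have "a \<noteq> 0" using P fibre_0 by auto
    then show "P \<in> affine_points" using a affine_pointI by (auto simp: fibre_def)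
  qed
qed

lemma coords_bij: "bij_betw coords affine_points affine_curve"
  unfolding bij_betw_def
proof
  show "inj_on coords affine_points"
  proof (rule inj_onI)
    fix P Q assume "P \<in> affine_points" "Q \<in> affine_points" and eq: "coords P = coords Q"
    then obtain a b a' b' where "P \<in> CP" "lies_above P a b" "Q \<in> CP" "lies_above Q a' b'"
      by (metis affine_point_cases)
    then show "P = Q" using coords_eq eq points_unique by (metis prod.inject)
  qed
  show "coords ` affine_points = affine_curve"
  proof
    show "coords ` affine_points \<subseteq> affine_curve"
      using coords_eq(1) by (auto elim!: affine_point_cases)
    show "affine_curve \<subseteq> coords ` affine_points"
    proof
      fix s assume s: "s \<in> affine_curve"
      obtain a b where ab: "s = (a, b)" by (cases s)
      then obtain P where P: "P \<in> CP" "lies_above P a b"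
        using point_exists[of b a] s by (auto simp: affine_curve_def poly_A)
      have "P \<in> affine_points" using affine_pointI[OF P] s ab by (simp add: affine_curve_def)
      then show "s \<in> coords ` affine_points" using coords_eq(1)[OF P] ab by force
    qed
  qed
qed

lemma affine_curve_galois:
  assumes "\<sigma> \<in> galois_group"
  shows "(\<sigma> a, \<sigma> b) \<in> affine_curve \<longleftrightarrow> (a, b) \<in> affine_curve"
proof -
  note s = galoisD(1)[OF assms]
  have "\<sigma> b ^ p = \<sigma> a ^ r * (to_ac d - \<sigma> a) \<longleftrightarrow> \<sigma> (b ^ p) = \<sigma> (a ^ r * (to_ac d - a))"
    by (simp add: rhom_simps[OF s] galoisD(3)[OF assms])
  then show ?thesis by (simp add: affine_curve_def rhom_inj[OF s] rhom_field_eq_0[OF s])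
qed

lemma affine_points_galois:
  assumes "\<sigma> \<in> galois_group"
  shows "galois_act \<sigma> P \<in> affine_points \<longleftrightarrow> P \<in> affine_points"
proof -
  have *: "galois_act \<tau> P \<in> affine_points" if \<tau>: "\<tau> \<in> galois_group" and P: "P \<in> affine_points" for \<tau> P
  proof -
    obtain a b where ab: "P \<in> CP" "lies_above P a b" "a \<noteq> 0" using P by (rule affine_point_cases)
    have "lies_above (galois_act \<tau> P) (inv_into UNIV \<tau> a) (inv_into UNIV \<tau> b)"
      using ab(2) by (simp add: galois_act_above[OF \<tau>] galois_inv_apply[OF \<tau>])
    moreover have "inv_into UNIV \<tau> a \<noteq> 0"
      using ab(3) rhom_field_eq_0[OF galoisD(1)[OF galois_inv[OF \<tau>]]] by blast
    ultimately show ?thesis using affine_pointI galois_act_point[OF \<tau>] ab(1) by blast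
  qed
  show ?thesis using *[OF assms] *[OF galois_inv[OF assms]] galois_act_inv[OF assms] by metis
qed

lemma coords_galois:
  assumes \<sigma>: "\<sigma> \<in> galois_group" and P: "P \<in> affine_points" "coords P = (\<sigma> a, \<sigma> b)"
  shows "coords (galois_act \<sigma> P) = (a, b)"
proof -
  obtain a' b' where ab: "P \<in> CP" "lies_above P a' b'" using P(1) by (rule affine_point_cases)
  then have "lies_above P (\<sigma> a) (\<sigma> b)" using coords_eq(1)[OF ab] P(2) by simp
  then show ?thesis
    using coords_eq(1) galois_act_point[OF \<sigma>] galois_act_above[OF \<sigma>] ab(1) by blast
qed

context
  fixes D :: "'l divisor" and m :: "'l alg_closure \<times> 'l alg_closure \<Rightarrow> int"
  assumes D: "{P. D P \<noteq> 0} \<subseteq> affine_points" and m: "{s. m s \<noteq> 0} \<subseteq> affine_curve"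
    and mD: "\<And>P. P \<in> affine_points \<Longrightarrow> m (coords P) = D P"
begin

lemma support_bij: "bij_betw coords {P. D P \<noteq> 0} {s. m s \<noteq> 0}"
proof (rule bij_betw_subset[OF coords_bij D])
  show "coords ` {P. D P \<noteq> 0} = {s. m s \<noteq> 0}"
  proof
    show "coords ` {P. D P \<noteq> 0} \<subseteq> {s. m s \<noteq> 0}" using D mD by auto
    show "{s. m s \<noteq> 0} \<subseteq> coords ` {P. D P \<noteq> 0}"
    proof
      fix s assume s: "s \<in> {s. m s \<noteq> 0}"
      then have "s \<in> coords ` affine_points" using m coords_bij by (auto simp: bij_betw_def)
      then show "s \<in> coords ` {P. D P \<noteq> 0}" using s mD by auto
    qed
  qed
qed

lemma finite_transfer: "finite {s. m s \<noteq> 0} \<longleftrightarrow> finite {P. D P \<noteq> 0}"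
  using bij_betw_finite[OF support_bij] by simp

lemma degree_transfer: "(\<Sum>s | m s \<noteq> 0. m s) = div_degree D"
proof -
  have "(\<Sum>s | m s \<noteq> 0. m s) = (\<Sum>P | D P \<noteq> 0. m (coords P))"
    by (rule sum.reindex_bij_betw[OF support_bij, symmetric])
  also have "\<dots> = (\<Sum>P | D P \<noteq> 0. D P)" using mD D by (intro sum.cong) auto
  finally show ?thesis by (simp add: div_degree_def)
qed

lemma value_transfer: "divisor_value m = x_value D"
proof -
  have "divisor_value m = (\<Prod>P | D P \<noteq> 0. fst (coords P) powi m (coords P))"
    unfolding divisor_value_def by (rule prod.reindex_bij_betw[OF support_bij, symmetric])
  also have "\<dots> = (\<Prod>P | D P \<noteq> 0. x_coord P powi D P)" using mD D by (intro prod.cong) (auto simp: coords_def)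
  finally show ?thesis by (simp add: x_value_def)
qed

text \<open>The definition of \<open>galois_act\<close> moves coordinates by the inverse
  automorphism; since invariance is required under the whole group, the two conventions
  agree.\<close>

lemma galois_transfer: "galois_invariant m \<longleftrightarrow> rational_divisor D"
proof -
  have "m (\<sigma> a, \<sigma> b) = m (a, b)" if rat: "rational_divisor D" and \<sigma>: "\<sigma> \<in> galois_group" for \<sigma> a b
  proof (cases "(a, b) \<in> affine_curve")
    case True
    then have "(\<sigma> a, \<sigma> b) \<in> affine_curve" using affine_curve_galois[OF \<sigma>] by blast
    then have "(\<sigma> a, \<sigma> b) \<in> coords ` affine_points" using coords_bij by (simp add: bij_betw_def)
    then obtain P where P: "P \<in> affine_points" "coords P = (\<sigma> a, \<sigma> b)" by auto
    have "m (a, b) = D (galois_act \<sigma> P)"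
      using mD[of "galois_act \<sigma> P"] coords_galois[OF \<sigma> P] affine_points_galois[OF \<sigma>] P(1) by simp
    also have "\<dots> = D P" using rat \<sigma> by (simp add: rational_divisor_def)
    also have "\<dots> = m (\<sigma> a, \<sigma> b)" using mD[OF P(1)] P(2) by simp
    finally show ?thesis by simp
  next
    case False
    then have "(\<sigma> a, \<sigma> b) \<notin> affine_curve" using affine_curve_galois[OF \<sigma>] by blast
    then show ?thesis using False m by (metis (mono_tags, lifting) mem_Collect_eq subsetD)
  qed
  moreover have "D (galois_act \<sigma> P) = D P" if inv: "galois_invariant m" and \<sigma>: "\<sigma> \<in> galois_group" for \<sigma> P
  proof (cases "P \<in> affine_points")
    case True
    define a b where "a = inv_into UNIV \<sigma> (fst (coords P))" and "b = inv_into UNIV \<sigma> (snd (coords P))"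
    have c: "coords P = (\<sigma> a, \<sigma> b)" by (simp add: a_def b_def galois_inv_apply[OF \<sigma>])
    have "D (galois_act \<sigma> P) = m (a, b)"
      using mD[of "galois_act \<sigma> P"] coords_galois[OF \<sigma> True c] affine_points_galois[OF \<sigma>] True by simp
    also have "\<dots> = m (\<sigma> a, \<sigma> b)" using inv \<sigma> by (simp add: galois_invariant_def)
    finally show ?thesis using mD[OF True] c by simp
  next
    case False
    then have "galois_act \<sigma> P \<notin> affine_points" using affine_points_galois[OF \<sigma>] by blast
    then show ?thesis using False D by (metis (mono_tags, lifting) mem_Collect_eq subsetD)
  qed
  ultimately show ?thesis unfolding galois_invariant_def rational_divisor_def by blast
qed

lemma divisor_transfer: "curve_divisor p r d m \<longleftrightarrow> D \<in> Div0"
proof -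
  have "m (a, b) \<noteq> 0 \<longrightarrow> a \<noteq> 0 \<and> b ^ p = a ^ r * (to_ac d - a)" for a b
    using m by (auto simp: affine_curve_def)
  moreover have "{P. D P \<noteq> 0} \<subseteq> CP" using D by (auto simp: affine_points_def)
  ultimately show ?thesis
    unfolding curve_divisor_def Div0_iff finite_transfer degree_transfer galois_transfer by blast
qed

end

lemma good_to_curve:
  assumes D: "D \<in> Div0" "{P. D P \<noteq> 0} \<subseteq> affine_points"
  shows "\<exists>m. curve_divisor p r d m \<and> divisor_value m = x_value D"
proof -
  define m where "m s = (if s \<in> affine_curve then D (inv_into affine_points coords s) else 0)" for s
  have m: "{s. m s \<noteq> 0} \<subseteq> affine_curve" by (auto simp: m_def)
  have mD: "m (coords P) = D P" if "P \<in> affine_points" for P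
    using that coords_bij by (auto simp: m_def bij_betw_def)
  show ?thesis using divisor_transfer[OF D(2) m mD] value_transfer[OF D(2) m mD] D(1) by blast
qed

lemma curve_to_good:
  assumes c: "curve_divisor p r d m"
  shows "\<exists>D. D \<in> Div0 \<and> {P. D P \<noteq> 0} \<subseteq> affine_points \<and> divisor_value m = x_value D"
proof -
  define D where "D P = (if P \<in> affine_points then m (coords P) else 0)" for P
  have D: "{P. D P \<noteq> 0} \<subseteq> affine_points" by (auto simp: D_def)
  have m: "{s. m s \<noteq> 0} \<subseteq> affine_curve" using c by (auto simp: curve_divisor_def affine_curve_def)
  have mD: "m (coords P) = D P" if "P \<in> affine_points" for P using that by (simp add: D_def)
  show ?thesis using divisor_transfer[OF D m mD] value_transfer[OF D m mD] D c by blast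
qed

lemma good_value:
  assumes "D \<in> Div0" "{P. D P \<noteq> 0} \<subseteq> affine_points"
  obtains u where "u \<in> divisor_values p r d" "to_ac u = x_value D"
proof -
  obtain m where m: "curve_divisor p r d m" "divisor_value m = x_value D" using good_to_curve[OF assms] by blast
  have "galois_invariant m" using m(1) by (simp add: curve_divisor_def)
  then have "divisor_value m \<in> range to_ac"
    unfolding divisor_value_def by (rule equivariant_prod[OF char0]) simp
  then obtain u where "to_ac u = divisor_value m" by auto
  moreover from this have "u \<in> divisor_values p r d" using m(1) unfolding divisor_values_def by blast
  ultimately show thesis using that m(2) by simp
qed

lemma x_coord_nonzero: "P \<in> affine_points \<Longrightarrow> x_coord P \<noteq> 0"
  using coords_eq(2) by (auto elim!: affine_point_cases)

lemma x_value_superset: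
  assumes "finite S" "{P. D P \<noteq> 0} \<subseteq> S"
  shows "x_value D = (\<Prod>P\<in>S. x_coord P powi D P)"
  unfolding x_value_def using assms by (intro prod.mono_neutral_left) auto

lemma x_value_add:
  assumes "finite {P. D P \<noteq> 0}" "{P. D P \<noteq> 0} \<subseteq> affine_points"
    and "finite {P. E P \<noteq> 0}" "{P. E P \<noteq> 0} \<subseteq> affine_points"
  shows "x_value (\<lambda>P. D P + E P) = x_value D * x_value E"
proof -
  let ?S = "{P. D P \<noteq> 0} \<union> {P. E P \<noteq> 0}"
  have S: "finite ?S" using assms by simp
  have "x_value (\<lambda>P. D P + E P) = (\<Prod>P\<in>?S. x_coord P powi (D P + E P))"
    by (rule x_value_superset[OF S]) auto
  also have "\<dots> = (\<Prod>P\<in>?S. x_coord P powi D P * x_coord P powi E P)"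
    using assms x_coord_nonzero by (intro prod.cong) (auto simp: power_int_add)
  also have "\<dots> = x_value D * x_value E"
    using x_value_superset[OF S, of D] x_value_superset[OF S, of E] by (simp add: prod.distrib)
  finally show ?thesis .
qed

lemma x_value_minus: "x_value (\<lambda>P. - D P) = inverse (x_value D)"
  unfolding x_value_def by (simp add: power_int_minus flip: prod_inversef)

lemma x_value_nonzero: "{P. D P \<noteq> 0} \<subseteq> affine_points \<Longrightarrow> x_value D \<noteq> 0"
  unfolding x_value_def using x_coord_nonzero by (cases "finite {P. D P \<noteq> 0}") auto

lemma aut_aut: "curve_aut (W ^ i) (curve_aut (W ^ j) P) = curve_aut (W ^ (j + i)) P"
  by (simp add: fun_eq_iff tau_prod_valuation tau_tau)

lemma aut_inverse:
  obtains n where "\<And>P. curve_aut (W ^ n) (curve_aut (W ^ j) P) = P" "\<And>P. curve_aut (W ^ j) (curve_aut (W ^ n) P) = P"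
proof -
  have "j + j * (p - 1) = j * p" using p_pos by (cases p) auto
  then obtain n where n: "j + n = j * p" by blast
  have "curve_aut (W ^ (j * p)) P = P" for P
    using tau_mod[of "j * p"] by (simp add: fun_eq_iff tau_prod_valuation tau_0)
  then show thesis using that[of n] n by (simp add: aut_aut add.commute)
qed

lemma aut_point_iff: "curve_aut (W ^ j) P \<in> CP \<longleftrightarrow> P \<in> CP"
  using aut_inverse[of j] curve_aut_point by metis

lemma aut_affine:
  assumes "P \<in> affine_points"
  shows "curve_aut (W ^ j) P \<in> affine_points" "x_coord (curve_aut (W ^ j) P) = x_coord P"
proof -
  obtain a b where ab: "P \<in> CP" "lies_above P a b" "a \<noteq> 0" using assms by (rule affine_point_cases)
  note l = lies_above_aut[OF ab(1,2), of j] and c = curve_aut_point[OF ab(1), of j]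
  show "curve_aut (W ^ j) P \<in> affine_points" by (rule affine_pointI[OF c l ab(3)])
  show "x_coord (curve_aut (W ^ j) P) = x_coord P" using coords_eq(2)[OF c l] coords_eq(2)[OF ab(1,2)] by simp
qed

lemma x_value_aut:
  assumes D: "finite {P. D P \<noteq> 0}" "{P. D P \<noteq> 0} \<subseteq> affine_points"
  shows "finite {P. D (curve_aut (W ^ j) P) \<noteq> 0}" "{P. D (curve_aut (W ^ j) P) \<noteq> 0} \<subseteq> affine_points"
    "x_value (\<lambda>P. D (curve_aut (W ^ j) P)) = x_value D"
proof -
  obtain n where n: "\<And>P. curve_aut (W ^ n) (curve_aut (W ^ j) P) = P" "\<And>P. curve_aut (W ^ j) (curve_aut (W ^ n) P) = P"
    using aut_inverse[of j] by blast
  have bij: "bij_betw (curve_aut (W ^ j)) {P. D (curve_aut (W ^ j) P) \<noteq> 0} {P. D P \<noteq> 0}"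
    by (rule bij_betw_byWitness[where f' = "curve_aut (W ^ n)"]) (auto simp: n)
  show "finite {P. D (curve_aut (W ^ j) P) \<noteq> 0}" using bij_betw_finite[OF bij] D(1) by simp
  show sub: "{P. D (curve_aut (W ^ j) P) \<noteq> 0} \<subseteq> affine_points"
    using D(2) aut_affine(1)[of "curve_aut (W ^ j) P" n for P] n(1) by fastforce
  have "x_value D = (\<Prod>P | D (curve_aut (W ^ j) P) \<noteq> 0. x_coord (curve_aut (W ^ j) P) powi D (curve_aut (W ^ j) P))"
    unfolding x_value_def by (rule prod.reindex_bij_betw[OF bij, symmetric])
  also have "\<dots> = x_value (\<lambda>P. D (curve_aut (W ^ j) P))"
    unfolding x_value_def using sub aut_affine(2) by (intro prod.cong) auto
  finally show "x_value (\<lambda>P. D (curve_aut (W ^ j) P)) = x_value D" by simp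
qed

lemma Pi_divisor_eq: "Pi_divisor w D = (\<lambda>P. D (curve_aut (W ^ (p - 1)) P) - D (curve_aut (W ^ 1) P))"
proof -
  have "W ^ (p - 1) * W = 1" using wp p_pos by (simp flip: power_Suc2)
  then have "inverse W = W ^ (p - 1)" by (metis inverse_unique mult.commute)
  then show ?thesis by (simp add: Pi_divisor_def)
qed

lemma Pi_add: "Pi_divisor w (\<lambda>P. D P + E P) = (\<lambda>P. Pi_divisor w D P + Pi_divisor w E P)"
  by (simp add: Pi_divisor_eq fun_eq_iff)

text \<open>The automorphism preserves \<open>x\<close>, so the two translates of \<open>D\<close>
  have equal \<open>x\<close>-values, which cancel.\<close>

lemma Pi_value:
  assumes D: "finite {P. D P \<noteq> 0}" "{P. D P \<noteq> 0} \<subseteq> affine_points"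
  shows "finite {P. Pi_divisor w D P \<noteq> 0}" "{P. Pi_divisor w D P \<noteq> 0} \<subseteq> affine_points"
    "x_value (Pi_divisor w D) = 1"
proof -
  note a = x_value_aut[OF D, of "p - 1"] and b = x_value_aut[OF D, of 1]
  have sub: "{P. Pi_divisor w D P \<noteq> 0} \<subseteq> {P. D (curve_aut (W ^ (p - 1)) P) \<noteq> 0} \<union> {P. D (curve_aut (W ^ 1) P) \<noteq> 0}"
    unfolding Pi_divisor_eq by auto
  show "finite {P. Pi_divisor w D P \<noteq> 0}" by (rule finite_subset[OF sub]) (use a b in blast)
  show "{P. Pi_divisor w D P \<noteq> 0} \<subseteq> affine_points" using sub a b by blast
  have "x_value (\<lambda>P. D (curve_aut (W ^ (p - 1)) P) + - D (curve_aut (W ^ 1) P)) =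
      x_value (\<lambda>P. D (curve_aut (W ^ (p - 1)) P)) * x_value (\<lambda>P. - D (curve_aut (W ^ 1) P))"
    by (rule x_value_add) (use a b in simp_all)
  then show "x_value (Pi_divisor w D) = 1"
    using x_value_nonzero[OF D(2)] a(3) b(3) by (simp add: Pi_divisor_eq x_value_minus)
qed

lemma Prin_aut:
  assumes "D \<in> Prin"
  shows "(\<lambda>P. D (curve_aut (W ^ j) P)) \<in> Prin"
proof -
  obtain g h where D: "D = pdiv g h" and gh: "\<not> FL dvd g" "\<not> FL dvd h" using assms by (auto simp: Prin_iff)
  define t where "t g = pcompose g [:0, [:w ^ j:]:]" for g :: "'l poly poly"
  have t: "rhom t" unfolding t_def by (rule rhom_pcompose)
  have lt: "lift (t f) = tau j (lift f)" for f
    by (rule rhom_poly2_eqI[OF rhom_comp[OF rhom_lift t] rhom_comp[OF rhom_tau rhom_lift]])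
       (simp_all add: t_def tau_def pcompose_pCons lift_pCons rhom_0[OF rhom_lift] one_pCons
         map_poly_pCons_rhom[OF rhom_to_ac])
  have nd: "\<not> FL dvd t f" if "\<not> FL dvd f" for f
  proof
    assume "FL dvd t f"
    then have "F dvd tau j (lift f)" using rhom_dvd[OF rhom_lift, of FL "t f"] by (simp add: lift_curve_poly lt)
    then show False using lift_not_dvd[OF that] tau_dvd by blast
  qed
  have "(\<lambda>P. D (curve_aut (W ^ j) P)) = pdiv (t g) (t h)"
    by (simp add: fun_eq_iff D pdiv_def aut_point_iff lt tau_prod_valuation)
  then show ?thesis using nd gh by (auto simp: Prin_iff)
qed

lemma Prin_Pi:
  assumes "D \<in> Prin"
  shows "Pi_divisor w D \<in> Prin"
  using Prin_add[OF Prin_aut[OF assms, of "p - 1"] Prin_minus[OF Prin_aut[OF assms, of 1]]]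
  by (simp add: Pi_divisor_eq)

text \<open>The functions \<open>x\<close> and \<open>y\<close> have coprime orders \<open>p\<close>
  and \<open>r\<close> at the first special point. The functions \<open>x - 1\<close> and
  \<open>y - 1\<close> have order 0 there but the same poles at infinity as \<open>x\<close> and
  \<open>y\<close>, of coprime orders \<open>p\<close> and \<open>r + 1\<close>. So both
  multiplicities can be adjusted independently.\<close>

lemma moving:
  obtains f where "f \<in> Prin" "D P0 + f P0 = 0" "D P_inf + f P_inf = 0"
proof -
  let ?x1 = "[:[:- 1, 1:]:] :: 'l poly poly" and ?y1 = "[:[:- 1:], 1:] :: 'l poly poly"
  have prin: "pdiv g 1 \<in> Prin" if "g = polyx \<or> g = polyy \<or> g = ?x1 \<or> g = ?y1" for g
    unfolding Prin_iff using that p_gt_2 by (intro exI conjI[OF refl] conjI FL_not_dvd) auto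
  have lifts: "lift (polyx :: 'l poly poly) = polyx" "lift (polyy :: 'l poly poly) = polyy" "lift ?x1 = [:[:- 1, 1:]:]" "lift ?y1 = [:[:- 1:], 1:]"
    using lift_x[of "0 :: 'l"] lift_y[of "0 :: 'l"] lift_x[of "- 1 :: 'l"] lift_y[of "- 1 :: 'l"] by simp_all
  have v1: "v (lift 1) = 0" if "v \<in> CP" for v
    using v_const[OF that, of 1] by (simp add: rhom_1[OF rhom_lift] flip: one_pCons)
  have pd: "pdiv g 1 v = v (lift g)" if "v \<in> CP" for g v using that v1 by (simp add: pdiv_def)
  have nd: "\<not> F dvd [:[:- 1:]:]" by (rule F_not_dvd_const) simp
  have y: "\<not> F dvd polyy" using y_not_dvd[of 0] by simp
  have y1: "v [:[:- 1:], 1:] = min (v polyy) 0" if v: "v \<in> CP" "v polyy \<noteq> 0" for v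
    using v_add_distinct[OF v(1) y nd] v_const[OF v(1), of "- 1"] v(2) by simp
  have x1: "\<And>c. c \<noteq> 0 \<Longrightarrow> P0 [:c:] = int p * int (order 0 c)" "\<And>c. c \<noteq> 0 \<Longrightarrow> P_inf [:c:] = - int p * int (degree c)"
    using P0_ramified P_inf_ramified by (simp_all add: ramified_def)
  have "order 0 [:- 1, 1 :: 'l alg_closure:] = 0" by (intro order_0I) simp
  then have P0: "P0 polyx = int p" "P0 polyy = int r" "P0 [:[:- 1, 1:]:] = 0" "P0 [:[:- 1:], 1:] = 0"
    using y1[OF P0_point] x1(1)[of "[:- 1, 1:]"] r by (simp_all add: valn_x valn_y subdegrees)
  have P_inf: "P_inf polyx = - int p" "P_inf polyy = - int (r + 1)" "P_inf [:[:- 1, 1:]:] = - int p"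
      "P_inf [:[:- 1:], 1:] = - int (r + 1)"
    using y1[OF P_inf_point] x1(2)[of "[:- 1, 1:]"] by (simp_all add: valn_x valn_y subdegrees)
  obtain i j where ij: "int p * i + int r * j = - D P0"
  proof -
    obtain u v where "u * int p + v * int r = gcd (int p) (int r)" using bezout_int by blast
    then have "u * int p + v * int r = 1" using coprime_r by simp
    then have "(u * int p + v * int r) * - D P0 = - D P0" by (simp only: mult_1_left)
    then show thesis using that[of "u * - D P0" "v * - D P0"] by (simp add: algebra_simps)
  qed
  obtain K M where KM: "int p * K + int (r + 1) * M = D P_inf"
  proof -
    obtain u v where "u * int p + v * int (r + 1) = gcd (int p) (int (r + 1))" using bezout_int by blast
    then have "u * int p + v * int (r + 1) = 1" using coprime_r1 by (simp only: gcd_int_int_eq coprime_iff_gcd_eq_1 of_nat_1)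
    then have "(u * int p + v * int (r + 1)) * D P_inf = D P_inf" by (simp only: mult_1_left)
    then show thesis using that[of "u * D P_inf" "v * D P_inf"] by (simp add: algebra_simps)
  qed
  \<comment> \<open>The exponents \<open>K - i\<close> and \<open>M - j\<close> compensate for what
    \<open>x\<close> and \<open>y\<close> already contribute at infinity.\<close>
  define f where "f = (\<lambda>P. (i * pdiv polyx 1 P + j * pdiv polyy 1 P) + ((K - i) * pdiv ?x1 1 P + (M - j) * pdiv ?y1 1 P))"
  have "f \<in> Prin"
    unfolding f_def by (intro Prin_add Prin_scale prin) auto
  moreover have "f P0 = int p * i + int r * j" by (simp add: f_def pd P0_point lifts P0)
  moreover have "f P_inf = - (int p * K + int (r + 1) * M)"
    unfolding f_def pd[OF P_inf_point] lifts P_inf by (simp add: algebra_simps)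
  ultimately show thesis using that ij KM by simp
qed

lemma affine_supportI: "D \<in> Div0 \<Longrightarrow> D P0 = 0 \<Longrightarrow> D P_inf = 0 \<Longrightarrow> {P. D P \<noteq> 0} \<subseteq> affine_points"
  unfolding affine_points_eq Div0_iff by auto

lemma good_support_iff: "D \<in> Div0 \<Longrightarrow> good_support D \<longleftrightarrow> {P. D P \<noteq> 0} \<subseteq> affine_points"
  unfolding good_support_def affine_points_def Div0_iff by blast

text \<open>Moving \<open>E\<close> makes \<open>\<Pi>E\<close> contribute the value \<open>1\<close>, so that only principal divisors remain.\<close>

lemma descent_unique:
  assumes D: "D \<in> Div0" "{P. D P \<noteq> 0} \<subseteq> affine_points" "to_ac u = x_value D"
    and D': "D' \<in> Div0" "{P. D' P \<noteq> 0} \<subseteq> affine_points" "to_ac u' = x_value D'"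
    and E: "E \<in> Div0" and f: "f \<in> Prin" "\<And>P. D P = f P + Pi_divisor w E P + D' P"
  obtains z where "z \<noteq> 0" "u = u' * z ^ p"
proof -
  obtain f1 where f1: "f1 \<in> Prin" "E P0 + f1 P0 = 0" "E P_inf + f1 P_inf = 0" using moving .
  define E' where "E' = (\<lambda>P. E P + f1 P)"
  have E': "E' \<in> Div0" unfolding E'_def by (rule Div0_add[OF E Prin_Div0[OF f1(1)]])
  have E'a: "{P. E' P \<noteq> 0} \<subseteq> affine_points" by (rule affine_supportI[OF E']) (use f1 in \<open>simp_all add: E'_def\<close>)
  have E'f: "finite {P. E' P \<noteq> 0}" "finite {P. D' P \<noteq> 0}" "finite {P. D P \<noteq> 0}"
    using E' D D' by (simp_all add: Div0_iff)
  note Pi = Pi_value[OF E'f(1) E'a]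
  \<comment> \<open>\<open>\<Pi>\<close> of the moving divisor is again principal, so it can be
    transferred from \<open>\<Pi>E\<close> to the principal part.\<close>
  define g where "g = (\<lambda>P. f P + - Pi_divisor w f1 P)"
  have g: "g \<in> Prin" unfolding g_def by (rule Prin_add[OF f(1) Prin_minus[OF Prin_Pi[OF f1(1)]]])
  have Dg: "D P = g P + (Pi_divisor w E' P + D' P)" for P
    unfolding g_def E'_def Pi_add using f(2)[of P] by simp
  have sub: "{P. Pi_divisor w E' P + D' P \<noteq> 0} \<subseteq> {P. Pi_divisor w E' P \<noteq> 0} \<union> {P. D' P \<noteq> 0}" by auto
  have s: "{P. Pi_divisor w E' P + D' P \<noteq> 0} \<subseteq> affine_points" "finite {P. Pi_divisor w E' P + D' P \<noteq> 0}"
    using sub Pi(2) D'(2) finite_subset[OF sub] Pi(1) E'f by blast+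
  have gs: "{P. g P \<noteq> 0} \<subseteq> affine_points"
  proof
    fix P assume "P \<in> {P. g P \<noteq> 0}"
    then have "D P \<noteq> 0 \<or> Pi_divisor w E' P + D' P \<noteq> 0" using Dg[of P] by auto
    then show "P \<in> affine_points" using D(2) s(1) by blast
  qed
  have gf: "finite {P. g P \<noteq> 0}" using Prin_Div0[OF g] by (simp add: Div0_iff)
  have nz: "P0 \<notin> affine_points" "P_inf \<notin> affine_points" by (simp_all add: affine_points_eq)
  obtain a b where ab: "g = pdiv a b" "\<not> FL dvd a" "\<not> FL dvd b" using g by (auto simp: Prin_iff)
  have "g P0 = 0" "g P_inf = 0" using gs nz by auto
  then obtain z where z: "z \<noteq> 0" "x_value g = to_ac z ^ p"
    using principal_power[OF ab(2,3)] unfolding ab(1) by blast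
  have "x_value D = x_value (\<lambda>P. g P + (Pi_divisor w E' P + D' P))" using Dg by (simp flip: Dg)
  also have "\<dots> = x_value g * x_value (\<lambda>P. Pi_divisor w E' P + D' P)" by (rule x_value_add[OF gf gs s(2,1)])
  also have "\<dots> = to_ac z ^ p * x_value D'" using x_value_add[OF Pi(1,2) E'f(2) D'(2)] Pi(3) z(2) by simp
  finally have "to_ac u = to_ac (u' * z ^ p)" using D(3) D'(3) by (simp add: mult.commute)
  then have "u = u' * z ^ p" by (simp only: rhom_inj[OF rhom_to_ac])
  then show thesis using that z(1) by blast
qed

end

section \<open>The descent map on cosets of cosets\<close>

context jacobian_curve
begin

lemma div_class_iff: "Y \<in> div_class p r d D \<longleftrightarrow> (\<exists>f\<in>Prin. Y = (\<lambda>P. f P + D P))"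
  by (auto simp: div_class_def r_coset_def div0_group_def)

lemma div_class_self: "D \<in> div_class p r d D"
  unfolding div_class_iff by (rule bexI[OF _ Prin_0]) simp

lemma div_class_eq:
  assumes f: "f \<in> Prin" and D: "D = (\<lambda>P. f P + E P)"
  shows "div_class p r d D = div_class p r d E"
proof
  show "div_class p r d D \<subseteq> div_class p r d E"
  proof
    fix Y assume "Y \<in> div_class p r d D"
    then obtain g where "g \<in> Prin" "Y = (\<lambda>P. g P + D P)" by (auto simp: div_class_iff)
    then show "Y \<in> div_class p r d E"
      unfolding div_class_iff using Prin_add[OF _ f] D by (intro bexI[of _ "\<lambda>P. g P + f P"]) (auto simp: add.assoc)
  qed
  show "div_class p r d E \<subseteq> div_class p r d D"
  proof
    fix Y assume "Y \<in> div_class p r d E"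
    then obtain g where "g \<in> Prin" "Y = (\<lambda>P. g P + E P)" by (auto simp: div_class_iff)
    then show "Y \<in> div_class p r d D"
      unfolding div_class_iff using Prin_add[OF _ Prin_minus[OF f]] D by (intro bexI[of _ "\<lambda>P. g P + - f P"]) auto
  qed
qed

lemma carrier_jacobian: "carrier (jacobian p r d) = div_class p r d ` Div0"
  by (auto simp: jacobian_def carrier_FactGroup div_class_def)

lemma Pi_jacobian_iff:
  "Y \<in> Pi_jacobian p r d w (div_class p r d E) \<longleftrightarrow> (\<exists>f\<in>Prin. Y = (\<lambda>P. f P + Pi_divisor w E P))"
proof
  assume "Y \<in> Pi_jacobian p r d w (div_class p r d E)"
  then obtain D1 where D1: "D1 \<in> div_class p r d E" "Y \<in> div_class p r d (Pi_divisor w D1)"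
    by (auto simp: Pi_jacobian_def)
  obtain f where f: "f \<in> Prin" "D1 = (\<lambda>P. f P + E P)" using D1(1) by (auto simp: div_class_iff)
  obtain g where g: "g \<in> Prin" "Y = (\<lambda>P. g P + Pi_divisor w D1 P)" using D1(2) by (auto simp: div_class_iff)
  have "Y = (\<lambda>P. (g P + Pi_divisor w f P) + Pi_divisor w E P)"
    using g(2) unfolding f(2) Pi_add by (simp add: add.assoc)
  then show "\<exists>f\<in>Prin. Y = (\<lambda>P. f P + Pi_divisor w E P)"
    using Prin_add[OF g(1) Prin_Pi[OF f(1)]] by (intro bexI[of _ "\<lambda>P. g P + Pi_divisor w f P"])
next
  assume "\<exists>f\<in>Prin. Y = (\<lambda>P. f P + Pi_divisor w E P)"
  then have "Y \<in> div_class p r d (Pi_divisor w E)" by (simp add: div_class_iff)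
  then show "Y \<in> Pi_jacobian p r d w (div_class p r d E)"
    unfolding Pi_jacobian_def using div_class_self[of E] by blast
qed

abbreviation quotient_class :: "'l divisor \<Rightarrow> 'l divisor set set" where
  "quotient_class D \<equiv> (Pi_jacobian p r d w ` carrier (jacobian p r d)) #>\<^bsub>jacobian p r d\<^esub> div_class p r d D"

lemma carrier_jacobian_mod_Pi: "carrier (jacobian_mod_Pi p r d w) = quotient_class ` Div0"
  by (simp add: jacobian_mod_Pi_def carrier_FactGroup carrier_jacobian image_image)

lemma quotient_class_iff:
  "Y \<in> quotient_class D \<longleftrightarrow>
    (\<exists>E\<in>Div0. Y = Pi_jacobian p r d w (div_class p r d E) <#>\<^bsub>div0_group p r d\<^esub> div_class p r d D)"
proof -
  have "Y \<otimes>\<^bsub>jacobian p r d\<^esub> Z = Y <#>\<^bsub>div0_group p r d\<^esub> Z" for Y Z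
    by (simp add: jacobian_def)
  then show ?thesis by (auto simp: r_coset_def carrier_jacobian)
qed

text \<open>Two nested quotients are unwound by testing the equality of sets on the divisor
  \<open>D\<close>, which belongs to its own class.\<close>

lemma mem_quotient_class:
  assumes "div_class p r d D \<in> quotient_class D0"
  obtains E f where "E \<in> Div0" "f \<in> Prin" "D = (\<lambda>P. f P + Pi_divisor w E P + D0 P)"
proof -
  obtain E where E: "E \<in> Div0"
    "div_class p r d D = Pi_jacobian p r d w (div_class p r d E) <#>\<^bsub>div0_group p r d\<^esub> div_class p r d D0"
    using assms unfolding quotient_class_iff by blast
  have "D \<in> Pi_jacobian p r d w (div_class p r d E) <#>\<^bsub>div0_group p r d\<^esub> div_class p r d D0"
    using div_class_self[of D] unfolding E(2) .
  then obtain Y Z where YZ: "Y \<in> Pi_jacobian p r d w (div_class p r d E)" "Z \<in> div_class p r d D0"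
    "D = (\<lambda>P. Y P + Z P)" by (auto simp: set_mult_def div0_group_def)
  obtain f where f: "f \<in> Prin" "Y = (\<lambda>P. f P + Pi_divisor w E P)" using YZ(1) by (auto simp: Pi_jacobian_iff)
  obtain g where g: "g \<in> Prin" "Z = (\<lambda>P. g P + D0 P)" using YZ(2) by (auto simp: div_class_iff)
  have "D = (\<lambda>P. (f P + g P) + Pi_divisor w E P + D0 P)" by (simp add: fun_eq_iff YZ(3) f(2) g(2))
  then show thesis using that[OF E(1) Prin_add[OF f(1) g(1)]] by blast
qed

lemma zero_Div0: "(\<lambda>P. 0) \<in> Div0" by (rule Prin_Div0[OF Prin_0])

lemma quotient_class_self: "div_class p r d D \<in> quotient_class D"
proof -
  have Pi0: "Pi_divisor w (\<lambda>P. 0) = (\<lambda>P. 0)" by (simp add: Pi_divisor_def)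
  have "div_class p r d D = Pi_jacobian p r d w (div_class p r d (\<lambda>P. 0)) <#>\<^bsub>div0_group p r d\<^esub> div_class p r d D"
  proof
    show "div_class p r d D \<subseteq> Pi_jacobian p r d w (div_class p r d (\<lambda>P. 0)) <#>\<^bsub>div0_group p r d\<^esub> div_class p r d D"
    proof
      fix Y assume Y: "Y \<in> div_class p r d D"
      have "(\<lambda>P. 0) \<in> Pi_jacobian p r d w (div_class p r d (\<lambda>P. 0))"
        unfolding Pi_jacobian_iff Pi0 by (rule bexI[OF _ Prin_0]) simp
      then show "Y \<in> Pi_jacobian p r d w (div_class p r d (\<lambda>P. 0)) <#>\<^bsub>div0_group p r d\<^esub> div_class p r d D"
        using Y by (force simp: set_mult_def div0_group_def)
    qed
    show "Pi_jacobian p r d w (div_class p r d (\<lambda>P. 0)) <#>\<^bsub>div0_group p r d\<^esub> div_class p r d D \<subseteq> div_class p r d D"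
    proof
      fix Y assume "Y \<in> Pi_jacobian p r d w (div_class p r d (\<lambda>P. 0)) <#>\<^bsub>div0_group p r d\<^esub> div_class p r d D"
      then obtain f g where fg: "f \<in> Prin" "g \<in> Prin" "Y = (\<lambda>P. f P + (g P + D P))"
        by (auto simp: set_mult_def div0_group_def Pi_jacobian_iff Pi0 div_class_iff)
      then show "Y \<in> div_class p r d D"
        unfolding div_class_iff using Prin_add[OF fg(1,2)]
        by (intro bexI[of _ "\<lambda>P. f P + g P"]) (auto simp: add.assoc)
    qed
  qed
  then show ?thesis unfolding quotient_class_iff using zero_Div0 by blast
qed

text \<open>By \<open>descent_unique\<close> the set under \<open>the_elem\<close> is a singleton,
  which is the well-definedness of the descent map.\<close>

lemma descent_map_eq:
  assumes D: "D \<in> Div0" "{P. D P \<noteq> 0} \<subseteq> affine_points" "to_ac u = x_value D"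
  shows "descent_map p r d (quotient_class D) = power_coset field_units p u"
proof -
  have "{power_coset field_units p u' | u' D'. D' \<in> Div0 \<and> good_support D' \<and>
      div_class p r d D' \<in> quotient_class D \<and> to_ac u' = x_value D'} = {power_coset field_units p u}"
  proof (intro equalityI subsetI)
    fix C assume "C \<in> {power_coset field_units p u' | u' D'. D' \<in> Div0 \<and> good_support D' \<and>
      div_class p r d D' \<in> quotient_class D \<and> to_ac u' = x_value D'}"
    then obtain u' D' where D': "C = power_coset field_units p u'" "D' \<in> Div0" "good_support D'"
      "div_class p r d D' \<in> quotient_class D" "to_ac u' = x_value D'" by blast
    obtain E f where Ef: "E \<in> Div0" "f \<in> Prin" "D' = (\<lambda>P. f P + Pi_divisor w E P + D P)"
      using mem_quotient_class[OF D'(4)] by blast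
    have eq: "D' P = f P + Pi_divisor w E P + D P" for P using fun_cong[OF Ef(3)] .
    have "{P. D' P \<noteq> 0} \<subseteq> affine_points" using good_support_iff[OF D'(2)] D'(3) by blast
    from descent_unique[OF D'(2) this D'(5) D Ef(1,2) eq] obtain z where "z \<noteq> 0" "u' = u * z ^ p" .
    then show "C \<in> {power_coset field_units p u}" using power_coset_eqI D'(1) by blast
  next
    fix C assume "C \<in> {power_coset field_units p u}"
    moreover have "good_support D" using good_support_iff[OF D(1)] D(2) by blast
    ultimately show "C \<in> {power_coset field_units p u' | u' D'. D' \<in> Div0 \<and> good_support D' \<and>
      div_class p r d D' \<in> quotient_class D \<and> to_ac u' = x_value D'}"
      using D quotient_class_self by blast
  qed
  then show ?thesis by (simp add: descent_map_def)
qed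

text \<open>Every class has a representative avoiding the two special points, by moving; conversely
  each divisor given in coordinates represents a class. The rest of the argument is arithmetic of
  \<open>divisor_values\<close>.\<close>

theorem descent_image_eq: "descent_image p r d w = power_coset field_units p ` divisor_values p r d"
proof
  show "descent_image p r d w \<subseteq> power_coset field_units p ` divisor_values p r d"
  proof
    fix C assume "C \<in> descent_image p r d w"
    then obtain D0 where D0: "D0 \<in> Div0" "C = descent_map p r d (quotient_class D0)"
      by (auto simp: descent_image_def carrier_jacobian_mod_Pi)
    obtain f where f: "f \<in> Prin" "D0 P0 + f P0 = 0" "D0 P_inf + f P_inf = 0" using moving .
    define D where "D = (\<lambda>P. f P + D0 P)"
    have D: "D \<in> Div0" unfolding D_def by (rule Div0_add[OF Prin_Div0[OF f(1)] D0(1)])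
    have Da: "{P. D P \<noteq> 0} \<subseteq> affine_points"
      by (rule affine_supportI[OF D]) (use f in \<open>simp_all add: D_def add.commute\<close>)
    obtain u where u: "u \<in> divisor_values p r d" "to_ac u = x_value D" using good_value[OF D Da] .
    have "div_class p r d D = div_class p r d D0" by (rule div_class_eq[OF f(1) D_def])
    then have "C = power_coset field_units p u" using descent_map_eq[OF D Da u(2)] D0(2) by simp
    then show "C \<in> power_coset field_units p ` divisor_values p r d" using u(1) by blast
  qed
  show "power_coset field_units p ` divisor_values p r d \<subseteq> descent_image p r d w"
  proof
    fix C assume "C \<in> power_coset field_units p ` divisor_values p r d"
    then obtain u m where u: "C = power_coset field_units p u" "curve_divisor p r d m" "to_ac u = divisor_value m"
      by (auto simp: divisor_values_def)
    then obtain D where D: "D \<in> Div0" "{P. D P \<noteq> 0} \<subseteq> affine_points" "divisor_value m = x_value D"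
      using curve_to_good by blast
    then have "C = descent_map p r d (quotient_class D)" using descent_map_eq u by simp
    then show "C \<in> descent_image p r d w" using D(1) by (auto simp: descent_image_def carrier_jacobian_mod_Pi)
  qed
qed

end

lemma jacobian_curve_exists:
  fixes d w :: "'l::field"
  assumes p: "prime p" "odd p" and r: "1 \<le> r" "r \<le> p - 2" and d: "d \<noteq> 0" and ch: "CHAR('l) = 0"
    and w: "primitive_root_of_unity p w"
  shows "\<exists>k e S0 Si. jacobian_curve p r d w k e S0 Si"
proof -
  have p0: "of_nat p \<noteq> (0 :: 'l)"
    using p(1) ch by (metis of_nat_eq_0_iff_char_dvd dvd_0_left_iff not_prime_0)
  then have pc: "of_nat p \<noteq> (0 :: 'l alg_closure)"
    by (metis to_ac_of_nat rhom_field_eq_0[OF rhom_to_ac])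
  have "primitive_root_of_unity p (to_ac w)"
    using w rhom_inj[OF rhom_to_ac, of "w ^ k" 1 for k] by (simp add: primitive_root_of_unity_def)
  then interpret superelliptic p r "to_ac d" "to_ac w"
    using p r d pc by unfold_locales (simp_all add: rhom_field_eq_0[OF rhom_to_ac])
  have "p \<noteq> 0" using p_pos by simp
  then obtain e k where "p * e = r * k + gcd p r" using bezout_nat by blast
  then have ke: "r * k + 1 = p * e" using coprime_r by simp
  \<comment> \<open>Needed because the expansion at \<open>(0,0)\<close> contains the exponent
    \<open>k - 1\<close>; \<open>k = 0\<close> would give \<open>p e = 1\<close>.\<close>
  have k: "k \<ge> 1"
  proof (rule ccontr)
    assume "\<not> k \<ge> 1"
    then have "k = 0" by simp
    then have "p * e = 1" using ke by simp
    then show False using p_gt_2 by simp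
  qed
  have root: "\<exists>S. S ^ p = 1 - fps_const c * fps_X ^ p \<and> S $ 0 = 1" for c :: "'l alg_closure"
  proof -
    have "(1 - fps_const c * fps_X ^ p :: 'l alg_closure fps) $ 0 = 1 ^ p" using p_pos by (simp add: fps_X_power_nth)
    then show ?thesis using fps_root_exists[OF pc, of 1] by (metis one_neq_zero)
  qed
  obtain S0 Si where S: "S0 ^ p = 1 - fps_const (to_ac d ^ (k - 1)) * fps_X ^ p" "S0 $ 0 = 1"
    "Si ^ p = 1 - fps_const (to_ac d) * fps_X ^ p" "Si $ 0 = 1" using root by metis
  have "jacobian_curve p r d w k e S0 Si" using k ke S ch by unfold_locales
  then show ?thesis by blast
qed

section \<open>Quotients by powers and the residue field\<close>

context comm_group
begin

lemma pth_powers_normal: "pth_powers G p \<lhd> G"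
proof (rule subgroup_imp_normal, rule subgroupI)
  show "pth_powers G p \<subseteq> carrier G" by (auto simp: pth_powers_def)
  show "pth_powers G p \<noteq> {}" by (auto simp: pth_powers_def)
  show "inv a \<in> pth_powers G p" if "a \<in> pth_powers G p" for a
    using that by (auto simp: pth_powers_def simp flip: nat_pow_inv)
  show "a \<otimes> b \<in> pth_powers G p" if "a \<in> pth_powers G p" "b \<in> pth_powers G p" for a b
    using that by (auto simp: pth_powers_def simp flip: nat_pow_distrib)
qed

lemma power_quot_group: "group (power_quot G p)"
  unfolding power_quot_def by (rule normal.factorgroup_is_group[OF pth_powers_normal])

lemma carrier_power_quot: "carrier (power_quot G p) = power_coset G p ` carrier G"
  by (simp add: power_quot_def carrier_FactGroup power_coset_def)

lemma power_coset_mult: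
  assumes "x \<in> carrier G" "y \<in> carrier G"
  shows "power_coset G p x \<otimes>\<^bsub>power_quot G p\<^esub> power_coset G p y = power_coset G p (x \<otimes> y)"
  using normal.rcos_sum[OF pth_powers_normal assms] by (simp add: power_quot_def power_coset_def)

lemma power_coset_one: "power_coset G p \<one> = \<one>\<^bsub>power_quot G p\<^esub>"
proof -
  have "pth_powers G p \<subseteq> carrier G" by (auto simp: pth_powers_def)
  then show ?thesis by (simp add: power_quot_def power_coset_def coset_mult_one)
qed

lemma power_coset_eq_iff:
  assumes "x \<in> carrier G" "y \<in> carrier G"
  shows "power_coset G p x = power_coset G p y \<longleftrightarrow> (\<exists>z\<in>carrier G. x = z [^] p \<otimes> y)"
proof
  have sub: "subgroup (pth_powers G p) G" using pth_powers_normal by (rule normal_imp_subgroup)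
  show "\<exists>z\<in>carrier G. x = z [^] p \<otimes> y" if "power_coset G p x = power_coset G p y"
    using rcos_self[OF assms(1) sub] that by (auto simp: power_coset_def r_coset_def pth_powers_def)
  show "power_coset G p x = power_coset G p y" if z: "\<exists>z\<in>carrier G. x = z [^] p \<otimes> y"
  proof -
    have "x \<in> pth_powers G p #> y" using z by (auto simp: r_coset_def pth_powers_def)
    then show ?thesis using repr_independence[OF _ assms(2) sub] by (simp add: power_coset_def)
  qed
qed

lemma power_coset_inv:
  assumes x: "x \<in> carrier G"
  shows "inv\<^bsub>power_quot G p\<^esub> power_coset G p x = power_coset G p (inv x)"
proof (rule group.inv_equality[OF power_quot_group])
  show "power_coset G p (inv x) \<otimes>\<^bsub>power_quot G p\<^esub> power_coset G p x = \<one>\<^bsub>power_quot G p\<^esub>"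
    using x by (simp add: power_coset_mult power_coset_one)
qed (use x in \<open>auto simp: carrier_power_quot\<close>)

lemma power_coset_subgroup:
  assumes "S \<subseteq> carrier G" "\<one> \<in> S" "\<And>x. x \<in> S \<Longrightarrow> inv x \<in> S" "\<And>x y. x \<in> S \<Longrightarrow> y \<in> S \<Longrightarrow> x \<otimes> y \<in> S"
  shows "subgroup (power_coset G p ` S) (power_quot G p)"
proof (rule group.subgroupI[OF power_quot_group])
  show "power_coset G p ` S \<subseteq> carrier (power_quot G p)" using assms(1) by (auto simp: carrier_power_quot)
  show "power_coset G p ` S \<noteq> {}" using assms(2) by blast
  show "inv\<^bsub>power_quot G p\<^esub> a \<in> power_coset G p ` S" if "a \<in> power_coset G p ` S" for a
    using that assms(1,3) by (auto simp: power_coset_inv subset_iff)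
  show "a \<otimes>\<^bsub>power_quot G p\<^esub> b \<in> power_coset G p ` S"
    if ab: "a \<in> power_coset G p ` S" "b \<in> power_coset G p ` S" for a b
  proof -
    obtain x y where xy: "a = power_coset G p x" "b = power_coset G p y" "x \<in> S" "y \<in> S" using ab by blast
    then have "a \<otimes>\<^bsub>power_quot G p\<^esub> b = power_coset G p (x \<otimes> y)"
      using power_coset_mult assms(1) by blast
    then show ?thesis using assms(4) xy by blast
  qed
qed

end

lemma comm_group_field_units: "comm_group (field_units :: 'a::field monoid)"
proof (rule comm_groupI)
  fix x :: 'a assume "x \<in> carrier field_units"
  then show "\<exists>y\<in>carrier field_units. y \<otimes>\<^bsub>field_units\<^esub> x = \<one>\<^bsub>field_units\<^esub>"
    by (intro bexI[of _ "inverse x"]) (auto simp: carrier_field_units mult_field_units one_field_units)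
qed (auto simp: carrier_field_units mult_field_units one_field_units)

lemma inv_field_units: "x \<noteq> 0 \<Longrightarrow> inv\<^bsub>field_units\<^esub> x = inverse (x :: 'a::field)"
  by (rule group.inv_equality[OF comm_group.axioms(2)[OF comm_group_field_units]])
     (auto simp: carrier_field_units mult_field_units one_field_units)

section \<open>The residue field as a quotient ring\<close>

context nonarch
begin

abbreviation "VR \<equiv> valuation_ring av"
abbreviation "MI \<equiv> {u. av u < 1}"
abbreviation "RF \<equiv> residue_field av"

lemma VR_simps: "carrier VR = {u. av u \<le> 1}" "x \<otimes>\<^bsub>VR\<^esub> y = x * y" "x \<oplus>\<^bsub>VR\<^esub> y = x + y"
  "\<one>\<^bsub>VR\<^esub> = 1" "\<zero>\<^bsub>VR\<^esub> = 0"
  by (simp_all add: valuation_ring_def ring_of_type_algebra_def)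

lemma cring_VR: "cring VR"
proof (rule cringI)
  show "abelian_group VR"
  proof (rule abelian_groupI)
    fix x assume "x \<in> carrier VR"
    then show "\<exists>y\<in>carrier VR. y \<oplus>\<^bsub>VR\<^esub> x = \<zero>\<^bsub>VR\<^esub>"
      by (intro bexI[of _ "- x"]) (simp_all add: VR_simps)
  qed (simp_all add: VR_simps av_add_le add_ac)
  show "comm_monoid VR"
    by (rule comm_monoidI) (simp_all add: VR_simps av_mult mult_le_one mult_ac)
qed (simp add: VR_simps algebra_simps)

lemma ideal_MI: "ideal MI VR"
proof (rule idealI)
  interpret cring VR by (rule cring_VR)
  show "ring VR" by (rule ring_axioms)
  have inv: "\<ominus>\<^bsub>VR\<^esub> x = - x" if "av x \<le> 1" for x
    by (rule minus_equality) (use that in \<open>simp_all add: VR_simps\<close>)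
  show "subgroup MI (add_monoid VR)"
  proof (rule add.subgroupI)
    show "MI \<noteq> {}" by (rule ex_in_conv[THEN iffD1], rule exI[of _ 0]) simp
    show "\<ominus>\<^bsub>VR\<^esub> a \<in> MI" if "a \<in> MI" for a using that by (simp add: inv)
  qed (auto simp: VR_simps av_add_less)
  show "x \<otimes>\<^bsub>VR\<^esub> a \<in> MI" "a \<otimes>\<^bsub>VR\<^esub> x \<in> MI" if "a \<in> MI" "x \<in> carrier VR" for a x
    using that mult_left_le_one_le[of "av a" "av x"] by (auto simp: VR_simps av_mult mult.commute)
qed

lemma cring_RF: "cring RF"
  unfolding residue_field_def by (rule ideal.quotient_is_cring[OF ideal_MI cring_VR])

text \<open>Residue classes are open unit balls, so algebra in the quotient ring turns into
  inequalities for \<open>av\<close>.\<close>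

lemma residue_eq: "residue av u = {v. av (v - u) < 1}"
proof -
  have "v \<in> residue av u" if "av (v - u) < 1" for v
    using that unfolding residue_def a_r_coset_def' by (auto simp: VR_simps intro!: exI[of _ "v - u"])
  then show ?thesis by (auto simp: residue_def a_r_coset_def' VR_simps)
qed

lemma residue_eq_iff: "residue av u = residue av v \<longleftrightarrow> av (u - v) < 1"
proof
  assume "residue av u = residue av v"
  moreover have "u \<in> residue av u" by (simp add: residue_eq)
  ultimately show "av (u - v) < 1" by (simp add: residue_eq)
next
  assume "av (u - v) < 1"
  moreover from this have "av (v - u) < 1" by (simp add: av_minus_commute)
  ultimately show "residue av u = residue av v"
    unfolding residue_eq using av_diff_trans_less[of _ u 1 v] av_diff_trans_less[of _ v 1 u] by blast
qed

lemma carrier_RF: "carrier RF = residue av ` {u. av u \<le> 1}"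
proof -
  have "a_rcosets\<^bsub>VR\<^esub> MI = (\<lambda>u. MI +>\<^bsub>VR\<^esub> u) ` carrier VR"
    unfolding A_RCOSETS_def RCOSETS_def a_r_coset_def by auto
  then show ?thesis by (simp add: residue_field_def FactRing_def residue_def VR_simps(1))
qed

lemma residue_mult: "av u \<le> 1 \<Longrightarrow> av v \<le> 1 \<Longrightarrow> residue av u \<otimes>\<^bsub>RF\<^esub> residue av v = residue av (u * v)"
  using ideal.rcoset_mult_add[OF ideal_MI, of u v] by (simp add: residue_field_def FactRing_def residue_def VR_simps)

lemma residue_one: "\<one>\<^bsub>RF\<^esub> = residue av 1"
  by (simp add: residue_field_def FactRing_def residue_def VR_simps)

lemma carrier_units_RF: "carrier (units_of RF) = residue av ` {u. av u = 1}"
proof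
  show "carrier (units_of RF) \<subseteq> residue av ` {u. av u = 1}"
  proof
    fix x assume "x \<in> carrier (units_of RF)"
    then obtain y where x: "x \<in> carrier RF" and y: "y \<in> carrier RF" and xy: "x \<otimes>\<^bsub>RF\<^esub> y = \<one>\<^bsub>RF\<^esub>"
      by (auto simp: units_of_def Units_def)
    obtain u v where u: "x = residue av u" "av u \<le> 1" and v: "y = residue av v" "av v \<le> 1"
      using x y by (auto simp: carrier_RF)
    have "av (u * v - 1) < av 1"
      using xy u v by (simp add: residue_mult residue_one residue_eq_iff)
    then have "av (u * v) = av 1" by (rule av_close_eq)
    then have "av u * av v = 1" by (simp add: av_mult)
    then have "av u = 1" using u(2) v(2) mult_left_le[of "av v" "av u"] by simp
    then show "x \<in> residue av ` {u. av u = 1}" using u(1) by blast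
  qed
  show "residue av ` {u. av u = 1} \<subseteq> carrier (units_of RF)"
  proof
    fix x assume "x \<in> residue av ` {u. av u = 1}"
    then obtain u where u: "x = residue av u" "av u = 1" by blast
    then have "u \<noteq> 0" by auto
    have iu: "av (inverse u) = 1" using u by (simp add: av_inverse)
    have c: "x \<in> carrier RF" "residue av (inverse u) \<in> carrier RF" using u iu by (auto simp: carrier_RF)
    have "residue av (inverse u) \<otimes>\<^bsub>RF\<^esub> x = \<one>\<^bsub>RF\<^esub>" "x \<otimes>\<^bsub>RF\<^esub> residue av (inverse u) = \<one>\<^bsub>RF\<^esub>"
      using u iu \<open>u \<noteq> 0\<close> by (simp_all add: residue_mult residue_one)
    then show "x \<in> carrier (units_of RF)" using c unfolding units_of_def Units_def by auto
  qed
qed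

lemma comm_group_units_RF: "comm_group (units_of RF)"
  using cring_RF comm_monoid.units_comm_group cring.axioms(2) by blast

lemma mult_units_RF: "av u = 1 \<Longrightarrow> av v = 1 \<Longrightarrow> residue av u \<otimes>\<^bsub>units_of RF\<^esub> residue av v = residue av (u * v)"
  by (simp add: units_of_def residue_mult)

lemma pow_units_RF: "av u = 1 \<Longrightarrow> residue av u [^]\<^bsub>units_of RF\<^esub> (n :: nat) = residue av (u ^ n)"
proof (induction n)
  case 0
  then show ?case by (simp add: nat_pow_def units_of_def residue_one)
next
  case (Suc n)
  then show ?case by (simp add: nat_pow_def mult_units_RF av_power mult.commute)
qed

end

section \<open>Assembling the two cases\<close>

context descent
begin

lemma descent_image: "descent_image p r d w = power_coset field_units p ` divisor_values p r d"
proof -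
  have "d \<noteq> 0" using \<delta> by simp
  then obtain k e S0 Si where "jacobian_curve p r d w k e S0 Si"
    using jacobian_curve_exists[OF p r _ char_0 w] by blast
  then show ?thesis by (rule jacobian_curve.descent_image_eq)
qed

abbreviation unit_coset :: "'l \<Rightarrow> 'l set" where "unit_coset \<equiv> power_coset field_units p"

lemma unramified_image:
  assumes "\<not> int l dvd \<delta>"
  shows "descent_image p r d w = unit_classes av p"
  unfolding descent_image unit_classes_def
proof (intro equalityI image_subsetI)
  fix u assume "u \<in> divisor_values p r d"
  then obtain z where z: "z \<noteq> 0" "av (u / z ^ p) = 1" using unramified_upper[OF assms] by blast
  then have "unit_coset u = unit_coset (u / z ^ p)" by (intro power_coset_eqI[OF _ z(1)]) simp
  then show "unit_coset u \<in> unit_coset ` {u. av u = 1}" using z(2) by blast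
next
  fix v assume "v \<in> {u. av u = 1}"
  then obtain u z where u: "u \<in> divisor_values p r d" "z \<noteq> 0" "v = u * z ^ p"
    using unramified_lower[OF assms] by blast
  then have "unit_coset v = unit_coset u" by (intro power_coset_eqI)
  then show "unit_coset v \<in> unit_coset ` divisor_values p r d" using u(1) by blast
qed

lemma unit_classes_subgroup: "subgroup (unit_classes av p) (power_quot (field_units :: 'l monoid) p)"
  unfolding unit_classes_def
proof (rule comm_group.power_coset_subgroup[OF comm_group_field_units])
  fix x assume "x \<in> {u. av u = 1}"
  then show "inv\<^bsub>field_units\<^esub> x \<in> {u. av u = 1}"
    using inv_field_units[of x] by (cases "x = 0") (simp_all add: av_inverse)
qed (auto simp: carrier_field_units one_field_units mult_field_units av_mult)

text \<open>A unit whose residue is a \<open>p\<close>-th power is a \<open>p\<close>-th power by Hensel's lemma.\<close>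

lemma unit_coset_iff:
  assumes u: "av u = 1" "av v = 1"
  shows "unit_coset u = unit_coset v \<longleftrightarrow>
    power_coset (units_of RF) p (residue av u) = power_coset (units_of RF) p (residue av v)"
proof -
  have c: "u \<in> carrier field_units" "v \<in> carrier field_units" using u by (auto simp: carrier_field_units)
  have rc: "residue av u \<in> carrier (units_of RF)" "residue av v \<in> carrier (units_of RF)"
    using u by (auto simp: carrier_units_RF)
  have L: "unit_coset u = unit_coset v \<longleftrightarrow> (\<exists>z. z \<noteq> 0 \<and> u = z ^ p * v)"
    unfolding comm_group.power_coset_eq_iff[OF comm_group_field_units c]
    by (auto simp: carrier_field_units mult_field_units pow_field_units)
  have "(\<exists>z\<in>carrier (units_of RF). residue av u = z [^]\<^bsub>units_of RF\<^esub> p \<otimes>\<^bsub>units_of RF\<^esub> residue av v) \<longleftrightarrow>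
      (\<exists>z. av z = 1 \<and> av (u - z ^ p * v) < 1)"
    unfolding carrier_units_RF using u
    by (auto simp: pow_units_RF mult_units_RF av_power residue_eq_iff)
  then have R: "power_coset (units_of RF) p (residue av u) = power_coset (units_of RF) p (residue av v) \<longleftrightarrow>
      (\<exists>z. av z = 1 \<and> av (u - z ^ p * v) < 1)"
    unfolding comm_group.power_coset_eq_iff[OF comm_group_units_RF rc] .
  have "(\<exists>z. z \<noteq> 0 \<and> u = z ^ p * v) \<longleftrightarrow> (\<exists>z. av z = 1 \<and> av (u - z ^ p * v) < 1)"
  proof
    assume "\<exists>z. z \<noteq> 0 \<and> u = z ^ p * v"
    then obtain z where z: "z \<noteq> 0" "u = z ^ p * v" by blast
    then have "av z ^ p = 1" using u by (simp add: av_mult av_power)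
    then have "av z = 1" using power_eq_imp_eq_base[of "av z" p 1] p_gt_2 by simp
    then show "\<exists>z. av z = 1 \<and> av (u - z ^ p * v) < 1" using z by (intro exI[of _ z]) simp
  next
    assume "\<exists>z. av z = 1 \<and> av (u - z ^ p * v) < 1"
    then obtain z where z: "av z = 1" "av (u - z ^ p * v) < 1" by blast
    have nz: "z \<noteq> 0" "v \<noteq> 0" using z u by auto
    have "u / (z ^ p * v) - 1 = (u - z ^ p * v) / (z ^ p * v)" using nz by (simp add: field_simps)
    then have "av (u / (z ^ p * v) - 1) < 1" using z u by (simp add: av_divide av_mult av_power)
    then obtain y where y: "y ^ p = u / (z ^ p * v)" using pth_root_one_unit by blast
    have "u = (y * z) ^ p * v" using y nz by (simp add: power_mult_distrib)
    moreover have "y \<noteq> 0"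
    proof
      assume "y = 0"
      then have "u = 0" using y nz p_gt_2 by (simp add: power_0_left)
      then show False using u by simp
    qed
    ultimately show "\<exists>z. z \<noteq> 0 \<and> u = z ^ p * v" using nz by (intro exI[of _ "y * z"]) simp
  qed
  then show ?thesis unfolding L R .
qed

text \<open>The map is defined through a chosen unit in each class; \<open>unit_coset_iff\<close>
  gives independence of the choice in one direction and injectivity in the other.\<close>

lemma unit_classes_iso:
  "\<exists>\<phi> \<in> iso ((power_quot (field_units :: 'l monoid) p)\<lparr>carrier := unit_classes av p\<rparr>) (power_quot (units_of RF) p).
     \<forall>u. av u = 1 \<longrightarrow> \<phi> (unit_coset u) = power_coset (units_of RF) p (residue av u)"
proof -
  let ?c = "power_coset (units_of RF) p" and ?Q = "power_quot (field_units :: 'l monoid) p"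
  define \<phi> where "\<phi> C = ?c (residue av (SOME u. av u = 1 \<and> C = unit_coset u))" for C
  have \<phi>: "\<phi> (unit_coset u) = ?c (residue av u)" if u: "av u = 1" for u
  proof -
    have "av (SOME v. av v = 1 \<and> unit_coset u = unit_coset v) = 1 \<and> unit_coset u = unit_coset (SOME v. av v = 1 \<and> unit_coset u = unit_coset v)"
      by (rule someI[of "\<lambda>v. av v = 1 \<and> unit_coset u = unit_coset v" u]) (simp add: u)
    then show ?thesis unfolding \<phi>_def using unit_coset_iff[OF u] by metis
  qed
  have carr: "carrier (power_quot (units_of RF) p) = ?c ` residue av ` {u. av u = 1}"
    by (simp add: comm_group.carrier_power_quot[OF comm_group_units_RF] carrier_units_RF)
  have "\<phi> \<in> hom (?Q\<lparr>carrier := unit_classes av p\<rparr>) (power_quot (units_of RF) p)"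
  proof (rule homI)
    fix x assume "x \<in> carrier (?Q\<lparr>carrier := unit_classes av p\<rparr>)"
    then show "\<phi> x \<in> carrier (power_quot (units_of RF) p)"
      unfolding carr by (auto simp: unit_classes_def \<phi>)
  next
    fix x y assume "x \<in> carrier (?Q\<lparr>carrier := unit_classes av p\<rparr>)" "y \<in> carrier (?Q\<lparr>carrier := unit_classes av p\<rparr>)"
    then obtain u v where u: "x = unit_coset u" "av u = 1" and v: "y = unit_coset v" "av v = 1"
      by (auto simp: unit_classes_def)
    have "u \<noteq> 0" "v \<noteq> 0" using u v by auto
    then have "x \<otimes>\<^bsub>?Q\<^esub> y = unit_coset (u * v)"
      using comm_group.power_coset_mult[OF comm_group_field_units, of u v p]
      by (simp add: carrier_field_units mult_field_units u(1) v(1))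
    moreover have "?c (residue av u) \<otimes>\<^bsub>power_quot (units_of RF) p\<^esub> ?c (residue av v) = ?c (residue av (u * v))"
      using comm_group.power_coset_mult[OF comm_group_units_RF, of "residue av u" "residue av v" p] u v
      by (simp add: carrier_units_RF mult_units_RF)
    ultimately show "\<phi> (x \<otimes>\<^bsub>?Q\<lparr>carrier := unit_classes av p\<rparr>\<^esub> y) = \<phi> x \<otimes>\<^bsub>power_quot (units_of RF) p\<^esub> \<phi> y"
      using u v by (simp add: \<phi> av_mult)
  qed
  moreover have "bij_betw \<phi> (unit_classes av p) (carrier (power_quot (units_of RF) p))"
    unfolding bij_betw_def
  proof
    show "inj_on \<phi> (unit_classes av p)"
    proof (rule inj_onI)
      fix x y assume "x \<in> unit_classes av p" "y \<in> unit_classes av p" and eq: "\<phi> x = \<phi> y"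
      then obtain u v where u: "x = unit_coset u" "av u = 1" and v: "y = unit_coset v" "av v = 1"
        unfolding unit_classes_def by blast
      then show "x = y" using eq unit_coset_iff[OF u(2) v(2)] by (simp add: \<phi>)
    qed
    show "\<phi> ` unit_classes av p = carrier (power_quot (units_of RF) p)"
      unfolding carr unit_classes_def image_image by (rule image_cong[OF refl]) (simp add: \<phi>)
  qed
  ultimately have "\<phi> \<in> iso (?Q\<lparr>carrier := unit_classes av p\<rparr>) (power_quot (units_of RF) p)"
    by (simp add: iso_def)
  then show ?thesis using \<phi> by blast
qed

lemma ramified_image:
  assumes ram: "int l dvd \<delta>"
  shows "descent_image p r d w = generate (power_quot field_units p) {unit_coset d}"
proof -
  let ?Q = "power_quot (field_units :: 'l monoid) p"
  note cg = comm_group_field_units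
  have d0: "d \<noteq> 0" using \<delta> by simp
  have G: "group ?Q" by (rule comm_group.power_quot_group[OF cg])
  have mult: "unit_coset x \<otimes>\<^bsub>?Q\<^esub> unit_coset y = unit_coset (x * y)" if "x \<noteq> 0" "y \<noteq> 0" for x y
    using comm_group.power_coset_mult[OF cg, of x y p] that by (simp add: carrier_field_units mult_field_units)
  have inv: "inv\<^bsub>?Q\<^esub> unit_coset x = unit_coset (inverse x)" if "x \<noteq> 0" for x
    using comm_group.power_coset_inv[OF cg, of x p] that by (simp add: carrier_field_units inv_field_units)
  have cd: "{unit_coset d} \<subseteq> carrier ?Q"
    using d0 by (auto simp: comm_group.carrier_power_quot[OF cg] carrier_field_units)
  have sub: "subgroup (generate ?Q {unit_coset d}) ?Q" by (rule group.generate_is_subgroup[OF G cd])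
  have nat: "unit_coset (d ^ n) \<in> generate ?Q {unit_coset d}" for n
  proof (induction n)
    case 0
    have "unit_coset 1 = \<one>\<^bsub>?Q\<^esub>" using comm_group.power_coset_one[OF cg, of p] by (simp add: one_field_units)
    then show ?case by (simp add: generate.one)
  next
    case (Suc n)
    have "unit_coset d \<otimes>\<^bsub>?Q\<^esub> unit_coset (d ^ n) \<in> generate ?Q {unit_coset d}"
      by (rule generate.eng[OF generate.incl Suc]) simp
    then show ?case using d0 by (simp add: mult)
  qed
  have powi: "unit_coset (d powi k) \<in> generate ?Q {unit_coset d}" for k
  proof (cases "k \<ge> 0")
    case True
    then show ?thesis using nat[of "nat k"] by (simp add: power_int_def)
  next
    case False
    have "inv\<^bsub>?Q\<^esub> unit_coset (d ^ nat (- k)) \<in> generate ?Q {unit_coset d}"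
      by (rule subgroup.m_inv_closed[OF sub nat])
    then show ?thesis using False d0 by (simp add: inv power_int_def power_inverse)
  qed
  show ?thesis
    unfolding descent_image
  proof
    show "unit_coset ` divisor_values p r d \<subseteq> generate ?Q {unit_coset d}"
    proof (rule image_subsetI)
      fix u assume "u \<in> divisor_values p r d"
      then obtain k z where "z \<noteq> 0" "u = d powi k * z ^ p" using ramified_upper[OF ram] by blast
      then have "unit_coset u = unit_coset (d powi k)" by (intro power_coset_eqI)
      then show "unit_coset u \<in> generate ?Q {unit_coset d}" using powi by simp
    qed
    have dv: "d powi k \<in> divisor_values p r d" for k
      by (rule divisor_values_powi[OF ramified_lower[OF ram]])
    \<comment> \<open>For the reverse inclusion it suffices that the classes of integral powers of
      \<open>d\<close> form a subgroup containing the generator, since each such power is a divisor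
      value.\<close>
    have "subgroup (unit_coset ` range (\<lambda>k. d powi k)) ?Q"
    proof (rule comm_group.power_coset_subgroup[OF cg])
      show "range (\<lambda>k. d powi k) \<subseteq> carrier field_units" using d0 by (auto simp: carrier_field_units)
      show "\<one>\<^bsub>field_units\<^esub> \<in> range (\<lambda>k. d powi k)" unfolding one_field_units by (rule range_eqI[of _ _ 0]) simp
      show "inv\<^bsub>field_units\<^esub> x \<in> range (\<lambda>k. d powi k)" if x: "x \<in> range (\<lambda>k. d powi k)" for x
      proof -
        obtain k where k: "x = d powi k" using x by blast
        then have "inv\<^bsub>field_units\<^esub> x = d powi (- k)" using d0 by (simp add: inv_field_units power_int_minus)
        then show ?thesis by blast
      qed
      show "x \<otimes>\<^bsub>field_units\<^esub> y \<in> range (\<lambda>k. d powi k)"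
        if xy: "x \<in> range (\<lambda>k. d powi k)" "y \<in> range (\<lambda>k. d powi k)" for x y
      proof -
        obtain j k where "x = d powi j" "y = d powi k" using xy by blast
        then have "x \<otimes>\<^bsub>field_units\<^esub> y = d powi (j + k)" using d0 by (simp add: mult_field_units power_int_add)
        then show ?thesis by blast
      qed
    qed
    moreover have "unit_coset d \<in> unit_coset ` range (\<lambda>k. d powi k)"
      by (rule imageI, rule range_eqI[of _ _ 1]) simp
    ultimately have "generate ?Q {unit_coset d} \<subseteq> unit_coset ` range (\<lambda>k. d powi k)"
      by (intro group.generate_subgroup_incl[OF G]) auto
    then show "generate ?Q {unit_coset d} \<subseteq> unit_coset ` divisor_values p r d" using dv by blast
  qed
qed

end

theorem theorem4p7:
  fixes p r l :: nat and \<delta> :: int and \<omega> :: complex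
    and V :: "complex \<Rightarrow> real"
    and \<iota> :: "complex \<Rightarrow> 'l::field" and av :: "'l \<Rightarrow> real"
  assumes "prime p" and "odd p"
    and "1 \<le> r" and "r \<le> p - 2"
    and "\<delta> \<noteq> 0" and "\<forall>q::int. q ^ p dvd \<delta> \<longrightarrow> q dvd 1"
    and "primitive_root_of_unity p \<omega>"
    and "prime l" and "l \<noteq> p"
    and "place_above (rat_adjoin \<omega>) l V"
    and "is_completion (rat_adjoin \<omega>) V \<iota> av"
  shows "(\<not> int l dvd \<delta> \<longrightarrow>
            descent_image p r (of_int \<delta>) (\<iota> \<omega>) = unit_classes av p \<and>
            subgroup (unit_classes av p) (power_quot (field_units :: 'l monoid) p) \<and>
            (\<exists>\<phi> \<in> iso ((power_quot (field_units :: 'l monoid) p)\<lparr>carrier := unit_classes av p\<rparr>)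
                       (power_quot (units_of (residue_field av)) p).
               \<forall>u. av u = 1 \<longrightarrow>
                 \<phi> (power_coset field_units p u)
                   = power_coset (units_of (residue_field av)) p (residue av u)))
       \<and> (int l dvd \<delta> \<longrightarrow>
            descent_image p r (of_int \<delta>) (\<iota> \<omega>)
              = generate (power_quot field_units p) {power_coset field_units p (of_int \<delta>)})"
proof -
  interpret unramified av p l "l ^ (p - 1)" "\<iota> \<omega>"
    by (rule unramified_completion) (use assms in blast)+
  interpret descent av p l "l ^ (p - 1)" "\<iota> \<omega>" r \<delta>
    by unfold_locales (use assms in blast)+
  show ?thesis
    using unramified_image unit_classes_subgroup unit_classes_iso ramified_image by blast
qed

end
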